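(* Let $\alpha,\beta\colon\Gamma\to\mathrm{GL}_2(\mathbf{C})$ be irreducible representations of $\Gamma=\mathrm{SL}_2(\mathbf{Z})$ such that $\alpha\otimes\beta$ is irreducible, and let $L_1,L_2$ be choices of exponents for $\alpha,\beta$ respectively. Put $\Lambda=L_1\otimes_e L_2$. Then: (1) the $M(1)\langle D\rangle$-module $M(\alpha\otimes\beta,\Lambda)$ is not cyclic; (2) the minimal weight for $(\alpha\otimes\beta,\Lambda)$ is $k+l$, where $k=6\operatorname{Tr}(L_1)-1$ and $l=6\operatorname{Tr}(L_2)-1$ are the minimal weights for $(\alpha,L_1)$ and $(\beta,L_2)$; (3) if $A$ and $B$ are forms of minimal weight for $(\alpha,L_1)$ and $(\beta,L_2)$ respectively, then, up to conjugation of $\alpha\otimes\beta$, an $M(1)$-basis of $M(\alpha\otimes\beta,\Lambda)$ is given by $F=A\otimes B$, $DF=D(A)\otimes B+A\otimes D(B)$, $H=D^2F-aE_4\,A\otimes B$, $G=\frac{1}{cE_4}(DH-bE_4DF)$, where, letting $e_1,\dots,e_4$ be the eigenvalues of $\Lambda$, $f_j=e_j-\tfrac14\operatorname{Tr}(\Lambda)+\tfrac16$ and $\sigma_d(f)$ the $d$-th elementary symmetric polynomial in $f_1,\dots,f_4$, $a=-3\sigma_3(f)+\tfrac12\sigma_2(f)-\tfrac1{24}$, $b=3\sigma_3(f)-\tfrac32\sigma_2(f)+\tfrac{13}{72}$, $c=-\sigma_4(f)-\tfrac1{18}a$.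
   Context: $T=\begin{pmatrix}1&1\\0&1\end{pmatrix}$. For a representation $\rho\colon\Gamma\to\mathrm{GL}_d(\mathbf{C})$, a choice of exponents is $L$ with $\rho(T)=e^{2\pi iL}$; $M_k(\rho,L)$ is the space of holomorphic $F\colon\mathfrak H\to\mathbf{C}^d$ with $F(\gamma\tau)=(c\tau+d)^k\rho(\gamma)F(\tau)$ for $\gamma\in\Gamma$ and $e^{-2\pi iL\tau}F(\tau)$ having a $q$-expansion in nonnegative powers of $q=e^{2\pi i\tau}$; $M(\rho,L)=\bigoplus_k M_k(\rho,L)$, a free module over $M(1)=\mathbf{C}[E_4,E_6]$. The minimal weight for $(\rho,L)$ is the least $k$ with $M_k(\rho,L)\ne0$, and a form of minimal weight is a nonzero element of that space. The modular derivative is $D_kF=q\frac{dF}{dq}-\frac{k}{12}E_2F$ in weight $k$ ($E_2=1-24\sum\sigma_1(n)q^n$); $M(1)\langle D\rangle$ is the ring of operators generated by multiplication by $M(1)$ and $D$, and a module over it is cyclic if generated by one element. The tensor product $\alpha\otimes\beta$ is realized by Kronecker products $\alpha(\gamma)\otimes\beta(\gamma)$ on $\mathbf{C}^2\otimes\mathbf{C}^2$ with basis ordered $e_1\otimes e_1,e_1\otimes e_2,e_2\otimes e_1,e_2\otimes e_2$; for $A=(f_1,f_2)^T$, $B=(g_1,g_2)^T$, $A\otimes B=(f_1g_1,f_1g_2,f_2g_1,f_2g_2)^T$. The induced tensor product exponents are $L_1\otimes_eL_2=L_1\otimes I_2+I_2\otimes L_2$ (Kronecker products), a choice of exponents for $\alpha\otimes\beta$.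 *)

theory Defs
  imports "HOL-Complex_Analysis.Complex_Analysis"
begin

section \<open>The modular group and its representations\<close>

definition SL2Z :: "(int^2^2) set" where
  "SL2Z = {\<gamma>. det \<gamma> = 1}"

definition T_mat :: "int^2^2" where
  "T_mat = vector [vector [1, 1], vector [0, 1]]"

definition UHP :: "complex set" where
  "UHP = {\<tau>. Im \<tau> > 0}"

definition cocycle :: "int^2^2 \<Rightarrow> complex \<Rightarrow> complex" where
  "cocycle \<gamma> \<tau> = of_int (\<gamma>$2$1) * \<tau> + of_int (\<gamma>$2$2)"

definition moebius :: "int^2^2 \<Rightarrow> complex \<Rightarrow> complex" where
  "moebius \<gamma> \<tau> = (of_int (\<gamma>$1$1) * \<tau> + of_int (\<gamma>$1$2)) / cocycle \<gamma> \<tau>"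

text \<open>A representation is a function on all integer matrices of which only the values on
  \<^const>\<open>SL2Z\<close> matter.\<close>

definition representation :: "(int^2^2 \<Rightarrow> complex^'n^'n) \<Rightarrow> bool" where
  "representation \<rho> \<longleftrightarrow> (\<forall>\<gamma>\<in>SL2Z. invertible (\<rho> \<gamma>)) \<and>
     (\<forall>\<gamma>\<in>SL2Z. \<forall>\<delta>\<in>SL2Z. \<rho> (\<gamma> ** \<delta>) = \<rho> \<gamma> ** \<rho> \<delta>)"

definition irreducible_rep :: "(int^2^2 \<Rightarrow> complex^'n^'n) \<Rightarrow> bool" where
  "irreducible_rep \<rho> \<longleftrightarrow> representation \<rho> \<and>
     (\<forall>W. vec.subspace W \<and> (\<forall>\<gamma>\<in>SL2Z. \<forall>w\<in>W. \<rho> \<gamma> *v w \<in> W) \<longrightarrow> W = {0} \<or> W = UNIV)"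

text \<open>The product type \<^typ>\<open>'m \<times> 'n\<close> indexes the basis \<open>e\<^sub>i \<otimes> e\<^sub>j\<close> of the tensor product.\<close>

definition kronecker :: "complex^'m^'m \<Rightarrow> complex^'n^'n \<Rightarrow> complex^('m \<times> 'n)^('m \<times> 'n)" where
  "kronecker P Q = (\<chi> p q. P $ fst p $ fst q * Q $ snd p $ snd q)"

definition tensor_rep :: "(int^2^2 \<Rightarrow> complex^'m^'m) \<Rightarrow> (int^2^2 \<Rightarrow> complex^'n^'n) \<Rightarrow>
    int^2^2 \<Rightarrow> complex^('m \<times> 'n)^('m \<times> 'n)" where
  "tensor_rep \<alpha> \<beta> \<gamma> = kronecker (\<alpha> \<gamma>) (\<beta> \<gamma>)"

definition tensor_exponents :: "complex^'m^'m \<Rightarrow> complex^'n^'n \<Rightarrow>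
    complex^('m \<times> 'n)^('m \<times> 'n)" where
  "tensor_exponents L1 L2 = kronecker L1 (mat 1) + kronecker (mat 1) L2"

definition tensor_form :: "(complex \<Rightarrow> complex^'m) \<Rightarrow> (complex \<Rightarrow> complex^'n) \<Rightarrow>
    complex \<Rightarrow> complex^('m \<times> 'n)" where
  "tensor_form A B \<tau> = (\<chi> p. A \<tau> $ fst p * B \<tau> $ snd p)"


section \<open>Choices of exponents\<close>

text \<open>The type of square matrices carries no Banach algebra structure for \<open>**\<close> in the library
  (the overloaded \<open>*\<close> on vectors is componentwise), so \<^const>\<open>exp\<close> is not available on it.\<close>

definition matrix_exp :: "complex^'n^'n \<Rightarrow> complex^'n^'n" where
  "matrix_exp X = (\<Sum>m. (1 / fact m) *\<^sub>R (((**) X ^^ m) (mat 1)))"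

definition choice_of_exponents :: "(int^2^2 \<Rightarrow> complex^'n^'n) \<Rightarrow> complex^'n^'n \<Rightarrow> bool" where
  "choice_of_exponents \<rho> L \<longleftrightarrow> \<rho> T_mat = matrix_exp (mat (2 * of_real pi * \<i>) ** L)"

text \<open>\<open>e\<close> enumerates the eigenvalues with algebraic multiplicity.\<close>

definition eigenvalues_of :: "complex^'n^'n \<Rightarrow> (nat \<Rightarrow> complex) \<Rightarrow> bool" where
  "eigenvalues_of X e \<longleftrightarrow> (\<forall>x. det (mat x - X) = (\<Prod>j=1..CARD('n). x - e j))"

definition elem_sym :: "nat \<Rightarrow> nat \<Rightarrow> (nat \<Rightarrow> complex) \<Rightarrow> complex" where
  "elem_sym n d f = (\<Sum>S | S \<subseteq> {1..n} \<and> card S = d. \<Prod>j\<in>S. f j)"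


section \<open>Scalar modular forms and the modular derivative\<close>

definition nome :: "complex \<Rightarrow> complex" where
  "nome \<tau> = exp (2 * of_real pi * \<i> * \<tau>)"

definition divisor_sum :: "nat \<Rightarrow> nat \<Rightarrow> nat" where
  "divisor_sum m n = (\<Sum>d | d dvd n. d ^ m)"

definition E2 :: "complex \<Rightarrow> complex" where
  "E2 \<tau> = 1 - 24 * (\<Sum>n. of_nat (divisor_sum 1 (Suc n)) * nome \<tau> ^ Suc n)"

definition E4 :: "complex \<Rightarrow> complex" where
  "E4 \<tau> = 1 + 240 * (\<Sum>n. of_nat (divisor_sum 3 (Suc n)) * nome \<tau> ^ Suc n)"

definition E6 :: "complex \<Rightarrow> complex" where
  "E6 \<tau> = 1 - 504 * (\<Sum>n. of_nat (divisor_sum 5 (Suc n)) * nome \<tau> ^ Suc n)"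

text \<open>Functions on the upper half-plane are represented by functions on \<^typ>\<open>complex\<close> that vanish
  off \<^const>\<open>UHP\<close>, so that equality of functions is equality on \<^const>\<open>UHP\<close>.\<close>

definition on_UHP :: "(complex \<Rightarrow> 'a::zero) \<Rightarrow> complex \<Rightarrow> 'a" where
  "on_UHP F = (\<lambda>\<tau>. if \<tau> \<in> UHP then F \<tau> else 0)"

text \<open>Since \<open>q = exp (2 \<pi> i \<tau>)\<close>, the operator \<open>q d/dq\<close> is \<open>(2 \<pi> i)\<^sup>-\<^sup>1 d/d\<tau>\<close>.\<close>

definition modular_deriv :: "int \<Rightarrow> (complex \<Rightarrow> complex^'n) \<Rightarrow> complex \<Rightarrow> complex^'n" where
  "modular_deriv k F = on_UHP (\<lambda>\<tau>.
     (1 / (2 * of_real pi * \<i>)) *s (\<chi> i. deriv (\<lambda>z. F z $ i) \<tau>)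
     - (of_int k / 12 * E2 \<tau>) *s F \<tau>)"

text \<open>The part of weight \<open>k\<close> of \<open>\<complex>[E\<^sub>4, E\<^sub>6]\<close>.\<close>

definition M1_weight :: "int \<Rightarrow> (complex \<Rightarrow> complex) set" where
  "M1_weight k = {on_UHP (\<lambda>\<tau>. \<Sum>(i, j) | int (4 * i + 6 * j) = k. c i j * E4 \<tau> ^ i * E6 \<tau> ^ j)
     | c :: nat \<Rightarrow> nat \<Rightarrow> complex. True}"


section \<open>Vector-valued modular forms\<close>

definition modular_forms :: "(int^2^2 \<Rightarrow> complex^'n^'n) \<Rightarrow> complex^'n^'n \<Rightarrow> int \<Rightarrow>
    (complex \<Rightarrow> complex^'n) set" where
  "modular_forms \<rho> L k = {F.
     (\<forall>\<tau>. \<tau> \<notin> UHP \<longrightarrow> F \<tau> = 0) \<and>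
     (\<forall>i. (\<lambda>\<tau>. F \<tau> $ i) holomorphic_on UHP) \<and>
     (\<forall>\<gamma>\<in>SL2Z. \<forall>\<tau>\<in>UHP. F (moebius \<gamma> \<tau>) = (cocycle \<gamma> \<tau> powi k) *s (\<rho> \<gamma> *v F \<tau>)) \<and>
     (\<exists>a :: nat \<Rightarrow> complex^'n. \<forall>\<tau>\<in>UHP.
        (\<lambda>m. (nome \<tau> ^ m) *s a m) sums
          (matrix_exp (mat (- (2 * of_real pi * \<i> * \<tau>)) ** L) *v F \<tau>))}"

definition minimal_weight :: "(int^2^2 \<Rightarrow> complex^'n^'n) \<Rightarrow> complex^'n^'n \<Rightarrow> int \<Rightarrow> bool" where
  "minimal_weight \<rho> L k \<longleftrightarrow> modular_forms \<rho> L k \<noteq> {\<lambda>_. 0} \<and>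
     (\<forall>j. modular_forms \<rho> L j \<noteq> {\<lambda>_. 0} \<longrightarrow> k \<le> j)"

definition minimal_weight_form :: "(int^2^2 \<Rightarrow> complex^'n^'n) \<Rightarrow> complex^'n^'n \<Rightarrow> int \<Rightarrow>
    (complex \<Rightarrow> complex^'n) \<Rightarrow> bool" where
  "minimal_weight_form \<rho> L k F \<longleftrightarrow>
     minimal_weight \<rho> L k \<and> F \<in> modular_forms \<rho> L k \<and> F \<noteq> (\<lambda>_. 0)"


section \<open>The graded modules\<close>

text \<open>An element of a direct sum over all weights is a finitely supported family indexed by the
  weight; \<open>homogeneous k F\<close> is the element \<open>F\<close> of weight \<open>k\<close>.\<close>

definition direct_sum :: "(int \<Rightarrow> (complex \<Rightarrow> 'a::zero) set) \<Rightarrow> (int \<Rightarrow> complex \<Rightarrow> 'a) set" where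
  "direct_sum V = {X. (\<forall>k. X k \<in> V k) \<and> finite {k. X k \<noteq> (\<lambda>_. 0)}}"

definition homogeneous :: "int \<Rightarrow> (complex \<Rightarrow> 'a::zero) \<Rightarrow> int \<Rightarrow> complex \<Rightarrow> 'a" where
  "homogeneous k F = (\<lambda>j. if j = k then F else (\<lambda>_. 0))"

definition M1 :: "(int \<Rightarrow> complex \<Rightarrow> complex) set" where
  "M1 = direct_sum M1_weight"

definition graded_forms :: "(int^2^2 \<Rightarrow> complex^'n^'n) \<Rightarrow> complex^'n^'n \<Rightarrow>
    (int \<Rightarrow> complex \<Rightarrow> complex^'n) set" where
  "graded_forms \<rho> L = direct_sum (modular_forms \<rho> L)"

definition graded_mult :: "(int \<Rightarrow> complex \<Rightarrow> complex) \<Rightarrow> (int \<Rightarrow> complex \<Rightarrow> complex^'n) \<Rightarrow>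
    int \<Rightarrow> complex \<Rightarrow> complex^'n" where
  "graded_mult f X = (\<lambda>k \<tau>. \<Sum>i | f i \<noteq> (\<lambda>_. 0). f i \<tau> *s X (k - i) \<tau>)"

definition graded_deriv :: "(int \<Rightarrow> complex \<Rightarrow> complex^'n) \<Rightarrow> int \<Rightarrow> complex \<Rightarrow> complex^'n" where
  "graded_deriv X = (\<lambda>k. modular_deriv (k - 2) (X (k - 2)))"

text \<open>The ring \<open>M(1)\<langle>D\<rangle>\<close>; its zero, identity and negatives come from \<open>M(1)\<close>.\<close>

inductive_set M1D :: "((int \<Rightarrow> complex \<Rightarrow> complex^'n) \<Rightarrow> (int \<Rightarrow> complex \<Rightarrow> complex^'n)) set" where
  mult: "f \<in> M1 \<Longrightarrow> graded_mult f \<in> M1D"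
| deriv: "graded_deriv \<in> M1D"
| add: "P \<in> M1D \<Longrightarrow> Q \<in> M1D \<Longrightarrow> (\<lambda>X k \<tau>. P X k \<tau> + Q X k \<tau>) \<in> M1D"
| comp: "P \<in> M1D \<Longrightarrow> Q \<in> M1D \<Longrightarrow> P \<circ> Q \<in> M1D"

definition cyclic_M1D_module :: "(int \<Rightarrow> complex \<Rightarrow> complex^'n) set \<Rightarrow> bool" where
  "cyclic_M1D_module M \<longleftrightarrow> (\<exists>X\<in>M. M = {P X | P. P \<in> M1D})"

definition M1_basis :: "(int \<Rightarrow> complex \<Rightarrow> complex^'n) set \<Rightarrow>
    (int \<Rightarrow> complex \<Rightarrow> complex^'n) list \<Rightarrow> bool" where
  "M1_basis M bs \<longleftrightarrow> set bs \<subseteq> M \<and>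
     (\<forall>X\<in>M. \<exists>!fs. length fs = length bs \<and> set fs \<subseteq> M1 \<and>
        X = (\<lambda>k \<tau>. \<Sum>i<length bs. graded_mult (fs ! i) (bs ! i) k \<tau>))"

end

theory Submission
  imports Defs
begin

text \<open>
  For a two-dimensional irreducible \<open>\<alpha>\<close> the form \<open>A\<close> of minimal weight is built from two solutions of the
  monic modular differential equation \<open>D\<^sup>2 f = a\<^sub>1 E\<^sub>4 f\<close>, found by the method of Frobenius (or, when
  \<open>L\<^sub>1\<close> is not diagonalisable, from a power of \<open>\<eta>\<close>).  The Wronskian of \<open>A\<close> is a power of \<open>\<eta>\<close>, so that
  after twisting by \<open>q\<^bsup>-L\<^esup>\<close> the vectors \<open>A\<close> and \<open>D A\<close> are independent on the whole disc \<open>\<bar>q\<bar> < 1\<close>,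
  cusp included; Cramer's rule then makes them a free basis.  Such bases are stable under Kronecker products: \<open>A \<otimes> B\<close>, \<open>D A \<otimes> B\<close>,
  \<open>A \<otimes> D B\<close>, \<open>D A \<otimes> D B\<close> is a free basis of weights \<open>m\<close>, \<open>m + 2\<close>, \<open>m + 2\<close>, \<open>m + 4\<close>, and
  \<open>F\<close>, \<open>D F\<close>, \<open>H = 2 D A \<otimes> D B\<close>, \<open>G = (D A \<otimes> B - A \<otimes> D B) / (a\<^sub>1 - a\<^sub>2)\<close> is obtained from it by a
  constant change of basis.  If \<open>a\<^sub>1 = a\<^sub>2\<close>, then \<open>D A \<otimes> B - A \<otimes> D B\<close> would be killed by \<open>D\<close> and span an
  invariant line.  In terms of the exponents, the roots \<open>f\<^sub>j\<close> are \<open>1/6 \<plusminus> u \<plusminus> v\<close> with \<open>a\<^sub>1 = u\<^sup>2 - 1/144\<close> and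
  \<open>a\<^sub>2 = v\<^sup>2 - 1/144\<close>, whence \<open>a = b = a\<^sub>1 + a\<^sub>2\<close> and \<open>c = - (a\<^sub>1 - a\<^sub>2)\<^sup>2\<close>.  The module is not cyclic because
  an operator applied to \<open>X\<close> produces in weight \<open>m + 2\<close> only multiples of \<open>D F\<close> when it vanishes in weight \<open>m\<close>.
\<close>

text \<open>\<open>E2\<close>, \<open>E4\<close>, \<open>E6\<close> are given only by divisor sums,
  so their behaviour under inversion is first recovered from lattice sums. The anomaly of
  \<open>E2\<close> is what makes \<open>D\<close> preserve modularity, and a power of eta without
  zeros in the half-plane lets cusp forms be divided by \<open>delta\<close>; this identifies the
  level one forms with \<open>\<complex>[E4, E6]\<close>, where the coefficients given by Cramer's
  rule must lie. The obstacle in degree two is that the differential equation sees only the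
  eigenvalues of \<open>\<alpha>(T)\<close>, while its solution must transform by
  \<open>\<alpha>(S)\<close>. The solution vector comes with some matrix \<open>S'\<close> of its
  own. The relations \<open>S^4 = 1\<close> and \<open>(S T)^3 = S^2\<close> fix traces and
  determinants on the side of \<open>\<alpha>\<close>; on the side of \<open>S'\<close> they are
  read off at the fixed points of \<open>S\<close> and \<open>S T\<close>, where the solution vector
  and its derivative are eigenvectors. In the diagonalisable case the agreement leaves only a
  conjugation by a diagonal matrix. The same relations give \<open>det \<alpha>(T)^6 = 1\<close>,
  which is why \<open>6 Tr(L) - 1\<close> is an integer.\<close>

no_notation fps_nth (infixl "$" 75)

subsection \<open>The generators of the modular group\<close>

definition S_mat :: "int^2^2" where
  "S_mat = vector [vector [0, -1], vector [1, 0]]"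

lemma mat2_eqI:
  fixes A B :: "'a^2^2"
  assumes "A$1$1 = B$1$1" "A$1$2 = B$1$2" "A$2$1 = B$2$1" "A$2$2 = B$2$2"
  shows "A = B"
  using assms by (simp add: vec_eq_iff forall_2)

lemma mat2_mult_nth:
  fixes A B :: "'a::semiring_1^2^2"
  shows "(A ** B) $ i $ j = A$i$1 * B$1$j + A$i$2 * B$2$j"
  by (simp add: matrix_matrix_mult_def sum_2)

lemma S_mat_nth [simp]: "S_mat$1$1 = 0" "S_mat$1$2 = -1" "S_mat$2$1 = 1" "S_mat$2$2 = 0"
  by (simp_all add: S_mat_def)

lemma T_mat_nth [simp]: "T_mat$1$1 = 1" "T_mat$1$2 = 1" "T_mat$2$1 = 0" "T_mat$2$2 = 1"
  by (simp_all add: T_mat_def)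

lemma S_mat_in_SL2Z [simp]: "S_mat \<in> SL2Z" and T_mat_in_SL2Z [simp]: "T_mat \<in> SL2Z"
  by (simp_all add: SL2Z_def det_2)

lemma SL2Z_mult [simp]: "\<gamma> \<in> SL2Z \<Longrightarrow> \<delta> \<in> SL2Z \<Longrightarrow> \<gamma> ** \<delta> \<in> SL2Z"
  by (simp add: SL2Z_def det_mul)

lemma mat1_in_SL2Z [simp]: "mat 1 \<in> SL2Z"
  by (simp add: SL2Z_def)

text \<open>Descent on the lower left entry by the Euclidean algorithm. The rule reduces a
  transformation law for the whole group to the two generators.\<close>

lemma SL2Z_induct [consumes 1, case_names S T mult]:
  assumes "\<gamma> \<in> SL2Z" and S: "P S_mat" and T: "P T_mat"
    and mult: "\<And>\<gamma> \<delta>. \<gamma> \<in> SL2Z \<Longrightarrow> \<delta> \<in> SL2Z \<Longrightarrow> P \<gamma> \<Longrightarrow> P \<delta> \<Longrightarrow> P (\<gamma> ** \<delta>)"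
  shows "P \<gamma>"
proof -
  define m where "m a b c d = (vector [vector [a, b], vector [c, d]] :: int^2^2)" for a b c d
  have m_nth [simp]: "m a b c d$1$1 = a" "m a b c d$1$2 = b" "m a b c d$2$1 = c" "m a b c d$2$2 = d"
    for a b c d by (simp_all add: m_def)
  have m_SL: "m a b c d \<in> SL2Z" if "a * d - b * c = 1" for a b c d
    using that by (simp add: SL2Z_def det_2)
  \<comment> \<open>\<open>P\<close> is closed under products only, so \<open>-1\<close> and the
    inverses of \<open>S\<close> and \<open>T\<close> have to be written as words in
    \<open>S\<close> and \<open>T\<close>; here \<open>-1 = S^2\<close>.\<close>
  have "P (S_mat ** S_mat)" by (intro mult S S_mat_in_SL2Z)
  also have "S_mat ** S_mat = m (-1) 0 0 (-1)" by (rule mat2_eqI) (simp_all add: mat2_mult_nth)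
  finally have neg: "P (m (-1) 0 0 (-1))" .
  have "P (m (-1) 0 0 (-1) ** m (-1) 0 0 (-1))" by (intro mult neg m_SL) auto
  also have "m (-1) 0 0 (-1) ** m (-1) 0 0 (-1) = m 1 0 0 1"
    by (rule mat2_eqI) (simp_all add: mat2_mult_nth)
  finally have one: "P (m 1 0 0 1)" .
  have "P (S_mat ** m (-1) 0 0 (-1))" by (intro mult S S_mat_in_SL2Z neg m_SL) auto
  also have "S_mat ** m (-1) 0 0 (-1) = m 0 1 (-1) 0"
    by (rule mat2_eqI) (simp_all add: mat2_mult_nth)
  finally have Sinv: "P (m 0 1 (-1) 0)" .
  \<comment> \<open>Since \<open>(S T)\<^sup>3 = S\<^sup>2\<close>, the inverse of \<open>T\<close> is \<open>S T S T S\<^sup>-\<^sup>1\<close>.\<close>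
  have "P (S_mat ** (T_mat ** (S_mat ** (T_mat ** m 0 1 (-1) 0))))"
    by (intro mult S T Sinv S_mat_in_SL2Z T_mat_in_SL2Z SL2Z_mult m_SL) auto
  also have "S_mat ** (T_mat ** (S_mat ** (T_mat ** m 0 1 (-1) 0))) = m 1 (-1) 0 1"
    by (rule mat2_eqI) (simp_all add: mat2_mult_nth)
  finally have Tinv: "P (m 1 (-1) 0 1)" .
  have Tn: "P (m 1 n 0 1)" for n
  proof (induction n rule: int_induct[where k = 0])
    case base
    show ?case by (rule one)
  next
    case (step1 i)
    have "P (m 1 i 0 1 ** T_mat)" by (intro mult T step1 T_mat_in_SL2Z m_SL) auto
    also have "m 1 i 0 1 ** T_mat = m 1 (i + 1) 0 1"
      by (rule mat2_eqI) (simp_all add: mat2_mult_nth)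
    finally show ?case .
  next
    case (step2 i)
    have "P (m 1 i 0 1 ** m 1 (-1) 0 1)" by (intro mult Tinv step2 m_SL) auto
    also have "m 1 i 0 1 ** m 1 (-1) 0 1 = m 1 (i - 1) 0 1"
      by (rule mat2_eqI) (simp_all add: mat2_mult_nth)
    finally show ?case .
  qed
  show ?thesis using assms(1)
  proof (induction "nat \<bar>\<gamma>$2$1\<bar>" arbitrary: \<gamma> rule: less_induct)
    case less
    define a b c d where abcd: "a = \<gamma>$1$1" "b = \<gamma>$1$2" "c = \<gamma>$2$1" "d = \<gamma>$2$2"
    have \<gamma>: "\<gamma> = m a b c d" by (rule mat2_eqI) (simp_all add: abcd)
    have det: "a * d - b * c = 1" using less.prems by (simp add: SL2Z_def det_2 abcd)
    show ?case
    proof (cases "c = 0")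
      case True
      then have "a * d = 1" using det by simp
      then consider "a = 1" "d = 1" | "a = -1" "d = -1"
        by (metis pos_zmult_eq_1_iff_lemma zmult_eq_1_iff)
      then show ?thesis
      proof cases
        case 1
        then show ?thesis using Tn[of b] True \<gamma> by simp
      next
        case 2
        have "P (m (-1) 0 0 (-1) ** m 1 (-b) 0 1)" by (intro mult neg Tn m_SL) auto
        also have "m (-1) 0 0 (-1) ** m 1 (-b) 0 1 = \<gamma>"
          unfolding \<gamma> by (rule mat2_eqI) (simp_all add: mat2_mult_nth 2 True)
        finally show ?thesis .
      qed
    next
      case False
      \<comment> \<open>Euclidean step: with \<open>a = c n + r\<close>, the matrix
        \<open>S T^(-n) \<gamma>\<close> has lower left entry \<open>r\<close>, smaller in absolute
        value than \<open>c\<close>.\<close>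
      define n r where "n = a div c" and "r = a mod c"
      have a: "a = c * n + r" by (simp add: n_def r_def)
      have r: "\<bar>r\<bar> < \<bar>c\<bar>" using False by (simp add: r_def abs_mod_less)
      have dd: "r * d - (b - n * d) * c = 1" using det by (simp add: a algebra_simps)
      have "P (m (-c) (-d) r (b - n * d))"
        by (rule less.hyps) (use r dd in \<open>auto simp: abcd[symmetric] intro!: m_SL simp: algebra_simps\<close>)
      then have "P (m 1 n 0 1 ** (m 0 1 (-1) 0 ** m (-c) (-d) r (b - n * d)))"
        using dd by (intro mult Tn Sinv SL2Z_mult m_SL) (auto simp: algebra_simps)
      also have "m 1 n 0 1 ** (m 0 1 (-1) 0 ** m (-c) (-d) r (b - n * d)) = \<gamma>"
        unfolding \<gamma> by (rule mat2_eqI) (simp_all add: mat2_mult_nth a algebra_simps)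
      finally show ?thesis .
    qed
  qed
qed

subsection \<open>The nome and power series on the unit disc\<close>

lemma UHP_nonzero: "\<tau> \<in> UHP \<Longrightarrow> \<tau> \<noteq> 0"
  by (auto simp: UHP_def)

lemma open_UHP: "open UHP"
  by (simp add: UHP_def open_halfspace_Im_gt)

lemma convex_UHP: "convex UHP"
  by (simp add: UHP_def convex_halfspace_Im_gt)

lemma neg_inverse_in_UHP: "\<tau> \<in> UHP \<Longrightarrow> -1/\<tau> \<in> UHP"
  by (simp add: UHP_def Im_divide' complex_eq_iff sum_power2_gt_zero_iff)

lemma plus_one_in_UHP: "\<tau> \<in> UHP \<Longrightarrow> \<tau> + 1 \<in> UHP"
  by (simp add: UHP_def)

lemma norm_nome: "norm (nome \<tau>) = exp (- (2 * pi * Im \<tau>))"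
  by (simp add: nome_def norm_exp_eq_Re)

lemma norm_nome_less_1: "\<tau> \<in> UHP \<Longrightarrow> norm (nome \<tau>) < 1"
  by (simp add: norm_nome UHP_def)

lemma nome_nonzero [simp]: "nome \<tau> \<noteq> 0"
  by (simp add: nome_def)

lemma nome_in_ball: "\<tau> \<in> UHP \<Longrightarrow> nome \<tau> \<in> ball 0 1"
  by (simp add: norm_nome_less_1)

lemma nome_plus_of_int [simp]: "nome (\<tau> + of_int n) = nome \<tau>"
proof -
  have "nome (\<tau> + of_int n) = nome \<tau> * exp (\<i> * (of_int n * (of_real pi * 2)))"
    by (simp add: nome_def exp_add[symmetric] algebra_simps)
  then show ?thesis by (simp only: exp_2pi_1_int mult_1_right)
qed

lemma nome_plus_1 [simp]: "nome (\<tau> + 1) = nome \<tau>"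
  using nome_plus_of_int[of \<tau> 1] by simp

lemma nome_surj:
  assumes "q \<in> ball 0 1" "q \<noteq> 0"
  obtains \<tau> where "\<tau> \<in> UHP" "nome \<tau> = q"
proof
  show "nome (Ln q / (2 * of_real pi * \<i>)) = q"
    using assms by (simp add: nome_def)
  have "ln (norm q) < 0" using assms by simp
  then show "Ln q / (2 * of_real pi * \<i>) \<in> UHP"
    using assms by (simp add: UHP_def Im_divide' divide_simps power2_eq_square mult_pos_neg)
qed

lemma nome_has_field_derivative [derivative_intros]:
  assumes "(f has_field_derivative f') (at z within A)"
  shows "((\<lambda>z. nome (f z)) has_field_derivative 2 * of_real pi * \<i> * f' * nome (f z)) (at z within A)"
  unfolding nome_def by (auto intro!: derivative_eq_intros assms)

lemma holomorphic_nome [holomorphic_intros]: "f holomorphic_on A \<Longrightarrow> (\<lambda>z. nome (f z)) holomorphic_on A"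
  unfolding nome_def by (intro holomorphic_intros)

text \<open>Holomorphic functions of \<open>q\<close> on the open unit disc, kept as formal series
  so that identities can be compared coefficient by coefficient.\<close>

definition disc_fps :: "complex fps \<Rightarrow> bool" where
  "disc_fps f \<longleftrightarrow> fps_conv_radius f \<ge> 1"

lemma disc_fps_less: "disc_fps f \<Longrightarrow> norm z < 1 \<Longrightarrow> ereal (norm z) < fps_conv_radius f"
  unfolding disc_fps_def by (metis ereal_less(3) order_less_le_trans)

lemma disc_fps_const [simp, intro]: "disc_fps (fps_const c)" "disc_fps 0" "disc_fps 1"
    "disc_fps fps_X" "disc_fps (numeral n)"
  by (simp_all add: disc_fps_def)

lemma disc_fps_arith [intro]:
  assumes "disc_fps f" "disc_fps g"
  shows "disc_fps (f + g)" "disc_fps (f - g)" "disc_fps (f * g)"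
  using assms fps_conv_radius_add[of f g] fps_conv_radius_diff[of f g] fps_conv_radius_mult[of f g]
  unfolding disc_fps_def by (auto simp: min_def intro: order_trans split: if_splits)

lemma disc_fps_power [intro]: "disc_fps f \<Longrightarrow> disc_fps (f ^ n)"
  and disc_fps_deriv [intro]: "disc_fps f \<Longrightarrow> disc_fps (fps_deriv f)"
  using fps_conv_radius_power[of f n] fps_conv_radius_deriv[of f]
  unfolding disc_fps_def by (auto intro: order_trans)

lemma eval_disc_fps:
  assumes "norm z < 1"
  shows "disc_fps f \<Longrightarrow> disc_fps g \<Longrightarrow> eval_fps (f + g) z = eval_fps f z + eval_fps g z"
    "disc_fps f \<Longrightarrow> disc_fps g \<Longrightarrow> eval_fps (f - g) z = eval_fps f z - eval_fps g z"
    "disc_fps f \<Longrightarrow> disc_fps g \<Longrightarrow> eval_fps (f * g) z = eval_fps f z * eval_fps g z"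
    "disc_fps f \<Longrightarrow> eval_fps (f ^ n) z = eval_fps f z ^ n"
  using assms by (auto intro!: eval_fps_add eval_fps_diff eval_fps_mult eval_fps_power disc_fps_less)

lemma holomorphic_disc_fps:
  assumes "disc_fps f"
  shows "eval_fps f holomorphic_on ball 0 1"
  by (rule holomorphic_on_eval_fps) (use assms disc_fps_less in auto)

lemma eval_disc_fps_deriv:
  assumes "disc_fps f" "norm z < 1"
  shows "(eval_fps f has_field_derivative eval_fps (fps_deriv f) z) (at z within A)"
  by (rule has_field_derivative_eval_fps) (use assms disc_fps_less in auto)

text \<open>The Euler operator \<open>q d/dq\<close>, that is
  \<open>(2 \<pi> i)^(-1) d/d\<tau>\<close> after substituting the nome.\<close>

definition theta_fps :: "complex fps \<Rightarrow> complex fps" where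
  "theta_fps f = fps_X * fps_deriv f"

lemma theta_fps_nth [simp]: "fps_nth (theta_fps f) n = of_nat n * fps_nth f n"
  by (cases n) (simp_all add: theta_fps_def)

lemma disc_theta_fps [intro]: "disc_fps f \<Longrightarrow> disc_fps (theta_fps f)"
  by (auto simp: theta_fps_def)

lemma eval_theta_fps:
  assumes "disc_fps f" "norm z < 1"
  shows "eval_fps (theta_fps f) z = z * eval_fps (fps_deriv f) z"
  unfolding theta_fps_def using assms by (subst eval_disc_fps) auto

lemma eval_fps_nome_deriv:
  assumes "disc_fps f" "\<tau> \<in> UHP"
  shows "((\<lambda>z. eval_fps f (nome z)) has_field_derivative
     2 * of_real pi * \<i> * eval_fps (theta_fps f) (nome \<tau>)) (at \<tau> within A)"
proof -
  have "((\<lambda>z. eval_fps f (nome z)) has_field_derivative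
      eval_fps (fps_deriv f) (nome \<tau>) * (2 * of_real pi * \<i> * 1 * nome \<tau>)) (at \<tau> within A)"
    by (rule DERIV_chain2[of "eval_fps f"] eval_disc_fps_deriv assms norm_nome_less_1 derivative_intros)+
  then show ?thesis using assms by (simp add: eval_theta_fps norm_nome_less_1 mult_ac)
qed

lemma holomorphic_eval_fps_nome:
  assumes "disc_fps f"
  shows "(\<lambda>z. eval_fps f (nome z)) holomorphic_on UHP"
  by (rule holomorphic_onI) (use eval_fps_nome_deriv[OF assms] in \<open>auto simp: field_differentiable_def\<close>)

text \<open>The point \<open>q = 0\<close> is left out because it is the nome of no
  \<open>\<tau>\<close>; continuity restores it.\<close>

lemma disc_fps_eqI:
  assumes "disc_fps f" "disc_fps g" "\<And>z. z \<noteq> 0 \<Longrightarrow> norm z < 1 \<Longrightarrow> eval_fps f z = eval_fps g z"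
  shows "f = g"
proof (rule eval_fps_eqD)
  have pos: "(0::ereal) < 1" by simp
  show "fps_conv_radius f > 0" "fps_conv_radius g > 0"
    using assms pos unfolding disc_fps_def by (blast intro: order_less_le_trans)+
  have hol: "(\<lambda>z. eval_fps f z - eval_fps g z) holomorphic_on ball 0 1"
    using assms by (intro holomorphic_intros holomorphic_disc_fps)
  have "((\<lambda>z. eval_fps f z - eval_fps g z) \<longlongrightarrow> eval_fps f 0 - eval_fps g 0) (at 0)"
    using holomorphic_on_imp_continuous_on[OF hol] by (simp add: continuous_on_eq_continuous_at isCont_def)
  moreover have "eventually (\<lambda>z. eval_fps f z - eval_fps g z = 0) (at 0)"
    using assms(3) eventually_at_in_open[of "ball 0 1" "0::complex"] by (auto elim!: eventually_mono)
  ultimately have "((\<lambda>z::complex. 0::complex) \<longlongrightarrow> eval_fps f 0 - eval_fps g 0) (at 0)"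
    by (rule Lim_transform_eventually)
  then have "eval_fps f 0 = eval_fps g 0"
    by (simp add: tendsto_const_iff)
  then have "eval_fps f z = eval_fps g z" if "norm z < 1" for z
    using assms(3)[of z] that by (cases "z = 0") auto
  then show "eventually (\<lambda>z. eval_fps f z = eval_fps g z) (nhds 0)"
    using eventually_nhds_in_open[of "ball 0 1" "0::complex"] by (auto elim!: eventually_mono)
qed

text \<open>The polylogarithm series of order \<open>-j\<close>, obtained from
  \<open>1 / (1 - q)\<close> by applying \<open>q d/dq\<close> exactly \<open>j\<close> times. For
  \<open>j = 0\<close> the constant term is \<open>0^0 = 1\<close>.\<close>

definition pow_fps :: "nat \<Rightarrow> complex fps" where
  "pow_fps j = Abs_fps (\<lambda>n. of_nat n ^ j)"

lemma pow_fps_Suc: "pow_fps (Suc j) = theta_fps (pow_fps j)"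
  by (simp add: fps_eq_iff pow_fps_def)

lemma disc_pow_fps [intro]: "disc_fps (pow_fps j)"
proof (induction j)
  case 0
  have "conv_radius (\<lambda>_. 1 :: complex) \<ge> 1"
  proof (rule conv_radius_geI_ex')
    fix r :: real
    assume "0 < r" "ereal r < 1"
    then show "summable (\<lambda>n. 1 * complex_of_real r ^ n)" by (simp add: summable_geometric_iff)
  qed
  then show ?case by (simp add: disc_fps_def fps_conv_radius_def pow_fps_def)
qed (auto simp: pow_fps_Suc)

definition sigma_fps :: "nat \<Rightarrow> complex fps" where
  "sigma_fps j = Abs_fps (\<lambda>n. of_nat (divisor_sum j n))"

lemma divisor_sum_0 [simp]: "divisor_sum j 0 = 0"
  by (simp add: divisor_sum_def)

lemma divisor_sum_le: "divisor_sum j n \<le> n ^ Suc j"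
proof (cases "n = 0")
  case False
  have "divisor_sum j n \<le> (\<Sum>d\<in>{1..n}. d ^ j)"
    unfolding divisor_sum_def using False
    by (intro sum_mono2) (auto simp: dvd_imp_le Suc_le_eq intro!: Nat.gr0I)
  also have "\<dots> \<le> (\<Sum>d\<in>{1..n}. n ^ j)" by (intro sum_mono power_mono) auto
  finally show ?thesis by simp
qed simp

lemma disc_sigma_fps [intro]: "disc_fps (sigma_fps j)"
proof -
  have "conv_radius (fps_nth (sigma_fps j)) \<ge> 1"
  proof (rule conv_radius_geI_ex')
    fix r :: real
    assume r: "0 < r" "ereal r < 1"
    show "summable (\<lambda>n. fps_nth (sigma_fps j) n * of_real r ^ n)"
    proof (rule summable_comparison_test)
      show "summable (\<lambda>n. norm (fps_nth (pow_fps (Suc j)) n * of_real r ^ n))"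
        by (rule norm_summable_fps, rule disc_fps_less) (use r in auto)
      have "norm (fps_nth (sigma_fps j) n) \<le> norm (fps_nth (pow_fps (Suc j)) n)" for n
        using divisor_sum_le[of j n, folded of_nat_le_iff[where 'a = real]]
        by (simp add: sigma_fps_def pow_fps_def norm_mult norm_power del: of_nat_le_iff)
      then show "\<exists>N. \<forall>n\<ge>N. norm (fps_nth (sigma_fps j) n * of_real r ^ n)
          \<le> norm (fps_nth (pow_fps (Suc j)) n * of_real r ^ n)"
        by (auto simp: norm_mult intro!: mult_right_mono)
    qed
  qed
  then show ?thesis by (simp add: disc_fps_def fps_conv_radius_def)
qed

lemma eval_sigma_fps:
  assumes "norm z < 1"
  shows "eval_fps (sigma_fps j) z = (\<Sum>n. of_nat (divisor_sum j (Suc n)) * z ^ Suc n)"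
proof -
  have "summable (\<lambda>n. fps_nth (sigma_fps j) n * z ^ n)"
    by (rule summable_fps, rule disc_fps_less) (use assms in auto)
  from suminf_split_head[OF this] show ?thesis
    by (simp add: eval_fps_def sigma_fps_def)
qed

definition "E2_fps = 1 - 24 * sigma_fps 1"
definition "E4_fps = 1 + 240 * sigma_fps 3"
definition "E6_fps = 1 - 504 * sigma_fps 5"

lemma disc_E_fps [intro]: "disc_fps E2_fps" "disc_fps E4_fps" "disc_fps E6_fps"
  by (auto simp: E2_fps_def E4_fps_def E6_fps_def)

lemma E2_eq: "\<tau> \<in> UHP \<Longrightarrow> E2 \<tau> = eval_fps E2_fps (nome \<tau>)"
  by (simp add: E2_def E2_fps_def eval_disc_fps disc_fps_arith disc_sigma_fps norm_nome_less_1 eval_sigma_fps)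

lemma E4_eq: "\<tau> \<in> UHP \<Longrightarrow> E4 \<tau> = eval_fps E4_fps (nome \<tau>)"
  by (simp add: E4_def E4_fps_def eval_disc_fps disc_fps_arith disc_sigma_fps norm_nome_less_1 eval_sigma_fps)

lemma E6_eq: "\<tau> \<in> UHP \<Longrightarrow> E6 \<tau> = eval_fps E6_fps (nome \<tau>)"
  by (simp add: E6_def E6_fps_def eval_disc_fps disc_fps_arith disc_sigma_fps norm_nome_less_1 eval_sigma_fps)

lemma divisor_sum_1 [simp]: "divisor_sum j (Suc 0) = 1"
  by (simp add: divisor_sum_def)

lemma E_fps_nth:
  "fps_nth E2_fps 0 = 1" "fps_nth E4_fps 0 = 1" "fps_nth E6_fps 0 = 1"
  "fps_nth E2_fps (Suc 0) = -24" "fps_nth E4_fps (Suc 0) = 240" "fps_nth E6_fps (Suc 0) = -504"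
  by (simp_all add: E2_fps_def E4_fps_def E6_fps_def sigma_fps_def numeral_fps_const)

subsection \<open>Sums over the integers\<close>

lemma int_UNIV_split:
  "UNIV = range int \<union> range (\<lambda>n. -1 - int n)" "range int \<inter> range (\<lambda>n. -1 - int n) = {}"
proof -
  have "x \<in> range int \<union> range (\<lambda>n. -1 - int n)" for x
  proof (cases "x \<ge> 0")
    case True
    then have "x = int (nat x)" by simp
    then show ?thesis by blast
  next
    case False
    then have "x = -1 - int (nat (-1 - x))" by simp
    then show ?thesis by blast
  qed
  then show "UNIV = range int \<union> range (\<lambda>n. -1 - int n)" by blast
qed auto

text \<open>Splits an unordered sum over the integers between \<open>-1\<close> and
  \<open>0\<close>. The halves are one-sided series of digamma or polygamma type; summability is a
  separate hypothesis because convergence of the halves does not imply it.\<close>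

lemma int_has_sumI:
  fixes f :: "int \<Rightarrow> complex"
  assumes "f summable_on UNIV" "(\<lambda>n. f (int n)) sums a" "(\<lambda>n. f (-1 - int n)) sums b"
  shows "(f has_sum (a + b)) UNIV"
proof -
  have "(f has_sum s) (range h)" if "(\<lambda>n. f (h n)) sums s" "inj h" for h :: "nat \<Rightarrow> int" and s
  proof -
    have "f summable_on range h" using assms(1) by (rule summable_on_subset_banach) auto
    then obtain s' where s': "(f has_sum s') (range h)" by (auto simp: summable_on_def)
    then have "((f \<circ> h) has_sum s') UNIV" using has_sum_reindex[OF that(2)] by blast
    then have "(\<lambda>n. f (h n)) sums s'" using has_sum_imp_sums by (fastforce simp: o_def)
    then show ?thesis using s' that(1) sums_unique2 by blast
  qed
  from has_sum_Un_disjoint[OF this[OF assms(2)] this[OF assms(3)] int_UNIV_split(2)]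
  show ?thesis by (simp add: int_UNIV_split(1)[symmetric] inj_def)
qed

lemma summable_on_inverse_1_plus_int_square: "(\<lambda>d::int. 1 / (1 + (real_of_int d)\<^sup>2)) summable_on UNIV"
proof -
  have *: "summable (\<lambda>n. 1 / (1 + (real n)\<^sup>2))"
  proof (rule summable_comparison_test)
    have "1 / (1 + (real n)\<^sup>2) \<le> inverse ((real n)\<^sup>2)" if "n \<ge> 1" for n
      using that by (simp add: inverse_eq_divide frac_le)
    then show "\<exists>N. \<forall>n\<ge>N. norm (1 / (1 + (real n)\<^sup>2)) \<le> inverse ((real n)\<^sup>2)"
      by (intro exI[of _ 1]) auto
  qed (use inverse_power_summable[of 2, where 'a = real] in simp)
  have **: "summable (\<lambda>n. 1 / (1 + (real (Suc n))\<^sup>2))" using * by (rule summable_Suc_iff[THEN iffD2])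
  have "(\<lambda>d::int. 1 / (1 + (real_of_int d)\<^sup>2)) summable_on range int"
    by (subst summable_on_reindex) (auto simp: o_def intro!: norm_summable_imp_summable_on *)
  moreover have "(\<lambda>d::int. 1 / (1 + (real_of_int d)\<^sup>2)) summable_on range (\<lambda>n. -1 - int n)"
  proof (subst summable_on_reindex)
    have "(\<lambda>n. 1 / (1 + (real (Suc n))\<^sup>2)) summable_on UNIV"
      by (rule norm_summable_imp_summable_on) (use ** in simp)
    moreover have "(real_of_int (-1 - int n))\<^sup>2 = (real (Suc n))\<^sup>2" for n
      by (simp add: power2_eq_square algebra_simps)
    ultimately show "((\<lambda>d::int. 1 / (1 + (real_of_int d)\<^sup>2)) \<circ> (\<lambda>n. -1 - int n)) summable_on UNIV"
      by (simp add: o_def del: of_int_diff)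
  qed (auto simp: inj_def)
  ultimately show ?thesis
    by (subst int_UNIV_split(1)) (rule summable_on_union)
qed

lemma summable_on_int_comparison:
  fixes f :: "int \<Rightarrow> complex"
  assumes "\<And>d. norm (f d) \<le> K / (1 + (real_of_int d)\<^sup>2)"
  shows "f summable_on UNIV"
proof (rule abs_summable_summable, rule Infinite_Sum.abs_summable_on_comparison_test')
  show "(\<lambda>d::int. K * (1 / (1 + (real_of_int d)\<^sup>2))) summable_on UNIV"
    by (intro summable_on_cmult_right summable_on_inverse_1_plus_int_square)
qed (use assms in simp)

text \<open>A product of one-dimensional majorants dominates the double series of weight at least 4
  and also the corrected series of weight 2.\<close>

lemma summable_on_int_int_comparison:
  fixes f :: "int \<times> int \<Rightarrow> complex"
  assumes "\<And>c d. norm (f (c, d)) \<le> K / ((1 + (real_of_int c)\<^sup>2) * (1 + (real_of_int d)\<^sup>2))"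
  shows "f summable_on UNIV"
proof (rule abs_summable_summable, rule Infinite_Sum.abs_summable_on_comparison_test')
  let ?g = "\<lambda>d::int. 1 / (1 + (real_of_int d)\<^sup>2)"
  obtain s where s: "(?g has_sum s) UNIV"
    using summable_on_inverse_1_plus_int_square by (auto simp: summable_on_def)
  have "(\<lambda>(c, d). K * (?g c * ?g d)) summable_on UNIV"
  proof -
    have "(\<lambda>(c, d). ?g c * ?g d) summable_on (SIGMA c:UNIV. UNIV)"
    proof (rule summable_on_SigmaI)
      show "((\<lambda>d. case (c, d) of (c, d) \<Rightarrow> ?g c * ?g d) has_sum (?g c * s)) UNIV" for c
        using has_sum_cmult_right[OF s, of "?g c"] by simp
      show "(\<lambda>c. ?g c * s) summable_on UNIV"
        using has_sum_cmult_left[OF s] has_sum_imp_summable by blast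
    qed auto
    from summable_on_cmult_right[OF this, of K] show ?thesis
      by (simp add: case_prod_unfold)
  qed
  then show "(\<lambda>p. K * (?g (fst p) * ?g (snd p))) summable_on UNIV"
    by (simp add: case_prod_unfold)
qed (use assms in auto)

text \<open>The two ends may have different limits; exactly such a difference produces the anomaly
  in weight 2.\<close>

lemma has_sum_telescope_int:
  fixes h :: "int \<Rightarrow> complex"
  assumes sum: "(\<lambda>n. h n - h (n + 1)) summable_on UNIV"
    and "(\<lambda>n. h (int n)) \<longlonglongrightarrow> a" "(\<lambda>n. h (- int n)) \<longlonglongrightarrow> b"
  shows "((\<lambda>n. h n - h (n + 1)) has_sum (b - a)) UNIV"
proof (rule int_has_sumI[OF sum, of "h 0 - a" "b - h 0", simplified])
  show "(\<lambda>n. h (int n) - h (int n + 1)) sums (h 0 - a)"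
    using telescope_sums'[OF assms(2)] by (simp add: add_ac)
  show "(\<lambda>n. h (-1 - int n) - h (- int n)) sums (b - h 0)"
    using telescope_sums[OF assms(3)] by (simp add: algebra_simps)
qed

lemma has_sum_uminus_int:
  fixes f :: "int \<Rightarrow> complex"
  shows "((\<lambda>d. f (- d)) has_sum s) UNIV \<longleftrightarrow> (f has_sum s) UNIV"
  by (rule has_sum_reindex_bij_betw) (rule bij_uminus)

subsection \<open>The Lipschitz formula\<close>

lemma nome_neq_1: "Im z \<noteq> 0 \<Longrightarrow> nome z \<noteq> 1"
  by (metis norm_nome norm_one exp_eq_one_iff mult_eq_0_iff neg_equal_0_iff_equal pi_neq_zero zero_neq_numeral)

lemma sin_cos_nome:
  assumes "nome z \<noteq> 1"
  shows "sin (of_real pi * z) \<noteq> 0" "cos (of_real pi * z) / sin (of_real pi * z) = \<i> * (nome z + 1) / (nome z - 1)"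
proof -
  define e where "e = exp (\<i> * (of_real pi * z))"
  have e: "nome z = e * e" "e \<noteq> 0"
    by (simp_all add: e_def nome_def exp_add[symmetric] mult_ac)
  have s: "sin (of_real pi * z) = (e - inverse e) / (2 * \<i>)" "cos (of_real pi * z) = (e + inverse e) / 2"
    by (simp_all add: sin_exp_eq cos_exp_eq e_def exp_minus)
  have ne: "e * e - 1 \<noteq> 0" using assms e by simp
  have *: "e - inverse e = (e * e - 1) / e" "e + inverse e = (e * e + 1) / e"
    using e by (simp_all add: field_simps)
  show "sin (of_real pi * z) \<noteq> 0"
    unfolding s * using ne e by simp
  show "cos (of_real pi * z) / sin (of_real pi * z) = \<i> * (nome z + 1) / (nome z - 1)"
    unfolding s * e(1) using ne e(2) by (simp add: divide_simps)
qed

lemma not_nonpos_Ints: "Im z \<noteq> 0 \<Longrightarrow> z \<notin> \<int>\<^sub>\<le>\<^sub>0"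
  by (auto elim!: nonpos_Ints_cases)

text \<open>Logarithmic derivative of
  \<open>Gamma z * Gamma (1 - z) = \<pi> / sin (\<pi> z)\<close>; the resulting cotangent is a
  rational function of the nome.\<close>

lemma Digamma_reflection:
  fixes z :: complex
  assumes "Im z \<noteq> 0"
  shows "Digamma (1 - z) - Digamma z = of_real pi * \<i> * (nome z + 1) / (nome z - 1)"
proof -
  note s = sin_cos_nome[OF nome_neq_1[OF assms]]
  have z: "z \<notin> \<int>\<^sub>\<le>\<^sub>0" "1 - z \<notin> \<int>\<^sub>\<le>\<^sub>0" using assms by (auto intro!: not_nonpos_Ints)
  have "((\<lambda>z. Gamma z * Gamma (1 - z)) has_field_derivative
          Gamma z * Gamma (1 - z) * (Digamma z - Digamma (1 - z))) (at z)"
    using z by (auto intro!: derivative_eq_intros simp: algebra_simps)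
  moreover have "((\<lambda>z. of_real pi / sin (of_real pi * z)) has_field_derivative
         - (of_real pi * of_real pi * cos (of_real pi * z) / (sin (of_real pi * z) * sin (of_real pi * z)))) (at z)"
    using s(1) by (auto intro!: derivative_eq_intros simp: divide_simps)
  ultimately have "of_real pi / sin (of_real pi * z) * (Digamma z - Digamma (1 - z)) =
        - (of_real pi * of_real pi * cos (of_real pi * z) / (sin (of_real pi * z) * sin (of_real pi * z)))"
    unfolding Gamma_reflection_complex by (rule DERIV_unique)
  note calculation = this
  have "Digamma z - Digamma (1 - z) = - of_real pi * (cos (of_real pi * z) / sin (of_real pi * z))"
  proof -
    have "D = - p * (c / s)" if "p / s * D = - (p * p * c / (s * s))" "s \<noteq> 0" "p \<noteq> 0" for D p c s :: complex
    proof -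
      have "D = (s / p) * (p / s * D)" using that(2,3) by simp
      also have "\<dots> = - p * (c / s)" unfolding that(1) using that(2,3) by simp
      finally show ?thesis .
    qed
    from this[OF _ s(1)] show ?thesis using calculation by simp
  qed
  from arg_cong[OF this, of uminus] show ?thesis
    unfolding s(2) by (simp only: minus_diff_eq mult_minus_left minus_minus times_divide_eq_right mult.assoc minus_divide_left)
qed

text \<open>Induction on \<open>j\<close> by differentiating in \<open>z\<close>: on the left the
  orders of the polygamma functions rise, on the right \<open>q d/dq\<close> acts. The constant
  \<open>\<pi> i\<close> survives only for \<open>j = 0\<close>.\<close>

lemma Polygamma_reflection:
  assumes "z \<in> UHP"
  shows "(-1) ^ j * Polygamma j (1 - z) - Polygamma j z =
    (if j = 0 then of_real pi * \<i> else 0) - (2 * of_real pi * \<i>) ^ Suc j * eval_fps (pow_fps j) (nome z)"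
  using assms
proof (induction j arbitrary: z)
  case 0
  have "norm (nome z) < 1" using 0 by (rule norm_nome_less_1)
  then have "eval_fps (pow_fps 0) (nome z) = 1 / (1 - nome z)"
    by (simp add: eval_fps_def pow_fps_def suminf_geometric)
  moreover have Im: "Im z \<noteq> 0" using 0 by (auto simp: UHP_def)
  moreover from this have "nome z \<noteq> 1" by (rule nome_neq_1)
  moreover have "(w + 1) / (w - 1) = 1 - 2 / (1 - w)" if "w \<noteq> 1" for w :: complex
    using that by (simp add: divide_simps) (simp add: algebra_simps)
  ultimately have "Digamma (1 - z) - Digamma z = of_real pi * \<i> * (1 - 2 * eval_fps (pow_fps 0) (nome z))"
    unfolding Digamma_reflection[OF Im] times_divide_eq_right[symmetric] mult.assoc by simp
  then show ?case by (simp add: algebra_simps)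
next
  case (Suc j)
  have z: "z \<notin> \<int>\<^sub>\<le>\<^sub>0" "1 - z \<notin> \<int>\<^sub>\<le>\<^sub>0" using Suc.prems by (auto intro!: not_nonpos_Ints simp: UHP_def)
  have "((\<lambda>z. (-1) ^ j * Polygamma j (1 - z) - Polygamma j z) has_field_derivative
       (-1) ^ Suc j * Polygamma (Suc j) (1 - z) - Polygamma (Suc j) z) (at z)"
    using z by (auto intro!: derivative_eq_intros)
  then have "((\<lambda>z. (if j = 0 then of_real pi * \<i> else 0) - (2 * of_real pi * \<i>) ^ Suc j * eval_fps (pow_fps j) (nome z))
      has_field_derivative (-1) ^ Suc j * Polygamma (Suc j) (1 - z) - Polygamma (Suc j) z) (at z)"
    by (rule has_field_derivative_transform_within_open[OF _ open_UHP Suc.prems Suc.IH])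
  moreover have "((\<lambda>z. (if j = 0 then of_real pi * \<i> else 0) - (2 * of_real pi * \<i>) ^ Suc j * eval_fps (pow_fps j) (nome z))
      has_field_derivative 0 - (2 * of_real pi * \<i>) ^ Suc j * (2 * of_real pi * \<i> * eval_fps (theta_fps (pow_fps j)) (nome z))) (at z)"
    by (intro DERIV_diff DERIV_const DERIV_cmult eval_fps_nome_deriv Suc.prems disc_pow_fps)
  ultimately have "(-1) ^ Suc j * Polygamma (Suc j) (1 - z) - Polygamma (Suc j) z =
      0 - (2 * of_real pi * \<i>) ^ Suc j * (2 * of_real pi * \<i> * eval_fps (theta_fps (pow_fps j)) (nome z))"
    by (rule DERIV_unique)
  then show ?case by (simp add: pow_fps_Suc mult_ac)
qed

text \<open>Positive definiteness of \<open>|c \<tau> + d|^2\<close> as a quadratic form in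
  \<open>(c, d)\<close>; the convergence estimates for lattice sums rest on it.\<close>

lemma UHP_quadratic_form_bound:
  assumes "\<tau> \<in> UHP"
  obtains \<delta> where "\<delta> > 0" "\<And>c d::real. \<delta> * (c\<^sup>2 + d\<^sup>2) \<le> (norm (of_real c * \<tau> + of_real d))\<^sup>2"
proof -
  define x y where "x = Re \<tau>" and "y = Im \<tau>"
  have y: "y > 0" using assms by (simp add: UHP_def y_def)
  \<comment> \<open>From \<open>d = (c x + d) - c x\<close> follows
    \<open>d^2 \<le> 2 (c x + d)^2 + 2 (c x)^2\<close>; the fraction absorbs
    \<open>c^2 + 2 (c x)^2\<close> into a multiple of \<open>(c y)^2\<close>.\<close>
  define K where "K = 2 + (1 + 2 * x\<^sup>2) / y\<^sup>2"
  have K: "K \<ge> 2" using y by (simp add: K_def)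
  show thesis
  proof
    show "1 / K > 0" using K by simp
    fix c d :: real
    have "(norm (of_real c * \<tau> + of_real d))\<^sup>2 = (c * x + d)\<^sup>2 + (c * y)\<^sup>2"
      by (simp add: cmod_power2 x_def y_def)
    moreover have "c\<^sup>2 + d\<^sup>2 \<le> K * ((c * x + d)\<^sup>2 + (c * y)\<^sup>2)"
    proof -
      have "d\<^sup>2 \<le> 2 * (c * x + d)\<^sup>2 + 2 * (c * x)\<^sup>2"
        using zero_le_power2[of "2 * (c * x) + d"] by (simp add: power2_eq_square algebra_simps)
      then have "c\<^sup>2 + d\<^sup>2 \<le> 2 * (c * x + d)\<^sup>2 + (1 + 2 * x\<^sup>2) / y\<^sup>2 * (c * y)\<^sup>2"
      proof -
        have "(1 + 2 * x\<^sup>2) / y\<^sup>2 * (c * y)\<^sup>2 = c\<^sup>2 + 2 * (c * x)\<^sup>2"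
          using y by (simp add: power_mult_distrib field_simps)
        then show ?thesis using \<open>d\<^sup>2 \<le> _\<close> by linarith
      qed
      also have "\<dots> \<le> K * (c * x + d)\<^sup>2 + K * (c * y)\<^sup>2"
        using y by (intro add_mono mult_right_mono) (auto simp: K_def)
      finally show ?thesis by (simp add: algebra_simps)
    qed
    ultimately show "1 / K * (c\<^sup>2 + d\<^sup>2) \<le> (norm (of_real c * \<tau> + of_real d))\<^sup>2"
      using K by (simp add: field_simps)
  qed
qed

lemma int_square_ge_1: "(c, d) \<noteq> (0, 0) \<Longrightarrow> (real_of_int c)\<^sup>2 + (real_of_int d)\<^sup>2 \<ge> 1"
proof -
  assume "(c, d) \<noteq> (0, 0)"
  then have "c\<^sup>2 + d\<^sup>2 > 0" by (simp add: sum_power2_gt_zero_iff)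
  then have "1 \<le> c\<^sup>2 + d\<^sup>2" by linarith
  then have "real_of_int 1 \<le> real_of_int (c\<^sup>2 + d\<^sup>2)" by (simp only: of_int_le_iff)
  then show ?thesis by simp
qed

text \<open>Away from the origin \<open>c^2 + d^2 \<ge> 1\<close>, so \<open>1 + c^2\<close> and
  \<open>1 + d^2\<close> are at most \<open>2 (c^2 + d^2)\<close>. The first two bounds serve single
  rows and columns, the third the absolutely convergent double series.\<close>

lemma lattice_term_bounds:
  assumes "\<tau> \<in> UHP" "m \<ge> 1"
  obtains K where "\<And>c d. norm (1 / (of_int c * \<tau> + of_int d) ^ (2 * m)) \<le> K / (1 + (real_of_int d)\<^sup>2)"
    and "\<And>c d. norm (1 / (of_int c * \<tau> + of_int d) ^ (2 * m)) \<le> K / (1 + (real_of_int c)\<^sup>2)"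
    and "\<And>c d. m \<ge> 2 \<Longrightarrow> norm (1 / (of_int c * \<tau> + of_int d) ^ (2 * m)) \<le>
           K / ((1 + (real_of_int c)\<^sup>2) * (1 + (real_of_int d)\<^sup>2))"
proof -
  from UHP_quadratic_form_bound[OF assms(1)] obtain \<delta> where
    \<delta>: "\<delta> > 0" "\<And>c d::real. \<delta> * (c\<^sup>2 + d\<^sup>2) \<le> (norm (of_real c * \<tau> + of_real d))\<^sup>2" by blast
  define K where "K = 4 / \<delta> ^ m"
  have K: "K > 0" using \<delta> by (simp add: K_def)
  have *: "norm (1 / (of_int c * \<tau> + of_int d) ^ (2 * m)) \<le> K / B"
    if "B > 0" "(c, d) \<noteq> (0,0) \<Longrightarrow> B \<le> 4 * ((real_of_int c)\<^sup>2 + (real_of_int d)\<^sup>2) ^ m" for c d B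
  proof (cases "(c, d) = (0, 0)")
    \<comment> \<open>The origin contributes \<open>1 / 0 = 0\<close> and satisfies any such
      bound.\<close>
    case True
    then show ?thesis using K that assms(2) by (simp add: power_0_left)
  next
    case False
    let ?s = "(real_of_int c)\<^sup>2 + (real_of_int d)\<^sup>2"
    have s: "?s \<ge> 1" using int_square_ge_1[OF False] .
    have "\<delta> ^ m * B \<le> \<delta> ^ m * (4 * ?s ^ m)" using that(2)[OF False] \<delta>(1) by (intro mult_left_mono) auto
    also have "\<dots> = 4 * (\<delta> * ?s) ^ m" by (simp add: power_mult_distrib)
    also have "\<dots> \<le> 4 * ((norm (of_int c * \<tau> + of_int d))\<^sup>2) ^ m"
      using \<delta>(2)[of "of_int c" "of_int d"] \<delta>(1) s by (intro mult_left_mono power_mono) auto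
    also have "\<dots> = 4 * norm (of_int c * \<tau> + of_int d) ^ (2 * m)" by (simp add: power_mult)
    finally have le: "\<delta> ^ m * B \<le> 4 * norm (of_int c * \<tau> + of_int d) ^ (2 * m)" .
    have "0 < \<delta> ^ m * B" using \<delta>(1) that(1) by simp
    then have "norm (of_int c * \<tau> + of_int d) ^ (2 * m) > 0" using le by linarith
    then show ?thesis using le \<delta>(1) that(1)
      by (simp add: K_def norm_divide norm_power field_simps)
  qed
  have pow: "s \<le> s ^ m" if "(s::real) \<ge> 1" for s
    using power_increasing[of 1 m s] that assms(2) by simp
  have pow2: "s\<^sup>2 \<le> s ^ m" if "(s::real) \<ge> 1" "m \<ge> 2" for s
    using power_increasing[of 2 m s] that by simp
  show thesis
  proof (rule that[of K])
    fix c d :: int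
    let ?s = "(real_of_int c)\<^sup>2 + (real_of_int d)\<^sup>2"
    show "norm (1 / (of_int c * \<tau> + of_int d) ^ (2 * m)) \<le> K / (1 + (real_of_int d)\<^sup>2)"
    proof (rule *)
      assume "(c, d) \<noteq> (0, 0)"
      then have s: "1 \<le> ?s" by (rule int_square_ge_1)
      moreover note pow[OF s]
      moreover have "(real_of_int d)\<^sup>2 \<le> ?s" by simp
      ultimately show "1 + (real_of_int d)\<^sup>2 \<le> 4 * ?s ^ m" by linarith
    qed (simp add: add_pos_nonneg)
    show "norm (1 / (of_int c * \<tau> + of_int d) ^ (2 * m)) \<le> K / (1 + (real_of_int c)\<^sup>2)"
    proof (rule *)
      assume "(c, d) \<noteq> (0, 0)"
      then have s: "1 \<le> ?s" by (rule int_square_ge_1)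
      moreover note pow[OF s]
      moreover have "(real_of_int c)\<^sup>2 \<le> ?s" by simp
      ultimately show "1 + (real_of_int c)\<^sup>2 \<le> 4 * ?s ^ m" by linarith
    qed (simp add: add_pos_nonneg)
    assume m: "m \<ge> 2"
    show "norm (1 / (of_int c * \<tau> + of_int d) ^ (2 * m)) \<le>
           K / ((1 + (real_of_int c)\<^sup>2) * (1 + (real_of_int d)\<^sup>2))"
    proof (rule *)
      assume "(c, d) \<noteq> (0, 0)"
      then have s: "1 \<le> ?s" by (rule int_square_ge_1)
      have "(1 + (real_of_int c)\<^sup>2) * (1 + (real_of_int d)\<^sup>2) \<le> (2 * ?s) * (2 * ?s)"
      proof (intro mult_mono)
        have *: "1 + a \<le> 2 * (a + b)" if "1 \<le> a + b" "0 \<le> b" for a b :: real using that by simp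
        show "1 + (real_of_int c)\<^sup>2 \<le> 2 * ?s"
          using s by (rule *) simp
        show "1 + (real_of_int d)\<^sup>2 \<le> 2 * ?s"
          using s unfolding add.commute[of "(real_of_int c)\<^sup>2"] by (rule *) simp
      qed auto
      also have "\<dots> = 4 * ?s\<^sup>2" by (simp only: power2_eq_square mult_ac)
      also have "\<dots> \<le> 4 * ?s ^ m" using pow2[OF s m] by simp
      finally show "(1 + (real_of_int c)\<^sup>2) * (1 + (real_of_int d)\<^sup>2) \<le> 4 * ?s ^ m" .
    qed (simp add: add_pos_nonneg)
  qed
qed

text \<open>The terms with \<open>d \<ge> 0\<close> form the polygamma series at \<open>z\<close>,
  those with \<open>d < 0\<close> the one at \<open>1 - z\<close>. For odd \<open>j\<close> the
  signs agree, and the reflection formula evaluates the sum.\<close>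

lemma Lipschitz_formula:
  assumes "z \<in> UHP" "odd j"
  shows "((\<lambda>d. 1 / (z + of_int d) ^ Suc j) has_sum
           (2 * of_real pi * \<i>) ^ Suc j / fact j * eval_fps (pow_fps j) (nome z)) UNIV"
proof -
  from assms(2) obtain m where m: "Suc j = 2 * m" by (metis evenE even_Suc)
  have j: "j \<ge> 1" using assms(2) by (cases j) auto
  from lattice_term_bounds[OF assms(1), of m] m obtain K where
    "norm (1 / (of_int 1 * z + of_int d) ^ (2 * m)) \<le> K / (1 + (real_of_int d)\<^sup>2)" for d
    by (metis One_nat_def Suc_leI bot_nat_0.not_eq_extremum mult_0_right nat.distinct(1))
  then have sum: "(\<lambda>d. 1 / (z + of_int d) ^ Suc j) summable_on UNIV"
    unfolding m by (intro summable_on_int_comparison[of _ K]) auto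
  have Im: "Im z \<noteq> 0" using assms by (simp add: UHP_def)
  have ne: "z \<noteq> 0" "1 - z \<noteq> 0" using Im by (auto simp: complex_eq_iff)
  have P: "(\<lambda>n. 1 / (w + of_nat n) ^ Suc j) sums (Polygamma j w / fact j)" if "w \<noteq> 0" for w :: complex
  proof -
    have "summable (\<lambda>n. inverse ((w + of_nat n) ^ Suc j))"
      using that j by (intro Polygamma_converges') auto
    then show ?thesis using j assms(2)
      by (simp add: Polygamma_def sums_iff divide_inverse del: power_Suc)
  qed
  have "(\<lambda>n. 1 / (z + of_int (-1 - int n)) ^ Suc j) sums (Polygamma j (1 - z) / fact j)"
  proof -
    have "(z + of_int (-1 - int n)) ^ Suc j = (1 - z + of_nat n) ^ Suc j" for n
    proof -
      have "z + of_int (-1 - int n) = - (1 - z + of_nat n)" by simp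
      then show ?thesis using assms(2) by (simp only: power_minus_even even_Suc not_not simp_thms)
    qed
    then show ?thesis using P[OF ne(2)] by simp
  qed
  moreover have "(\<lambda>n. 1 / (z + of_int (int n)) ^ Suc j) sums (Polygamma j z / fact j)"
    using P[OF ne(1)] by simp
  ultimately have "((\<lambda>d. 1 / (z + of_int d) ^ Suc j) has_sum
      (Polygamma j z / fact j + Polygamma j (1 - z) / fact j)) UNIV"
    by (intro int_has_sumI sum)
  moreover have "Polygamma j (1 - z) + Polygamma j z = (2 * of_real pi * \<i>) ^ Suc j * eval_fps (pow_fps j) (nome z)"
    using Polygamma_reflection[OF assms(1), of j] assms(2) j
    by (simp add: minus_equation_iff algebra_simps)
  ultimately show ?thesis by (simp add: add_divide_distrib[symmetric] add_ac)
qed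

subsection \<open>Eisenstein series\<close>

lemma has_sum_diff_complex:
  fixes f g :: "'a \<Rightarrow> complex"
  assumes "(f has_sum a) A" "(g has_sum b) A"
  shows "((\<lambda>x. f x - g x) has_sum (a - b)) A"
proof -
  have "((\<lambda>x. - g x) has_sum (- b)) A" using assms(2) by (simp add: has_sum_uminus)
  from has_sum_add[OF assms(1) this] show ?thesis by simp
qed

lemma summable_on_diff_complex:
  fixes f g :: "'a \<Rightarrow> complex"
  shows "f summable_on A \<Longrightarrow> g summable_on A \<Longrightarrow> (\<lambda>x. f x - g x) summable_on A"
  unfolding summable_on_def using has_sum_diff_complex by blast

lemma has_sum_eval_fps:
  assumes "disc_fps f" "norm z < 1"
  shows "((\<lambda>n. fps_nth f n * z ^ n) has_sum eval_fps f z) UNIV"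
  by (rule norm_summable_imp_has_sum) (auto intro!: norm_summable_fps sums_eval_fps disc_fps_less assms)

text \<open>Two groupings of the absolutely convergent sum of \<open>n^j q^(c n)\<close> over
  \<open>c, n \<ge> 1\<close>: by \<open>c\<close>, and by the product
  \<open>N = c n\<close>.\<close>

lemma Lambert_series:
  assumes q: "norm q < 1" and j: "j \<ge> 1"
  shows "((\<lambda>c. eval_fps (pow_fps j) (q ^ c)) has_sum eval_fps (sigma_fps j) q) {1..}"
proof -
  define D where "D = Sigma {1..} (\<lambda>N::nat. {d. d dvd N})"
  define h :: "nat \<times> nat \<Rightarrow> complex" where "h = (\<lambda>(N, d). of_nat d ^ j * q ^ N)"
  have inner: "((\<lambda>d. h (N, d)) has_sum (fps_nth (sigma_fps j) N * q ^ N)) {d. d dvd N}" if "N \<in> {1..}" for N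
    using that by (intro has_sum_finiteI)
      (auto simp: h_def sigma_fps_def divisor_sum_def sum_distrib_right intro!: finite_divisors_nat)
  have "(\<lambda>p. norm (h p)) summable_on D"
    unfolding D_def
  proof (rule summable_on_SigmaI)
    fix N :: nat assume "N \<in> {1..}"
    then show "((\<lambda>d. norm (h (N, d))) has_sum (norm (fps_nth (sigma_fps j) N * q ^ N))) {d. d dvd N}"
      by (intro has_sum_finiteI, auto simp: h_def sigma_fps_def norm_mult norm_power)
        (simp add: divisor_sum_def sum_distrib_right)
  next
    have "(\<lambda>N. norm (fps_nth (sigma_fps j) N * q ^ N)) summable_on UNIV"
      by (rule norm_summable_imp_summable_on)
        (use norm_summable_fps[OF disc_fps_less[OF disc_sigma_fps q]] in simp)
    then show "(\<lambda>N. norm (fps_nth (sigma_fps j) N * q ^ N)) summable_on {1..}"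
      by (rule summable_on_subset_banach) simp
  qed simp
  then have "h summable_on D" by (rule abs_summable_summable)
  then obtain x where x: "(h has_sum x) D" by (auto simp: summable_on_def)
  have "((\<lambda>N. fps_nth (sigma_fps j) N * q ^ N) has_sum x) {1..}"
    using has_sum_SigmaD[OF x[unfolded D_def] inner] by simp
  moreover have "((\<lambda>N. fps_nth (sigma_fps j) N * q ^ N) has_sum eval_fps (sigma_fps j) q) {1..}
      \<longleftrightarrow> ((\<lambda>N. fps_nth (sigma_fps j) N * q ^ N) has_sum eval_fps (sigma_fps j) q) UNIV"
    by (rule has_sum_cong_neutral) (auto simp: sigma_fps_def not_le)
  ultimately have x_eq: "x = eval_fps (sigma_fps j) q"
    using has_sum_eval_fps[OF disc_sigma_fps q] has_sum_unique by blast
  have "bij_betw (\<lambda>(c, n). (c * n, n)) ({1..} \<times> {1..}) D"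
  proof (rule bij_betwI[where g = "\<lambda>(N, d). (N div d, d)"])
    have "N div d \<ge> 1 \<and> d \<ge> 1 \<and> N div d * d = N" if "d dvd N" "N \<ge> 1" for d N :: nat
      using that by (metis One_nat_def Suc_leI dvd_div_mult_self mult_is_0 neq0_conv not_less_eq_eq zero_le)
    then show "(\<lambda>(N, d). (N div d, d)) \<in> D \<rightarrow> {1..} \<times> {1..}"
      "\<And>y. y \<in> D \<Longrightarrow> (\<lambda>(c, n). (c * n, n)) ((\<lambda>(N, d). (N div d, d)) y) = y"
      by (auto simp: D_def)
  qed (auto simp: D_def)
  from has_sum_reindex_bij_betw[OF this, of h x] x
  have "((\<lambda>(c, n). of_nat n ^ j * q ^ (c * n)) has_sum x) ({1..} \<times> {1..})"
    by (simp add: h_def case_prod_unfold)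
  moreover have "((\<lambda>n. of_nat n ^ j * q ^ (c * n)) has_sum eval_fps (pow_fps j) (q ^ c)) {1..}"
    if "c \<in> {1..}" for c :: nat
  proof -
    have "norm (q ^ c) < 1" using q that by (simp add: norm_power power_less_one_iff)
    from has_sum_eval_fps[OF disc_pow_fps this, of j]
    have "((\<lambda>n. of_nat n ^ j * q ^ (c * n)) has_sum eval_fps (pow_fps j) (q ^ c)) UNIV"
      by (simp add: pow_fps_def power_mult)
    moreover have "((\<lambda>n. of_nat n ^ j * q ^ (c * n)) has_sum eval_fps (pow_fps j) (q ^ c)) UNIV
      \<longleftrightarrow> ((\<lambda>n. of_nat n ^ j * q ^ (c * n)) has_sum eval_fps (pow_fps j) (q ^ c)) {1..}"
      by (rule has_sum_cong_neutral) (use j in \<open>auto simp: not_le\<close>)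
    ultimately show ?thesis by blast
  qed
  ultimately show ?thesis
    unfolding x_eq by - (rule has_sum_SigmaD[where B = "\<lambda>_. {1..}"], assumption, simp)
qed

text \<open>Summation is by rows, with \<open>d\<close> inside and \<open>c\<close> outside. The
  order matters for \<open>k = 2\<close>, where convergence is only conditional. For
  \<open>k > 0\<close> the term at the origin is \<open>1 / 0 = 0\<close>.\<close>

definition lattice_sum :: "nat \<Rightarrow> complex \<Rightarrow> complex" where
  "lattice_sum k \<tau> = (\<Sum>\<^sub>\<infinity>c::int. \<Sum>\<^sub>\<infinity>d::int. 1 / (of_int c * \<tau> + of_int d) ^ k)"

text \<open>The rows with \<open>c > 0\<close> come from the Lipschitz formula at
  \<open>c \<tau>\<close> and add up to a Lambert series; evenness of the exponent gives the rows
  with \<open>c < 0\<close>. The row \<open>c = 0\<close> is kept as an unevaluated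
  constant.\<close>

lemma lattice_row:
  assumes \<tau>: "\<tau> \<in> UHP" and j: "odd j"
  shows "((\<lambda>c::int. \<Sum>\<^sub>\<infinity>d::int. 1 / (of_int c * \<tau> + of_int d) ^ Suc j) has_sum
     ((\<Sum>\<^sub>\<infinity>d::int. 1 / of_int d ^ Suc j) +
       2 * ((2 * of_real pi * \<i>) ^ Suc j / fact j * eval_fps (sigma_fps j) (nome \<tau>)))) UNIV"
proof -
  define R where "R = (\<lambda>c::int. \<Sum>\<^sub>\<infinity>d::int. 1 / (of_int c * \<tau> + of_int d) ^ Suc j)"
  define A where "A = (2 * of_real pi * \<i>) ^ Suc j / fact j * eval_fps (sigma_fps j) (nome \<tau>)"
  have R_uminus: "R (- c) = R c" for c
  proof -
    have "1 / (of_int (- c) * \<tau> + of_int (- d)) ^ Suc j = 1 / (of_int c * \<tau> + of_int d) ^ Suc j" for d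
    proof -
      have "of_int (- c) * \<tau> + of_int (- d) = - (of_int c * \<tau> + of_int d)" by simp
      then show ?thesis using j by (simp only: power_minus_even even_Suc not_not simp_thms)
    qed
    moreover have "R (- c) = (\<Sum>\<^sub>\<infinity>d. 1 / (of_int (- c) * \<tau> + of_int (- d)) ^ Suc j)"
      unfolding R_def by (rule infsum_reindex_bij_betw[symmetric, OF bij_uminus])
    ultimately show ?thesis by (simp only: R_def)
  qed
  have R_pos: "R (int c) = (2 * of_real pi * \<i>) ^ Suc j / fact j * eval_fps (pow_fps j) (nome \<tau> ^ c)"
    if "c \<in> {1..}" for c
  proof -
    have "of_nat c * \<tau> \<in> UHP" using \<tau> that by (simp add: UHP_def)
    moreover have "nome (of_nat c * \<tau>) = nome \<tau> ^ c"
      by (simp add: nome_def exp_of_nat_mult[symmetric] mult_ac)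
    ultimately show ?thesis
      unfolding R_def using infsumI[OF Lipschitz_formula[of "of_nat c * \<tau>" j]] j by simp
  qed
  have "j \<ge> 1" using j by (cases j) auto
  have "((\<lambda>c. R (int c)) has_sum A) {1..}"
    using has_sum_cmult_right[OF Lambert_series[OF norm_nome_less_1[OF \<tau>] \<open>j \<ge> 1\<close>], of "(2 * of_real pi * \<i>) ^ Suc j / fact j"]
    unfolding A_def[symmetric] by (subst has_sum_cong[OF R_pos])
  moreover have "bij_betw int {1..} {0<..}"
    by (rule bij_betwI[where g = nat]) auto
  ultimately have pos: "(R has_sum A) {0<..}"
    using has_sum_reindex_bij_betw by blast
  have "bij_betw uminus {0<..} {..<0::int}"
    by (rule bij_betwI[where g = uminus]) auto
  from has_sum_reindex_bij_betw[OF this, of R A] pos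
  have neg: "(R has_sum A) {..<0}" by (simp add: R_uminus)
  have "(R has_sum R 0) {0}" by (rule has_sum_finiteI) auto
  from has_sum_Un_disjoint[OF this has_sum_Un_disjoint[OF pos neg]]
  have "(R has_sum (R 0 + (A + A))) ({0} \<union> ({0<..} \<union> {..<0}))" by fastforce
  also have "{0} \<union> ({0<..} \<union> {..<0}) = (UNIV :: int set)" by auto
  finally have *: "(R has_sum (R 0 + (A + A))) UNIV" .
  have "R 0 + (A + A) = (\<Sum>\<^sub>\<infinity>d::int. 1 / of_int d ^ Suc j) + 2 * A" by (simp add: R_def)
  with * show ?thesis unfolding R_def A_def by (simp only:)
qed

lemma lattice_sum_eq:
  assumes "\<tau> \<in> UHP" and "odd j"
  shows "lattice_sum (Suc j) \<tau> = (\<Sum>\<^sub>\<infinity>d::int. 1 / of_int d ^ Suc j) +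
       2 * ((2 * of_real pi * \<i>) ^ Suc j / fact j * eval_fps (sigma_fps j) (nome \<tau>))"
  unfolding lattice_sum_def by (rule infsumI, rule lattice_row[OF assms])

text \<open>Since \<open>c (-1/\<tau>) + d = (d \<tau> - c) / \<tau>\<close>, inversion exchanges
  rows and columns up to the sign of an index.\<close>

lemma lattice_column:
  assumes \<tau>: "\<tau> \<in> UHP" and j: "odd j"
  shows "((\<lambda>d::int. \<Sum>\<^sub>\<infinity>c::int. 1 / (of_int c * \<tau> + of_int d) ^ Suc j) has_sum
     (lattice_sum (Suc j) (-1/\<tau>) / \<tau> ^ Suc j)) UNIV"
proof -
  have ne: "\<tau> \<noteq> 0" using \<tau> by (rule UHP_nonzero)
  have tm: "1 / (of_int c * (-1/\<tau>) + of_int d) ^ Suc j = \<tau> ^ Suc j * (1 / (of_int d * \<tau> + of_int (- c)) ^ Suc j)"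
    for c d :: int
  proof -
    have "of_int c * (-1/\<tau>) + of_int d = (of_int d * \<tau> + of_int (- c)) / \<tau>"
      using ne by (simp add: field_simps)
    then show ?thesis by (simp only: power_divide divide_divide_eq_right mult_1_left times_divide_eq_right mult_1_right)
  qed
  have "((\<lambda>c::int. \<Sum>\<^sub>\<infinity>d::int. 1 / (of_int c * (-1/\<tau>) + of_int d) ^ Suc j) has_sum lattice_sum (Suc j) (-1/\<tau>)) UNIV"
    unfolding lattice_sum_def
    using has_sum_imp_summable[OF lattice_row[OF neg_inverse_in_UHP[OF \<tau>] j]] by (rule has_sum_infsum)
  then have "((\<lambda>c::int. \<tau> ^ Suc j * (\<Sum>\<^sub>\<infinity>d::int. 1 / (of_int d * \<tau> + of_int (- c)) ^ Suc j)) has_sum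
     lattice_sum (Suc j) (-1/\<tau>)) UNIV"
    unfolding tm infsum_cmult_right' .
  then have "((\<lambda>c::int. \<tau> ^ Suc j * (\<Sum>\<^sub>\<infinity>d::int. 1 / (of_int d * \<tau> + of_int c) ^ Suc j)) has_sum
     lattice_sum (Suc j) (-1/\<tau>)) UNIV"
    by (subst (asm) has_sum_uminus_int[where f = "\<lambda>c. \<tau> ^ Suc j * (\<Sum>\<^sub>\<infinity>d::int. 1 / (of_int d * \<tau> + of_int c) ^ Suc j)"])
  from has_sum_cmult_right[OF this, of "inverse (\<tau> ^ Suc j)"] ne show ?thesis
    by (simp add: field_simps)
qed

text \<open>In weight at least 4 the double series converges absolutely, so summation by rows and by
  columns agree.\<close>

lemma lattice_sum_S:
  assumes \<tau>: "\<tau> \<in> UHP" and j: "odd j" "j \<ge> 3"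
  shows "lattice_sum (Suc j) (-1/\<tau>) = \<tau> ^ Suc j * lattice_sum (Suc j) \<tau>"
proof -
  from j(1) obtain m where m: "Suc j = 2 * m" by (metis evenE even_Suc)
  from lattice_term_bounds[OF \<tau>, of m] m j obtain K where
    "norm (1 / (of_int c * \<tau> + of_int d) ^ (2 * m)) \<le> K / ((1 + (real_of_int c)\<^sup>2) * (1 + (real_of_int d)\<^sup>2))" for c d
  proof -
    have "m \<ge> 1" "m \<ge> 2" using m j by linarith+
    then show thesis using lattice_term_bounds[OF \<tau>, of m] that by metis
  qed
  then have "(\<lambda>(c, d). 1 / (of_int c * \<tau> + of_int d) ^ Suc j) summable_on UNIV \<times> UNIV"
    unfolding m using summable_on_int_int_comparison[of "\<lambda>(c, d). 1 / (of_int c * \<tau> + of_int d) ^ (2 * m)" K] by simp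
  from infsum_swap_banach[OF this] have "lattice_sum (Suc j) \<tau> = lattice_sum (Suc j) (-1/\<tau>) / \<tau> ^ Suc j"
    unfolding lattice_sum_def[of _ \<tau>] using infsumI[OF lattice_column[OF \<tau> j(1)]] by simp
  then show ?thesis using UHP_nonzero[OF \<tau>] by simp
qed

text \<open>Each half of the series is a difference of two digamma series, in which the Euler
  constants cancel.\<close>

lemma Digamma_difference_has_sum:
  fixes z1 z2 :: complex
  assumes Im: "Im z1 \<noteq> 0" "Im z2 \<noteq> 0"
    and sum: "(\<lambda>c. 1 / (z1 + of_int c) - 1 / (z2 + of_int c)) summable_on UNIV"
  shows "((\<lambda>c. 1 / (z1 + of_int c) - 1 / (z2 + of_int c)) has_sum
     ((Digamma (1 - z1) - Digamma z1) - (Digamma (1 - z2) - Digamma z2))) UNIV"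
proof -
  have D: "(\<lambda>n. 1 / (z + of_nat n) - 1 / (w + of_nat n)) sums (Digamma w - Digamma z)"
    if "z \<noteq> 0" "w \<noteq> 0" for z w :: complex
  proof -
    have "(\<lambda>n. inverse (of_nat (Suc n)) - inverse (u + of_nat n)) sums (Digamma u + euler_mascheroni)"
      if "u \<noteq> 0" for u :: complex
      using summable_sums[OF summable_Digamma[OF that]] by (simp add: Digamma_def)
    from sums_diff[OF this[OF that(2)] this[OF that(1)]] show ?thesis by (simp add: divide_inverse)
  qed
  have ne: "z1 \<noteq> 0" "z2 \<noteq> 0" "1 - z1 \<noteq> 0" "1 - z2 \<noteq> 0" using Im by (auto simp: complex_eq_iff)
  have "1 / (z1 + of_int (-1 - int n)) - 1 / (z2 + of_int (-1 - int n)) =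
      1 / ((1 - z2) + of_nat n) - 1 / ((1 - z1) + of_nat n)" for n
  proof -
    have "z + of_int (-1 - int n) = - ((1 - z) + of_nat n)" for z :: complex by simp
    then show ?thesis by (simp only: divide_minus_right) simp
  qed
  then have "(\<lambda>n. 1 / (z1 + of_int (-1 - int n)) - 1 / (z2 + of_int (-1 - int n))) sums
      (Digamma (1 - z1) - Digamma (1 - z2))"
    using D[OF ne(4,3)] by simp
  moreover have "(\<lambda>n. 1 / (z1 + of_int (int n)) - 1 / (z2 + of_int (int n))) sums (Digamma z2 - Digamma z1)"
    using D[OF ne(1,2)] by simp
  ultimately have "((\<lambda>c. 1 / (z1 + of_int c) - 1 / (z2 + of_int c)) has_sum
     ((Digamma z2 - Digamma z1) + (Digamma (1 - z1) - Digamma (1 - z2)))) UNIV"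
    by (intro int_has_sumI sum)
  then show ?thesis by (simp add: algebra_simps)
qed

lemma inverse_shift_tendsto_0:
  fixes z :: complex
  shows "(\<lambda>n. 1 / (z + of_int (int n))) \<longlonglongrightarrow> 0" "(\<lambda>n. 1 / (z + of_int (- int n))) \<longlonglongrightarrow> 0"
proof -
  have *: "(\<lambda>n. inverse (z + of_nat n)) \<longlonglongrightarrow> 0" for z :: complex
    by (intro filterlim_compose[OF tendsto_inverse_0]
              tendsto_add_filterlim_at_infinity[OF tendsto_const] tendsto_of_nat)
  show "(\<lambda>n. 1 / (z + of_int (int n))) \<longlonglongrightarrow> 0" using *[of z] by (simp add: divide_inverse)
  have "(\<lambda>n. - inverse (- z + of_nat n)) \<longlonglongrightarrow> - 0" by (intro tendsto_minus *)
  moreover have "- inverse (- z + of_nat n) = 1 / (z + of_int (- int n))" for n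
    by (metis (no_types, opaque_lifting) add.inverse_inverse divide_inverse inverse_minus_eq
        minus_add_distrib mult_1 of_int_minus of_int_of_nat_eq)
  ultimately show "(\<lambda>n. 1 / (z + of_int (- int n))) \<longlonglongrightarrow> 0" by simp
qed

text \<open>The double series of weight 2 converges only conditionally.  Subtracting from \<open>1 / x\<^sup>2\<close> the term
  \<open>1 / (x\<^sup>2 - 1/4) = 1 / (x - 1/2) - 1 / (x + 1/2)\<close>, which telescopes in both directions, makes it
  absolutely convergent; the telescoping sum is 0 by rows but \<open>-2 \<pi> i / \<tau>\<close> by columns.\<close>

lemma lattice_sum_2_S:
  assumes \<tau>: "\<tau> \<in> UHP"
  shows "lattice_sum 2 (-1/\<tau>) = \<tau>\<^sup>2 * lattice_sum 2 \<tau> - 2 * of_real pi * \<i> * \<tau>"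
proof -
  define x where "x = (\<lambda>c d :: int. of_int c * \<tau> + of_int d)"
  define a where "a = (\<lambda>c d. 1 / (x c d)\<^sup>2)"
  define t where "t = (\<lambda>c d. 1 / (x c d - 1/2) - 1 / (x c d + 1/2))"
  define u where "u = (\<lambda>c d. a c d - t c d)"
  have ne: "\<tau> \<noteq> 0" using \<tau> by (rule UHP_nonzero)
  from UHP_quadratic_form_bound[OF \<tau>] obtain \<delta> where
    \<delta>: "\<delta> > 0" "\<And>c d::real. \<delta> * (c\<^sup>2 + d\<^sup>2) \<le> (norm (of_real c * \<tau> + of_real d))\<^sup>2" by blast
  \<comment> \<open>The summand \<open>4\<close> covers the origin, where \<open>u 0 0 = 4\<close>;
    the summand \<open>4 / \<delta>^2\<close> covers all other lattice points.\<close>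
  define K where "K = 4 + 4 / \<delta>\<^sup>2"
  have K: "K \<ge> 4" "K * \<delta>\<^sup>2 \<ge> 4" using \<delta>(1) by (simp_all add: K_def field_simps)
  have half: "\<delta> * ((real_of_int c)\<^sup>2 + (real_of_int d)\<^sup>2) / 4 \<le> (norm (x c d + of_real r))\<^sup>2"
    "x c d + of_real r \<noteq> 0" if "r = 1/2 \<or> r = -1/2" for c d r
  proof -
    have *: "\<delta> * ((real_of_int c)\<^sup>2 + (real_of_int d + r)\<^sup>2) \<le> (norm (x c d + of_real r))\<^sup>2"
      using \<delta>(2)[of "of_int c" "of_int d + r"] by (simp add: x_def add_ac)
    have d0: "(real_of_int d)\<^sup>2 \<le> 4 * (real_of_int d + r)\<^sup>2 \<and> (real_of_int d + r)\<^sup>2 > 0"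
    proof -
      define s :: int where "s = (if r = 1/2 then 1 else -1)"
      have r: "r = real_of_int s / 2" and s: "s = 1 \<or> s = -1" using that by (auto simp: s_def)
      have "d\<^sup>2 \<le> (2 * d + s)\<^sup>2"
      proof -
        \<comment> \<open>No integer lies strictly between \<open>-1\<close> and
          \<open>-1/3\<close>, so the product is nonnegative for the integer
          \<open>s d\<close>.\<close>
        have "0 \<le> (3 * (s * d) + 1) * (s * d + 1)"
        proof -
          have "0 \<le> (3 * e + 1) * (e + 1)" for e :: int
            by (cases "e \<ge> 0") (auto intro!: mult_nonneg_nonneg mult_nonpos_nonpos)
          then show ?thesis .
        qed
        also have "\<dots> = (2 * d + s)\<^sup>2 - d\<^sup>2" using s by (auto simp: power2_eq_square algebra_simps)
        finally show ?thesis by simp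
      qed
      then have "real_of_int (d\<^sup>2) \<le> real_of_int ((2 * d + s)\<^sup>2)" by (simp only: of_int_le_iff)
      moreover have "real_of_int ((2 * d + s)\<^sup>2) = 4 * (real_of_int d + r)\<^sup>2"
        by (simp add: r power2_eq_square algebra_simps)
      moreover have "2 * d + s \<noteq> 0" using s by presburger
      then have "(2 * d + s)\<^sup>2 > 0" by simp
      then have "real_of_int ((2 * d + s)\<^sup>2) > 0" by (simp only: of_int_0_less_iff)
      ultimately show ?thesis by simp
    qed
    have "(real_of_int c)\<^sup>2 + (real_of_int d)\<^sup>2 \<le> 4 * ((real_of_int c)\<^sup>2 + (real_of_int d + r)\<^sup>2)"
    proof -
      have "C + D \<le> 4 * (C + E)" if "D \<le> 4 * E" "0 \<le> C" for C D E :: real using that by simp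
      from this[OF conjunct1[OF d0] zero_le_power2] show ?thesis .
    qed
    then have "\<delta> * ((real_of_int c)\<^sup>2 + (real_of_int d)\<^sup>2) \<le> \<delta> * (4 * ((real_of_int c)\<^sup>2 + (real_of_int d + r)\<^sup>2))"
      using \<delta>(1) by (intro mult_left_mono) auto
    also have "\<dots> = 4 * (\<delta> * ((real_of_int c)\<^sup>2 + (real_of_int d + r)\<^sup>2))" by (simp only: mult_ac)
    also have "\<dots> \<le> 4 * (norm (x c d + of_real r))\<^sup>2" using * by (intro mult_left_mono) auto
    finally show "\<delta> * ((real_of_int c)\<^sup>2 + (real_of_int d)\<^sup>2) / 4 \<le> (norm (x c d + of_real r))\<^sup>2"
      by (simp only: divide_le_eq_numeral1 mult.commute[of 4])
    have "0 < \<delta> * ((real_of_int c)\<^sup>2 + (real_of_int d + r)\<^sup>2)"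
      using d0 \<delta>(1) by (intro mult_pos_pos add_nonneg_pos) auto
    then show "x c d + of_real r \<noteq> 0" using * by auto
  qed
  have u_bound: "norm (u c d) \<le> K / ((1 + (real_of_int c)\<^sup>2) * (1 + (real_of_int d)\<^sup>2))" for c d
  proof (cases "(c, d) = (0, 0)")
    case True
    then show ?thesis using K by (simp add: u_def a_def t_def x_def)
  next
    case False
    define s where "s = (real_of_int c)\<^sup>2 + (real_of_int d)\<^sup>2"
    have s: "s \<ge> 1" unfolding s_def by (rule int_square_ge_1[OF False])
    have x2: "\<delta> * s \<le> (norm (x c d))\<^sup>2" using \<delta>(2)[of "of_int c" "of_int d"] by (simp add: s_def x_def)
    have x0: "x c d \<noteq> 0" using x2 s \<delta>(1) by auto (metis mult_pos_pos not_le order_less_le_trans zero_less_one)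
    have p: "\<delta> * s / 4 \<le> (norm (x c d + 1/2))\<^sup>2" "\<delta> * s / 4 \<le> (norm (x c d - 1/2))\<^sup>2"
      "x c d + 1/2 \<noteq> 0" "x c d - 1/2 \<noteq> 0"
      using half[of "1/2" c d] half[of "-1/2" c d] by (simp_all add: s_def)
    have "(\<delta> * s / 4)\<^sup>2 \<le> (norm (x c d + 1/2) * norm (x c d - 1/2))\<^sup>2"
      unfolding power_mult_distrib power2_eq_square[of "\<delta> * s / 4"]
      using p(1,2) \<delta>(1) s by (intro mult_mono) auto
    then have q: "\<delta> * s / 4 \<le> norm (x c d + 1/2) * norm (x c d - 1/2)"
      by (rule power2_le_imp_le) simp
    \<comment> \<open>The difference of \<open>1 / x^2\<close> and \<open>1 / (x^2 - 1/4)\<close>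
      decays like \<open>|x|^(-4)\<close>; this is the gain that makes the double sum of
      \<open>u\<close> absolutely convergent.\<close>
    have "u c d = - (1/4) / ((x c d)\<^sup>2 * ((x c d + 1/2) * (x c d - 1/2)))"
    proof -
      have "1 / X\<^sup>2 - (1 / (X - 1/2) - 1 / (X + 1/2)) = - (1/4) / (X\<^sup>2 * ((X + 1/2) * (X - 1/2)))"
        if "X \<noteq> 0" "X + 1/2 \<noteq> 0" "X - 1/2 \<noteq> 0" for X :: complex
      proof -
        have "1 / (X - 1/2) - 1 / (X + 1/2) = 1 / ((X + 1/2) * (X - 1/2))"
          using that by (simp add: diff_frac_eq)
        moreover have "1 / X\<^sup>2 - 1 / Y = (Y - X\<^sup>2) / (X\<^sup>2 * Y)" if "Y \<noteq> 0" for Y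
          using that \<open>X \<noteq> 0\<close> by (simp add: diff_frac_eq)
        moreover have "(X + 1/2) * (X - 1/2) - X\<^sup>2 = - (1/4)" by (simp add: power2_eq_square algebra_simps)
        moreover have "(X + 1/2) * (X - 1/2) \<noteq> 0" using that by simp
        ultimately show ?thesis by simp
      qed
      then show ?thesis using x0 p by (simp add: u_def a_def t_def)
    qed
    then have "norm (u c d) = (1/4) / ((norm (x c d))\<^sup>2 * (norm (x c d + 1/2) * norm (x c d - 1/2)))"
      by (simp add: norm_divide norm_mult norm_power)
    also have "\<dots> \<le> (1/4) / ((\<delta> * s) * (\<delta> * s / 4))"
      using x2 q \<delta>(1) s by (intro frac_le mult_mono mult_pos_pos) auto
    also have "\<dots> = 1 / (\<delta>\<^sup>2 * s\<^sup>2)" using \<delta>(1) s by (simp add: power2_eq_square field_simps)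
    also have "\<dots> \<le> K / (4 * s\<^sup>2)"
      using K \<delta>(1) s by (simp add: field_simps)
    also have "\<dots> \<le> K / ((1 + (real_of_int c)\<^sup>2) * (1 + (real_of_int d)\<^sup>2))"
    proof (intro divide_left_mono)
      have *: "1 + a \<le> 2 * (a + b)" if "1 \<le> a + b" "0 \<le> b" for a b :: real using that by simp
      have "(1 + (real_of_int c)\<^sup>2) * (1 + (real_of_int d)\<^sup>2) \<le> (2 * s) * (2 * s)"
      proof (intro mult_mono)
        show "1 + (real_of_int c)\<^sup>2 \<le> 2 * s" using s unfolding s_def by (rule *) simp
        show "1 + (real_of_int d)\<^sup>2 \<le> 2 * s"
          using s unfolding s_def add.commute[of "(real_of_int c)\<^sup>2"] by (rule *) simp
      qed (use s in auto)
      then show "(1 + (real_of_int c)\<^sup>2) * (1 + (real_of_int d)\<^sup>2) \<le> 4 * s\<^sup>2"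
        by (simp add: power2_eq_square)
    qed (use K s in \<open>auto intro!: mult_pos_pos add_pos_nonneg\<close>)
    finally show ?thesis .
  qed
  have frac_le: "K / ((1 + r\<^sup>2) * (1 + s\<^sup>2)) \<le> K / (1 + s\<^sup>2)" "K / ((1 + s\<^sup>2) * (1 + r\<^sup>2)) \<le> K / (1 + s\<^sup>2)" for r s :: real
    using K by (auto intro!: divide_left_mono mult_pos_pos add_pos_nonneg simp: algebra_simps)
  have u_row: "(\<lambda>d. u c d) summable_on UNIV" for c
    by (rule summable_on_int_comparison[of _ K]) (rule order_trans[OF u_bound frac_le(1)])
  have u_col: "(\<lambda>c. u c d) summable_on UNIV" for d
    by (rule summable_on_int_comparison[of _ K]) (rule order_trans[OF u_bound frac_le(2)])
  have u_sum: "(\<lambda>(c, d). u c d) summable_on UNIV \<times> UNIV"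
    using summable_on_int_int_comparison[of "\<lambda>(c, d). u c d" K] u_bound by simp
  have u_sum': "(\<lambda>(d, c). u c d) summable_on UNIV \<times> UNIV"
    using u_sum summable_on_swap[of "\<lambda>(c, d). u c d" UNIV UNIV] by simp
  from lattice_term_bounds[OF \<tau>, of 1] obtain K' where K':
    "\<And>c d. norm (1 / (of_int c * \<tau> + of_int d) ^ (2 * 1)) \<le> K' / (1 + (real_of_int d)\<^sup>2)"
    "\<And>c d. norm (1 / (of_int c * \<tau> + of_int d) ^ (2 * 1)) \<le> K' / (1 + (real_of_int c)\<^sup>2)"
    by auto
  have a_row: "(\<lambda>d. a c d) summable_on UNIV" for c
    by (rule summable_on_int_comparison[of _ K']) (use K'(1) in \<open>simp add: a_def x_def\<close>)
  have a_col: "(\<lambda>c. a c d) summable_on UNIV" for d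
    by (rule summable_on_int_comparison[of _ K']) (use K'(2) in \<open>simp add: a_def x_def\<close>)
  have t_eq: "t c d = a c d - u c d" for c d by (simp add: u_def)
  have t_row: "(t c has_sum 0) UNIV" for c
  proof -
    define h where "h = (\<lambda>d::int. 1 / ((of_int c * \<tau> - 1/2) + of_int d))"
    have t: "t c d = h d - h (d + 1)" for d by (simp add: t_def h_def x_def algebra_simps)
    have "(\<lambda>d. h d - h (d + 1)) summable_on UNIV"
      unfolding t[symmetric] unfolding t_eq by (intro summable_on_diff_complex a_row u_row)
    moreover have "(\<lambda>n. h (int n)) \<longlonglongrightarrow> 0" "(\<lambda>n. h (- int n)) \<longlonglongrightarrow> 0"
      unfolding h_def by (rule inverse_shift_tendsto_0)+
    ultimately have "((\<lambda>d. h d - h (d + 1)) has_sum (0 - 0)) UNIV" by (rule has_sum_telescope_int)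
    then show ?thesis unfolding t[symmetric] by simp
  qed
  have "infsum (u c) UNIV = infsum (a c) UNIV" for c
  proof -
    have "((\<lambda>d. a c d - t c d) has_sum (infsum (a c) UNIV - 0)) UNIV"
      by (intro has_sum_diff_complex has_sum_infsum a_row t_row)
    then show ?thesis unfolding u_def by (simp add: infsumI)
  qed
  then have L1: "lattice_sum 2 \<tau> = (\<Sum>\<^sub>\<infinity>c. \<Sum>\<^sub>\<infinity>d. u c d)"
    by (simp add: lattice_sum_def a_def x_def)
  define z where "z = (\<lambda>d::int. (of_int d - 1/2) / \<tau>)"
  have Im_z: "Im (z d) \<noteq> 0" for d
  proof -
    have "2 * d - 1 \<noteq> 0" by presburger
    then have "real_of_int (2 * d - 1) \<noteq> 0" by (simp only: of_int_eq_0_iff not_False_eq_True)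
    then have "real_of_int d - 1/2 \<noteq> 0" by simp
    moreover have "z d = of_real (real_of_int d - 1/2) / \<tau>" by (simp add: z_def)
    ultimately show ?thesis using \<tau> ne by (simp add: Im_divide_of_real Im_divide' UHP_def complex_eq_iff sum_power2_eq_zero_iff)
  qed
  \<comment> \<open>Summed over \<open>c\<close>, the correction \<open>t\<close> becomes
    \<open>h d - h (d + 1)\<close>, with \<open>h\<close> a cotangent by the reflection formula. So
    only the limits of \<open>h\<close> at both ends matter.\<close>
  define h where "h = (\<lambda>d. 1 / \<tau> * (Digamma (1 - z d) - Digamma (z d)))"
  have t_col: "((\<lambda>c. t c d) has_sum (h d - h (d + 1))) UNIV" for d
  proof -
    have tz: "t c d = 1 / \<tau> * (1 / (z d + of_int c) - 1 / (z (d + 1) + of_int c))" for c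
    proof -
      have "x c d - 1/2 = \<tau> * (z d + of_int c)" "x c d + 1/2 = \<tau> * (z (d + 1) + of_int c)"
        using ne by (simp_all add: x_def z_def field_simps)
      then show ?thesis unfolding t_def by (simp add: algebra_simps)
    qed
    have "(\<lambda>c. t c d) summable_on UNIV" unfolding t_eq by (intro summable_on_diff_complex a_col u_col)
    then have "(\<lambda>c. \<tau> * t c d) summable_on UNIV" by (rule summable_on_cmult_right)
    then have "(\<lambda>c. 1 / (z d + of_int c) - 1 / (z (d + 1) + of_int c)) summable_on UNIV"
      unfolding tz using ne by simp
    from has_sum_cmult_right[OF Digamma_difference_has_sum[OF Im_z Im_z this], of "1 / \<tau>"]
    show ?thesis unfolding tz h_def by (simp add: algebra_simps)
  qed
  define C where "C = (\<lambda>d. \<Sum>\<^sub>\<infinity>c. a c d)"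
  have C: "(C has_sum (lattice_sum 2 (-1/\<tau>) / \<tau>\<^sup>2)) UNIV"
    using lattice_column[OF \<tau>, of 1] by (simp add: C_def a_def x_def numeral_2_eq_2)
  have u_col_sum: "(\<Sum>\<^sub>\<infinity>c. u c d) = C d - (h d - h (d + 1))" for d
    unfolding u_def C_def by (intro infsumI has_sum_diff_complex has_sum_infsum a_col t_col)
  have "(\<lambda>d. \<Sum>\<^sub>\<infinity>c. u c d) summable_on UNIV"
    using summable_on_Sigma_banach[OF u_sum'] by simp
  from summable_on_diff_complex[OF has_sum_imp_summable[OF C] this]
  have h_sum: "(\<lambda>d. h d - h (d + 1)) summable_on UNIV"
    unfolding u_col_sum by simp
  \<comment> \<open>As \<open>d\<close> tends to plus infinity the nome of \<open>z d\<close> tends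
    to infinity, as \<open>d\<close> tends to minus infinity it tends to 0; the quotient
    \<open>(w + 1) / (w - 1)\<close> then has the limits \<open>1\<close> and
    \<open>-1\<close>.\<close>
  have "((\<lambda>d. h d - h (d + 1)) has_sum (- (of_real pi * \<i> / \<tau>) - of_real pi * \<i> / \<tau>)) UNIV"
  proof (rule has_sum_telescope_int[OF h_sum])
    define v A where "v = nome (-1/\<tau>)" and "A = nome (-1/(2*\<tau>))"
    have "norm v < 1" unfolding v_def by (intro norm_nome_less_1 neg_inverse_in_UHP \<tau>)
    then have v: "(\<lambda>n. v ^ n) \<longlonglongrightarrow> 0" by (rule LIMSEQ_power_zero)
    have A: "A \<noteq> 0" "v \<noteq> 0" by (simp_all add: A_def v_def)
    have hd: "h d = of_real pi * \<i> / \<tau> * ((nome (z d) + 1) / (nome (z d) - 1))" for d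
      unfolding h_def Digamma_reflection[OF Im_z] by simp
    have neg: "nome (z (- int n)) = A * v ^ n" for n
      unfolding A_def v_def nome_def z_def exp_of_nat_mult[symmetric] exp_add[symmetric]
      using ne by (intro arg_cong[where f = exp]) (simp add: field_simps)
    have "nome (z (int n)) * inverse A * v ^ n = 1" for n
      unfolding A_def v_def nome_def z_def exp_of_nat_mult[symmetric] exp_minus[symmetric] exp_add[symmetric]
      using ne by (simp add: field_simps)
    then have pos: "nome (z (int n)) = 1 / (inverse A * v ^ n)" for n
      using A by (simp add: field_simps)
    have "(\<lambda>n. of_real pi * \<i> / \<tau> * ((1 + inverse A * v ^ n) / (1 - inverse A * v ^ n))) \<longlonglongrightarrow>
        of_real pi * \<i> / \<tau> * ((1 + inverse A * 0) / (1 - inverse A * 0))"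
      by (intro tendsto_intros v) simp
    moreover have "(1 / w + 1) / (1 / w - 1) = (1 + w) / (1 - w)" if "w \<noteq> 0" for w :: complex
    proof -
      have "1 / w + 1 = (1 + w) / w" "1 / w - 1 = (1 - w) / w" using that by (simp_all add: field_simps)
      then show ?thesis using that by simp
    qed
    ultimately show "(\<lambda>n. h (int n)) \<longlonglongrightarrow> of_real pi * \<i> / \<tau>"
      unfolding hd pos using A by simp
    have "(\<lambda>n. of_real pi * \<i> / \<tau> * ((A * v ^ n + 1) / (A * v ^ n - 1))) \<longlonglongrightarrow>
        of_real pi * \<i> / \<tau> * ((A * 0 + 1) / (A * 0 - 1))"
      by (intro tendsto_intros v) simp
    then show "(\<lambda>n. h (- int n)) \<longlonglongrightarrow> - (of_real pi * \<i> / \<tau>)"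
      unfolding hd neg by simp
  qed
  from has_sum_diff_complex[OF C this]
  have "(\<Sum>\<^sub>\<infinity>d. \<Sum>\<^sub>\<infinity>c. u c d) = lattice_sum 2 (-1/\<tau>) / \<tau>\<^sup>2 + 2 * (of_real pi * \<i> / \<tau>)"
    unfolding u_col_sum by (auto intro!: infsumI simp: algebra_simps)
  moreover have "(\<Sum>\<^sub>\<infinity>c. \<Sum>\<^sub>\<infinity>d. u c d) = (\<Sum>\<^sub>\<infinity>d. \<Sum>\<^sub>\<infinity>c. u c d)"
    by (rule infsum_swap_banach[OF u_sum])
  ultimately show ?thesis
    unfolding L1 using ne by (simp add: power2_eq_square field_simps)
qed

text \<open>The row \<open>c = 0\<close> is twice the sum of the inverse squares,
  \<open>\<pi>^2 / 3\<close>. Dividing by it turns the lattice sum of weight 2 into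
  \<open>E2\<close>, anomaly included.\<close>

lemma E2_S:
  assumes \<tau>: "\<tau> \<in> UHP"
  shows "eval_fps E2_fps (nome (-1/\<tau>)) = \<tau>\<^sup>2 * eval_fps E2_fps (nome \<tau>) + 12 * \<tau> / (2 * of_real pi * \<i>)"
proof -
  have zeta: "((\<lambda>d::int. 1 / (of_int d)\<^sup>2) has_sum complex_of_real (pi\<^sup>2 / 6 + pi\<^sup>2 / 6)) UNIV"
  proof -
    have c: "(\<lambda>n. 1 / (of_nat n + 1)\<^sup>2) sums complex_of_real (pi\<^sup>2 / 6)"
      using sums_of_real[OF inverse_squares_sums, where 'a = complex] by (simp add: add.commute)
    have "(\<lambda>n. 1 / (complex_of_int (int n))\<^sup>2) sums complex_of_real (pi\<^sup>2 / 6)"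
      using sums_Suc[of "\<lambda>n. 1 / (complex_of_int (int n))\<^sup>2" "complex_of_real (pi\<^sup>2 / 6)"] c
      by (simp add: add.commute)
    moreover have "(complex_of_int (-1 - int n))\<^sup>2 = (of_nat n + 1)\<^sup>2" for n
      by (simp add: power2_eq_square algebra_simps)
    then have "(\<lambda>n. 1 / (complex_of_int (-1 - int n))\<^sup>2) sums complex_of_real (pi\<^sup>2 / 6)"
      using c by simp
    moreover have "(\<lambda>d::int. 1 / (complex_of_int d)\<^sup>2) summable_on UNIV"
    proof (rule summable_on_int_comparison)
      fix d :: int
      show "norm (1 / (complex_of_int d)\<^sup>2) \<le> 2 / (1 + (real_of_int d)\<^sup>2)"
      proof (cases "d = 0")
        case False
        then have "(real_of_int d)\<^sup>2 \<ge> 1" using int_square_ge_1[of d 0] by simp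
        then have "1 / D \<le> 2 / (1 + D)" if "D = (real_of_int d)\<^sup>2" for D
          using that by (simp add: divide_simps)
        then show ?thesis by (simp add: norm_divide norm_power)
      qed simp
    qed
    ultimately show ?thesis unfolding of_real_add by (intro int_has_sumI)
  qed
  have L: "lattice_sum 2 \<tau> = of_real pi ^ 2 / 3 * eval_fps E2_fps (nome \<tau>)" if "\<tau> \<in> UHP" for \<tau>
  proof -
    have E: "eval_fps E2_fps (nome \<tau>) = 1 - 24 * eval_fps (sigma_fps 1) (nome \<tau>)"
      by (simp add: E2_fps_def eval_disc_fps disc_fps_arith disc_sigma_fps norm_nome_less_1 that)
    have "lattice_sum 2 \<tau> = of_real pi ^ 2 / 3 + 2 * ((2 * of_real pi * \<i>) ^ 2 * eval_fps (sigma_fps 1) (nome \<tau>))"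
      using lattice_sum_eq[OF that, of 1] infsumI[OF zeta] by (simp add: numeral_2_eq_2[symmetric])
    then show ?thesis unfolding E by (simp add: power_mult_distrib algebra_simps)
  qed
  have eq: "of_real pi ^ 2 / 3 * eval_fps E2_fps (nome (-1/\<tau>)) =
      \<tau>\<^sup>2 * (of_real pi ^ 2 / 3 * eval_fps E2_fps (nome \<tau>)) - 2 * of_real pi * \<i> * \<tau>"
    using lattice_sum_2_S[OF \<tau>] unfolding L[OF \<tau>] L[OF neg_inverse_in_UHP[OF \<tau>]] .
  have "a = t\<^sup>2 * b + 12 * t / (2 * p * \<i>)"
    if "p ^ 2 / 3 * a = t\<^sup>2 * (p ^ 2 / 3 * b) - 2 * p * \<i> * t" "p \<noteq> 0" for a b p t :: complex
  proof -
    have "p * (p * (a - t\<^sup>2 * b)) = 3 * (p ^ 2 / 3 * a - t\<^sup>2 * (p ^ 2 / 3 * b))"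
      by (simp add: power2_eq_square algebra_simps)
    also have "\<dots> = p * (- 6 * \<i> * t)" unfolding that(1) by simp
    finally have "p * (a - t\<^sup>2 * b) = - 6 * \<i> * t" using that(2) by (simp only: mult_cancel_left simp_thms)
    moreover have "p * (12 * t / (2 * p * \<i>)) = - 6 * \<i> * t"
      using that(2) by (simp add: divide_simps)
    ultimately have "p * (a - t\<^sup>2 * b) = p * (12 * t / (2 * p * \<i>))" by (simp only:)
    then have "a - t\<^sup>2 * b = 12 * t / (2 * p * \<i>)" using that(2) by (simp only: mult_cancel_left simp_thms)
    then show ?thesis by (simp add: algebra_simps)
  qed
  from this[OF eq] show ?thesis by simp
qed

subsection \<open>The modular derivative of scalar functions\<close>

lemma has_field_derivative_powi:
  fixes z :: complex
  assumes "z \<noteq> 0"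
  shows "((\<lambda>z. z powi k) has_field_derivative of_int k * z powi (k - 1)) (at z within A)"
  using has_derivative_power_int'[OF assms, of k A]
  by (simp add: has_field_derivative_def mult_commute_abs mult_ac)

lemma powi_Suc: "z \<noteq> 0 \<Longrightarrow> z powi (k + 1) = z powi k * z" "z \<noteq> 0 \<Longrightarrow> z powi (k + 2) = z powi k * z\<^sup>2"
  "z \<noteq> 0 \<Longrightarrow> z powi (k - 1) = z powi k / z" for z :: complex
  by (simp_all add: power_int_add power_int_diff)

text \<open>The operator \<open>D\<close> on one component, without the cut-off outside the
  half-plane, so that iterating and differentiating it needs no case distinction.\<close>

definition scalar_deriv :: "int \<Rightarrow> (complex \<Rightarrow> complex) \<Rightarrow> complex \<Rightarrow> complex" where
  "scalar_deriv k f \<tau> = deriv f \<tau> / (2 * of_real pi * \<i>) - of_int k / 12 * E2 \<tau> * f \<tau>"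

lemma scalar_derivI:
  assumes "(f has_field_derivative 2 * of_real pi * \<i> * f') (at \<tau>)"
  shows "scalar_deriv k f \<tau> = f' - of_int k / 12 * E2 \<tau> * f \<tau>"
  unfolding scalar_deriv_def DERIV_imp_deriv[OF assms] by simp

lemma scalar_deriv_cong:
  assumes "\<tau> \<in> UHP" "\<And>z. z \<in> UHP \<Longrightarrow> f z = g z"
  shows "scalar_deriv k f \<tau> = scalar_deriv k g \<tau>"
proof -
  have "eventually (\<lambda>z. f z = g z) (nhds \<tau>)"
    using eventually_nhds_in_open[OF open_UHP assms(1)] by (rule eventually_mono) (use assms(2) in auto)
  then show ?thesis unfolding scalar_deriv_def by (simp add: deriv_cong_ev assms)
qed

lemma holomorphic_UHP_deriv:
  assumes "f holomorphic_on UHP" "\<tau> \<in> UHP"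
  shows "(f has_field_derivative deriv f \<tau>) (at \<tau>)"
  using assms by (rule holomorphic_derivI[OF _ open_UHP])

lemma E2_holomorphic: "E2 holomorphic_on UHP"
  using holomorphic_eval_fps_nome[OF disc_E_fps(1)] E2_eq by (simp cong: holomorphic_cong)

lemma holomorphic_scalar_deriv:
  assumes "f holomorphic_on UHP"
  shows "scalar_deriv k f holomorphic_on UHP"
  unfolding scalar_deriv_def
  by (intro holomorphic_intros holomorphic_deriv assms open_UHP E2_holomorphic) auto

lemma scalar_deriv_linear:
  assumes "\<And>j. j \<in> J \<Longrightarrow> f j holomorphic_on UHP" "\<tau> \<in> UHP"
  shows "scalar_deriv k (\<lambda>z. \<Sum>j\<in>J. c j * f j z) \<tau> = (\<Sum>j\<in>J. c j * scalar_deriv k (f j) \<tau>)"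
proof -
  have "((\<lambda>z. \<Sum>j\<in>J. c j * f j z) has_field_derivative (\<Sum>j\<in>J. c j * deriv (f j) \<tau>)) (at \<tau>)"
    by (intro DERIV_sum DERIV_cmult holomorphic_UHP_deriv assms)
  from DERIV_imp_deriv[OF this] show ?thesis
    by (simp add: scalar_deriv_def sum_divide_distrib sum_distrib_left sum_subtractf[symmetric] algebra_simps)
qed

lemma scalar_deriv_mult:
  assumes "f holomorphic_on UHP" "g holomorphic_on UHP" "\<tau> \<in> UHP"
  shows "scalar_deriv (k + l) (\<lambda>z. f z * g z) \<tau> = scalar_deriv k f \<tau> * g \<tau> + f \<tau> * scalar_deriv l g \<tau>"
proof -
  have "deriv (\<lambda>z. f z * g z) \<tau> = deriv f \<tau> * g \<tau> + f \<tau> * deriv g \<tau>"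
    by (rule DERIV_imp_deriv) (auto intro!: derivative_eq_intros holomorphic_UHP_deriv assms)
  then show ?thesis by (simp add: scalar_deriv_def field_simps)
qed

lemma E2_neg_inverse: "\<tau> \<in> UHP \<Longrightarrow> E2 (-1/\<tau>) = \<tau>\<^sup>2 * E2 \<tau> + 12 * \<tau> / (2 * of_real pi * \<i>)"
  using E2_S[of \<tau>] by (simp only: E2_eq neg_inverse_in_UHP)

lemma E2_plus_1: "\<tau> \<in> UHP \<Longrightarrow> E2 (\<tau> + 1) = E2 \<tau>"
  by (simp add: E2_eq plus_one_in_UHP)

lemma has_field_derivative_neg_inverse:
  fixes z :: complex
  assumes "z \<noteq> 0"
  shows "((\<lambda>z. -1/z) has_field_derivative 1 / z\<^sup>2) (at z within A)"
  using assms by (auto intro!: derivative_eq_intros simp: power2_eq_square)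

text \<open>Differentiating \<open>z^k\<close> produces a term \<open>k / z\<close>, which the
  anomaly of \<open>E2\<close> cancels. Two functions \<open>f\<close> and \<open>g\<close> are
  allowed so that the rule applies to components of a vector multiplied by a matrix.\<close>

lemma scalar_deriv_S:
  assumes f: "f holomorphic_on UHP" and g: "g holomorphic_on UHP" and \<tau>: "\<tau> \<in> UHP"
    and fg: "\<And>z. z \<in> UHP \<Longrightarrow> f (-1/z) = z powi k * g z"
  shows "scalar_deriv k f (-1/\<tau>) = \<tau> powi (k + 2) * scalar_deriv k g \<tau>"
proof -
  have ne: "\<tau> \<noteq> 0" using \<tau> by (rule UHP_nonzero)
  have \<tau>': "-1/\<tau> \<in> UHP" using \<tau> by (rule neg_inverse_in_UHP)
  have "((\<lambda>z. f (-1/z)) has_field_derivative deriv f (-1/\<tau>) * (1 / \<tau>\<^sup>2)) (at \<tau>)"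
    by (rule DERIV_chain2[OF holomorphic_UHP_deriv[OF f \<tau>'] has_field_derivative_neg_inverse[OF ne]])
  then have "((\<lambda>z. z powi k * g z) has_field_derivative deriv f (-1/\<tau>) * (1 / \<tau>\<^sup>2)) (at \<tau>)"
    by (rule has_field_derivative_transform_within_open[OF _ open_UHP \<tau> fg])
  moreover have "((\<lambda>z. z powi k * g z) has_field_derivative
      of_int k * \<tau> powi (k - 1) * g \<tau> + deriv g \<tau> * \<tau> powi k) (at \<tau>)"
    by (intro DERIV_mult has_field_derivative_powi ne holomorphic_UHP_deriv g \<tau>)
  ultimately have "deriv f (-1/\<tau>) * (1 / \<tau>\<^sup>2) = of_int k * \<tau> powi (k - 1) * g \<tau> + deriv g \<tau> * \<tau> powi k"
    by (rule DERIV_unique)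
  then have d: "deriv f (-1/\<tau>) = \<tau> powi k * (of_int k * \<tau> * g \<tau> + \<tau>\<^sup>2 * deriv g \<tau>)"
    using ne by (simp add: powi_Suc field_simps power2_eq_square)
  show ?thesis
    unfolding scalar_deriv_def d fg[OF \<tau>] E2_neg_inverse[OF \<tau>] powi_Suc(2)[OF ne]
    by (simp add: divide_simps) (simp add: algebra_simps power2_eq_square)
qed

lemma scalar_deriv_T:
  assumes f: "f holomorphic_on UHP" and \<tau>: "\<tau> \<in> UHP"
    and fg: "\<And>z. z \<in> UHP \<Longrightarrow> f (z + 1) = g z"
  shows "scalar_deriv k f (\<tau> + 1) = scalar_deriv k g \<tau>"
proof -
  have "((\<lambda>z. f (z + 1)) has_field_derivative deriv f (\<tau> + 1) * (1 + 0)) (at \<tau>)"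
    by (rule DERIV_chain2[where f = f and g = "\<lambda>z. z + 1", OF holomorphic_UHP_deriv[OF f plus_one_in_UHP[OF \<tau>]]])
      (intro DERIV_add DERIV_ident DERIV_const)
  then have "(g has_field_derivative deriv f (\<tau> + 1) * (1 + 0)) (at \<tau>)"
    by (rule has_field_derivative_transform_within_open[OF _ open_UHP \<tau> fg])
  then show ?thesis
    using fg[OF \<tau>] E2_plus_1[OF \<tau>] by (simp add: scalar_deriv_def DERIV_imp_deriv)
qed

text \<open>The quotient \<open>f / g\<close> has derivative zero on the convex set
  \<open>UHP\<close>.\<close>

lemma first_order_ODE_unique:
  assumes f: "\<And>\<tau>. \<tau> \<in> UHP \<Longrightarrow> (f has_field_derivative p \<tau> * f \<tau>) (at \<tau>)"
    and g: "\<And>\<tau>. \<tau> \<in> UHP \<Longrightarrow> (g has_field_derivative p \<tau> * g \<tau>) (at \<tau>)"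
    and nz: "\<And>\<tau>. \<tau> \<in> UHP \<Longrightarrow> g \<tau> \<noteq> 0"
  obtains c where "\<And>\<tau>. \<tau> \<in> UHP \<Longrightarrow> f \<tau> = c * g \<tau>"
proof -
  have "((\<lambda>\<tau>. f \<tau> / g \<tau>) has_field_derivative 0) (at \<tau> within UHP)" if "\<tau> \<in> UHP" for \<tau>
  proof -
    have "((\<lambda>\<tau>. f \<tau> / g \<tau>) has_field_derivative
        (p \<tau> * f \<tau> * g \<tau> - f \<tau> * (p \<tau> * g \<tau>)) / (g \<tau> * g \<tau>)) (at \<tau>)"
      by (intro DERIV_divide f g that nz)
    then show ?thesis by (simp add: mult_ac has_field_derivative_at_within)
  qed
  from has_field_derivative_zero_constant[OF convex_UHP this]
  obtain c where "\<And>\<tau>. \<tau> \<in> UHP \<Longrightarrow> f \<tau> / g \<tau> = c" by blast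
  then have "f \<tau> = c * g \<tau>" if "\<tau> \<in> UHP" for \<tau>
    using nz[OF that] that by (metis nonzero_divide_eq_eq)
  then show thesis by (rule that)
qed

subsection \<open>Powers of the eta function\<close>

text \<open>Twice the logarithm of the product of \<open>1 - q^n\<close> over
  \<open>n \<ge> 1\<close>: the sum of \<open>1/m\<close> over the divisors \<open>m\<close> of
  \<open>n\<close> is \<open>\<sigma>_1(n) / n\<close>.\<close>

definition eta_log_fps :: "complex fps" where
  "eta_log_fps = Abs_fps (\<lambda>n. - 2 * of_nat (divisor_sum 1 n) / of_nat n)"

lemma disc_eta_log_fps [intro]: "disc_fps eta_log_fps"
proof -
  have "conv_radius (fps_nth eta_log_fps) \<ge> 1"
  proof (rule conv_radius_geI_ex')
    fix r :: real
    assume r: "0 < r" "ereal r < 1"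
    show "summable (\<lambda>n. fps_nth eta_log_fps n * of_real r ^ n)"
    proof (rule summable_comparison_test)
      have "summable (\<lambda>n. norm (fps_nth (sigma_fps 1) n * of_real r ^ n))"
        by (rule norm_summable_fps, rule disc_fps_less) (use r in auto)
      then show "summable (\<lambda>n. 2 * norm (fps_nth (sigma_fps 1) n * of_real r ^ n))"
        by (rule summable_mult)
      have "norm (fps_nth eta_log_fps n) \<le> 2 * norm (fps_nth (sigma_fps 1) n)" for n
      proof (cases "n = 0")
        case False
        then show ?thesis
          by (auto simp: sigma_fps_def eta_log_fps_def norm_divide norm_mult divide_simps)
            (metis One_nat_def Suc_leI mult.right_neutral mult_left_mono neq0_conv of_nat_0_le_iff of_nat_1 of_nat_mono)
      qed (simp add: eta_log_fps_def)
      from mult_right_mono[OF this, of "r ^ n" for n]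
      show "\<exists>N. \<forall>n\<ge>N. norm (fps_nth eta_log_fps n * of_real r ^ n)
          \<le> 2 * norm (fps_nth (sigma_fps 1) n * of_real r ^ n)"
        using r by (auto simp: norm_mult norm_power)
    qed
  qed
  then show ?thesis by (simp add: disc_fps_def fps_conv_radius_def)
qed

text \<open>\<open>eta_power k\<close> is \<open>\<eta>\<^bsup>2 k\<^esup>\<close>, the solution of \<open>D\<^sub>k f = 0\<close>.\<close>

definition eta_power :: "int \<Rightarrow> complex \<Rightarrow> complex" where
  "eta_power k \<tau> = nome (of_int k / 12 * \<tau>) * exp (of_int k * eval_fps eta_log_fps (nome \<tau>))"

lemma eta_power_nonzero [simp]: "eta_power k \<tau> \<noteq> 0"
  by (simp add: eta_power_def)

lemma theta_eta_log_fps: "theta_fps eta_log_fps = fps_const (1/12) * (E2_fps - 1)"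
  by (rule fps_ext) (simp add: eta_log_fps_def E2_fps_def sigma_fps_def numeral_fps_const)

lemma eta_power_deriv:
  assumes \<tau>: "\<tau> \<in> UHP"
  shows "(eta_power k has_field_derivative 2 * of_real pi * \<i> * (of_int k / 12 * E2 \<tau> * eta_power k \<tau>)) (at \<tau>)"
proof -
  have "norm (nome \<tau>) < 1" using \<tau> by (rule norm_nome_less_1)
  then have th: "eval_fps (theta_fps eta_log_fps) (nome \<tau>) = (E2 \<tau> - 1) / 12"
    unfolding theta_eta_log_fps using \<tau> by (simp add: eval_disc_fps disc_fps_arith disc_E_fps E2_eq)
  have "(eta_power k has_field_derivative
      (2 * of_real pi * \<i> * (of_int k / 12 * 1) * nome (of_int k / 12 * \<tau>)) * exp (of_int k * eval_fps eta_log_fps (nome \<tau>)) +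
      (exp (of_int k * eval_fps eta_log_fps (nome \<tau>)) * (of_int k * (2 * of_real pi * \<i> * eval_fps (theta_fps eta_log_fps) (nome \<tau>)))) *
       nome (of_int k / 12 * \<tau>)) (at \<tau>)"
    unfolding eta_power_def[abs_def]
    by (intro DERIV_mult nome_has_field_derivative DERIV_cmult DERIV_ident DERIV_fun_exp eval_fps_nome_deriv \<tau> disc_eta_log_fps)
  then show ?thesis unfolding th
    by (rule DERIV_cong) (simp add: eta_power_def field_simps)
qed

lemma eta_power_holomorphic: "eta_power k holomorphic_on UHP"
  by (rule holomorphic_onI) (use eta_power_deriv in \<open>auto simp: field_differentiable_def intro: has_field_derivative_at_within\<close>)

lemma scalar_deriv_eta_power: "\<tau> \<in> UHP \<Longrightarrow> scalar_deriv k (eta_power k) \<tau> = 0"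
  using scalar_derivI[OF eta_power_deriv] by simp

text \<open>By the anomaly of \<open>E2\<close> both sides solve the same linear first-order
  equation, hence are proportional; the fixed point \<open>i\<close> of the inversion determines the
  constant.\<close>

lemma eta_power_S:
  assumes "\<tau> \<in> UHP"
  shows "eta_power k (-1/\<tau>) = \<i> powi (-k) * \<tau> powi k * eta_power k \<tau>"
proof -
  define p where "p = (\<lambda>\<tau>. 2 * of_real pi * \<i> * (of_int k / 12 * E2 \<tau>) + of_int k / \<tau>)"
  have d1: "((\<lambda>\<tau>. eta_power k (-1/\<tau>)) has_field_derivative p z * eta_power k (-1/z)) (at z)" if z: "z \<in> UHP" for z
  proof -
    have ne: "z \<noteq> 0" using z by (rule UHP_nonzero)
    have "((\<lambda>\<tau>. eta_power k (-1/\<tau>)) has_field_derivative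
       2 * of_real pi * \<i> * (of_int k / 12 * E2 (-1/z) * eta_power k (-1/z)) * (1 / z\<^sup>2)) (at z)"
      by (rule DERIV_chain2[OF eta_power_deriv[OF neg_inverse_in_UHP[OF z]] has_field_derivative_neg_inverse[OF ne]])
    then show ?thesis unfolding E2_neg_inverse[OF z]
      by (rule DERIV_cong) (use ne in \<open>simp add: p_def field_simps power2_eq_square\<close>)
  qed
  have d2: "((\<lambda>z. z powi k * eta_power k z) has_field_derivative p z * (z powi k * eta_power k z)) (at z)"
    if z: "z \<in> UHP" for z
  proof -
    have ne: "z \<noteq> 0" using z by (rule UHP_nonzero)
    have "((\<lambda>z. z powi k * eta_power k z) has_field_derivative
       of_int k * z powi (k - 1) * eta_power k z + 2 * of_real pi * \<i> * (of_int k / 12 * E2 z * eta_power k z) * z powi k) (at z)"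
      by (intro DERIV_mult has_field_derivative_powi ne eta_power_deriv z)
    then show ?thesis
      by (rule DERIV_cong) (use ne in \<open>simp add: p_def powi_Suc field_simps\<close>)
  qed
  have d3: "z powi k * eta_power k z \<noteq> 0" if "z \<in> UHP" for z
    using UHP_nonzero[OF that] by simp
  obtain c where c: "\<And>z. z \<in> UHP \<Longrightarrow> eta_power k (-1/z) = c * (z powi k * eta_power k z)"
    using first_order_ODE_unique[of "\<lambda>\<tau>. eta_power k (-1/\<tau>)" p "\<lambda>z. z powi k * eta_power k z", OF d1 d2 d3]
    by blast
  have "eta_power k \<i> = c * (\<i> powi k * eta_power k \<i>)" using c[of \<i>] by (simp add: UHP_def)
  then have "c * \<i> powi k = 1" by simp
  then have "c = \<i> powi (-k)" by (simp add: power_int_minus field_simps)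
  then show ?thesis using c[OF assms] by simp
qed

subsection \<open>Modular forms of level one\<close>

text \<open>A modular form of level one, as a function of \<open>q\<close>: invariance under \<open>T\<close> is built in.\<close>

definition level1_form :: "int \<Rightarrow> (complex \<Rightarrow> complex) \<Rightarrow> bool" where
  "level1_form k h \<longleftrightarrow> h holomorphic_on ball 0 1 \<and>
     (\<forall>\<tau>\<in>UHP. h (nome (-1/\<tau>)) = \<tau> powi k * h (nome \<tau>))"

lemma level1_form_mult:
  assumes "level1_form k g" "level1_form l h"
  shows "level1_form (k + l) (\<lambda>q. g q * h q)"
  using assms UHP_nonzero by (auto simp: level1_form_def power_int_add intro!: holomorphic_intros)

lemma level1_form_cmult: "level1_form k g \<Longrightarrow> level1_form k (\<lambda>q. c * g q)"
  by (auto simp: level1_form_def intro!: holomorphic_intros)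

lemma level1_form_diff: "level1_form k g \<Longrightarrow> level1_form k h \<Longrightarrow> level1_form k (\<lambda>q. g q - h q)"
  by (auto simp: level1_form_def algebra_simps intro!: holomorphic_intros)

lemma level1_form_const: "level1_form 0 (\<lambda>q. c)"
  by (simp add: level1_form_def)

lemma level1_form_power:
  assumes "level1_form k g"
  shows "level1_form (int n * k) (\<lambda>q. g q ^ n)"
proof (induction n)
  case (Suc n)
  from level1_form_mult[OF assms Suc] show ?case by (simp add: algebra_simps)
qed (simp add: level1_form_const)

text \<open>The discriminant, \<open>q\<close> times the product of \<open>(1 - q^n)^24\<close>. The
  exponential form shows that its only zero is simple and lies at \<open>q = 0\<close>.\<close>

definition delta :: "complex \<Rightarrow> complex" where
  "delta q = q * exp (12 * eval_fps eta_log_fps q)"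

lemma delta_eq_0_iff [simp]: "delta q = 0 \<longleftrightarrow> q = 0"
  by (simp add: delta_def)

lemma level1_form_delta: "level1_form 12 delta"
proof -
  have "delta (nome \<tau>) = eta_power 12 \<tau>" for \<tau> by (simp add: delta_def eta_power_def)
  moreover have "\<i> powi (-12) = 1" by (simp add: power_int_minus)
  ultimately have "delta (nome (-1/\<tau>)) = \<tau> powi 12 * delta (nome \<tau>)" if "\<tau> \<in> UHP" for \<tau>
    using eta_power_S[OF that, of 12] by simp
  moreover have "delta holomorphic_on ball 0 1"
    unfolding delta_def[abs_def] by (intro holomorphic_intros holomorphic_disc_fps disc_eta_log_fps)
  ultimately show ?thesis by (simp add: level1_form_def)
qed

text \<open>After a translation to \<open>|Re z| \<le> 1/2\<close>, a point with
  \<open>Im z < 1/2\<close> has \<open>|z|^2 \<le> 1/2\<close>, so inversion at least doubles the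
  imaginary part. The induction counts the doublings still needed.\<close>

lemma UHP_reduce:
  assumes "\<tau> \<in> UHP"
    and h: "\<And>z. z \<in> UHP \<Longrightarrow> h (nome (-1/z)) = h (nome z)"
  obtains \<tau>' where "\<tau>' \<in> UHP" "Im \<tau>' \<ge> 1/2" "h (nome \<tau>') = h (nome \<tau>)"
proof -
  have "\<exists>\<tau>'\<in>UHP. Im \<tau>' \<ge> 1/2 \<and> h (nome \<tau>') = h (nome \<tau>)" if "\<tau> \<in> UHP" "Im \<tau> \<ge> 1 / 2 ^ n" for n \<tau>
    using that
  proof (induction n arbitrary: \<tau>)
    case 0
    then show ?case by (intro bexI[of _ \<tau>]) auto
  next
    case (Suc n)
    show ?case
    proof (cases "Im \<tau> \<ge> 1/2")
      case True
      then show ?thesis using Suc.prems by blast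
    next
      case False
      define z where "z = \<tau> + of_int (- round (Re \<tau>))"
      have z: "z \<in> UHP" "Im z = Im \<tau>" "nome z = nome \<tau>"
        using Suc.prems(1) by (simp_all add: z_def UHP_def del: of_int_minus)
      have "\<bar>Re z\<bar> \<le> 1/2"
        using of_int_round_abs_le[of "Re \<tau>"] by (simp add: z_def abs_minus_commute)
      then have "(Re z)\<^sup>2 \<le> (1/2)\<^sup>2" by (metis abs_ge_zero power2_abs power_mono)
      moreover have "(Im z)\<^sup>2 \<le> (1/2)\<^sup>2" using False z by (intro power_mono) (auto simp: UHP_def)
      ultimately have le: "(Re z)\<^sup>2 + (Im z)\<^sup>2 \<le> 1/2" by (simp add: power2_eq_square)
      have pos: "(Re z)\<^sup>2 + (Im z)\<^sup>2 > 0" using z by (simp add: UHP_def sum_power2_gt_zero_iff)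
      have "Im (-1/z) = Im z / ((Re z)\<^sup>2 + (Im z)\<^sup>2)"
        by (simp add: Im_divide' cmod_power2)
      also have "\<dots> \<ge> Im z / (1/2)" using z le pos by (intro divide_left_mono) (auto simp: UHP_def)
      finally have "Im (-1/z) \<ge> 2 * Im \<tau>" using z by simp
      also have "2 * Im \<tau> \<ge> 2 * (1 / 2 ^ Suc n)" using Suc.prems(2) by (intro mult_left_mono) auto
      finally have "Im (-1/z) \<ge> 1 / 2 ^ n" by simp
      from Suc.IH[OF neg_inverse_in_UHP[OF z(1)] this] show ?thesis
        using h[OF z(1)] z(3) by simp
    qed
  qed
  moreover have "\<exists>n. Im \<tau> \<ge> 1 / 2 ^ n"
    using real_arch_pow_inv[of "Im \<tau>" "1/2"] assms(1) by (auto simp: UHP_def power_one_over intro: less_imp_le)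
  ultimately show thesis using assms(1) that by blast
qed

text \<open>Every value of \<open>h\<close> is attained on the closed disc of radius
  \<open>exp (- \<pi>)\<close>, which contains the cusp and the nomes of all \<open>\<tau>\<close>
  with \<open>Im \<tau> \<ge> 1/2\<close>. So \<open>|h|\<close> has an interior maximum.\<close>

lemma level1_form_weight_0:
  assumes "level1_form 0 h" "q \<in> ball 0 1"
  shows "h q = h 0"
proof -
  have hol: "h holomorphic_on ball 0 1" and inv: "\<And>z. z \<in> UHP \<Longrightarrow> h (nome (-1/z)) = h (nome z)"
    using assms(1) by (auto simp: level1_form_def)
  define r where "r = exp (- pi)"
  have r: "0 < r" "r < 1" by (simp_all add: r_def)
  have "continuous_on (cball 0 r) (\<lambda>q. norm (h q))"
    by (intro continuous_intros continuous_on_subset[OF holomorphic_on_imp_continuous_on[OF hol]]) (use r in auto)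
  then obtain q0 where q0: "q0 \<in> cball 0 r" "\<And>q. q \<in> cball 0 r \<Longrightarrow> norm (h q) \<le> norm (h q0)"
    using continuous_attains_sup[of "cball 0 r" "\<lambda>q. norm (h q)"] r by auto
  have "norm (h q) \<le> norm (h q0)" if "q \<in> ball 0 1" for q
  proof (cases "q = 0")
    case True
    then show ?thesis using q0(2)[of 0] r by simp
  next
    case False
    from nome_surj[OF that this] obtain \<tau> where \<tau>: "\<tau> \<in> UHP" "nome \<tau> = q" .
    from UHP_reduce[OF \<tau>(1), of h] inv obtain \<tau>' where
      \<tau>': "\<tau>' \<in> UHP" "Im \<tau>' \<ge> 1/2" "h (nome \<tau>') = h (nome \<tau>)" by metis
    have "norm (nome \<tau>') \<le> r" using \<tau>'(2) by (simp add: norm_nome r_def)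
    then show ?thesis using q0(2)[of "nome \<tau>'"] \<tau> \<tau>' by simp
  qed
  then have "h constant_on ball 0 1"
    by (intro maximum_modulus_principle[OF hol open_ball connected_ball open_ball order_refl, of q0]) (use q0 r in auto)
  then show ?thesis using assms(2) by (auto simp: constant_on_def)
qed

lemma eq_0_on_disc:
  assumes "h holomorphic_on ball 0 1" "\<And>q. q \<in> ball 0 1 \<Longrightarrow> q \<noteq> 0 \<Longrightarrow> h q = 0" "q \<in> ball 0 1"
  shows "h q = (0::complex)"
proof (cases "q = 0")
  case True
  have "(h \<longlongrightarrow> h 0) (at 0)"
    using holomorphic_on_imp_continuous_on[OF assms(1)] by (simp add: continuous_on_eq_continuous_at isCont_def)
  moreover have "eventually (\<lambda>z. h z = 0) (at 0)"
    using assms(2) eventually_at_in_open[of "ball 0 1" "0::complex"] by (auto elim!: eventually_mono)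
  ultimately have "((\<lambda>z::complex. 0::complex) \<longlongrightarrow> h 0) (at 0)" by (rule Lim_transform_eventually)
  then show ?thesis using True by (simp add: tendsto_const_iff)
qed (use assms in auto)

text \<open>The product of \<open>h^12\<close> with the power \<open>-k\<close> of
  \<open>delta\<close> has weight 0 and vanishes at the cusp, so it is zero; \<open>delta\<close>
  has no zero for \<open>q \<noteq> 0\<close>.\<close>

lemma level1_form_negative_weight:
  assumes h: "level1_form k h" and "k < 0" "q \<in> ball 0 1"
  shows "h q = 0"
proof (rule eq_0_on_disc[of h])
  show "h holomorphic_on ball 0 1" using h by (simp add: level1_form_def)
  fix q assume q: "q \<in> ball (0::complex) 1" "q \<noteq> 0"
  have "level1_form (int 12 * k + int (nat (- k)) * 12) (\<lambda>q. h q ^ 12 * delta q ^ nat (- k))"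
    by (intro level1_form_mult level1_form_power level1_form_delta h)
  then have "level1_form 0 (\<lambda>q. h q ^ 12 * delta q ^ nat (- k))" using \<open>k < 0\<close> by simp
  from level1_form_weight_0[OF this q(1)] \<open>k < 0\<close> have "h q ^ 12 * delta q ^ nat (- k) = 0" by simp
  then show "h q = 0" using q by simp
qed (use assms in auto)

text \<open>Applying the inversion twice gives the factor \<open>(-1)^k = -1\<close>.\<close>

lemma level1_form_odd:
  assumes h: "level1_form k h" and "odd k" "q \<in> ball 0 1"
  shows "h q = 0"
proof (rule eq_0_on_disc[of h])
  show "h holomorphic_on ball 0 1" using h by (simp add: level1_form_def)
  fix q assume q: "q \<in> ball (0::complex) 1" "q \<noteq> 0"
  from nome_surj[OF q] obtain \<tau> where \<tau>: "\<tau> \<in> UHP" "nome \<tau> = q" .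
  have ne: "\<tau> \<noteq> 0" using \<tau>(1) by (rule UHP_nonzero)
  have inv: "-1/(-1/\<tau>) = \<tau>" by simp
  have trans: "h (nome (-1/z)) = z powi k * h (nome z)" if "z \<in> UHP" for z
    using h that unfolding level1_form_def by blast
  have "h (nome \<tau>) = ((-1/\<tau>) powi k * \<tau> powi k) * h (nome \<tau>)"
    using trans[OF neg_inverse_in_UHP[OF \<tau>(1)]] unfolding inv trans[OF \<tau>(1)] by (simp only: mult.assoc)
  also have "(-1/\<tau>) powi k * \<tau> powi k = -1"
    unfolding power_int_mult_distrib[symmetric] using ne \<open>odd k\<close> by simp
  finally have "h (nome \<tau>) = 0" by simp
  then show "h q = 0" using \<tau> by simp
qed (use assms in auto)

text \<open>The zero of \<open>delta\<close> at \<open>q = 0\<close> is simple and it has no other,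
  so dividing by \<open>delta\<close> keeps holomorphy on the disc.\<close>

lemma level1_cusp_form:
  assumes h: "level1_form k h" "h 0 = 0"
  obtains g where "level1_form (k - 12) g" "\<And>q. q \<in> ball 0 1 \<Longrightarrow> h q = delta q * g q"
proof -
  have hol: "h holomorphic_on ball 0 1" using h by (simp add: level1_form_def)
  from Schwarz3[OF hol h(2)] obtain f where f: "f holomorphic_on ball 0 1" "\<And>z. norm z < 1 \<Longrightarrow> h z = z * f z" by metis
  define g where "g = (\<lambda>q. f q / exp (12 * eval_fps eta_log_fps q))"
  have eq: "h q = delta q * g q" if "q \<in> ball 0 1" for q
    using f(2)[of q] that by (simp add: g_def delta_def)
  have "g holomorphic_on ball 0 1"
    unfolding g_def by (intro holomorphic_intros holomorphic_disc_fps disc_eta_log_fps f) auto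
  moreover have "g (nome (-1/\<tau>)) = \<tau> powi (k - 12) * g (nome \<tau>)" if \<tau>: "\<tau> \<in> UHP" for \<tau>
  proof -
    have ne: "\<tau> \<noteq> 0" using \<tau> by (rule UHP_nonzero)
    have "delta (nome (-1/\<tau>)) * g (nome (-1/\<tau>)) = \<tau> powi k * (delta (nome \<tau>) * g (nome \<tau>))"
      using h(1) \<tau> eq[OF nome_in_ball[OF \<tau>]] eq[OF nome_in_ball[OF neg_inverse_in_UHP[OF \<tau>]]]
      by (simp add: level1_form_def)
    moreover have "delta (nome (-1/\<tau>)) = \<tau> powi 12 * delta (nome \<tau>)"
      using level1_form_delta \<tau> unfolding level1_form_def by blast
    moreover have "\<tau> powi k = \<tau> powi 12 * \<tau> powi (k - 12)"
      using ne power_int_add[of \<tau> 12 "k - 12"] by simp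
    ultimately have "(\<tau> powi 12 * delta (nome \<tau>)) * g (nome (-1/\<tau>)) = (\<tau> powi 12 * delta (nome \<tau>)) * (\<tau> powi (k - 12) * g (nome \<tau>))"
      by (simp only: mult_ac)
    then show ?thesis using ne by (simp only: mult_cancel_left) simp
  qed
  ultimately have "level1_form (k - 12) g" by (simp add: level1_form_def)
  then show thesis using eq by (rule that)
qed

lemma level1_form_small_weight:
  assumes h: "level1_form k h" "h 0 = 0" "k < 12" "q \<in> ball 0 1"
  shows "h q = 0"
proof -
  from level1_cusp_form[OF h(1,2)] obtain g where
    g: "level1_form (k - 12) g" "\<And>q. q \<in> ball 0 1 \<Longrightarrow> h q = delta q * g q" by blast
  then show ?thesis using level1_form_negative_weight[OF g(1), of q] h by simp
qed

text \<open>The difference of the two sides is a cusp form of weight less than 12.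
  Cross-multiplication avoids a case distinction on vanishing constant terms.\<close>

lemma level1_form_proportional:
  assumes "level1_form k g" "level1_form k h" "k < 12" "q \<in> ball 0 1"
  shows "h 0 * g q = g 0 * h q"
proof -
  have "level1_form k (\<lambda>q. h 0 * g q - g 0 * h q)"
    by (intro level1_form_diff level1_form_cmult assms)
  from level1_form_small_weight[OF this _ assms(3,4)] show ?thesis by simp
qed

section \<open>Ramanujan's identities and the modularity of \<open>E4\<close> and
  \<open>E6\<close>\<close>

lemma level1_form_evalI:
  assumes "disc_fps F" "\<And>\<tau>. \<tau> \<in> UHP \<Longrightarrow> eval_fps F (nome (-1/\<tau>)) = \<tau> powi k * eval_fps F (nome \<tau>)"
  shows "level1_form k (eval_fps F)"
  using assms holomorphic_disc_fps by (simp add: level1_form_def)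

lemma level1_form_derivative:
  assumes F: "disc_fps F" "level1_form k (eval_fps F)"
  shows "level1_form (k + 2) (eval_fps (theta_fps F - fps_const (of_int k / 12) * E2_fps * F))"
proof (rule level1_form_evalI)
  have eq: "eval_fps (theta_fps F - fps_const (of_int k / 12) * E2_fps * F) (nome \<tau>) =
      scalar_deriv k (\<lambda>z. eval_fps F (nome z)) \<tau>" if "\<tau> \<in> UHP" for \<tau>
    unfolding scalar_derivI[OF eval_fps_nome_deriv[OF F(1) that]]
    using norm_nome_less_1[OF that] that F(1)
    by (simp add: eval_disc_fps disc_fps_arith disc_E_fps disc_theta_fps E2_eq)
  fix \<tau> assume \<tau>: "\<tau> \<in> UHP"
  show "eval_fps (theta_fps F - fps_const (of_int k / 12) * E2_fps * F) (nome (-1/\<tau>)) =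
     \<tau> powi (k + 2) * eval_fps (theta_fps F - fps_const (of_int k / 12) * E2_fps * F) (nome \<tau>)"
    unfolding eq[OF \<tau>] eq[OF neg_inverse_in_UHP[OF \<tau>]]
    by (rule scalar_deriv_S) (use F \<tau> in \<open>auto simp: level1_form_def intro!: holomorphic_eval_fps_nome\<close>)
qed (use F in auto)

text \<open>The combination \<open>E\<^sub>2\<^sup>2 - 12 \<theta> E\<^sub>2\<close> is modular because the anomalies of the two terms cancel.\<close>

lemma level1_form_E2_square:
  "level1_form 4 (eval_fps (E2_fps ^ 2 - 12 * theta_fps E2_fps))"
proof (rule level1_form_evalI)
  fix \<tau> assume \<tau>: "\<tau> \<in> UHP"
  have ne: "\<tau> \<noteq> 0" using \<tau> by (rule UHP_nonzero)
  note \<tau>' = neg_inverse_in_UHP[OF \<tau>]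
  let ?P = "2 * of_real pi * \<i> :: complex" and ?E = "\<lambda>z. eval_fps E2_fps (nome z)"
    and ?D = "\<lambda>z. eval_fps (theta_fps E2_fps) (nome z)"
  have "((\<lambda>z. ?E (-1/z)) has_field_derivative ?P * ?D (-1/\<tau>) * (1 / \<tau>\<^sup>2)) (at \<tau>)"
    by (rule DERIV_chain2[OF eval_fps_nome_deriv[OF disc_E_fps(1) \<tau>'] has_field_derivative_neg_inverse[OF ne]])
  then have "((\<lambda>z. z\<^sup>2 * ?E z + 12 * z / ?P) has_field_derivative ?P * ?D (-1/\<tau>) * (1 / \<tau>\<^sup>2)) (at \<tau>)"
    by (rule has_field_derivative_transform_within_open[OF _ open_UHP \<tau> E2_S])
  moreover have "((\<lambda>z. z\<^sup>2 * ?E z + 12 * z / ?P) has_field_derivative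
      (2 * \<tau> * ?E \<tau> + (?P * ?D \<tau>) * \<tau>\<^sup>2) + 12 / ?P) (at \<tau>)"
  proof -
    have "((\<lambda>z. z\<^sup>2) has_field_derivative 2 * \<tau>) (at \<tau>)" by (auto intro!: derivative_eq_intros)
    moreover have "((\<lambda>z. 12 * z / ?P) has_field_derivative 12 / ?P) (at \<tau>)"
      by (auto intro!: derivative_eq_intros)
    ultimately show ?thesis
      by (intro DERIV_add DERIV_mult eval_fps_nome_deriv[OF disc_E_fps(1) \<tau>])
  qed
  ultimately have D: "?P * ?D (-1/\<tau>) * (1 / \<tau>\<^sup>2) = (2 * \<tau> * ?E \<tau> + (?P * ?D \<tau>) * \<tau>\<^sup>2) + 12 / ?P"
    by (rule DERIV_unique)
  have "?D (-1/\<tau>) = \<tau>\<^sup>2 * (?P * ?D (-1/\<tau>) * (1 / \<tau>\<^sup>2)) / ?P"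
    using ne by simp
  then have D': "?D (-1/\<tau>) = \<tau>\<^sup>2 * ((2 * \<tau> * ?E \<tau> + (?P * ?D \<tau>) * \<tau>\<^sup>2) + 12 / ?P) / ?P"
    unfolding D .
  have gen: "(t\<^sup>2 * e + 12 * t / P) ^ 2 - 12 * (t\<^sup>2 * ((2 * t * e + (P * d) * t\<^sup>2) + 12 / P) / P) = t ^ 4 * (e ^ 2 - 12 * d)"
    if "P \<noteq> 0" for t e P d :: complex
    using that by (simp add: field_simps power2_eq_square power4_eq_xxxx)
  have "?E (-1/\<tau>) ^ 2 - 12 * ?D (-1/\<tau>) = \<tau> ^ 4 * (?E \<tau> ^ 2 - 12 * ?D \<tau>)"
    unfolding E2_S[OF \<tau>] D' by (rule gen) simp
  then show "eval_fps (E2_fps ^ 2 - 12 * theta_fps E2_fps) (nome (-1/\<tau>)) =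
      \<tau> powi 4 * eval_fps (E2_fps ^ 2 - 12 * theta_fps E2_fps) (nome \<tau>)"
    using norm_nome_less_1[OF \<tau>] norm_nome_less_1[OF \<tau>']
    by (simp add: eval_disc_fps disc_fps_arith disc_fps_power disc_E_fps disc_theta_fps)
qed auto

text \<open>Comparing a form \<open>F\<close> of weight \<open>j + 1 < 12\<close> with the lattice sum, all coefficients of \<open>F\<close> follow
  from the first two; in particular no value of the zeta function is needed.\<close>

lemma level1_form_eq_sigma:
  assumes j: "odd j" "3 \<le> j" "j < 11" and F: "disc_fps F" "level1_form (int (Suc j)) (eval_fps F)" "fps_nth F 0 = 1"
  shows "F = 1 + fps_const (fps_nth F (Suc 0)) * sigma_fps j"
proof -
  define Z :: complex where "Z = (\<Sum>\<^sub>\<infinity>d::int. 1 / of_int d ^ Suc j)"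
  define K :: complex where "K = 2 * ((2 * of_real pi * \<i>) ^ Suc j / fact j)"
  have K: "K \<noteq> 0" by (simp add: K_def)
  define G where "G = fps_const Z + fps_const K * sigma_fps j"
  have G: "disc_fps G" by (auto simp: G_def)
  have eq: "eval_fps G (nome \<tau>) = lattice_sum (Suc j) \<tau>" if "\<tau> \<in> UHP" for \<tau>
    unfolding lattice_sum_eq[OF that j(1)] G_def using norm_nome_less_1[OF that]
    by (simp add: eval_disc_fps disc_fps_arith disc_sigma_fps Z_def K_def del: power_Suc)
  have "level1_form (int (Suc j)) (eval_fps G)"
  proof (rule level1_form_evalI[OF G])
    fix \<tau> assume \<tau>: "\<tau> \<in> UHP"
    show "eval_fps G (nome (-1/\<tau>)) = \<tau> powi int (Suc j) * eval_fps G (nome \<tau>)"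
      unfolding eq[OF \<tau>] eq[OF neg_inverse_in_UHP[OF \<tau>]] power_int_of_nat
      by (rule lattice_sum_S[OF \<tau> j(1,2)])
  qed
  from level1_form_proportional[OF F(2) this] j(3)
  have *: "eval_fps G 0 * eval_fps F q = eval_fps F 0 * eval_fps G q" if "norm q < 1" for q using that by simp
  have "fps_const Z * F = G"
  proof (rule disc_fps_eqI)
    fix q :: complex assume "norm q < 1"
    then show "eval_fps (fps_const Z * F) q = eval_fps G q"
      using * F by (simp add: eval_disc_fps eval_fps_at_0 G_def sigma_fps_def)
  qed (use F G in auto)
  then have 1: "Z * fps_nth F n = fps_nth G n" for n by (metis fps_mult_left_const_nth)
  \<comment> \<open>The coefficient of \<open>q\<close> shows that \<open>Z\<close> is nonzero,
    because \<open>K\<close> is; then \<open>Z\<close> can be cancelled in every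
    coefficient.\<close>
  from 1[of 1] have Z1: "Z * fps_nth F (Suc 0) = K" by (simp add: G_def sigma_fps_def)
  then have "Z \<noteq> 0" using K by auto
  show ?thesis
  proof (rule fps_ext)
    fix n
    have "Z * fps_nth F n = Z * fps_nth (1 + fps_const (fps_nth F (Suc 0)) * sigma_fps j) n"
      unfolding 1 using Z1 by (cases n) (simp_all add: G_def sigma_fps_def mult.assoc[symmetric])
    then show "fps_nth F n = fps_nth (1 + fps_const (fps_nth F (Suc 0)) * sigma_fps j) n"
      using \<open>Z \<noteq> 0\<close> by simp
  qed
qed

text \<open>Ramanujan's identity for the derivative of \<open>E2\<close>. The series
  \<open>E2^2 - 12 q dE2/dq\<close> is already known to be modular, and its first coefficients
  \<open>1\<close> and \<open>-48 + 288 = 240\<close> identify it with \<open>E4\<close>.\<close>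

lemma E4_fps_eq: "E4_fps = E2_fps ^ 2 - 12 * theta_fps E2_fps"
  and level1_form_E4: "level1_form 4 (eval_fps E4_fps)"
proof -
  let ?F = "E2_fps ^ 2 - 12 * theta_fps E2_fps"
  have "?F = 1 + fps_const (fps_nth ?F (Suc 0)) * sigma_fps 3"
    by (rule level1_form_eq_sigma) (use level1_form_E2_square in \<open>auto simp: E_fps_nth numeral_fps_const power2_eq_square\<close>)
  also have "fps_nth ?F (Suc 0) = 240" by (simp add: E_fps_nth numeral_fps_const power2_eq_square)
  finally show "E4_fps = ?F" by (simp add: E4_fps_def numeral_fps_const)
  then show "level1_form 4 (eval_fps E4_fps)" using level1_form_E2_square by simp
qed

text \<open>Ramanujan's identity \<open>D E4 = - E6 / 3\<close>: the form \<open>-3 D E4\<close> of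
  weight 6 has constant term \<open>1\<close> and coefficient \<open>-504\<close> at
  \<open>q\<close>.\<close>

lemma level1_form_E6: "level1_form 6 (eval_fps E6_fps)"
proof -
  define F where "F = fps_const (-3) * (theta_fps E4_fps - fps_const (of_int 4 / 12) * E2_fps * E4_fps)"
  have "level1_form (4 + 2) (\<lambda>q. -3 * eval_fps (theta_fps E4_fps - fps_const (of_int 4 / 12) * E2_fps * E4_fps) q)"
    by (rule level1_form_cmult[OF level1_form_derivative[OF disc_E_fps(2) level1_form_E4]])
  then have "level1_form 6 (\<lambda>q. -3 * eval_fps (theta_fps E4_fps - fps_const (of_int 4 / 12) * E2_fps * E4_fps) q)"
    by simp
  then have L: "\<forall>\<tau>\<in>UHP. -3 * eval_fps (theta_fps E4_fps - fps_const (of_int 4 / 12) * E2_fps * E4_fps) (nome (-1/\<tau>)) =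
      \<tau> powi 6 * (-3 * eval_fps (theta_fps E4_fps - fps_const (of_int 4 / 12) * E2_fps * E4_fps) (nome \<tau>))"
    unfolding level1_form_def by blast
  have ev: "eval_fps F q = -3 * eval_fps (theta_fps E4_fps - fps_const (of_int 4 / 12) * E2_fps * E4_fps) q"
    if "norm q < 1" for q
    unfolding F_def using that by (subst eval_disc_fps) auto
  have dF: "disc_fps F"
    unfolding F_def by (intro disc_fps_arith disc_fps_const disc_theta_fps disc_E_fps)
  have F: "level1_form 6 (eval_fps F)"
  proof (rule level1_form_evalI[OF dF])
    fix \<tau> assume \<tau>: "\<tau> \<in> UHP"
    show "eval_fps F (nome (-1/\<tau>)) = \<tau> powi 6 * eval_fps F (nome \<tau>)"
      unfolding ev[OF norm_nome_less_1[OF \<tau>]] ev[OF norm_nome_less_1[OF neg_inverse_in_UHP[OF \<tau>]]]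
      using L \<tau> by blast
  qed
  have "F = 1 + fps_const (fps_nth F (Suc 0)) * sigma_fps 5"
    by (rule level1_form_eq_sigma[OF _ _ _ dF]) (use F in \<open>simp_all, simp add: F_def E_fps_nth\<close>)
  also have "fps_nth F (Suc 0) = -504" by (simp add: F_def E_fps_nth)
  also have "1 + fps_const (-504) * sigma_fps 5 = E6_fps"
    by (rule fps_ext) (simp add: E6_fps_def numeral_fps_const)
  finally have "F = E6_fps" .
  then show ?thesis using F by simp
qed

text \<open>The coefficients of \<open>q\<close> are \<open>720\<close> and
  \<open>-1008\<close>.\<close>

lemma E4_cube_neq_E6_square: "E4_fps ^ 3 \<noteq> E6_fps ^ 2"
proof
  assume "E4_fps ^ 3 = E6_fps ^ 2"
  then have "fps_nth (E4_fps ^ 3) (Suc 0) = fps_nth (E6_fps ^ 2) (Suc 0)" by simp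
  then show False by (simp add: power3_eq_cube power2_eq_square E_fps_nth)
qed

text \<open>If \<open>h 0 \<noteq> 0\<close>, then \<open>h^2\<close> and \<open>h^3\<close> are
  multiples of \<open>E4\<close> and \<open>E6\<close>, and comparing \<open>h^6\<close> in two ways
  would give \<open>E4^3 = E6^2\<close>.\<close>

lemma level1_form_weight_2:
  assumes h: "level1_form 2 h" "q \<in> ball 0 1"
  shows "h q = 0"
proof -
  have "h 0 = 0"
  proof (rule ccontr)
    assume h0: "h 0 \<noteq> 0"
    have 4: "h q ^ 2 = h 0 ^ 2 * eval_fps E4_fps q" and 6: "h q ^ 3 = h 0 ^ 3 * eval_fps E6_fps q"
      if "q \<in> ball 0 1" for q
      using level1_form_proportional[OF level1_form_power[OF h(1), of 2], of "eval_fps E4_fps" q]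
        level1_form_proportional[OF level1_form_power[OF h(1), of 3], of "eval_fps E6_fps" q]
        level1_form_E4 level1_form_E6 that by (simp_all add: eval_fps_at_0 E_fps_nth)
    have "E4_fps ^ 3 = E6_fps ^ 2"
    proof (rule disc_fps_eqI)
      fix q :: complex assume q: "norm q < 1"
      have "(h q ^ 2) ^ 3 = (h q ^ 3) ^ 2" by (simp flip: power_mult)
      then have "h 0 ^ 6 * eval_fps E4_fps q ^ 3 = h 0 ^ 6 * eval_fps E6_fps q ^ 2"
        using 4[of q] 6[of q] q by (simp add: power_mult_distrib flip: power_mult)
      then show "eval_fps (E4_fps ^ 3) q = eval_fps (E6_fps ^ 2) q"
        using h0 q by (simp add: eval_disc_fps disc_E_fps)
    qed auto
    then show False using E4_cube_neq_E6_square by simp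
  qed
  then show ?thesis using level1_form_small_weight[OF h(1) _ _ h(2)] by simp
qed

lemma E4_S:
  assumes "\<tau> \<in> UHP"
  shows "E4 (-1/\<tau>) = \<tau> ^ 4 * E4 \<tau>"
proof -
  have "eval_fps E4_fps (nome (-1/\<tau>)) = \<tau> powi 4 * eval_fps E4_fps (nome \<tau>)"
    using level1_form_E4 assms unfolding level1_form_def by blast
  then show ?thesis unfolding E4_eq[OF assms] E4_eq[OF neg_inverse_in_UHP[OF assms]] by simp
qed

section \<open>The polynomial ring in \<open>E4\<close> and \<open>E6\<close> and the structure
  theorem for level one\<close>

lemma finite_weights: "finite {(i, j). int (4 * i + 6 * j) = k}"
  by (rule finite_subset[of _ "{..nat k} \<times> {..nat k}"]) auto

lemma M1_weightI:
  assumes "\<And>\<tau>. \<tau> \<in> UHP \<Longrightarrow> f \<tau> = (\<Sum>(i, j) | int (4 * i + 6 * j) = k. c i j * E4 \<tau> ^ i * E6 \<tau> ^ j)"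
  shows "on_UHP f \<in> M1_weight k"
  unfolding M1_weight_def using assms by (auto simp: on_UHP_def intro!: exI[of _ c])

lemma M1_weightE:
  assumes "f \<in> M1_weight k"
  obtains c where "f = on_UHP (\<lambda>\<tau>. \<Sum>(i, j) | int (4 * i + 6 * j) = k. c i j * E4 \<tau> ^ i * E6 \<tau> ^ j)"
  using assms unfolding M1_weight_def by auto

lemma M1_weight_linear:
  assumes "on_UHP f \<in> M1_weight k" "on_UHP g \<in> M1_weight k"
  shows "on_UHP (\<lambda>\<tau>. a * f \<tau> + b * g \<tau>) \<in> M1_weight k"
proof -
  from assms(1) obtain c where c: "on_UHP f = on_UHP (\<lambda>\<tau>. \<Sum>(i, j) | int (4 * i + 6 * j) = k. c i j * E4 \<tau> ^ i * E6 \<tau> ^ j)"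
    by (rule M1_weightE)
  from assms(2) obtain d where d: "on_UHP g = on_UHP (\<lambda>\<tau>. \<Sum>(i, j) | int (4 * i + 6 * j) = k. d i j * E4 \<tau> ^ i * E6 \<tau> ^ j)"
    by (rule M1_weightE)
  show ?thesis
  proof (rule M1_weightI[where c = "\<lambda>i j. a * c i j + b * d i j"])
    fix \<tau> assume "\<tau> \<in> UHP"
    then show "a * f \<tau> + b * g \<tau> = (\<Sum>(i, j) | int (4 * i + 6 * j) = k. (a * c i j + b * d i j) * E4 \<tau> ^ i * E6 \<tau> ^ j)"
      using fun_cong[OF c, of \<tau>] fun_cong[OF d, of \<tau>]
      by (simp add: on_UHP_def sum_distrib_left sum.distrib[symmetric] case_prod_unfold algebra_simps)
  qed
qed

lemma M1_weight_0: "on_UHP (\<lambda>_. 0) \<in> M1_weight k"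
  by (rule M1_weightI[where c = "\<lambda>_ _. 0"]) simp

lemma M1_weight_const: "on_UHP (\<lambda>_. a) \<in> M1_weight 0"
proof (rule M1_weightI[where c = "\<lambda>_ _. a"])
  have "{(i, j). int (4 * i + 6 * j) = 0} = {(0, 0)}" by auto
  then show "a = (\<Sum>(i, j) | int (4 * i + 6 * j) = 0. a * E4 \<tau> ^ i * E6 \<tau> ^ j)" for \<tau> by simp
qed

lemma M1_weight_mult_monomial:
  assumes "on_UHP f \<in> M1_weight k"
  shows "on_UHP (\<lambda>\<tau>. E4 \<tau> ^ m * E6 \<tau> ^ n * f \<tau>) \<in> M1_weight (k + int (4 * m + 6 * n))"
proof -
  let ?S = "\<lambda>k. {(i, j). int (4 * i + 6 * j) = k}"
  from assms(1) obtain c where c: "on_UHP f = on_UHP (\<lambda>\<tau>. \<Sum>(i, j) | int (4 * i + 6 * j) = k. c i j * E4 \<tau> ^ i * E6 \<tau> ^ j)"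
    by (rule M1_weightE)
  show ?thesis
  proof (rule M1_weightI[where c = "\<lambda>i j. if m \<le> i \<and> n \<le> j then c (i - m) (j - n) else 0"])
    fix \<tau> assume "\<tau> \<in> UHP"
    then have "E4 \<tau> ^ m * E6 \<tau> ^ n * f \<tau> =
        (\<Sum>(i, j)\<in>?S k. c i j * E4 \<tau> ^ (i + m) * E6 \<tau> ^ (j + n))"
      using fun_cong[OF c, of \<tau>]
      by (simp add: on_UHP_def sum_distrib_left case_prod_unfold power_add mult_ac)
    also have "\<dots> = (\<Sum>(i, j)\<in>(\<lambda>(i, j). (i + m, j + n)) ` ?S k. c (i - m) (j - n) * E4 \<tau> ^ i * E6 \<tau> ^ j)"
      by (subst sum.reindex) (auto simp: inj_on_def case_prod_unfold)
    also have "\<dots> = (\<Sum>(i, j)\<in>?S (k + int (4 * m + 6 * n)).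
        (if m \<le> i \<and> n \<le> j then c (i - m) (j - n) else 0) * E4 \<tau> ^ i * E6 \<tau> ^ j)"
    proof (rule sum.mono_neutral_cong_left)
      show "finite (?S (k + int (4 * m + 6 * n)))" by (rule finite_weights)
      show "\<forall>x\<in>?S (k + int (4 * m + 6 * n)) - (\<lambda>(i, j). (i + m, j + n)) ` ?S k.
          (case x of (i, j) \<Rightarrow> (if m \<le> i \<and> n \<le> j then c (i - m) (j - n) else 0) * E4 \<tau> ^ i * E6 \<tau> ^ j) = 0"
      proof
        fix x assume x: "x \<in> ?S (k + int (4 * m + 6 * n)) - (\<lambda>(i, j). (i + m, j + n)) ` ?S k"
        obtain i j where ij: "x = (i, j)" by fastforce
        have "\<not> (m \<le> i \<and> n \<le> j)"
        proof
          assume "m \<le> i \<and> n \<le> j"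
          then have "x = (\<lambda>(i, j). (i + m, j + n)) (i - m, j - n)" "(i - m, j - n) \<in> ?S k"
            using x by (auto simp: ij)
          then show False using x by blast
        qed
        then show "(case x of (i, j) \<Rightarrow> (if m \<le> i \<and> n \<le> j then c (i - m) (j - n) else 0) * E4 \<tau> ^ i * E6 \<tau> ^ j) = 0"
          by (auto simp: ij)
      qed
    qed auto
    finally show "E4 \<tau> ^ m * E6 \<tau> ^ n * f \<tau> = (\<Sum>(i, j)\<in>?S (k + int (4 * m + 6 * n)).
        (if m \<le> i \<and> n \<le> j then c (i - m) (j - n) else 0) * E4 \<tau> ^ i * E6 \<tau> ^ j)" .
  qed
qed

text \<open>The difference \<open>E4^3 - E6^2\<close> has weight 12 and no constant term, so its
  quotient by \<open>delta\<close> has weight 0 and is constant.\<close>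

lemma delta_eq:
  obtains \<kappa> where "\<kappa> \<noteq> 0" "\<And>q. q \<in> ball 0 1 \<Longrightarrow> delta q = \<kappa> * (eval_fps E4_fps q ^ 3 - eval_fps E6_fps q ^ 2)"
proof -
  let ?h = "\<lambda>q. eval_fps E4_fps q ^ 3 - eval_fps E6_fps q ^ 2"
  have "level1_form (int 3 * 4) ?h"
    using level1_form_diff[OF level1_form_power[OF level1_form_E4, of 3], of "\<lambda>q. eval_fps E6_fps q ^ 2"]
      level1_form_power[OF level1_form_E6, of 2] by simp
  moreover have "?h 0 = 0" by (simp add: eval_fps_at_0 E_fps_nth)
  ultimately obtain g where g: "level1_form (int 3 * 4 - 12) g" "\<And>q. q \<in> ball 0 1 \<Longrightarrow> ?h q = delta q * g q"
    by (rule level1_cusp_form) blast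
  from g(1) have "level1_form 0 g" by simp
  then have c: "g q = g 0" if "q \<in> ball 0 1" for q using level1_form_weight_0 that by blast
  have "g 0 \<noteq> 0"
  proof
    assume "g 0 = 0"
    have "E4_fps ^ 3 = E6_fps ^ 2"
    proof (rule disc_fps_eqI)
      fix q :: complex assume q: "norm q < 1"
      then have "?h q = 0" using g(2)[of q] c[of q] \<open>g 0 = 0\<close> by simp
      then show "eval_fps (E4_fps ^ 3) q = eval_fps (E6_fps ^ 2) q"
        using q by (simp add: eval_disc_fps disc_E_fps)
    qed auto
    then show False using E4_cube_neq_E6_square by simp
  qed
  show thesis
  proof (rule that[of "1 / g 0"])
    show "1 / g 0 \<noteq> 0" using \<open>g 0 \<noteq> 0\<close> by simp
    show "delta q = 1 / g 0 * ?h q" if "q \<in> ball 0 1" for q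
      using g(2)[OF that] c[OF that] \<open>g 0 \<noteq> 0\<close> by simp
  qed
qed

lemma on_UHP_cong: "(\<And>\<tau>. \<tau> \<in> UHP \<Longrightarrow> f \<tau> = g \<tau>) \<Longrightarrow> on_UHP f = on_UHP g"
  by (auto simp: on_UHP_def)

text \<open>Subtracting \<open>h 0\<close> times a monomial of the same weight leaves a cusp form.
  Its quotient by \<open>delta\<close> has weight \<open>k - 12\<close>, and \<open>delta\<close>
  itself is a polynomial in \<open>E4\<close> and \<open>E6\<close>.\<close>

theorem level1_form_in_M1_weight:
  assumes "level1_form k h"
  shows "on_UHP (\<lambda>\<tau>. h (nome \<tau>)) \<in> M1_weight k"
  using assms
proof (induction "nat k" arbitrary: k h rule: less_induct)
  case less
  have zero: ?case if "\<And>q. q \<in> ball 0 1 \<Longrightarrow> h q = 0"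
    using M1_weight_0[of k] on_UHP_cong[of "\<lambda>\<tau>. h (nome \<tau>)" "\<lambda>_. 0"] that nome_in_ball by simp
  have "k < 0 \<or> odd k \<or> k = 0 \<or> k = 2 \<or> even k \<and> k \<ge> 4" by presburger
  then consider "k < 0" | "odd k" | "k = 0" | "k = 2" | "even k" "k \<ge> 4" by blast
  then show ?case
  proof cases
    case 1
    then show ?thesis using level1_form_negative_weight[OF less.prems] by (intro zero) simp
  next
    case 2
    then show ?thesis using level1_form_odd[OF less.prems] by (intro zero) simp
  next
    case 3
    have "h (nome \<tau>) = h 0" if "\<tau> \<in> UHP" for \<tau>
      by (rule level1_form_weight_0) (use less.prems nome_in_ball[OF that] 3 in simp_all)
    then have "on_UHP (\<lambda>\<tau>. h (nome \<tau>)) = on_UHP (\<lambda>_. h 0)" by (rule on_UHP_cong)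
    then show ?thesis using M1_weight_const[of "h 0"] 3 by (simp only:)
  next
    case 4
    then show ?thesis using level1_form_weight_2 less.prems by (intro zero) blast
  next
    case 5
    \<comment> \<open>Even weights from 4 on are \<open>4 i\<close> or \<open>4 i + 6\<close>,
      according to the residue modulo 4.\<close>
    have "\<exists>i j. k = int (4 * i + 6 * j)"
    proof (cases "4 dvd k")
      case True
      then have "k = int (4 * nat (k div 4) + 6 * 0)" using 5 by simp
      then show ?thesis by blast
    next
      case False
      then have "k = int (4 * nat ((k - 6) div 4) + 6 * 1)" using 5 False by simp presburger
      then show ?thesis by blast
    qed
    then obtain i j where k: "k = int (4 * i + 6 * j)" by blast
    let ?m = "\<lambda>q. eval_fps E4_fps q ^ i * eval_fps E6_fps q ^ j"
    have "level1_form (int i * 4 + int j * 6) ?m"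
      by (intro level1_form_mult level1_form_power level1_form_E4 level1_form_E6)
    then have m: "level1_form k ?m" unfolding k by (simp add: algebra_simps)
    have "level1_form k (\<lambda>q. h q - h 0 * ?m q)"
      by (intro level1_form_diff level1_form_cmult m less.prems)
    moreover have "h 0 - h 0 * ?m 0 = 0" by (simp add: eval_fps_at_0 E_fps_nth)
    ultimately obtain g where g: "level1_form (k - 12) g" "\<And>q. q \<in> ball 0 1 \<Longrightarrow> h q - h 0 * ?m q = delta q * g q"
      by (rule level1_cusp_form) blast
    have "on_UHP (\<lambda>\<tau>. g (nome \<tau>)) \<in> M1_weight (k - 12)"
      by (rule less.hyps[OF _ g(1)]) (use 5 in auto)
    note G = M1_weight_mult_monomial[OF this, of 3 0] M1_weight_mult_monomial[OF this, of 0 2]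
    obtain \<kappa> where \<kappa>: "\<And>q. q \<in> ball 0 1 \<Longrightarrow> delta q = \<kappa> * (eval_fps E4_fps q ^ 3 - eval_fps E6_fps q ^ 2)"
      using delta_eq by metis
    have "on_UHP (\<lambda>\<tau>. \<kappa> * (E4 \<tau> ^ 3 * E6 \<tau> ^ 0 * g (nome \<tau>)) + (- \<kappa>) * (E4 \<tau> ^ 0 * E6 \<tau> ^ 2 * g (nome \<tau>))) \<in> M1_weight k"
      by (rule M1_weight_linear) (use G in simp_all)
    moreover have "on_UHP (\<lambda>\<tau>. E4 \<tau> ^ i * E6 \<tau> ^ j * 1) \<in> M1_weight k"
      using M1_weight_mult_monomial[OF M1_weight_const[of 1], of i j] by (simp add: k)
    ultimately have "on_UHP (\<lambda>\<tau>. 1 * (\<kappa> * (E4 \<tau> ^ 3 * E6 \<tau> ^ 0 * g (nome \<tau>)) + (- \<kappa>) * (E4 \<tau> ^ 0 * E6 \<tau> ^ 2 * g (nome \<tau>)))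
        + h 0 * (E4 \<tau> ^ i * E6 \<tau> ^ j * 1)) \<in> M1_weight k"
      by (rule M1_weight_linear)
    also have "on_UHP (\<lambda>\<tau>. 1 * (\<kappa> * (E4 \<tau> ^ 3 * E6 \<tau> ^ 0 * g (nome \<tau>)) + (- \<kappa>) * (E4 \<tau> ^ 0 * E6 \<tau> ^ 2 * g (nome \<tau>)))
        + h 0 * (E4 \<tau> ^ i * E6 \<tau> ^ j * 1)) = on_UHP (\<lambda>\<tau>. h (nome \<tau>))"
    proof (rule on_UHP_cong)
      fix \<tau> assume "\<tau> \<in> UHP"
      then show "1 * (\<kappa> * (E4 \<tau> ^ 3 * E6 \<tau> ^ 0 * g (nome \<tau>)) + (- \<kappa>) * (E4 \<tau> ^ 0 * E6 \<tau> ^ 2 * g (nome \<tau>)))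
        + h 0 * (E4 \<tau> ^ i * E6 \<tau> ^ j * 1) = h (nome \<tau>)"
        using g(2)[OF nome_in_ball, of \<tau>] \<kappa>[OF nome_in_ball, of \<tau>] by (simp add: E4_eq E6_eq algebra_simps)
    qed
    finally show ?thesis .
  qed
qed

text \<open>No monomial in \<open>E4\<close> and \<open>E6\<close> has such a weight. The gap at
  weight 2 is what prevents a multiplication from passing from weight \<open>m\<close> to weight
  \<open>m + 2\<close>.\<close>

lemma M1_weight_small:
  assumes "f \<in> M1_weight k" "k < 0 \<or> odd k \<or> k = 2"
  shows "f = (\<lambda>_. 0)"
proof -
  have "{(i, j). int (4 * i + 6 * j) = k} = {}" using assms(2) by auto presburger
  then show ?thesis using assms(1) by (auto elim!: M1_weightE simp: on_UHP_def)
qed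

lemma M1_weight_0E:
  assumes "f \<in> M1_weight 0"
  obtains a where "f = on_UHP (\<lambda>_. a)"
proof -
  have "{(i, j). int (4 * i + 6 * j) = 0} = {(0, 0)}" by auto
  then show thesis using assms that by (auto elim!: M1_weightE)
qed

lemma M1_weight_outside: "f \<in> M1_weight k \<Longrightarrow> \<tau> \<notin> UHP \<Longrightarrow> f \<tau> = 0"
  by (auto elim!: M1_weightE simp: on_UHP_def)

subsection \<open>The matrix exponential\<close>

abbreviation mat_power :: "complex^'n^'n \<Rightarrow> nat \<Rightarrow> complex^'n^'n" where
  "mat_power X m \<equiv> (((**) X) ^^ m) (mat 1)"

lemma sums_vec_iff:
  fixes f :: "nat \<Rightarrow> 'a::real_normed_vector^'n"
  shows "f sums s \<longleftrightarrow> (\<forall>i. (\<lambda>m. f m $ i) sums (s $ i))"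
proof
  assume "f sums s"
  then show "\<forall>i. (\<lambda>m. f m $ i) sums (s $ i)"
    unfolding sums_def by (auto dest: tendsto_vec_nth simp flip: sum_component)
next
  assume "\<forall>i. (\<lambda>m. f m $ i) sums (s $ i)"
  then show "f sums s"
    unfolding sums_def by (intro vec_tendstoI) (simp add: sum_component)
qed

lemma matrix_mult_nth: "(A ** B) $ i $ j = (\<Sum>k\<in>UNIV. A $ i $ k * B $ k $ j)"
  by (simp add: matrix_matrix_mult_def)

lemma mat_power_bound:
  fixes X :: "complex^'n^'n"
  shows "norm (mat_power X m $ p $ q) \<le> (\<Sum>i\<in>UNIV. \<Sum>j\<in>UNIV. norm (X $ i $ j)) ^ m"
proof (induction m arbitrary: p q)
  case 0
  then show ?case by (simp add: mat_def)
next
  case (Suc m)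
  let ?C = "\<Sum>i\<in>UNIV. \<Sum>j\<in>UNIV. norm (X $ i $ j)"
  have C: "?C \<ge> 0" by (intro sum_nonneg) auto
  have "norm (mat_power X (Suc m) $ p $ q) \<le> (\<Sum>s\<in>UNIV. norm (X $ p $ s * mat_power X m $ s $ q))"
    by (simp add: matrix_matrix_mult_def norm_sum)
  also have "\<dots> \<le> (\<Sum>s\<in>UNIV. norm (X $ p $ s) * ?C ^ m)"
    unfolding norm_mult by (intro sum_mono mult_left_mono Suc.IH) auto
  also have "\<dots> = (\<Sum>s\<in>UNIV. norm (X $ p $ s)) * ?C ^ m" by (simp add: sum_distrib_right)
  also have "\<dots> \<le> ?C * ?C ^ m"
    using C member_le_sum[of p UNIV "\<lambda>p. \<Sum>s\<in>UNIV. norm (X $ p $ s)"]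
    by (intro mult_right_mono) (auto simp: sum_nonneg)
  finally show ?case by simp
qed

lemma mat_power_norm_summable:
  fixes X :: "complex^'n^'n"
  shows "summable (\<lambda>m. norm (mat_power X m $ p $ q / fact m))"
proof (rule summable_comparison_test)
  let ?C = "\<Sum>i\<in>UNIV. \<Sum>j\<in>UNIV. norm (X $ i $ j)"
  show "summable (\<lambda>m. inverse (fact m) * ?C ^ m)" by (rule summable_exp)
  show "\<exists>N. \<forall>m\<ge>N. norm (norm (mat_power X m $ p $ q / fact m)) \<le> inverse (fact m) * ?C ^ m"
    using mat_power_bound[where X = X] by (auto simp: norm_divide norm_mult norm_inverse divide_inverse mult.commute intro!: mult_left_mono)
qed

lemma matrix_exp_sums:
  fixes X :: "complex^'n^'n"
  shows "(\<lambda>m. mat_power X m $ p $ q / fact m) sums (matrix_exp X $ p $ q)"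
proof -
  define S where "S = (\<chi> p q. \<Sum>m. mat_power X m $ p $ q / fact m)"
  have S: "(\<lambda>m. mat_power X m $ p $ q / fact m) sums (S $ p $ q)" for p q
    by (simp only: S_def vec_lambda_beta) (rule summable_sums, rule summable_norm_cancel[OF mat_power_norm_summable])
  have "(\<lambda>m. (1 / fact m) *\<^sub>R mat_power X m) sums S"
    unfolding sums_vec_iff using S by (simp add: scaleR_conv_of_real[where 'a = complex] divide_inverse mult.commute)
  then have "matrix_exp X = S" unfolding matrix_exp_def by (rule sums_unique[symmetric])
  then show ?thesis using S by simp
qed

lemma matrix_exp_eqI:
  fixes X :: "complex^'n^'n"
  assumes "\<And>p q. (\<lambda>m. mat_power X m $ p $ q / fact m) sums (Y $ p $ q)"
  shows "matrix_exp X = Y"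
  using sums_unique2[OF matrix_exp_sums assms] by (simp add: vec_eq_iff)

text \<open>The matrix \<open>P\<close> intertwines all powers of \<open>X\<close> and
  \<open>Y\<close>, and the two series are compared entry by entry. This form serves for conjugation
  without naming an inverse.\<close>

lemma matrix_exp_intertwine:
  fixes X Y P :: "complex^'n^'n"
  assumes "X ** P = P ** Y"
  shows "matrix_exp X ** P = P ** matrix_exp Y"
proof -
  have pow: "mat_power X m ** P = P ** mat_power Y m" for m
    by (induction m) (simp_all add: matrix_mul_assoc[symmetric], simp add: matrix_mul_assoc assms)
  have "(matrix_exp X ** P) $ p $ q = (P ** matrix_exp Y) $ p $ q" for p q
  proof (rule sums_unique2)
    show "(\<lambda>m. (mat_power X m ** P) $ p $ q / fact m) sums ((matrix_exp X ** P) $ p $ q)"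
      unfolding matrix_mult_nth sum_divide_distrib
      by (intro sums_sum) (use sums_mult2[OF matrix_exp_sums] in simp)
    show "(\<lambda>m. (mat_power X m ** P) $ p $ q / fact m) sums ((P ** matrix_exp Y) $ p $ q)"
      unfolding pow matrix_mult_nth sum_divide_distrib
      by (intro sums_sum) (use sums_mult[OF matrix_exp_sums] in simp)
  qed
  then show ?thesis by (simp add: vec_eq_iff)
qed

section \<open>Exponentials of two-by-two normal forms\<close>

definition mat2 :: "'a \<Rightarrow> 'a \<Rightarrow> 'a \<Rightarrow> 'a \<Rightarrow> 'a^2^2" where
  "mat2 a b c d = (\<chi> i j. if i = 1 then if j = 1 then a else b else if j = 1 then c else d)"

lemma mat2_nth [simp]: "mat2 a b c d $ 1 $ 1 = a" "mat2 a b c d $ 1 $ 2 = b"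
  "mat2 a b c d $ 2 $ 1 = c" "mat2 a b c d $ 2 $ 2 = d"
  by (simp_all add: mat2_def)

lemma mat2_mult: "mat2 a b c d ** mat2 a' b' c' d' =
    mat2 (a * a' + b * c') (a * b' + b * d') (c * a' + d * c') (c * b' + d * d')"
  for a :: "'a::semiring_1"
  by (rule mat2_eqI) (simp_all add: mat2_mult_nth)

lemma mat2_cases: "(A :: 'a^2^2) = mat2 (A$1$1) (A$1$2) (A$2$1) (A$2$2)"
  by (rule mat2_eqI) simp_all

lemma mat_eq_mat2: "mat x = mat2 x 0 0 (x::'a::zero)"
  by (rule mat2_eqI) (simp_all add: mat_def)

lemma matrix_exp_diag: "matrix_exp (mat2 a 0 0 b) = mat2 (exp a) 0 0 (exp b)"
proof (rule matrix_exp_eqI)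
  have pow: "mat_power (mat2 a 0 0 b) m = mat2 (a ^ m) 0 0 (b ^ m)" for m
    by (induction m) (simp_all add: mat_eq_mat2 mat2_mult)
  have e: "(\<lambda>m. x ^ m / fact m) sums exp x" for x :: complex
    using exp_converges[of x] by (simp add: scaleR_conv_of_real divide_inverse mult.commute)
  have "(\<lambda>m. mat_power (mat2 a 0 0 b) m $ p $ q / fact m) sums (mat2 (exp a) 0 0 (exp b) $ p $ q)" if "p = 1 \<or> p = 2" "q = 1 \<or> q = 2" for p q
    unfolding pow using that e by auto
  then show "(\<lambda>m. mat_power (mat2 a 0 0 b) m $ p $ q / fact m) sums (mat2 (exp a) 0 0 (exp b) $ p $ q)" for p q
    using exhaust_2 by blast
qed

lemma matrix_exp_Jordan: "matrix_exp (mat2 a b 0 a) = mat2 (exp a) (b * exp a) 0 (exp a)"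
proof (rule matrix_exp_eqI)
  have pow: "mat_power (mat2 a b 0 a) m = mat2 (a ^ m) (of_nat m * a ^ (m - 1) * b) 0 (a ^ m)" for m
  proof (induction m)
    case (Suc m)
    then show ?case by (cases m) (simp_all add: mat2_mult algebra_simps)
  qed (simp add: mat_eq_mat2)
  have e: "(\<lambda>m. x ^ m / fact m) sums exp x" for x :: complex
    using exp_converges[of x] by (simp add: scaleR_conv_of_real divide_inverse mult.commute)
  have e': "(\<lambda>m. of_nat m * a ^ (m - 1) * b / fact m) sums (b * exp a)"
  proof -
    have "(\<lambda>m. b * (a ^ m / fact m)) sums (b * exp a)" by (rule sums_mult[OF e])
    moreover have "of_nat (Suc m) * a ^ (Suc m - 1) * b / fact (Suc m) = b * (a ^ m / fact m)" for m
      by (simp del: of_nat_Suc)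
    ultimately have "(\<lambda>m. of_nat (Suc m) * a ^ (Suc m - 1) * b / fact (Suc m)) sums (b * exp a)" by simp
    from sums_Suc[OF this] show ?thesis by simp
  qed
  have "(\<lambda>m. mat_power (mat2 a b 0 a) m $ p $ q / fact m) sums (mat2 (exp a) (b * exp a) 0 (exp a) $ p $ q)" if "p = 1 \<or> p = 2" "q = 1 \<or> q = 2" for p q
    unfolding pow using that e e' by auto
  then show "(\<lambda>m. mat_power (mat2 a b 0 a) m $ p $ q / fact m) sums (mat2 (exp a) (b * exp a) 0 (exp a) $ p $ q)" for p q
    using exhaust_2 by blast
qed

subsection \<open>Kronecker products\<close>

lemma UNIV_prod_sum: "(\<Sum>p\<in>(UNIV :: ('m::finite \<times> 'n::finite) set). f p) = (\<Sum>i\<in>UNIV. \<Sum>j\<in>UNIV. f (i, j))"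
  unfolding UNIV_Times_UNIV[symmetric] sum.cartesian_product by simp

lemma kronecker_mult: "kronecker P Q ** kronecker P' Q' = kronecker (P ** P') (Q ** Q')"
  by (simp add: kronecker_def matrix_matrix_mult_def vec_eq_iff UNIV_prod_sum sum_product mult_ac)

lemma kronecker_mat_1: "kronecker (mat 1) (mat 1) = mat 1"
  by (simp add: kronecker_def mat_def vec_eq_iff prod_eq_iff)

lemma tensor_exponents_mult_nth:
  "(tensor_exponents X Y ** M) $ (p, r) $ s =
     (\<Sum>p'\<in>UNIV. X $ p $ p' * M $ (p', r) $ s) + (\<Sum>r'\<in>UNIV. Y $ r $ r' * M $ (p, r') $ s)"
proof -
  have "(tensor_exponents X Y ** M) $ (p, r) $ s =
     (\<Sum>p'\<in>UNIV. \<Sum>r'\<in>UNIV. (if r = r' then X $ p $ p' * M $ (p', r') $ s else 0)) +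
     (\<Sum>p'\<in>UNIV. \<Sum>r'\<in>UNIV. (if p = p' then Y $ r $ r' * M $ (p', r') $ s else 0))"
    unfolding sum.distrib[symmetric]
    by (simp add: tensor_exponents_def kronecker_def matrix_matrix_mult_def UNIV_prod_sum mat_def
        algebra_simps if_distrib cong: if_cong) (auto intro!: sum.cong simp: algebra_simps)
  also have "(\<Sum>p'\<in>UNIV. \<Sum>r'\<in>UNIV. (if p = p' then Y $ r $ r' * M $ (p', r') $ s else 0)) =
      (\<Sum>r'\<in>UNIV. \<Sum>p'\<in>UNIV. (if p = p' then Y $ r $ r' * M $ (p', r') $ s else 0))"
    by (rule sum.swap)
  finally show ?thesis by simp
qed

text \<open>The binomial formula in divided powers, valid because \<open>X \<otimes> 1\<close> and
  \<open>1 \<otimes> Y\<close> commute. In this form the entries are terms of a Cauchy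
  product.\<close>

lemma mat_power_tensor_exponents:
  "mat_power (tensor_exponents X Y) m $ (p, r) $ (q, s) / fact m =
    (\<Sum>i\<le>m. (mat_power X i $ p $ q / fact i) * (mat_power Y (m - i) $ r $ s / fact (m - i)))"
proof (induction m arbitrary: p r)
  case 0
  then show ?case by (simp add: mat_def)
next
  case (Suc m)
  define x where "x = (\<lambda>i p. mat_power X i $ p $ q / fact i)"
  define y where "y = (\<lambda>i r. mat_power Y i $ r $ s / fact i)"
  have xS: "of_nat (Suc i) * x (Suc i) p = (\<Sum>p'\<in>UNIV. X $ p $ p' * x i p')" for i p
    by (simp add: x_def matrix_matrix_mult_def sum_divide_distrib sum_distrib_left del: of_nat_Suc)
  have yS: "of_nat (Suc i) * y (Suc i) r = (\<Sum>r'\<in>UNIV. Y $ r $ r' * y i r')" for i r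
    by (simp add: y_def matrix_matrix_mult_def sum_divide_distrib sum_distrib_left del: of_nat_Suc)
  \<comment> \<open>The factor \<open>m + 1\<close> is split as \<open>i + (m + 1 - i)\<close>: one
    part lowers the power of \<open>X\<close>, the other that of \<open>Y\<close>.\<close>
  have "of_nat (Suc m) * (\<Sum>i\<le>Suc m. x i p * y (Suc m - i) r) =
      (\<Sum>i\<le>Suc m. of_nat i * x i p * y (Suc m - i) r + x i p * (of_nat (Suc m - i) * y (Suc m - i) r))"
    unfolding sum_distrib_left
  proof (rule sum.cong)
    fix i assume "i \<in> {..Suc m}"
    then have "(of_nat (Suc m) :: complex) = of_nat i + of_nat (Suc m - i)"
      by (metis atMost_iff le_add_diff_inverse of_nat_add)
    then show "of_nat (Suc m) * (x i p * y (Suc m - i) r) =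
      of_nat i * x i p * y (Suc m - i) r + x i p * (of_nat (Suc m - i) * y (Suc m - i) r)"
      by (simp only: ) (simp only: algebra_simps)
  qed simp
  also have "\<dots> = (\<Sum>i\<le>Suc m. of_nat i * x i p * y (Suc m - i) r) + (\<Sum>i\<le>Suc m. x i p * (of_nat (Suc m - i) * y (Suc m - i) r))"
    by (rule sum.distrib)
  also have "(\<Sum>i\<le>Suc m. of_nat i * x i p * y (Suc m - i) r) = (\<Sum>i\<le>m. (of_nat (Suc i) * x (Suc i) p) * y (m - i) r)"
    by (subst sum.atMost_Suc_shift) simp
  also have "\<dots> = (\<Sum>p'\<in>UNIV. X $ p $ p' * (\<Sum>i\<le>m. x i p' * y (m - i) r))"
    unfolding xS sum_distrib_right sum_distrib_left by (subst sum.swap) (simp add: mult_ac)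
  also have "(\<Sum>i\<le>Suc m. x i p * (of_nat (Suc m - i) * y (Suc m - i) r)) = (\<Sum>i\<le>m. x i p * (of_nat (Suc (m - i)) * y (Suc (m - i)) r))"
    by (simp add: Suc_diff_le add_diff_eq)
  also have "\<dots> = (\<Sum>r'\<in>UNIV. Y $ r $ r' * (\<Sum>i\<le>m. x i p * y (m - i) r'))"
    unfolding yS sum_distrib_right sum_distrib_left by (subst sum.swap) (simp add: mult_ac)
  finally have "of_nat (Suc m) * (\<Sum>i\<le>Suc m. x i p * y (Suc m - i) r) =
      (\<Sum>p'\<in>UNIV. X $ p $ p' * (mat_power (tensor_exponents X Y) m $ (p', r) $ (q, s) / fact m)) +
      (\<Sum>r'\<in>UNIV. Y $ r $ r' * (mat_power (tensor_exponents X Y) m $ (p, r') $ (q, s) / fact m))"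
    unfolding Suc.IH x_def y_def .
  also have "\<dots> = mat_power (tensor_exponents X Y) (Suc m) $ (p, r) $ (q, s) / fact m"
    by (simp add: tensor_exponents_mult_nth sum_divide_distrib add_divide_distrib)
  finally have "(\<Sum>i\<le>Suc m. x i p * y (Suc m - i) r) =
      mat_power (tensor_exponents X Y) (Suc m) $ (p, r) $ (q, s) / fact m / of_nat (Suc m)"
    by (simp add: eq_divide_eq mult_ac del: of_nat_Suc sum.atMost_Suc funpow.simps)
  then show ?case by (simp add: x_def y_def mult.commute del: sum.atMost_Suc funpow.simps)
qed

lemma matrix_exp_tensor_exponents:
  "matrix_exp (tensor_exponents X Y) = kronecker (matrix_exp X) (matrix_exp Y)"
proof (rule matrix_exp_eqI)
  fix u v :: "'a \<times> 'b"
  obtain p r q s where uv: "u = (p, r)" "v = (q, s)" by fastforce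
  have X: "(\<Sum>m. mat_power X m $ p $ q / fact m) = matrix_exp X $ p $ q" for p q
    by (rule sums_unique[symmetric, OF matrix_exp_sums])
  have Y: "(\<Sum>m. mat_power Y m $ p $ q / fact m) = matrix_exp Y $ p $ q" for p q
    by (rule sums_unique[symmetric, OF matrix_exp_sums])
  from Cauchy_product_sums[OF mat_power_norm_summable[where X = X and p = p and q = q] mat_power_norm_summable[where X = Y and p = r and q = s]]
  show "(\<lambda>m. mat_power (tensor_exponents X Y) m $ u $ v / fact m) sums (kronecker (matrix_exp X) (matrix_exp Y) $ u $ v)"
    unfolding uv mat_power_tensor_exponents X Y by (simp add: kronecker_def)
qed

lemma mat_mult_nth: "(mat x ** (A :: complex^'n^'n)) $ i $ j = x * A $ i $ j"
  by (simp add: matrix_mult_nth mat_def if_distrib[where f = "\<lambda>z. z * _"] cong: if_cong)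

lemma mat_mult_tensor_exponents:
  "mat x ** tensor_exponents X Y = tensor_exponents (mat x ** X) (mat x ** Y)"
  by (simp add: vec_eq_iff mat_mult_nth tensor_exponents_def kronecker_def algebra_simps)

lemma kronecker_mult_tensor_form:
  "kronecker P Q *v (\<chi> p. x $ fst p * y $ snd p) = (\<chi> p. (P *v x) $ fst p * (Q *v y) $ snd p)"
  by (simp add: kronecker_def matrix_vector_mult_def vec_eq_iff UNIV_prod_sum sum_product mult_ac)

subsection \<open>Expansions in powers of the nome\<close>

text \<open>Turns the condition at the cusp into holomorphy of one function on the whole disc,
  \<open>q = 0\<close> included. One direction sums the series, the other takes Taylor
  coefficients.\<close>

lemma nome_expansion_iff:
  fixes G :: "complex \<Rightarrow> complex^'n"
  shows "(\<exists>a :: nat \<Rightarrow> complex^'n. \<forall>\<tau>\<in>UHP. (\<lambda>m. (nome \<tau> ^ m) *s a m) sums G \<tau>) \<longleftrightarrow>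
    (\<exists>h. (\<forall>i. (\<lambda>q. h q $ i) holomorphic_on ball 0 1) \<and> (\<forall>\<tau>\<in>UHP. G \<tau> = h (nome \<tau>)))"
proof
  assume "\<exists>a :: nat \<Rightarrow> complex^'n. \<forall>\<tau>\<in>UHP. (\<lambda>m. (nome \<tau> ^ m) *s a m) sums G \<tau>"
  then obtain a :: "nat \<Rightarrow> complex^'n" where a: "(\<lambda>m. a m $ i * nome \<tau> ^ m) sums (G \<tau> $ i)" if "\<tau> \<in> UHP" for \<tau> i
    unfolding sums_vec_iff by (auto simp: mult.commute)
  define f where "f = (\<lambda>i. Abs_fps (\<lambda>m. a m $ i))"
  have f: "disc_fps (f i)" for i
    unfolding disc_fps_def fps_conv_radius_def
  proof (rule conv_radius_geI_ex')
    fix r :: real assume r: "0 < r" "ereal r < 1"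
    then obtain \<tau> where "\<tau> \<in> UHP" "nome \<tau> = of_real r" using nome_surj[of "of_real r"] by auto
    then show "summable (\<lambda>m. fps_nth (f i) m * of_real r ^ m)"
      using a[of \<tau> i] by (auto simp: f_def sums_iff)
  qed
  show "\<exists>h. (\<forall>i. (\<lambda>q. h q $ i) holomorphic_on ball 0 1) \<and> (\<forall>\<tau>\<in>UHP. G \<tau> = h (nome \<tau>))"
  proof (intro exI[of _ "\<lambda>q. \<chi> i. eval_fps (f i) q"] conjI allI ballI)
    show "(\<lambda>q. (\<chi> i. eval_fps (f i) q) $ i) holomorphic_on ball 0 1" for i
      using holomorphic_disc_fps[OF f] by simp
    show "G \<tau> = (\<chi> i. eval_fps (f i) (nome \<tau>))" if "\<tau> \<in> UHP" for \<tau>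
      using a[OF that] by (simp add: vec_eq_iff eval_fps_def f_def sums_iff)
  qed
next
  assume "\<exists>h. (\<forall>i. (\<lambda>q. h q $ i) holomorphic_on ball 0 1) \<and> (\<forall>\<tau>\<in>UHP. G \<tau> = h (nome \<tau>))"
  then obtain h where h: "\<And>i. (\<lambda>q. h q $ i) holomorphic_on ball 0 1" "\<And>\<tau>. \<tau> \<in> UHP \<Longrightarrow> G \<tau> = h (nome \<tau>)" by blast
  show "\<exists>a :: nat \<Rightarrow> complex^'n. \<forall>\<tau>\<in>UHP. (\<lambda>m. (nome \<tau> ^ m) *s a m) sums G \<tau>"
  proof (intro exI[of _ "\<lambda>m. \<chi> i. (deriv ^^ m) (\<lambda>q. h q $ i) 0 / fact m"] ballI)
    fix \<tau> assume \<tau>: "\<tau> \<in> UHP"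
    show "(\<lambda>m. (nome \<tau> ^ m) *s (\<chi> i. (deriv ^^ m) (\<lambda>q. h q $ i) 0 / fact m)) sums G \<tau>"
      unfolding sums_vec_iff h(2)[OF \<tau>]
      using holomorphic_power_series[OF h(1) nome_in_ball[OF \<tau>]] by (simp add: mult.commute)
  qed
qed

abbreviation twist :: "complex^'n^'n \<Rightarrow> complex \<Rightarrow> complex^'n^'n" where
  "twist L \<tau> \<equiv> matrix_exp (mat (- (2 * of_real pi * \<i> * \<tau>)) ** L)"

subsection \<open>Vector-valued modular forms\<close>

text \<open>The product rules are pure algebra once \<open>cocycle \<gamma> \<tau>\<close> is
  nonzero. That, and the stability of the half-plane, pass from the generators to products.\<close>

lemma moebius_cocycle:
  assumes "\<gamma> \<in> SL2Z"
  shows "\<forall>\<tau>\<in>UHP. cocycle \<gamma> \<tau> \<noteq> 0 \<and> moebius \<gamma> \<tau> \<in> UHP"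
    and "\<And>\<delta> \<tau>. \<delta> \<in> SL2Z \<Longrightarrow> \<tau> \<in> UHP \<Longrightarrow> cocycle (\<delta> ** \<gamma>) \<tau> = cocycle \<delta> (moebius \<gamma> \<tau>) * cocycle \<gamma> \<tau>
      \<and> moebius (\<delta> ** \<gamma>) \<tau> = moebius \<delta> (moebius \<gamma> \<tau>)"
proof -
  have prod: "cocycle (\<delta> ** \<gamma>) \<tau> = cocycle \<delta> (moebius \<gamma> \<tau>) * cocycle \<gamma> \<tau> \<and>
      moebius (\<delta> ** \<gamma>) \<tau> = moebius \<delta> (moebius \<gamma> \<tau>)" if "cocycle \<gamma> \<tau> \<noteq> 0" for \<gamma> \<delta> \<tau>
  proof -
    have n: "(of_int ((\<delta> ** \<gamma>) $ i $ 1) * \<tau> + of_int ((\<delta> ** \<gamma>) $ i $ 2)) =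
        (of_int (\<delta> $ i $ 1) * moebius \<gamma> \<tau> + of_int (\<delta> $ i $ 2)) * cocycle \<gamma> \<tau>" for i
    proof -
      have "moebius \<gamma> \<tau> * cocycle \<gamma> \<tau> = of_int (\<gamma> $ 1 $ 1) * \<tau> + of_int (\<gamma> $ 1 $ 2)"
        using that by (simp add: moebius_def)
      then have "(of_int (\<delta> $ i $ 1) * moebius \<gamma> \<tau> + of_int (\<delta> $ i $ 2)) * cocycle \<gamma> \<tau> =
        of_int (\<delta> $ i $ 1) * (of_int (\<gamma> $ 1 $ 1) * \<tau> + of_int (\<gamma> $ 1 $ 2)) + of_int (\<delta> $ i $ 2) * cocycle \<gamma> \<tau>"
        by (simp add: distrib_right mult.assoc)
      then show ?thesis by (simp add: mat2_mult_nth cocycle_def algebra_simps)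
    qed
    show ?thesis
      using n[of 1] n[of 2] that by (simp add: cocycle_def[of "\<delta> ** \<gamma>"] cocycle_def[of \<delta>] moebius_def[of "\<delta> ** \<gamma>"] moebius_def[of \<delta>])
  qed
  have 1: "\<forall>\<tau>\<in>UHP. cocycle \<gamma> \<tau> \<noteq> 0 \<and> moebius \<gamma> \<tau> \<in> UHP" if "\<gamma> \<in> SL2Z" for \<gamma>
    using that
  proof (induction rule: SL2Z_induct)
    case S
    show ?case using neg_inverse_in_UHP UHP_nonzero by (auto simp: cocycle_def moebius_def)
  next
    case T
    show ?case by (auto simp: cocycle_def moebius_def plus_one_in_UHP)
  next
    case (mult \<gamma> \<delta>)
    then show ?case using prod by auto
  qed
  show "\<forall>\<tau>\<in>UHP. cocycle \<gamma> \<tau> \<noteq> 0 \<and> moebius \<gamma> \<tau> \<in> UHP" by (rule 1[OF assms])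
  show "cocycle (\<delta> ** \<gamma>) \<tau> = cocycle \<delta> (moebius \<gamma> \<tau>) * cocycle \<gamma> \<tau> \<and> moebius (\<delta> ** \<gamma>) \<tau> = moebius \<delta> (moebius \<gamma> \<tau>)"
    if "\<delta> \<in> SL2Z" "\<tau> \<in> UHP" for \<delta> \<tau>
    by (rule prod) (use 1[OF assms] that in blast)
qed

lemma moebius_S: "moebius S_mat \<tau> = -1/\<tau>" "cocycle S_mat \<tau> = \<tau>"
  and moebius_T: "moebius T_mat \<tau> = \<tau> + 1" "cocycle T_mat \<tau> = 1"
  by (simp_all add: moebius_def cocycle_def)

lemma modular_formsI:
  fixes F :: "complex \<Rightarrow> complex^'n"
  assumes rep: "representation \<rho>" and out: "\<And>\<tau>. \<tau> \<notin> UHP \<Longrightarrow> F \<tau> = 0"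
    and hol: "\<And>i. (\<lambda>\<tau>. F \<tau> $ i) holomorphic_on UHP"
    and T: "\<And>\<tau>. \<tau> \<in> UHP \<Longrightarrow> F (\<tau> + 1) = \<rho> T_mat *v F \<tau>"
    and S: "\<And>\<tau>. \<tau> \<in> UHP \<Longrightarrow> F (-1/\<tau>) = (\<tau> powi k) *s (\<rho> S_mat *v F \<tau>)"
    and h: "\<And>i. (\<lambda>q. h q $ i) holomorphic_on ball 0 1" "\<And>\<tau>. \<tau> \<in> UHP \<Longrightarrow> twist L \<tau> *v F \<tau> = h (nome \<tau>)"
  shows "F \<in> modular_forms \<rho> L k"
proof -
  have "\<forall>\<tau>\<in>UHP. F (moebius \<gamma> \<tau>) = (cocycle \<gamma> \<tau> powi k) *s (\<rho> \<gamma> *v F \<tau>)" if "\<gamma> \<in> SL2Z" for \<gamma>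
    using that
  proof (induction rule: SL2Z_induct)
    case S
    then show ?case using assms(5) by (simp add: moebius_S)
  next
    case T
    then show ?case using assms(4) by (simp add: moebius_T)
  next
    case (mult \<gamma> \<delta>)
    show ?case
    proof
      fix \<tau> assume \<tau>: "\<tau> \<in> UHP"
      then have \<tau>': "moebius \<delta> \<tau> \<in> UHP" using moebius_cocycle(1)[OF mult(2)] by blast
      have "F (moebius (\<gamma> ** \<delta>) \<tau>) = cocycle \<gamma> (moebius \<delta> \<tau>) powi k *s (\<rho> \<gamma> *v (cocycle \<delta> \<tau> powi k *s (\<rho> \<delta> *v F \<tau>)))"
        using moebius_cocycle(2)[OF mult(2,1) \<tau>] mult(3,4) \<tau> \<tau>' by simp
      also have "\<dots> = cocycle (\<gamma> ** \<delta>) \<tau> powi k *s (\<rho> (\<gamma> ** \<delta>) *v F \<tau>)"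
        using moebius_cocycle(2)[OF mult(2,1) \<tau>] rep mult(1,2)
        by (simp add: representation_def power_int_mult_distrib vector_scalar_commute vector_smult_assoc matrix_vector_mul_assoc)
      finally show "F (moebius (\<gamma> ** \<delta>) \<tau>) = cocycle (\<gamma> ** \<delta>) \<tau> powi k *s (\<rho> (\<gamma> ** \<delta>) *v F \<tau>)" .
    qed
  qed
  moreover have "\<exists>a :: nat \<Rightarrow> complex^'n. \<forall>\<tau>\<in>UHP. (\<lambda>m. (nome \<tau> ^ m) *s a m) sums (twist L \<tau> *v F \<tau>)"
    unfolding nome_expansion_iff using h by blast
  ultimately show ?thesis using out hol by (simp add: modular_forms_def)
qed

lemma modular_formsD:
  fixes F :: "complex \<Rightarrow> complex^'n"
  assumes "F \<in> modular_forms \<rho> L k"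
  shows "\<tau> \<notin> UHP \<Longrightarrow> F \<tau> = 0" "(\<lambda>\<tau>. F \<tau> $ i) holomorphic_on UHP"
    "\<tau> \<in> UHP \<Longrightarrow> F (\<tau> + 1) = \<rho> T_mat *v F \<tau>"
    "\<tau> \<in> UHP \<Longrightarrow> F (-1/\<tau>) = (\<tau> powi k) *s (\<rho> S_mat *v F \<tau>)"
    "\<exists>h. (\<forall>i. (\<lambda>q. h q $ i) holomorphic_on ball 0 1) \<and> (\<forall>\<tau>\<in>UHP. twist L \<tau> *v F \<tau> = h (nome \<tau>))"
proof -
  note * = assms[unfolded modular_forms_def, simplified]
  show "\<tau> \<notin> UHP \<Longrightarrow> F \<tau> = 0" "(\<lambda>\<tau>. F \<tau> $ i) holomorphic_on UHP" using * by blast+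
  have act: "F (moebius \<gamma> \<tau>) = (cocycle \<gamma> \<tau> powi k) *s (\<rho> \<gamma> *v F \<tau>)" if "\<gamma> \<in> SL2Z" "\<tau> \<in> UHP" for \<gamma>
    using * that by blast
  show "\<tau> \<in> UHP \<Longrightarrow> F (\<tau> + 1) = \<rho> T_mat *v F \<tau>"
    "\<tau> \<in> UHP \<Longrightarrow> F (-1/\<tau>) = (\<tau> powi k) *s (\<rho> S_mat *v F \<tau>)"
    using act[of T_mat] act[of S_mat] by (simp_all add: moebius_S moebius_T)
  show "\<exists>h. (\<forall>i. (\<lambda>q. h q $ i) holomorphic_on ball 0 1) \<and> (\<forall>\<tau>\<in>UHP. twist L \<tau> *v F \<tau> = h (nome \<tau>))"
    using assms unfolding modular_forms_def nome_expansion_iff by blast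
qed

subsection \<open>Free bases\<close>

lemma holomorphic_det:
  fixes M :: "complex \<Rightarrow> complex^'n^'n"
  assumes "\<And>i j. (\<lambda>q. M q $ i $ j) holomorphic_on A"
  shows "(\<lambda>q. det (M q)) holomorphic_on A"
  unfolding det_def by (intro holomorphic_intros assms)

lemma matrix_vector_mult_nth: "(A *v x) $ i = (\<Sum>j\<in>UNIV. A $ i $ j * x $ j)"
  by (simp add: matrix_vector_mult_def)

lemma matrix_vector_mult_sum_smult:
  fixes A :: "'a::comm_semiring_1^'n^'m"
  shows "A *v (\<Sum>j\<in>J. c j *s v j) = (\<Sum>j\<in>J. c j *s (A *v v j))"
proof -
  have "(A *v (\<Sum>j\<in>J. c j *s v j)) $ i = (\<Sum>j\<in>J. c j *s (A *v v j)) $ i" for i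
    unfolding matrix_vector_mult_nth sum_component vector_smult_component sum_distrib_left
    by (subst sum.swap) (simp add: mult_ac)
  then show ?thesis by (simp add: vec_eq_iff)
qed

lemma det_nonzero_mult_cancel:
  fixes A :: "complex^'n^'n"
  assumes "det A \<noteq> 0" "A *v x = A *v y"
  shows "x = y"
proof -
  from assms(1) obtain B where "B ** A = mat 1"
    using invertible_det_nz[of A] unfolding invertible_def by blast
  then show ?thesis using arg_cong[OF assms(2), of "\<lambda>v. B *v v"] by (simp add: matrix_vector_mul_assoc)
qed

text \<open>The columns of the fundamental matrix, twisted by \<open>q^(-L)\<close>, must be
  holomorphic and independent on the whole disc; independence at \<open>q = 0\<close> is what makes
  coordinates holomorphic at the cusp. Indexing by the matrix index type makes the number of forms
  equal to the dimension.\<close>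

definition free_basis :: "(int^2^2 \<Rightarrow> complex^'n^'n) \<Rightarrow> complex^'n^'n \<Rightarrow> ('n \<Rightarrow> int) \<Rightarrow>
    ('n \<Rightarrow> complex \<Rightarrow> complex^'n) \<Rightarrow> bool" where
  "free_basis \<rho> L w b \<longleftrightarrow> (\<forall>j. b j \<in> modular_forms \<rho> L (w j)) \<and>
     (\<exists>\<Phi> :: complex \<Rightarrow> complex^'n^'n. (\<forall>i j. (\<lambda>q. \<Phi> q $ i $ j) holomorphic_on ball 0 1) \<and>
       (\<forall>q\<in>ball 0 1. det (\<Phi> q) \<noteq> 0) \<and>
       (\<forall>\<tau>\<in>UHP. \<forall>j. twist L \<tau> *v b j \<tau> = column j (\<Phi> (nome \<tau>))))"

lemma matrix_vector_column_sum: "(A :: complex^'n^'m) *v x = (\<Sum>j\<in>UNIV. x $ j *s column j A)"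
  by (simp add: vec_eq_iff matrix_vector_mult_nth column_def mult.commute)

lemma free_basis_independent:
  assumes "free_basis \<rho> L w b" and "\<tau> \<in> UHP"
    and "(\<Sum>j\<in>UNIV. c j *s b j \<tau>) = (\<Sum>j\<in>UNIV. d j *s b j \<tau>)"
  shows "c = d"
proof -
  from assms(1,2) obtain \<Phi> where \<Phi>: "det (\<Phi> (nome \<tau>)) \<noteq> 0" "\<And>j. twist L \<tau> *v b j \<tau> = column j (\<Phi> (nome \<tau>))"
    unfolding free_basis_def using nome_in_ball[OF assms(2)] by metis
  have "\<Phi> (nome \<tau>) *v (\<chi> j. c j) = \<Phi> (nome \<tau>) *v (\<chi> j. d j)"
    using arg_cong[OF assms(3), of "\<lambda>v. twist L \<tau> *v v"]
    unfolding matrix_vector_mult_sum_smult \<Phi>(2) by (simp add: matrix_vector_column_sum)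
  from det_nonzero_mult_cancel[OF \<Phi>(1) this] show ?thesis by (simp add: vec_eq_iff fun_eq_iff)
qed

text \<open>Cramer's rule for the twisted fundamental matrix gives coordinates that are holomorphic
  in \<open>q\<close>. Their behaviour under inversion follows from uniqueness of coordinates at
  each point, and the structure theorem puts them into \<open>\<complex>[E4, E6]\<close>.\<close>

theorem free_basis_span:
  fixes \<rho> :: "int^2^2 \<Rightarrow> complex^'n^'n"
  assumes rep: "representation \<rho>" and fb: "free_basis \<rho> L w b" and X: "X \<in> modular_forms \<rho> L k"
  obtains c where "\<And>j. c j \<in> M1_weight (k - w j)"
    and "X = (\<lambda>\<tau>. \<Sum>j\<in>UNIV. c j \<tau> *s b j \<tau>)"
proof -
  from fb obtain \<Phi> where \<Phi>: "\<And>i j. (\<lambda>q. \<Phi> q $ i $ j) holomorphic_on ball 0 1"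
    "\<And>q. q \<in> ball 0 1 \<Longrightarrow> det (\<Phi> q) \<noteq> 0"
    "\<And>\<tau> j. \<tau> \<in> UHP \<Longrightarrow> twist L \<tau> *v b j \<tau> = column j (\<Phi> (nome \<tau>))"
    unfolding free_basis_def by blast
  have b: "b j \<in> modular_forms \<rho> L (w j)" for j using fb by (simp add: free_basis_def)
  from modular_formsD(5)[OF X] obtain h where h: "\<And>i. (\<lambda>q. h q $ i) holomorphic_on ball 0 1"
    "\<And>\<tau>. \<tau> \<in> UHP \<Longrightarrow> twist L \<tau> *v X \<tau> = h (nome \<tau>)" by blast
  define c where "c = (\<lambda>j q. det (\<chi> i l. if l = j then h q $ i else \<Phi> q $ i $ l) / det (\<Phi> q))"
  have c_hol: "c j holomorphic_on ball 0 1" for j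
  proof -
    have "(\<lambda>q. (\<chi> i l. if l = j then h q $ i else \<Phi> q $ i $ l) $ i $ l) holomorphic_on ball 0 1" for i l
      using \<Phi>(1) h(1) by (cases "l = j") auto
    then show ?thesis
      unfolding c_def by (intro holomorphic_on_divide holomorphic_det \<Phi>)
  qed
  have cramer: "(\<Sum>j\<in>UNIV. c j q *s column j (\<Phi> q)) = h q" if "q \<in> ball 0 1" for q
    using cramer[OF \<Phi>(2)[OF that], of "\<chi> j. c j q" "h q"]
    by (simp add: c_def matrix_vector_column_sum)
  have X_eq: "X \<tau> = (\<Sum>j\<in>UNIV. c j (nome \<tau>) *s b j \<tau>)" if \<tau>: "\<tau> \<in> UHP" for \<tau>
  proof (rule det_nonzero_mult_cancel)
    have "twist L \<tau> ** (\<chi> i j. b j \<tau> $ i) = \<Phi> (nome \<tau>)"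
      using \<Phi>(3)[OF \<tau>] by (simp add: vec_eq_iff matrix_mult_nth matrix_vector_mult_nth column_def)
    then show "det (twist L \<tau>) \<noteq> 0" using \<Phi>(2)[OF nome_in_ball[OF \<tau>]] by (metis det_mul mult_zero_left)
    show "twist L \<tau> *v X \<tau> = twist L \<tau> *v (\<Sum>j\<in>UNIV. c j (nome \<tau>) *s b j \<tau>)"
      unfolding matrix_vector_mult_sum_smult \<Phi>(3)[OF \<tau>] cramer[OF nome_in_ball[OF \<tau>]] h(2)[OF \<tau>] ..
  qed
  have "level1_form (k - w j) (c j)" for j
    unfolding level1_form_def
  proof (intro conjI ballI)
    fix \<tau> assume \<tau>: "\<tau> \<in> UHP"
    note \<tau>' = neg_inverse_in_UHP[OF \<tau>]
    have ne: "\<tau> \<noteq> 0" using \<tau> by (rule UHP_nonzero)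
    from rep have "invertible (\<rho> S_mat)" by (simp add: representation_def)
    then have det: "det (\<rho> S_mat) \<noteq> 0" by (simp add: invertible_det_nz)
    have "\<rho> S_mat *v (\<Sum>j\<in>UNIV. (\<tau> powi k * c j (nome \<tau>)) *s b j \<tau>) = X (-1/\<tau>)"
      unfolding modular_formsD(4)[OF X \<tau>] X_eq[OF \<tau>]
      by (simp add: matrix_vector_mult_sum_smult vec.scale_sum_right vector_smult_assoc)
    also have "\<dots> = \<rho> S_mat *v (\<Sum>j\<in>UNIV. (c j (nome (-1/\<tau>)) * \<tau> powi w j) *s b j \<tau>)"
      unfolding X_eq[OF \<tau>'] modular_formsD(4)[OF b \<tau>]
      by (simp add: matrix_vector_mult_sum_smult vector_smult_assoc)
    finally have "(\<Sum>j\<in>UNIV. (\<tau> powi k * c j (nome \<tau>)) *s b j \<tau>) = (\<Sum>j\<in>UNIV. (c j (nome (-1/\<tau>)) * \<tau> powi w j) *s b j \<tau>)"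
      by (rule det_nonzero_mult_cancel[OF det])
    from free_basis_independent[OF fb \<tau> this]
    have "\<tau> powi k * c j (nome \<tau>) = c j (nome (-1/\<tau>)) * \<tau> powi w j" by (rule fun_cong)
    then show "c j (nome (-1/\<tau>)) = \<tau> powi (k - w j) * c j (nome \<tau>)"
      using ne by (simp add: power_int_diff field_simps)
  qed (rule c_hol)
  then have "on_UHP (\<lambda>\<tau>. c j (nome \<tau>)) \<in> M1_weight (k - w j)" for j by (rule level1_form_in_M1_weight)
  moreover have "X = (\<lambda>\<tau>. \<Sum>j\<in>UNIV. on_UHP (\<lambda>\<tau>. c j (nome \<tau>)) \<tau> *s b j \<tau>)"
  proof
    show "X \<tau> = (\<Sum>j\<in>UNIV. on_UHP (\<lambda>\<tau>. c j (nome \<tau>)) \<tau> *s b j \<tau>)" for \<tau>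
      using X_eq[of \<tau>] modular_formsD(1)[OF X, of \<tau>] by (cases "\<tau> \<in> UHP") (simp_all add: on_UHP_def)
  qed
  ultimately show thesis by (rule that)
qed

lemma free_basis_nonzero:
  assumes "free_basis \<rho> L w b"
  shows "b j \<noteq> (\<lambda>_. 0)"
proof
  assume "b j = (\<lambda>_. 0)"
  then have "(\<Sum>l\<in>UNIV. (if l = j then 1 else 0) *s b l \<i>) = (\<Sum>l\<in>UNIV. 0 *s b l \<i>)"
    by (intro sum.cong) auto
  from fun_cong[OF free_basis_independent[OF assms _ this], of j] show False by (simp add: UHP_def)
qed

lemma zero_in_modular_forms: "(\<lambda>_. 0) \<in> modular_forms \<rho> L k"
  by (auto simp: modular_forms_def intro!: exI[of _ "\<lambda>_. 0"])

text \<open>Coefficients of negative weight vanish, so no nonzero form lies below the lowest weight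
  in the basis.\<close>

lemma free_basis_minimal_weight:
  assumes rep: "representation \<rho>" and fb: "free_basis \<rho> L w b" and min: "\<And>j. w j0 \<le> w j"
  shows "minimal_weight \<rho> L (w j0)"
  unfolding minimal_weight_def
proof (intro conjI allI impI)
  show "modular_forms \<rho> L (w j0) \<noteq> {\<lambda>_. 0}"
    using fb free_basis_nonzero[OF fb, of j0] by (auto simp: free_basis_def)
  fix k assume "modular_forms \<rho> L k \<noteq> {\<lambda>_. 0}"
  then obtain X where X: "X \<in> modular_forms \<rho> L k" "X \<noteq> (\<lambda>_. 0)" using zero_in_modular_forms by fast
  from free_basis_span[OF rep fb X(1)] obtain c where
    c: "\<And>j. c j \<in> M1_weight (k - w j)" "X = (\<lambda>\<tau>. \<Sum>j\<in>UNIV. c j \<tau> *s b j \<tau>)" by blast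
  have "\<exists>j. c j \<noteq> (\<lambda>_. 0)"
  proof (rule ccontr)
    assume "\<not> (\<exists>j. c j \<noteq> (\<lambda>_. 0))"
    then have "c j \<tau> = 0" for j \<tau> by metis
    then show False using c(2) X(2) by simp
  qed
  then obtain j where "c j \<noteq> (\<lambda>_. 0)" by blast
  then have "\<not> k - w j < 0" using M1_weight_small[OF c(1)] by blast
  then show "w j0 \<le> k" using min[of j] by simp
qed

subsection \<open>The method of Frobenius\<close>

text \<open>The recursion for the coefficients of a solution \<open>q^r (1 + ...)\<close> of
  \<open>\<theta>^2 f + P \<theta> f + Q f = 0\<close> with \<open>\<theta> = q d/dq\<close>; the
  denominator is the indicial polynomial at \<open>r + n\<close>.\<close>

fun frobenius_coeff :: "complex fps \<Rightarrow> complex fps \<Rightarrow> complex \<Rightarrow> nat \<Rightarrow> complex" where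
  "frobenius_coeff P Q r n = (if n = 0 then 1 else
     - (\<Sum>m<n. frobenius_coeff P Q r m * ((r + of_nat m) * fps_nth P (n - m) + fps_nth Q (n - m))) /
       ((r + of_nat n)\<^sup>2 + (r + of_nat n) * fps_nth P 0 + fps_nth Q 0))"

declare frobenius_coeff.simps [simp del]

text \<open>\<open>shift_theta r f\<close> is \<open>q\<^bsup>-r\<^esup> \<theta> (q\<^bsup>r\<^esup> f)\<close>.\<close>

definition shift_theta :: "complex \<Rightarrow> complex fps \<Rightarrow> complex fps" where
  "shift_theta r f = fps_const r * f + theta_fps f"

lemma shift_theta_nth [simp]: "fps_nth (shift_theta r f) n = (r + of_nat n) * fps_nth f n"
  by (simp add: shift_theta_def algebra_simps)

lemma disc_shift_theta [intro]: "disc_fps f \<Longrightarrow> disc_fps (shift_theta r f)"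
  by (auto simp: shift_theta_def)

lemma geometric_growth:
  fixes b :: "nat \<Rightarrow> real"
  assumes s: "s > 0" and step: "\<And>n. n \<ge> N \<Longrightarrow> b (Suc n) \<le> s * b n"
  shows "n \<ge> N \<Longrightarrow> b n \<le> b N / s ^ N * s ^ n"
proof (induction n rule: dec_induct)
  case (step n)
  have "b (Suc n) \<le> s * b n" using assms(2) step by simp
  also have "\<dots> \<le> s * (b N / s ^ N * s ^ n)" using step s by (intro mult_left_mono) auto
  finally show ?case by (simp add: mult_ac)
qed (use s in simp)

text \<open>With \<open>b n = |a n| \<rho>^n\<close> and its partial sums \<open>B n\<close>, the
  recursion bounds \<open>b n\<close> by a multiple of \<open>B n / n\<close> for large
  \<open>n\<close>: the indicial polynomial grows quadratically, the numerator only linearly. So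
  \<open>B\<close> eventually grows by at most the factor \<open>s\<close> per step.\<close>

lemma frobenius_coeff_summable:
  assumes P: "disc_fps P" and Q: "disc_fps Q" and \<rho>0: "0 < \<rho>0" "\<rho>0 < 1"
    and nz: "\<And>n. n \<ge> 1 \<Longrightarrow> (r + of_nat n)\<^sup>2 + (r + of_nat n) * fps_nth P 0 + fps_nth Q 0 \<noteq> 0"
  shows "summable (\<lambda>n. frobenius_coeff P Q r n * of_real \<rho>0 ^ n)"
proof -
  define \<rho> where "\<rho> = (\<rho>0 + 1) / 2"
  have \<rho>: "\<rho>0 < \<rho>" "0 < \<rho>" "\<rho> < 1" using \<rho>0 by (auto simp: \<rho>_def)
  \<comment> \<open>The midpoint of \<open>1\<close> and \<open>\<rho> / \<rho>0\<close> leaves room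
    on both sides: growth by the factor \<open>s\<close> is permitted, and
    \<open>s \<rho>0 / \<rho> < 1\<close> still gives a convergent geometric majorant.\<close>
  define s where "s = (1 + \<rho> / \<rho>0) / 2"
  have s: "1 < s" "s * \<rho>0 / \<rho> < 1" using \<rho> \<rho>0 by (auto simp: s_def field_simps)
  have bdd: "\<exists>C. \<forall>n. norm (fps_nth F n) * \<rho> ^ n \<le> C" if "disc_fps F" for F
  proof -
    have "summable (\<lambda>n. norm (fps_nth F n * of_real \<rho> ^ n))"
      by (rule norm_summable_fps, rule disc_fps_less[OF that]) (use \<rho> in simp)
    then have "Bseq (\<lambda>n. norm (fps_nth F n * of_real \<rho> ^ n))"
      using summable_LIMSEQ_zero convergentI convergent_imp_Bseq by blast
    then obtain K where "\<forall>n. norm (norm (fps_nth F n * of_real \<rho> ^ n)) \<le> K" by (auto simp: Bseq_def)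
    then show ?thesis using \<rho> by (auto simp: norm_mult norm_power)
  qed
  from bdd[OF P] bdd[OF Q] obtain C1 C2 where C12: "\<And>n. norm (fps_nth P n) * \<rho> ^ n \<le> C1" "\<And>n. norm (fps_nth Q n) * \<rho> ^ n \<le> C2"
    by metis
  define C where "C = max (max C1 C2) 0"
  have C: "norm (fps_nth P n) * \<rho> ^ n \<le> C" "norm (fps_nth Q n) * \<rho> ^ n \<le> C" "C \<ge> 0" for n
    using C12[of n] by (auto simp: C_def)
  define a where "a = frobenius_coeff P Q r"
  define I where "I = (\<lambda>n. (r + of_nat n)\<^sup>2 + (r + of_nat n) * fps_nth P 0 + fps_nth Q 0)"
  define b where "b = (\<lambda>n. norm (a n) * \<rho> ^ n)"
  define B where "B = (\<lambda>n. \<Sum>m<n. b m)"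
  have b0: "b n \<ge> 0" for n using \<rho> by (simp add: b_def)
  have rec: "norm (I n) * b n \<le> C * (norm r + 1 + real n) * B n" if n: "n \<ge> 1" for n
  proof -
    have "I n * a n = - (\<Sum>m<n. a m * ((r + of_nat m) * fps_nth P (n - m) + fps_nth Q (n - m)))"
      using n nz[OF n] by (simp add: a_def I_def frobenius_coeff.simps[of P Q r n])
    then have "norm (I n) * norm (a n) = norm (\<Sum>m<n. a m * ((r + of_nat m) * fps_nth P (n - m) + fps_nth Q (n - m)))"
      by (metis norm_minus_cancel norm_mult)
    then have "norm (I n) * b n \<le> (\<Sum>m<n. norm (a m * ((r + of_nat m) * fps_nth P (n - m) + fps_nth Q (n - m)))) * \<rho> ^ n"
      unfolding b_def mult.assoc[symmetric] using \<rho> by (intro mult_right_mono) (auto intro: norm_sum)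
    also have "\<dots> = (\<Sum>m<n. b m * (norm ((r + of_nat m) * fps_nth P (n - m) + fps_nth Q (n - m)) * \<rho> ^ (n - m)))"
      unfolding sum_distrib_right
      by (intro sum.cong) (auto simp: b_def norm_mult mult_ac simp flip: power_add)
    also have "\<dots> \<le> (\<Sum>m<n. b m * (C * (norm r + 1 + real n)))"
    proof (intro sum_mono mult_left_mono b0)
      fix m assume "m \<in> {..<n}"
      then have m: "real m \<le> real n" by simp
      have "norm ((r + of_nat m) * fps_nth P (n - m) + fps_nth Q (n - m)) * \<rho> ^ (n - m) \<le>
          (norm (r + of_nat m) * norm (fps_nth P (n - m)) + norm (fps_nth Q (n - m))) * \<rho> ^ (n - m)"
        using \<rho> by (intro mult_right_mono) (auto simp flip: norm_mult intro: norm_triangle_ineq)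
      also have "\<dots> = norm (r + of_nat m) * (norm (fps_nth P (n - m)) * \<rho> ^ (n - m)) + norm (fps_nth Q (n - m)) * \<rho> ^ (n - m)"
        by (simp add: algebra_simps)
      also have "\<dots> \<le> (norm r + real n) * C + C"
      proof (intro add_mono mult_mono C)
        have "norm (r + of_nat m) \<le> norm r + real m" using norm_triangle_ineq[of r "of_nat m"] by simp
        then show "norm (r + of_nat m) \<le> norm r + real n" using m by simp
      qed (use \<rho> in auto)
      also have "\<dots> = C * (norm r + 1 + real n)" by (simp add: algebra_simps)
      finally show "norm ((r + of_nat m) * fps_nth P (n - m) + fps_nth Q (n - m)) * \<rho> ^ (n - m) \<le> C * (norm r + 1 + real n)" .
    qed
    also have "\<dots> = C * (norm r + 1 + real n) * B n" by (simp add: B_def sum_distrib_right mult.commute)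
    finally show ?thesis .
  qed
  define \<alpha> where "\<alpha> = 2 * norm r + norm (fps_nth P 0)"
  define \<beta> where "\<beta> = norm (r\<^sup>2 + r * fps_nth P 0 + fps_nth Q 0)"
  define D where "D = C / (s - 1)"
  have D: "D \<ge> 0" "D * (s - 1) = C" using C(3) s by (auto simp: D_def)
  have I_ge: "norm (I n) \<ge> (real n)\<^sup>2 - \<alpha> * real n - \<beta>" for n
  proof -
    have "I n = of_nat n ^ 2 + ((2 * r + fps_nth P 0) * of_nat n + (r\<^sup>2 + r * fps_nth P 0 + fps_nth Q 0))"
      by (simp add: I_def power2_eq_square algebra_simps)
    then have "norm (I n) \<ge> norm (of_nat n ^ 2 :: complex) - norm ((2 * r + fps_nth P 0) * of_nat n + (r\<^sup>2 + r * fps_nth P 0 + fps_nth Q 0))"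
      by (metis norm_diff_ineq)
    moreover have "norm ((2 * r + fps_nth P 0) * of_nat n + (r\<^sup>2 + r * fps_nth P 0 + fps_nth Q 0)) \<le> norm ((2 * r + fps_nth P 0) * of_nat n) + \<beta>"
      unfolding \<beta>_def by (rule norm_triangle_ineq)
    moreover have "norm ((2 * r + fps_nth P 0) * of_nat n) \<le> \<alpha> * real n"
      unfolding norm_mult norm_of_nat \<alpha>_def using norm_triangle_ineq[of "2 * r" "fps_nth P 0"]
      by (intro mult_right_mono) (auto simp: norm_mult)
    ultimately show ?thesis by (simp add: norm_power)
  qed
  \<comment> \<open>Beyond this threshold \<open>D (|r| + 1 + n) + n\<close> is at most the
    quadratic lower bound for \<open>|I n|\<close>.\<close>
  obtain N where N: "real N \<ge> max 1 (\<alpha> + \<beta> + D * (norm r + 2) + 1)" using real_arch_simple by blast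
  have B_step: "B (Suc n) \<le> s * B n" if n: "n \<ge> N" for n
  proof -
    have n1: "real n \<ge> 1" "real n \<ge> \<alpha> + \<beta> + D * (norm r + 2) + 1" using n N by auto
    have \<alpha>\<beta>: "\<alpha> \<ge> 0" "\<beta> \<ge> 0" by (simp_all add: \<alpha>_def \<beta>_def)
    have "real n * (\<alpha> + \<beta> + D * (norm r + 2) + 1) \<le> real n * real n" using n1 by (intro mult_left_mono) auto
    moreover have "1 * \<beta> \<le> real n * \<beta>" "1 * (D * (norm r + 1)) \<le> real n * (D * (norm r + 1))"
      using n1 \<alpha>\<beta> D by (intro mult_right_mono; simp)+
    ultimately have "D * (norm r + 1 + real n) + real n \<le> (real n)\<^sup>2 - \<alpha> * real n - \<beta>"
      by (simp add: power2_eq_square algebra_simps)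
    then have I_n: "D * (norm r + 1 + real n) + real n \<le> norm (I n)" using I_ge[of n] by linarith
    then have le: "D * (norm r + 1 + real n) \<le> norm (I n)" by linarith
    have "0 \<le> D * (norm r + 1 + real n)" using D by (intro mult_nonneg_nonneg) auto
    then have pos: "norm (I n) > 0" using I_n n1 by linarith
    have B0: "B n \<ge> 0" unfolding B_def by (intro sum_nonneg b0)
    have "norm (I n) * b n \<le> C * (norm r + 1 + real n) * B n" using rec[of n] n1 by simp
    also have "\<dots> = (s - 1) * (D * (norm r + 1 + real n)) * B n" using D(2) by (simp add: mult_ac)
    also have "\<dots> \<le> (s - 1) * norm (I n) * B n" using le s B0 by (intro mult_right_mono mult_left_mono) auto
    finally have "norm (I n) * b n \<le> norm (I n) * ((s - 1) * B n)" by (simp add: mult_ac)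
    then have "b n \<le> (s - 1) * B n" using pos by (simp only: mult_le_cancel_left_pos)
    then show ?thesis by (simp add: B_def algebra_simps)
  qed
  define M where "M = B N / s ^ N"
  have B_le: "B n \<le> M * s ^ n" if "n \<ge> N" for n
    unfolding M_def by (rule geometric_growth[of s N B, OF _ B_step that]) (use s in auto)
  have b_le: "b n \<le> M * s * s ^ n" if "n \<ge> N" for n
  proof -
    have "b n \<le> B (Suc n)" unfolding B_def using b0 by (simp add: sum_nonneg)
    also have "\<dots> \<le> M * s ^ Suc n" using that by (intro B_le) simp
    finally show ?thesis by (simp add: mult_ac)
  qed
  show ?thesis
  proof (rule summable_comparison_test)
    have "0 \<le> s * \<rho>0 / \<rho>" using s \<rho> \<rho>0 by simp
    then show "summable (\<lambda>n. M * s * (s * \<rho>0 / \<rho>) ^ n)"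
      using s(2) by (intro summable_mult summable_geometric) simp
    show "\<exists>N. \<forall>n\<ge>N. norm (frobenius_coeff P Q r n * of_real \<rho>0 ^ n) \<le> M * s * (s * \<rho>0 / \<rho>) ^ n"
    proof (intro exI[of _ N] allI impI)
      fix n assume "N \<le> n"
      have "norm (frobenius_coeff P Q r n * of_real \<rho>0 ^ n) = b n * (\<rho>0 / \<rho>) ^ n"
        using \<rho> \<rho>0 by (simp add: b_def a_def norm_mult norm_power power_divide)
      also have "\<dots> \<le> (M * s * s ^ n) * (\<rho>0 / \<rho>) ^ n"
        using b_le[OF \<open>N \<le> n\<close>] \<rho> \<rho>0 by (intro mult_right_mono) auto
      also have "\<dots> = M * s * (s * \<rho>0 / \<rho>) ^ n" by (simp add: power_mult_distrib power_divide)
      finally show "norm (frobenius_coeff P Q r n * of_real \<rho>0 ^ n) \<le> M * s * (s * \<rho>0 / \<rho>) ^ n" .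
    qed
  qed
qed

lemma frobenius:
  assumes P: "disc_fps P" and Q: "disc_fps Q"
    and ind: "r\<^sup>2 + r * fps_nth P 0 + fps_nth Q 0 = 0"
    and nz: "\<And>n. n \<ge> 1 \<Longrightarrow> (r + of_nat n)\<^sup>2 + (r + of_nat n) * fps_nth P 0 + fps_nth Q 0 \<noteq> 0"
  obtains f where "disc_fps f" "fps_nth f 0 = 1"
    "shift_theta r (shift_theta r f) + shift_theta r f * P + f * Q = 0"
proof
  define f where "f = Abs_fps (frobenius_coeff P Q r)"
  show "disc_fps f" unfolding disc_fps_def fps_conv_radius_def f_def fps_nth_Abs_fps
    by (rule conv_radius_geI_ex') (use frobenius_coeff_summable[OF P Q _ _ nz] in auto)
  show "fps_nth f 0 = 1" by (simp add: f_def frobenius_coeff.simps)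
  show "shift_theta r (shift_theta r f) + shift_theta r f * P + f * Q = 0"
  proof (rule fps_ext)
    fix n
    let ?a = "frobenius_coeff P Q r"
    have "fps_nth (shift_theta r (shift_theta r f) + shift_theta r f * P + f * Q) n =
       (r + of_nat n)\<^sup>2 * ?a n + (\<Sum>m\<in>{0..n}. ?a m * ((r + of_nat m) * fps_nth P (n - m) + fps_nth Q (n - m)))"
      unfolding fps_add_nth fps_mult_nth shift_theta_nth f_def fps_nth_Abs_fps
      by (simp add: power2_eq_square sum.distrib[symmetric] algebra_simps)
    also have "{0..n} = insert n {..<n}" by auto
    finally have "fps_nth (shift_theta r (shift_theta r f) + shift_theta r f * P + f * Q) n =
       ((r + of_nat n)\<^sup>2 + (r + of_nat n) * fps_nth P 0 + fps_nth Q 0) * ?a n +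
       (\<Sum>m<n. ?a m * ((r + of_nat m) * fps_nth P (n - m) + fps_nth Q (n - m)))"
      by (simp add: algebra_simps)
    also have "\<dots> = 0"
    proof (cases "n = 0")
      case True
      then show ?thesis using ind by simp
    next
      case False
      then show ?thesis using nz[of n] by (simp add: frobenius_coeff.simps[of P Q r n])
    qed
    finally show "fps_nth (shift_theta r (shift_theta r f) + shift_theta r f * P + f * Q) n = fps_nth 0 n" by simp
  qed
qed

lemma scalar_deriv_nome_mult:
  assumes "disc_fps f" "\<tau> \<in> UHP"
  shows "((\<lambda>z. nome (r * z) * eval_fps f (nome z)) has_field_derivative
      2 * of_real pi * \<i> * (nome (r * \<tau>) * eval_fps (shift_theta r f) (nome \<tau>))) (at \<tau>)"
    "scalar_deriv k (\<lambda>z. nome (r * z) * eval_fps f (nome z)) \<tau> =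
      nome (r * \<tau>) * eval_fps (shift_theta r f - fps_const (of_int k / 12) * E2_fps * f) (nome \<tau>)"
proof -
  have n: "norm (nome \<tau>) < 1" using assms(2) by (rule norm_nome_less_1)
  have "((\<lambda>z. nome (r * z) * eval_fps f (nome z)) has_field_derivative
      (2 * of_real pi * \<i> * (r * 1) * nome (r * \<tau>)) * eval_fps f (nome \<tau>) +
      (2 * of_real pi * \<i> * eval_fps (theta_fps f) (nome \<tau>)) * nome (r * \<tau>)) (at \<tau>)"
    by (intro DERIV_mult nome_has_field_derivative DERIV_cmult DERIV_ident eval_fps_nome_deriv assms)
  moreover have "eval_fps (shift_theta r f) (nome \<tau>) = r * eval_fps f (nome \<tau>) + eval_fps (theta_fps f) (nome \<tau>)"
    unfolding shift_theta_def using n assms by (simp add: eval_disc_fps disc_fps_arith disc_theta_fps)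
  ultimately show *: "((\<lambda>z. nome (r * z) * eval_fps f (nome z)) has_field_derivative
      2 * of_real pi * \<i> * (nome (r * \<tau>) * eval_fps (shift_theta r f) (nome \<tau>))) (at \<tau>)"
    by (simp add: algebra_simps)
  show "scalar_deriv k (\<lambda>z. nome (r * z) * eval_fps f (nome z)) \<tau> =
      nome (r * \<tau>) * eval_fps (shift_theta r f - fps_const (of_int k / 12) * E2_fps * f) (nome \<tau>)"
    unfolding scalar_derivI[OF *] using n assms
    by (simp add: eval_disc_fps disc_fps_arith disc_E_fps disc_shift_theta E2_eq algebra_simps)
qed

text \<open>The monic modular differential equation \<open>D\<^sup>2 f = a E\<^sub>4 f\<close> in weight \<open>k\<close> has exponents \<open>r\<close>, \<open>s\<close> with
  \<open>r + s = (k + 1) / 6\<close>, and \<open>a\<close> is determined by \<open>r - s\<close>.\<close>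

lemma modular_ODE_solution:
  assumes rs: "r + s = (of_int k + 1) / 6" and nonint: "r - s \<notin> \<int>"
  obtains f where "disc_fps f" "fps_nth f 0 = 1"
    "\<And>\<tau>. \<tau> \<in> UHP \<Longrightarrow> scalar_deriv (k + 2) (scalar_deriv k (\<lambda>z. nome (r * z) * eval_fps f (nome z))) \<tau> =
       (((r - s) / 2)\<^sup>2 - 1/144) * E4 \<tau> * (nome (r * \<tau>) * eval_fps f (nome \<tau>))"
proof -
  define a where "a = ((r - s) / 2)\<^sup>2 - 1/144"
  define \<kappa> where "\<kappa> = (of_int k :: complex)"
  \<comment> \<open>\<open>P\<close> and \<open>Q\<close> are the coefficients when the operator
    \<open>D^2 - a E4\<close> in weight \<open>k\<close> is expanded as
    \<open>\<theta>^2 + P \<theta> + Q\<close>.\<close>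
  define P where "P = fps_const (- ((\<kappa> + 1) / 6)) * E2_fps"
  define Q where "Q = fps_const (\<kappa> * (\<kappa> + 2) / 144) * E2_fps ^ 2 - fps_const (\<kappa> / 12) * theta_fps E2_fps - fps_const a * E4_fps"
  have \<kappa>: "\<kappa> = 6 * (r + s) - 1" unfolding rs by (simp add: \<kappa>_def field_simps)
  have P0: "fps_nth P 0 = - (r + s)"
  proof -
    have *: "(\<kappa> + 1) / 6 = r + s" unfolding rs \<kappa>_def ..
    show ?thesis unfolding P_def * by (simp add: E_fps_nth)
  qed
  have Q0: "fps_nth Q 0 = r * s"
    by (simp add: Q_def E_fps_nth power2_eq_square a_def \<kappa>) (simp add: field_simps)
  \<comment> \<open>The indicial polynomial is \<open>(X - r)(X - s)\<close>. It vanishes at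
    \<open>r + n\<close> with \<open>n \<ge> 1\<close> only if \<open>s - r = n\<close>, which
    \<open>nonint\<close> excludes.\<close>
  have I: "(r + x)\<^sup>2 + (r + x) * fps_nth P 0 + fps_nth Q 0 = x * (x + (r - s))" for x
    unfolding P0 Q0 by (simp add: power2_eq_square algebra_simps)
  have P: "disc_fps P" by (auto simp: P_def)
  have Q: "disc_fps Q" unfolding Q_def by (intro disc_fps_arith disc_fps_power disc_theta_fps disc_E_fps disc_fps_const)
  obtain f where f: "disc_fps f" "fps_nth f 0 = 1"
    "shift_theta r (shift_theta r f) + shift_theta r f * P + f * Q = 0"
  proof (rule frobenius[OF P Q])
    show "r\<^sup>2 + r * fps_nth P 0 + fps_nth Q 0 = 0" using I[of 0] by simp
    fix n :: nat assume "n \<ge> 1"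
    moreover have "of_nat n + (r - s) \<noteq> 0"
    proof
      assume "of_nat n + (r - s) = 0"
      then have "r - s = - of_nat n" by (simp add: eq_neg_iff_add_eq_0 add.commute)
      then show False using nonint by simp
    qed
    ultimately show "(r + of_nat n)\<^sup>2 + (r + of_nat n) * fps_nth P 0 + fps_nth Q 0 \<noteq> 0" unfolding I by simp
  qed blast
  define g where "g = shift_theta r f - fps_const (of_int k / 12) * E2_fps * f"
  have g: "disc_fps g" unfolding g_def by (intro disc_fps_arith disc_shift_theta disc_E_fps disc_fps_const f)
  have st: "shift_theta r (E2_fps * f) = theta_fps E2_fps * f + E2_fps * shift_theta r f"
    by (simp add: shift_theta_def theta_fps_def algebra_simps)
  have st2: "shift_theta r (x - fps_const c * y) = shift_theta r x - fps_const c * shift_theta r y" for x y c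
    by (rule fps_ext) (simp add: algebra_simps)
  have "shift_theta r g - fps_const (of_int (k + 2) / 12) * E2_fps * g = fps_const a * E4_fps * f"
  proof -
    let ?c = "fps_const (\<kappa> / 12)" and ?d = "fps_const ((\<kappa> + 2) / 12)"
    have 1: "shift_theta r g = shift_theta r (shift_theta r f) - ?c * (theta_fps E2_fps * f + E2_fps * shift_theta r f)"
      unfolding g_def mult.assoc st2 st \<kappa>_def ..
    have cd: "fps_const (- ((\<kappa> + 1) / 6)) = - (?c + ?d)" "fps_const (\<kappa> * (\<kappa> + 2) / 144) = ?c * ?d"
      by (simp_all add: field_simps)
    have P': "P = - (?c + ?d) * E2_fps"
      and Q': "Q = ?c * ?d * E2_fps ^ 2 - ?c * theta_fps E2_fps - fps_const a * E4_fps"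
      unfolding P_def Q_def cd by (rule refl)+
    have g': "g = shift_theta r f - ?c * E2_fps * f" unfolding g_def \<kappa>_def ..
    have 2: "shift_theta r (shift_theta r f) = - (shift_theta r f * P + f * Q)"
      using f(3) unfolding add.assoc by (simp only: eq_neg_iff_add_eq_0)
    have "shift_theta r g - ?d * E2_fps * g =
       - (shift_theta r f * P + f * Q) - ?c * (theta_fps E2_fps * f + E2_fps * shift_theta r f) - ?d * E2_fps * g"
      unfolding 1 2 ..
    also have "\<dots> =
       - (shift_theta r f * (- (?c + ?d) * E2_fps) + f * (?c * ?d * E2_fps ^ 2 - ?c * theta_fps E2_fps - fps_const a * E4_fps))
       - ?c * (theta_fps E2_fps * f + E2_fps * shift_theta r f) - ?d * E2_fps * (shift_theta r f - ?c * E2_fps * f)"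
      unfolding P' Q' g' ..
    also have "\<dots> = fps_const a * E4_fps * f"
    proof -
      have "- (S * (- (c + d) * E) + g * (c * d * E ^ 2 - c * E' - A)) - c * (E' * g + E * S) - d * E * (S - c * E * g) = A * g"
        for c d E E' A S g :: "complex fps"
        by (simp add: algebra_simps power2_eq_square)
      then show ?thesis .
    qed
    finally show ?thesis by (simp add: \<kappa>_def)
  qed
  moreover have "scalar_deriv (k + 2) (scalar_deriv k (\<lambda>z. nome (r * z) * eval_fps f (nome z))) \<tau> =
      nome (r * \<tau>) * eval_fps (shift_theta r g - fps_const (of_int (k + 2) / 12) * E2_fps * g) (nome \<tau>)"
    if "\<tau> \<in> UHP" for \<tau>
    unfolding scalar_deriv_nome_mult(2)[OF g that, symmetric]
    by (rule scalar_deriv_cong[OF that]) (simp add: scalar_deriv_nome_mult(2)[OF f(1)] g_def)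
  ultimately have "scalar_deriv (k + 2) (scalar_deriv k (\<lambda>z. nome (r * z) * eval_fps f (nome z))) \<tau> =
      a * E4 \<tau> * (nome (r * \<tau>) * eval_fps f (nome \<tau>))" if "\<tau> \<in> UHP" for \<tau>
    using norm_nome_less_1[OF that] that f(1)
    by (simp add: eval_disc_fps disc_fps_arith disc_E_fps E4_eq)
  with f(1,2) show thesis unfolding a_def by (rule that)
qed

lemma scalar_deriv_eq_0:
  assumes "f holomorphic_on UHP" "\<And>\<tau>. \<tau> \<in> UHP \<Longrightarrow> scalar_deriv k f \<tau> = 0"
  obtains c where "\<And>\<tau>. \<tau> \<in> UHP \<Longrightarrow> f \<tau> = c * eta_power k \<tau>"
proof -
  define p where "p = (\<lambda>\<tau>. 2 * of_real pi * \<i> * (of_int k / 12 * E2 \<tau>))"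
  have f: "(f has_field_derivative p \<tau> * f \<tau>) (at \<tau>)" if "\<tau> \<in> UHP" for \<tau>
    using holomorphic_UHP_deriv[OF assms(1) that]
    by (rule DERIV_cong) (use assms(2)[OF that] in \<open>simp add: scalar_deriv_def p_def divide_simps mult_ac\<close>)
  have g: "(eta_power k has_field_derivative p \<tau> * eta_power k \<tau>) (at \<tau>)" if "\<tau> \<in> UHP" for \<tau>
    using eta_power_deriv[OF that] by (rule DERIV_cong) (simp add: p_def)
  show thesis
    using first_order_ODE_unique[of f p "eta_power k", OF f g] that by auto
qed

text \<open>The equation has no first-order term, so \<open>D\<close> in weight
  \<open>2 k + 2\<close> kills the Wronskian; the kernel of \<open>D\<close> consists of the
  multiples of a power of eta.\<close>

lemma wronskian:
  assumes f: "f holomorphic_on UHP" "\<And>\<tau>. \<tau> \<in> UHP \<Longrightarrow> scalar_deriv (k + 2) (scalar_deriv k f) \<tau> = a * E4 \<tau> * f \<tau>"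
    and g: "g holomorphic_on UHP" "\<And>\<tau>. \<tau> \<in> UHP \<Longrightarrow> scalar_deriv (k + 2) (scalar_deriv k g) \<tau> = a * E4 \<tau> * g \<tau>"
  obtains c where "\<And>\<tau>. \<tau> \<in> UHP \<Longrightarrow> f \<tau> * scalar_deriv k g \<tau> - scalar_deriv k f \<tau> * g \<tau> = c * eta_power (2 * k + 2) \<tau>"
proof (rule scalar_deriv_eq_0)
  note hol = f(1) g(1) holomorphic_scalar_deriv[OF f(1), of k] holomorphic_scalar_deriv[OF g(1), of k]
  show "(\<lambda>\<tau>. f \<tau> * scalar_deriv k g \<tau> - scalar_deriv k f \<tau> * g \<tau>) holomorphic_on UHP"
    by (intro holomorphic_intros hol)
  fix \<tau> assume \<tau>: "\<tau> \<in> UHP"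
  have 1: "scalar_deriv (k + (k + 2)) (\<lambda>z. f z * scalar_deriv k g z) \<tau> = scalar_deriv k f \<tau> * scalar_deriv k g \<tau> + f \<tau> * (a * E4 \<tau> * g \<tau>)"
    by (subst scalar_deriv_mult) (use hol \<tau> g in auto)
  have 2: "scalar_deriv ((k + 2) + k) (\<lambda>z. scalar_deriv k f z * g z) \<tau> = a * E4 \<tau> * f \<tau> * g \<tau> + scalar_deriv k f \<tau> * scalar_deriv k g \<tau>"
    by (subst scalar_deriv_mult) (use hol \<tau> f in auto)
  have "scalar_deriv (2 * k + 2) (\<lambda>z. \<Sum>j\<in>{0,1::nat}. (if j = 0 then 1 else -1) * (if j = 0 then \<lambda>z. f z * scalar_deriv k g z else (\<lambda>z. scalar_deriv k f z * g z)) z) \<tau> =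
     (\<Sum>j\<in>{0,1::nat}. (if j = 0 then 1 else -1) * scalar_deriv (2 * k + 2) (if j = 0 then \<lambda>z. f z * scalar_deriv k g z else (\<lambda>z. scalar_deriv k f z * g z)) \<tau>)"
    by (rule scalar_deriv_linear) (use \<tau> in \<open>auto intro!: holomorphic_intros hol\<close>)
  moreover have "k + (k + 2) = 2 * k + 2" "(k + 2) + k = 2 * k + 2" by simp_all
  ultimately show "scalar_deriv (2 * k + 2) (\<lambda>\<tau>. f \<tau> * scalar_deriv k g \<tau> - scalar_deriv k f \<tau> * g \<tau>) \<tau> = 0"
    using 1 2 by (simp add: mult_ac)
qed blast

subsection \<open>Irreducible representations of degree two\<close>

definition vec2 :: "'a \<Rightarrow> 'a \<Rightarrow> 'a^2" where
  "vec2 a b = (\<chi> i. if i = 1 then a else b)"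

lemma vec2_nth [simp]: "vec2 a b $ 1 = a" "vec2 a b $ 2 = b"
  by (simp_all add: vec2_def)

lemma vec2_eqI: "v $ 1 = w $ 1 \<Longrightarrow> v $ 2 = w $ 2 \<Longrightarrow> (v :: 'a^2) = w"
  by (simp add: vec_eq_iff forall_2)

lemma mat2_vec2: "mat2 a b c d *v vec2 x y = vec2 (a * x + b * y) (c * x + d * y)"
  for a :: "'a::semiring_1"
  by (rule vec2_eqI) (simp_all add: matrix_vector_mult_nth sum_2)

lemma mat2_eq_iff: "mat2 a b c d = mat2 a' b' c' d' \<longleftrightarrow> a = a' \<and> b = b' \<and> c = c' \<and> d = d'"
  by (metis mat2_nth)

lemma det_mat2: "det (mat2 a b c d) = a * d - b * (c :: complex)"
  by (simp add: det_2)

lemma trace_mat2: "trace (mat2 a b c d) = a + (d :: complex)"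
  by (simp add: trace_def sum_2)

text \<open>Jordan form with a prescribed superdiagonal entry \<open>y\<close>. The later choice
  \<open>y = 1 / (2 \<pi> i)\<close> makes the exponential of \<open>2 \<pi> i L\<close> a block
  whose nonzero entries coincide.\<close>

lemma normal_form_2:
  fixes L :: "complex^2^2"
  assumes "y \<noteq> (0::complex)"
  obtains P r s x where "det P \<noteq> 0" "L ** P = P ** mat2 r x 0 s" "x = 0 \<or> r = s \<and> x = y"
proof -
  obtain a b c d where L: "L = mat2 a b c d" using mat2_cases by blast
  define D where "D = csqrt ((a - d)\<^sup>2 + 4 * b * c)"
  define r s where "r = (a + d + D) / 2" and "s = (a + d - D) / 2"
  have D2: "D * D = (a - d)\<^sup>2 + 4 * b * c"
    using power2_csqrt[of "(a - d)\<^sup>2 + 4 * b * c"] by (simp add: D_def power2_eq_square)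
  have r: "(r - a) * (r - d) = b * c" and s: "(s - a) * (s - d) = b * c"
  proof -
    have "4 * ((r - a) * (r - d)) = D * D - (a - d)\<^sup>2" "4 * ((s - a) * (s - d)) = D * D - (a - d)\<^sup>2"
      by (simp_all add: r_def s_def power2_eq_square field_simps)
    then show "(r - a) * (r - d) = b * c" "(s - a) * (s - d) = b * c" using D2 by simp_all
  qed
  have rs: "r - s = D" "r + s = a + d" by (simp_all add: r_def s_def field_simps)
  consider "b = 0" "c = 0" "a \<noteq> d \<or> True" | "D \<noteq> 0" "b \<noteq> 0" | "D \<noteq> 0" "b = 0" "c \<noteq> 0"
    | "D = 0" "b \<noteq> 0" | "D = 0" "b = 0" "c \<noteq> 0" by blast
  then show thesis
  proof cases
    case 1
    show ?thesis by (rule that[of "mat 1" a 0 d]) (simp_all add: L 1)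
  next
    case 2
    have "b * (r - a) \<noteq> 0 \<or> True" by simp
    show ?thesis
    proof (rule that[of "mat2 b b (r - a) (s - a)" r 0 s])
      have "det (mat2 b b (r - a) (s - a)) = - (b * (r - s))" by (simp add: det_mat2 algebra_simps)
      then show "det (mat2 b b (r - a) (s - a)) \<noteq> 0" using 2 rs by simp
      show "L ** mat2 b b (r - a) (s - a) = mat2 b b (r - a) (s - a) ** mat2 r 0 0 s"
        unfolding L mat2_mult mat2_eq_iff using r s by (simp add: algebra_simps)
    qed simp
  next
    case 3
    show ?thesis
    proof (rule that[of "mat2 (r - d) (s - d) c c" r 0 s])
      have "det (mat2 (r - d) (s - d) c c) = c * (r - s)" by (simp add: det_mat2 algebra_simps)
      then show "det (mat2 (r - d) (s - d) c c) \<noteq> 0" using 3 rs by simp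
      show "L ** mat2 (r - d) (s - d) c c = mat2 (r - d) (s - d) c c ** mat2 r 0 0 s"
        unfolding L mat2_mult mat2_eq_iff using r s by (simp add: algebra_simps)
    qed simp
  next
    case 4
    then have "r = s" "a = r + (r - d)" using rs by (simp_all add: algebra_simps)
    show ?thesis
    proof (rule that[of "mat2 (b / y) 0 ((d - r) / y) 1" r y r])
      show "det (mat2 (b / y) 0 ((d - r) / y) 1) \<noteq> 0" using 4 assms by (simp add: det_mat2)
      have "c * b = (r - a) * (r - d)" using r by simp
      also have "r - a = d - r" using \<open>a = r + (r - d)\<close> by simp
      finally have cb: "c * b = (d - r) * (r - d)" .
      show "L ** mat2 (b / y) 0 ((d - r) / y) 1 = mat2 (b / y) 0 ((d - r) / y) 1 ** mat2 r y 0 r"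
        unfolding L mat2_mult mat2_eq_iff using cb assms
        by (simp add: \<open>a = r + (r - d)\<close> field_simps)
    qed simp
  next
    case 5
    then have "D * D = (a - d)\<^sup>2" using D2 by simp
    then have "a = d" using 5 by simp
    then have "a = r" "d = r" "r = s" using 5 by (simp_all add: r_def s_def)
    show ?thesis
    proof (rule that[of "mat2 0 1 (c / y) 0" r y r])
      show "det (mat2 0 1 (c / y) 0) \<noteq> 0" using 5 assms by (simp add: det_mat2)
      show "L ** mat2 0 1 (c / y) 0 = mat2 0 1 (c / y) 0 ** mat2 r y 0 r"
        unfolding L mat2_mult mat2_eq_iff using \<open>a = r\<close> \<open>d = r\<close> 5 assms by (simp add: field_simps)
    qed simp
  qed
qed

text \<open>A common eigenvector of the two generators spans an invariant line; the indices
  \<open>i \<noteq> j\<close> express that the dimension is at least 2.\<close>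

lemma irreducible_rep_no_eigenvector:
  fixes \<rho> :: "int^2^2 \<Rightarrow> complex^'n^'n"
  assumes irr: "irreducible_rep \<rho>" and v: "v \<noteq> 0" and ij: "(i :: 'n) \<noteq> j"
    and S: "\<rho> S_mat *v v = \<sigma> *s v" and T: "\<rho> T_mat *v v = \<xi> *s v"
  shows False
proof -
  define W where "W = range (\<lambda>c. c *s v)"
  have rep: "\<rho> (\<gamma> ** \<delta>) = \<rho> \<gamma> ** \<rho> \<delta>" if "\<gamma> \<in> SL2Z" "\<delta> \<in> SL2Z" for \<gamma> \<delta>
    using irr that by (simp add: irreducible_rep_def representation_def)
  have "\<exists>c. \<rho> \<gamma> *v v = c *s v" if "\<gamma> \<in> SL2Z" for \<gamma>
    using that
  proof (induction rule: SL2Z_induct)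
    case (mult \<gamma> \<delta>)
    then obtain c d where "\<rho> \<gamma> *v v = c *s v" "\<rho> \<delta> *v v = d *s v" by blast
    then have "\<rho> (\<gamma> ** \<delta>) *v v = (d * c) *s v"
      by (simp add: rep mult matrix_vector_mul_assoc[symmetric] vector_scalar_commute vector_smult_assoc)
    then show ?case by blast
  qed (use S T in auto)
  then have "\<forall>\<gamma>\<in>SL2Z. \<forall>w\<in>W. \<rho> \<gamma> *v w \<in> W"
    by (auto simp: W_def vector_scalar_commute vector_smult_assoc) (metis rangeI vector_smult_assoc)
  moreover have "vec.subspace W"
    unfolding vec.subspace_def W_def
    by (auto simp: image_iff vector_smult_assoc intro: exI[of _ 0]) (metis vector_sadd_rdistrib)+
  ultimately have "W = {0} \<or> W = UNIV" using irr by (simp add: irreducible_rep_def)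
  moreover have "v \<in> W" unfolding W_def by (rule range_eqI[of _ _ 1]) simp
  ultimately have "W = UNIV" using v by auto
  then obtain c d where "axis i 1 = c *s v" "axis j 1 = d *s v" unfolding W_def by (metis UNIV_I imageE)
  then have "axis i 1 $ i = (c *s v) $ i" "axis i 1 $ j = (c *s v) $ j" "axis j 1 $ j = (d *s v) $ j"
    by simp_all
  then have "c * v $ i = 1" "c * v $ j = 0" "d * v $ j = 1"
    using ij by (simp_all add: axis_def)
  then show False by auto
qed

lemma representation_relations:
  assumes "representation \<rho>"
  shows "\<rho> S_mat ** \<rho> S_mat ** (\<rho> S_mat ** \<rho> S_mat) = mat 1"
    "\<rho> S_mat ** \<rho> T_mat ** (\<rho> S_mat ** \<rho> T_mat) ** (\<rho> S_mat ** \<rho> T_mat) = \<rho> S_mat ** \<rho> S_mat"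
proof -
  have rep: "\<rho> \<gamma> ** \<rho> \<delta> = \<rho> (\<gamma> ** \<delta>)" if "\<gamma> \<in> SL2Z" "\<delta> \<in> SL2Z" for \<gamma> \<delta>
    using assms that by (simp add: representation_def)
  have "invertible (\<rho> (mat 1))" using assms by (simp add: representation_def)
  then obtain B where B: "B ** \<rho> (mat 1) = mat 1" by (auto simp: invertible_def)
  have "\<rho> (mat 1) ** \<rho> (mat 1) = \<rho> (mat 1)"
    using rep[OF mat1_in_SL2Z mat1_in_SL2Z] by simp
  from arg_cong[OF this, of "\<lambda>M. B ** M"] have one: "\<rho> (mat 1) = mat 1"
    by (simp add: matrix_mul_assoc B)
  have "S_mat ** S_mat ** (S_mat ** S_mat) = mat 1"
    by (rule mat2_eqI) (simp_all add: mat2_mult_nth mat_def)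
  then show "\<rho> S_mat ** \<rho> S_mat ** (\<rho> S_mat ** \<rho> S_mat) = mat 1" by (simp add: rep one)
  have "S_mat ** T_mat ** (S_mat ** T_mat) ** (S_mat ** T_mat) = S_mat ** S_mat"
    by (rule mat2_eqI) (simp_all add: mat2_mult_nth)
  then show "\<rho> S_mat ** \<rho> T_mat ** (\<rho> S_mat ** \<rho> T_mat) ** (\<rho> S_mat ** \<rho> T_mat) = \<rho> S_mat ** \<rho> S_mat"
    by (simp add: rep)
qed

text \<open>A case of Schur's lemma. \<open>N = \<rho>(S)^2\<close> commutes with
  \<open>\<rho>(S)\<close> and, being the cube of \<open>\<rho>(S T)\<close>, also with that matrix,
  hence with the whole image. As \<open>N^2 = 1\<close>, the invariant space of fixed vectors of
  \<open>N\<close> is everything, or it is zero and \<open>N = -1\<close>.\<close>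

lemma irreducible_rep_center:
  fixes \<rho> :: "int^2^2 \<Rightarrow> complex^'n^'n"
  assumes irr: "irreducible_rep \<rho>"
  obtains \<epsilon> where "\<rho> S_mat ** \<rho> S_mat = mat \<epsilon>" "\<epsilon> * \<epsilon> = 1"
proof -
  have repr: "representation \<rho>" using irr by (simp add: irreducible_rep_def)
  define N where "N = \<rho> S_mat ** \<rho> S_mat"
  note rel = representation_relations[OF repr]
  have NN: "N ** N = mat 1" using rel(1) by (simp add: N_def)
  have NS: "N ** \<rho> S_mat = \<rho> S_mat ** N" by (simp add: N_def matrix_mul_assoc)
  have N3: "N = \<rho> S_mat ** \<rho> T_mat ** (\<rho> S_mat ** \<rho> T_mat) ** (\<rho> S_mat ** \<rho> T_mat)"
    using rel(2) by (simp add: N_def)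
  have "N ** (\<rho> S_mat ** \<rho> T_mat) = (\<rho> S_mat ** \<rho> T_mat) ** N"
    unfolding N3 by (simp only: matrix_mul_assoc)
  then have "\<rho> S_mat ** (N ** \<rho> T_mat) = \<rho> S_mat ** (\<rho> T_mat ** N)"
    by (simp add: matrix_mul_assoc NS)
  note eq = arg_cong[OF this, of "\<lambda>M. N ** \<rho> S_mat ** M"]
  have NT: "N ** \<rho> T_mat = \<rho> T_mat ** N"
  proof -
    have "N ** \<rho> S_mat ** (\<rho> S_mat ** M) = M" for M :: "complex^'n^'n"
      using NN by (simp add: matrix_mul_assoc) (simp add: N_def matrix_mul_assoc)
    then show ?thesis using eq by simp
  qed
  have comm: "N ** \<rho> \<gamma> = \<rho> \<gamma> ** N" if "\<gamma> \<in> SL2Z" for \<gamma>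
    using that
  proof (induction rule: SL2Z_induct)
    case (mult \<gamma> \<delta>)
    have "\<rho> (\<gamma> ** \<delta>) = \<rho> \<gamma> ** \<rho> \<delta>" using repr mult(1,2) by (simp add: representation_def)
    then show ?case using mult(3,4) by (metis matrix_mul_assoc)
  qed (use NS NT in auto)
  define W where "W = {w. N *v w = w}"
  have "vec.subspace W"
    by (auto simp: vec.subspace_def W_def matrix_vector_right_distrib vector_scalar_commute)
  moreover have "\<forall>\<gamma>\<in>SL2Z. \<forall>w\<in>W. \<rho> \<gamma> *v w \<in> W"
    using comm by (auto simp: W_def matrix_vector_mul_assoc) (metis matrix_vector_mul_assoc)
  ultimately consider "W = {0}" | "W = UNIV" using irr by (auto simp: irreducible_rep_def)
  then show thesis
  proof cases
    case 1
    have "N *v w = mat (-1) *v w" for w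
    proof -
      have "N *v (N *v w + w) = N *v w + w"
        by (simp add: matrix_vector_right_distrib matrix_vector_mul_assoc NN add.commute)
      then have "N *v w + w = 0" using 1 by (auto simp: W_def)
      then have "N *v w = - w" by (simp add: eq_neg_iff_add_eq_0)
      also have "- w = mat (-1) *v w" by (simp add: vec_eq_iff matrix_vector_mult_nth mat_def if_distrib[where f = "\<lambda>z. z * _"] cong: if_cong)
      finally show ?thesis .
    qed
    then have "N = mat (-1)" by (simp add: matrix_eq)
    then show ?thesis using that[of "-1"] by (simp add: N_def)
  next
    case 2
    then have "N = mat 1" by (auto simp: matrix_eq W_def)
    then show ?thesis using that[of 1] by (simp add: N_def)
  qed
qed

text \<open>By Cayley-Hamilton, \<open>R^3 = (t^2 - d) R - t d\<close> with trace \<open>t\<close>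
  and determinant \<open>d\<close>. The nonzero off-diagonal entry forces \<open>t^2 = d\<close>,
  and then \<open>- t d = \<epsilon>\<close>.\<close>

lemma cube_root_of_scalar_2:
  fixes A B C D \<epsilon> :: complex
  assumes "mat2 A B C D ** mat2 A B C D ** mat2 A B C D = mat \<epsilon>" "C \<noteq> 0"
  shows "(A + D)\<^sup>2 = A * D - B * C" "(A + D) * (A * D - B * C) = - \<epsilon>"
proof -
  have "C * ((A + D)\<^sup>2 - (A * D - B * C)) = 0" and 11: "A ^ 3 + 2 * (A * B * C) + B * C * D = \<epsilon>"
    using assms(1) unfolding mat2_mult mat_eq_mat2 mat2_eq_iff
    by (simp_all add: algebra_simps power2_eq_square power3_eq_cube)
  then show *: "(A + D)\<^sup>2 = A * D - B * C" using assms(2) by simp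
  have "A ^ 3 + 2 * (A * B * C) + B * C * D + (A + D) * (A * D - B * C) = A * ((A + D)\<^sup>2 - (A * D - B * C))"
    by (simp add: algebra_simps power2_eq_square power3_eq_cube)
  also have "\<dots> = 0" using * by simp
  finally have "\<epsilon> + (A + D) * (A * D - B * C) = 0" unfolding 11 .
  then show "(A + D) * (A * D - B * C) = - \<epsilon>" by (simp add: eq_neg_iff_add_eq_0 add.commute)
qed

lemma similar_trace_det:
  fixes A B M :: "complex^'n^'n"
  assumes "A ** M = M ** B" "det M \<noteq> 0"
  shows "trace A = trace B" "det A = det B"
proof -
  from assms(2) obtain N where N: "M ** N = mat 1" "N ** M = mat 1"
    using invertible_det_nz[of M] unfolding invertible_def by blast
  have "A = M ** B ** N" unfolding assms(1)[symmetric] matrix_mul_assoc[symmetric] N by simp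
  moreover have "trace (M ** B ** N) = trace (N ** (M ** B))" by (rule trace_mul_sym)
  ultimately show "trace A = trace B" by (simp add: matrix_mul_assoc N)
  show "det A = det B" using arg_cong[OF assms(1), of det] assms(2) by (simp add: det_mul)
qed

text \<open>The relations \<open>S\<^sup>4 = 1\<close> and \<open>(S T)\<^sup>3 = S\<^sup>2\<close> force the trace of \<open>\<rho> (S T)\<close> to be \<open>1 / det (\<rho> T)\<close>.\<close>

lemma irreducible_rep_2_data:
  fixes \<rho> :: "int^2^2 \<Rightarrow> complex^2^2"
  assumes irr: "irreducible_rep \<rho>" and P: "det P \<noteq> 0"
    and T: "\<rho> T_mat ** P = P ** mat2 \<xi> \<nu> 0 \<mu>"
  obtains x y z \<epsilon> where "\<rho> S_mat ** P = P ** mat2 x y z (-x)" "z \<noteq> 0" "\<nu> = 0 \<Longrightarrow> y \<noteq> 0"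
    "x\<^sup>2 + y * z = \<epsilon>" "\<epsilon>\<^sup>2 = 1" "(\<xi> * \<mu>) ^ 3 = - \<epsilon>"
    "x * \<xi> + (z * \<nu> - x * \<mu>) = 1 / (\<xi> * \<mu>)" "\<xi> * \<mu> \<noteq> 0"
proof -
  have repr: "representation \<rho>" using irr by (simp add: irreducible_rep_def)
  obtain N where N: "P ** N = mat 1" "N ** P = mat 1"
    using P invertible_det_nz[of P] unfolding invertible_def by blast
  obtain x y z w where S1: "N ** \<rho> S_mat ** P = mat2 x y z w" using mat2_cases by blast
  have S: "\<rho> S_mat ** P = P ** mat2 x y z w"
    unfolding S1[symmetric] by (simp add: matrix_mul_assoc N)
  obtain \<epsilon> where \<epsilon>: "\<rho> S_mat ** \<rho> S_mat = mat \<epsilon>" "\<epsilon> * \<epsilon> = 1" by (rule irreducible_rep_center[OF irr])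
  have conj: "A ** B ** P = P ** (A' ** B')" if "A ** P = P ** A'" "B ** P = P ** B'" for A B A' B' :: "complex^2^2"
    by (metis that matrix_mul_assoc)
  have cancel: "A = B" if "P ** A = P ** B" for A B :: "complex^2^2"
    using arg_cong[OF that, of "\<lambda>M. N ** M"] by (simp add: matrix_mul_assoc N)
  have scalar: "mat \<epsilon> ** P = P ** mat \<epsilon>"
    by (simp add: vec_eq_iff matrix_mult_nth mat_def if_distrib[where f = "\<lambda>z. z * _"] if_distrib[where f = "\<lambda>z. _ * z"] mult.commute cong: if_cong)
  have SS: "mat2 x y z w ** mat2 x y z w = mat \<epsilon>"
    using conj[OF S S] scalar unfolding \<epsilon> by (metis cancel)
  have col1: "P *v vec2 1 0 \<noteq> 0" "P *v vec2 0 1 \<noteq> 0"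
  proof -
    have "v = 0" if "P *v v = 0" for v using det_nonzero_mult_cancel[OF P, of v 0] that by simp
    then show "P *v vec2 1 0 \<noteq> 0" "P *v vec2 0 1 \<noteq> 0"
      by (metis vec2_nth(1) vec2_nth(2) zero_index zero_neq_one)+
  qed
  \<comment> \<open>If \<open>z = 0\<close>, the first column of \<open>P\<close> is a common
    eigenvector of \<open>\<rho>(S)\<close> and \<open>\<rho>(T)\<close>.\<close>
  have z: "z \<noteq> 0"
  proof
    assume "z = 0"
    have "\<rho> S_mat *v (P *v vec2 1 0) = x *s (P *v vec2 1 0)" "\<rho> T_mat *v (P *v vec2 1 0) = \<xi> *s (P *v vec2 1 0)"
    proof -
      have "mat2 x y z w *v vec2 1 0 = x *s vec2 1 0" "mat2 \<xi> \<nu> 0 \<mu> *v vec2 1 0 = \<xi> *s vec2 1 0"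
        unfolding mat2_vec2 \<open>z = 0\<close> by (rule vec2_eqI, simp, simp)+
      then show "\<rho> S_mat *v (P *v vec2 1 0) = x *s (P *v vec2 1 0)" "\<rho> T_mat *v (P *v vec2 1 0) = \<xi> *s (P *v vec2 1 0)"
        by (simp_all add: matrix_vector_mul_assoc S T) (simp_all add: matrix_vector_mul_assoc[symmetric] vector_scalar_commute)
    qed
    from irreducible_rep_no_eigenvector[OF irr col1(1) _ this, of 1 2] show False by simp
  qed
  \<comment> \<open>When \<open>\<nu> = 0\<close> the same argument applies to the second
    column.\<close>
  have y: "y \<noteq> 0" if "\<nu> = 0"
  proof
    assume "y = 0"
    have "\<rho> S_mat *v (P *v vec2 0 1) = w *s (P *v vec2 0 1)" "\<rho> T_mat *v (P *v vec2 0 1) = \<mu> *s (P *v vec2 0 1)"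
    proof -
      have "mat2 x y z w *v vec2 0 1 = w *s vec2 0 1" "mat2 \<xi> \<nu> 0 \<mu> *v vec2 0 1 = \<mu> *s vec2 0 1"
        unfolding mat2_vec2 \<open>y = 0\<close> \<open>\<nu> = 0\<close> by (rule vec2_eqI, simp, simp)+
      then show "\<rho> S_mat *v (P *v vec2 0 1) = w *s (P *v vec2 0 1)" "\<rho> T_mat *v (P *v vec2 0 1) = \<mu> *s (P *v vec2 0 1)"
        by (simp_all add: matrix_vector_mul_assoc S T) (simp_all add: matrix_vector_mul_assoc[symmetric] vector_scalar_commute)
    qed
    from irreducible_rep_no_eigenvector[OF irr col1(2) _ this, of 1 2] show False by simp
  qed
  have "z * (x + w) = 0" and sq: "x\<^sup>2 + y * z = \<epsilon>"
    using SS unfolding mat2_mult mat_eq_mat2 mat2_eq_iff by (simp_all add: algebra_simps power2_eq_square)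
  \<comment> \<open>The off-diagonal entry \<open>z (x + w)\<close> of the square vanishes because
    the square is scalar.\<close>
  then have w: "w = - x" using z by (simp add: eq_neg_iff_add_eq_0 add.commute)
  have ST: "\<rho> S_mat ** \<rho> T_mat ** P = P ** (mat2 x y z w ** mat2 \<xi> \<nu> 0 \<mu>)" by (rule conj[OF S T])
  have cube: "mat2 x y z w ** mat2 \<xi> \<nu> 0 \<mu> ** (mat2 x y z w ** mat2 \<xi> \<nu> 0 \<mu>) ** (mat2 x y z w ** mat2 \<xi> \<nu> 0 \<mu>) = mat \<epsilon>"
    using conj[OF conj[OF ST ST] ST] scalar unfolding representation_relations(2)[OF repr] \<epsilon>(1) by (metis cancel)
  have R: "mat2 (x * \<xi>) (x * \<nu> + y * \<mu>) (z * \<xi>) (z * \<nu> - x * \<mu>) ** mat2 (x * \<xi>) (x * \<nu> + y * \<mu>) (z * \<xi>) (z * \<nu> - x * \<mu>)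
     ** mat2 (x * \<xi>) (x * \<nu> + y * \<mu>) (z * \<xi>) (z * \<nu> - x * \<mu>) = mat \<epsilon>"
  proof -
    have "mat2 x y z (-x) ** mat2 \<xi> \<nu> 0 \<mu> = mat2 (x * \<xi>) (x * \<nu> + y * \<mu>) (z * \<xi>) (z * \<nu> - x * \<mu>)"
      by (simp add: mat2_mult)
    with cube show ?thesis unfolding w by simp
  qed
  have "invertible (\<rho> T_mat)" using repr by (simp add: representation_def)
  then have "det (\<rho> T_mat) \<noteq> 0" by (simp add: invertible_det_nz)
  moreover have "det (\<rho> T_mat) = \<xi> * \<mu>" using similar_trace_det(2)[OF T P] by (simp add: det_mat2)
  ultimately have \<xi>\<mu>: "\<xi> * \<mu> \<noteq> 0" by simp
  then have "z * \<xi> \<noteq> 0" using z by auto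
  note c = cube_root_of_scalar_2[OF R this]
  have d: "x * \<xi> * (z * \<nu> - x * \<mu>) - (x * \<nu> + y * \<mu>) * (z * \<xi>) = - \<epsilon> * (\<xi> * \<mu>)"
    unfolding sq[symmetric] by (simp add: algebra_simps power2_eq_square)
  define p where "p = x * \<xi> + (z * \<nu> - x * \<mu>)"
  have \<epsilon>0: "\<epsilon> \<noteq> 0" using \<epsilon>(2) by auto
  \<comment> \<open>\<open>p\<close> is the trace and \<open>- \<epsilon> \<xi> \<mu>\<close> the
    determinant of \<open>\<rho>(S T)\<close>, whose cube is the scalar
    \<open>\<epsilon>\<close>.\<close>
  have "p * (- \<epsilon> * (\<xi> * \<mu>)) = - \<epsilon>" and p2: "p\<^sup>2 = - \<epsilon> * (\<xi> * \<mu>)" using c unfolding d p_def by simp_all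
  then have p: "p = 1 / (\<xi> * \<mu>)" using \<xi>\<mu> \<epsilon>0 by (simp add: field_simps)
  have "(\<xi> * \<mu>) ^ 3 * \<epsilon> = -1"
  proof -
    have "1 = (\<xi> * \<mu>)\<^sup>2 * p\<^sup>2" unfolding p using \<xi>\<mu> by (simp add: power_divide)
    also have "\<dots> = - ((\<xi> * \<mu>) ^ 3 * \<epsilon>)" unfolding p2 by (simp add: power2_eq_square power3_eq_cube mult_ac)
    finally show ?thesis by (metis minus_minus)
  qed
  then have "(\<xi> * \<mu>) ^ 3 * (\<epsilon> * \<epsilon>) = - \<epsilon>" by (simp add: mult.assoc[symmetric])
  then have "(\<xi> * \<mu>) ^ 3 = - \<epsilon>" using \<epsilon>(2) by simp
  moreover have "\<epsilon>\<^sup>2 = 1" using \<epsilon>(2) by (simp add: power2_eq_square)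
  ultimately show thesis
    using that[of x y z \<epsilon>] S z y sq p \<xi>\<mu> unfolding p_def w by blast
qed

subsection \<open>Modular derivatives of vector-valued functions\<close>

definition vector_deriv :: "int \<Rightarrow> (complex \<Rightarrow> complex^'n) \<Rightarrow> complex \<Rightarrow> complex^'n" where
  "vector_deriv k F \<tau> = (\<chi> i. scalar_deriv k (\<lambda>z. F z $ i) \<tau>)"

lemma vector_deriv_nth [simp]: "vector_deriv k F \<tau> $ i = scalar_deriv k (\<lambda>z. F z $ i) \<tau>"
  by (simp add: vector_deriv_def)

lemma modular_deriv_eq: "modular_deriv k F = on_UHP (vector_deriv k F)"
  by (auto simp: modular_deriv_def on_UHP_def vec_eq_iff scalar_deriv_def fun_eq_iff)

lemma vector_deriv_cong:
  assumes "\<tau> \<in> UHP" "\<And>z. z \<in> UHP \<Longrightarrow> F z = G z"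
  shows "vector_deriv k F \<tau> = vector_deriv k G \<tau>"
  unfolding vec_eq_iff vector_deriv_nth by (intro allI scalar_deriv_cong assms) (simp add: assms)

lemma vector_deriv_mult:
  assumes "\<And>j. (\<lambda>z. F z $ j) holomorphic_on UHP" "\<tau> \<in> UHP"
  shows "vector_deriv k (\<lambda>z. M *v F z) \<tau> = M *v vector_deriv k F \<tau>"
  using scalar_deriv_linear[of UNIV "\<lambda>j z. F z $ j" \<tau> k] assms
  by (simp add: vec_eq_iff matrix_vector_mult_nth)

lemma holomorphic_matrix_vector:
  assumes "\<And>j. (\<lambda>z. F z $ j) holomorphic_on A"
  shows "(\<lambda>z. (M *v F z) $ i) holomorphic_on A"
  unfolding matrix_vector_mult_nth by (intro holomorphic_intros assms)

lemma vector_deriv_T: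
  assumes "\<And>j. (\<lambda>z. F z $ j) holomorphic_on UHP" "\<tau> \<in> UHP" "\<And>z. z \<in> UHP \<Longrightarrow> F (z + 1) = M *v F z"
  shows "vector_deriv k F (\<tau> + 1) = M *v vector_deriv k F \<tau>"
  unfolding vector_deriv_mult[OF assms(1,2), symmetric]
  by (simp add: vec_eq_iff) (intro allI scalar_deriv_T, use assms in auto)

lemma vector_deriv_S:
  assumes "\<And>j. (\<lambda>z. F z $ j) holomorphic_on UHP" "\<tau> \<in> UHP"
    "\<And>z. z \<in> UHP \<Longrightarrow> F (-1/z) = z powi k *s (M *v F z)"
  shows "vector_deriv k F (-1/\<tau>) = \<tau> powi (k + 2) *s (M *v vector_deriv k F \<tau>)"
  unfolding vector_deriv_mult[OF assms(1,2), symmetric] vec_eq_iff vector_smult_component vector_deriv_nth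
  by (intro allI scalar_deriv_S holomorphic_matrix_vector assms) (simp only: assms(3) vector_smult_component)

subsection \<open>Construction of a form of minimal weight\<close>

lemma column_matrix_mult: "column j (A ** B) = A *v column j B"
  by (simp add: vec_eq_iff column_def matrix_mult_nth matrix_vector_mult_nth)

text \<open>The common last step of the diagonalisable and the Jordan case. \<open>F\<close> lives
  in coordinates adapted to \<open>T\<close>, \<open>Q\<close> carries it over to
  \<open>\<alpha>\<close>, and \<open>V\<close> is the twist in the adapted coordinates. The
  hypothesis \<open>nz\<close> is the Wronskian in the variable \<open>q\<close>, up to
  \<open>det Q\<close> the determinant of the fundamental matrix.\<close>

lemma minimal_form_construction:
  fixes L Q T' S' :: "complex^2^2"
  assumes rep: "representation \<alpha>" and Q: "det Q \<noteq> 0"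
    and F: "\<And>j. (\<lambda>z. F z $ j) holomorphic_on UHP"
    and ode: "\<And>\<tau> i. \<tau> \<in> UHP \<Longrightarrow> scalar_deriv (k + 2) (scalar_deriv k (\<lambda>z. F z $ i)) \<tau> = a * E4 \<tau> * F \<tau> $ i"
    and T: "\<alpha> T_mat ** Q = Q ** T'" "\<And>\<tau>. \<tau> \<in> UHP \<Longrightarrow> F (\<tau> + 1) = T' *v F \<tau>"
    and S: "\<alpha> S_mat ** Q = Q ** S'" "\<And>\<tau>. \<tau> \<in> UHP \<Longrightarrow> F (-1/\<tau>) = \<tau> powi k *s (S' *v F \<tau>)"
    and V: "\<And>\<tau>. twist L \<tau> ** Q = Q ** V \<tau>"
      "\<And>\<tau>. \<tau> \<in> UHP \<Longrightarrow> V \<tau> *v F \<tau> = vec2 (\<phi>1 (nome \<tau>)) (\<phi>2 (nome \<tau>))"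
      "\<And>\<tau>. \<tau> \<in> UHP \<Longrightarrow> V \<tau> *v vector_deriv k F \<tau> = vec2 (\<psi>1 (nome \<tau>)) (\<psi>2 (nome \<tau>))"
    and hol: "\<phi>1 holomorphic_on ball 0 1" "\<phi>2 holomorphic_on ball 0 1" "\<psi>1 holomorphic_on ball 0 1" "\<psi>2 holomorphic_on ball 0 1"
    and nz: "\<And>q. q \<in> ball 0 1 \<Longrightarrow> \<phi>1 q * \<psi>2 q - \<psi>1 q * \<phi>2 q \<noteq> 0"
  obtains A where "A \<in> modular_forms \<alpha> L k"
    "\<And>\<tau>. \<tau> \<in> UHP \<Longrightarrow> vector_deriv (k + 2) (vector_deriv k A) \<tau> = (a * E4 \<tau>) *s A \<tau>"
    "free_basis \<alpha> L (\<lambda>j. if j = 1 then k else k + 2) (\<lambda>j. if j = 1 then A else modular_deriv k A)"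
proof -
  define A where "A = on_UHP (\<lambda>\<tau>. Q *v F \<tau>)"
  have A: "A \<tau> = Q *v F \<tau>" if "\<tau> \<in> UHP" for \<tau> using that by (simp add: A_def on_UHP_def)
  have DF: "(\<lambda>z. vector_deriv k F z $ j) holomorphic_on UHP" for j
    by (simp add: holomorphic_scalar_deriv F)
  have DA: "vector_deriv k A \<tau> = Q *v vector_deriv k F \<tau>" if "\<tau> \<in> UHP" for \<tau>
    by (rule trans[OF vector_deriv_cong[OF that A] vector_deriv_mult[OF F that]])
  have mf: "on_UHP (\<lambda>\<tau>. Q *v G \<tau>) \<in> modular_forms \<alpha> L w"
    if G: "\<And>j. (\<lambda>z. G z $ j) holomorphic_on UHP" "\<And>\<tau>. \<tau> \<in> UHP \<Longrightarrow> G (\<tau> + 1) = T' *v G \<tau>"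
      "\<And>\<tau>. \<tau> \<in> UHP \<Longrightarrow> G (-1/\<tau>) = \<tau> powi w *s (S' *v G \<tau>)"
      "\<And>\<tau>. \<tau> \<in> UHP \<Longrightarrow> V \<tau> *v G \<tau> = vec2 (h1 (nome \<tau>)) (h2 (nome \<tau>))"
      "h1 holomorphic_on ball 0 1" "h2 holomorphic_on ball 0 1" for G w h1 h2
  proof (rule modular_formsI[OF rep, where h = "\<lambda>q. Q *v vec2 (h1 q) (h2 q)"])
    show "(\<lambda>\<tau>. on_UHP (\<lambda>\<tau>. Q *v G \<tau>) \<tau> $ i) holomorphic_on UHP" for i
      using holomorphic_matrix_vector[OF G(1), of Q i] by (simp add: on_UHP_def cong: holomorphic_cong)
    show "on_UHP (\<lambda>\<tau>. Q *v G \<tau>) (\<tau> + 1) = \<alpha> T_mat *v on_UHP (\<lambda>\<tau>. Q *v G \<tau>) \<tau>" if "\<tau> \<in> UHP" for \<tau>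
      using that plus_one_in_UHP[OF that] by (simp add: on_UHP_def G(2) matrix_vector_mul_assoc T(1))
    show "on_UHP (\<lambda>\<tau>. Q *v G \<tau>) (-1/\<tau>) = \<tau> powi w *s (\<alpha> S_mat *v on_UHP (\<lambda>\<tau>. Q *v G \<tau>) \<tau>)" if "\<tau> \<in> UHP" for \<tau>
      unfolding on_UHP_def if_P[OF that] if_P[OF neg_inverse_in_UHP[OF that]] G(3)[OF that]
      by (simp add: matrix_vector_mul_assoc S(1) vector_scalar_commute)
    show "twist L \<tau> *v on_UHP (\<lambda>\<tau>. Q *v G \<tau>) \<tau> = Q *v vec2 (h1 (nome \<tau>)) (h2 (nome \<tau>))" if "\<tau> \<in> UHP" for \<tau>
      unfolding on_UHP_def if_P[OF that] matrix_vector_mul_assoc V(1) G(4)[OF that, symmetric] ..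
    have "(\<lambda>q. vec2 (h1 q) (h2 q) $ j) holomorphic_on ball 0 1" for j
      using G(5,6) exhaust_2[of j] by auto
    then show "(\<lambda>q. (Q *v vec2 (h1 q) (h2 q)) $ i) holomorphic_on ball 0 1" for i
      by (rule holomorphic_matrix_vector)
  qed (simp add: on_UHP_def)
  show thesis
  proof (rule that[of A])
    show A_mf: "A \<in> modular_forms \<alpha> L k"
      unfolding A_def by (rule mf[OF F T(2) S(2) V(2) hol(1,2)])
    show "vector_deriv (k + 2) (vector_deriv k A) \<tau> = (a * E4 \<tau>) *s A \<tau>" if \<tau>: "\<tau> \<in> UHP" for \<tau>
    proof -
      have "vector_deriv (k + 2) (vector_deriv k A) \<tau> = vector_deriv (k + 2) (\<lambda>z. Q *v vector_deriv k F z) \<tau>"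
        by (rule vector_deriv_cong[OF \<tau> DA])
      also have "\<dots> = Q *v vector_deriv (k + 2) (vector_deriv k F) \<tau>" by (rule vector_deriv_mult[OF DF \<tau>])
      also have "vector_deriv (k + 2) (vector_deriv k F) \<tau> = (a * E4 \<tau>) *s F \<tau>"
        using ode[OF \<tau>] by (simp add: vec_eq_iff)
      finally show ?thesis by (simp add: A[OF \<tau>] vector_scalar_commute)
    qed
    have eq: "modular_deriv k A = on_UHP (\<lambda>\<tau>. Q *v vector_deriv k F \<tau>)"
      unfolding modular_deriv_eq by (rule on_UHP_cong[OF DA])
    have DA_mf: "modular_deriv k A \<in> modular_forms \<alpha> L (k + 2)"
    proof -
      have DT: "vector_deriv k F (\<tau> + 1) = T' *v vector_deriv k F \<tau>" if "\<tau> \<in> UHP" for \<tau>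
        by (rule vector_deriv_T[OF F that T(2)])
      have DS: "vector_deriv k F (-1/\<tau>) = \<tau> powi (k + 2) *s (S' *v vector_deriv k F \<tau>)" if "\<tau> \<in> UHP" for \<tau>
        by (rule vector_deriv_S[OF F that S(2)])
      show ?thesis
        unfolding eq by (rule mf[of "vector_deriv k F", OF DF DT DS V(3) hol(3,4)])
    qed
    define \<Phi> where "\<Phi> = (\<lambda>q. Q ** mat2 (\<phi>1 q) (\<psi>1 q) (\<phi>2 q) (\<psi>2 q))"
    show "free_basis \<alpha> L (\<lambda>j. if j = 1 then k else k + 2) (\<lambda>j. if j = 1 then A else modular_deriv k A)"
      unfolding free_basis_def
    proof (intro conjI exI[of _ \<Phi>] allI ballI)
      show "(if j = 1 then A else modular_deriv k A) \<in> modular_forms \<alpha> L (if j = 1 then k else k + 2)" for j :: 2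
        using A_mf DA_mf by simp
      have "(\<lambda>q. mat2 (\<phi>1 q) (\<psi>1 q) (\<phi>2 q) (\<psi>2 q) $ i $ j) holomorphic_on ball 0 1" for i j
        using hol exhaust_2[of i] exhaust_2[of j] by auto
      then show "(\<lambda>q. \<Phi> q $ i $ j) holomorphic_on ball 0 1" for i j
        unfolding \<Phi>_def matrix_mult_nth by (intro holomorphic_intros)
      show "det (\<Phi> q) \<noteq> 0" if "q \<in> ball 0 1" for q
        using Q nz[OF that] by (simp add: \<Phi>_def det_mul det_mat2)
      fix \<tau> and j :: 2 assume \<tau>: "\<tau> \<in> UHP"
      have "column 1 (mat2 a b c d) = vec2 a c" "column 2 (mat2 a b c d) = vec2 b d" for a b c d :: complex
        by (rule vec2_eqI; simp add: column_def)+
      then show "twist L \<tau> *v (if j = 1 then A else modular_deriv k A) \<tau> = column j (\<Phi> (nome \<tau>))"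
        using exhaust_2[of j] \<tau>
        by (auto simp: \<Phi>_def column_matrix_mult V(2,3)[symmetric] A eq on_UHP_def matrix_vector_mul_assoc V(1))
    qed
  qed
qed

text \<open>Used at elliptic points with a vector of solutions and its modular derivative; these are
  independent because the Wronskian does not vanish.\<close>

lemma eigenvectors_trace_det_2:
  fixes R :: "complex^2^2"
  assumes "R *v F = a *s F" "R *v G = b *s G" "F $ 1 * G $ 2 - G $ 1 * F $ 2 \<noteq> 0"
  shows "trace R = a + b" "det R = a * b"
proof -
  have F: "R$1$1 * F$1 + R$1$2 * F$2 = a * F$1" "R$2$1 * F$1 + R$2$2 * F$2 = a * F$2"
    using arg_cong[OF assms(1), of "\<lambda>v. v $ 1"] arg_cong[OF assms(1), of "\<lambda>v. v $ 2"]
    by (simp_all add: matrix_vector_mult_nth sum_2)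
  have G: "R$1$1 * G$1 + R$1$2 * G$2 = b * G$1" "R$2$1 * G$1 + R$2$2 * G$2 = b * G$2"
    using arg_cong[OF assms(2), of "\<lambda>v. v $ 1"] arg_cong[OF assms(2), of "\<lambda>v. v $ 2"]
    by (simp_all add: matrix_vector_mult_nth sum_2)
  have "R ** mat2 (F$1) (G$1) (F$2) (G$2) = mat2 (F$1) (G$1) (F$2) (G$2) ** mat2 a 0 0 b"
    by (rule mat2_eqI) (simp_all add: mat2_mult_nth F G)
  from similar_trace_det[OF this] assms(3) show "trace R = a + b" "det R = a * b"
    by (simp_all add: det_mat2 trace_mat2)
qed

lemma exp_2pi_eq_1_iff: "exp (2 * of_real pi * \<i> * w) = 1 \<longleftrightarrow> w \<in> \<int>"
proof
  assume "exp (2 * of_real pi * \<i> * w) = 1"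
  then obtain n :: int where "Im w = 0" "Re w = of_int n" by (auto simp: exp_eq_1)
  then have "w = of_int n" by (simp add: complex_eq_iff)
  then show "w \<in> \<int>" by simp
next
  assume "w \<in> \<int>"
  then obtain n where "w = of_int n" by (auto elim: Ints_cases)
  then show "exp (2 * of_real pi * \<i> * w) = 1" using nome_plus_of_int[of 0 n] by (simp add: nome_def)
qed

lemma nome_add: "nome (a + b) = nome a * nome b"
  by (simp add: nome_def exp_add[symmetric] algebra_simps)

lemma nome_0 [simp]: "nome 0 = 1"
  by (simp add: nome_def)

text \<open>The factors \<open>q^r\<close> and \<open>q^s\<close> combine to the fractional power of
  \<open>q\<close> in \<open>eta_power (2 k + 2)\<close>, because
  \<open>r + s = (2 k + 2) / 12\<close>. What remains is a constant times an exponential on the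
  whole disc, and \<open>q = 0\<close> shows the constant to be \<open>s - r\<close>.\<close>

lemma wronskian_nonzero:
  assumes rs: "r + s = (of_int k + 1) / 6" "r \<noteq> s"
    and f: "disc_fps f" "fps_nth f 0 = 1" "disc_fps g" "fps_nth g 0 = 1"
    and odef: "\<And>\<tau>. \<tau> \<in> UHP \<Longrightarrow> scalar_deriv (k + 2) (scalar_deriv k (\<lambda>z. nome (r * z) * eval_fps f (nome z))) \<tau> =
       a * E4 \<tau> * (nome (r * \<tau>) * eval_fps f (nome \<tau>))"
    and odeg: "\<And>\<tau>. \<tau> \<in> UHP \<Longrightarrow> scalar_deriv (k + 2) (scalar_deriv k (\<lambda>z. nome (s * z) * eval_fps g (nome z))) \<tau> =
       a * E4 \<tau> * (nome (s * \<tau>) * eval_fps g (nome \<tau>))"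
    and q: "q \<in> ball 0 1"
  defines "\<psi> \<equiv> shift_theta r f - fps_const (of_int k / 12) * E2_fps * f"
    and "\<omega> \<equiv> shift_theta s g - fps_const (of_int k / 12) * E2_fps * g"
  shows "eval_fps f q * eval_fps \<omega> q - eval_fps \<psi> q * eval_fps g q \<noteq> 0"
proof -
  let ?f = "\<lambda>z. nome (r * z) * eval_fps f (nome z)" and ?g = "\<lambda>z. nome (s * z) * eval_fps g (nome z)"
  have hol: "?f holomorphic_on UHP" "?g holomorphic_on UHP"
    by (intro holomorphic_intros holomorphic_eval_fps_nome f)+
  have disc: "disc_fps \<psi>" "disc_fps \<omega>"
    unfolding \<psi>_def \<omega>_def by (intro disc_fps_arith disc_shift_theta disc_E_fps disc_fps_const f)+
  obtain c where c: "\<And>\<tau>. \<tau> \<in> UHP \<Longrightarrow> ?f \<tau> * scalar_deriv k ?g \<tau> - scalar_deriv k ?f \<tau> * ?g \<tau> = c * eta_power (2 * k + 2) \<tau>"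
    using wronskian[OF hol(1) odef hol(2) odeg] by blast
  define e where "e = (\<lambda>q. exp (of_int (2 * k + 2) * eval_fps eta_log_fps q))"
  have w: "eval_fps f q * eval_fps \<omega> q - eval_fps \<psi> q * eval_fps g q - c * e q = 0" if "q \<in> ball 0 1" for q
  proof (rule eq_0_on_disc[of "\<lambda>q. eval_fps f q * eval_fps \<omega> q - eval_fps \<psi> q * eval_fps g q - c * e q"])
    show "(\<lambda>q. eval_fps f q * eval_fps \<omega> q - eval_fps \<psi> q * eval_fps g q - c * e q) holomorphic_on ball 0 1"
      unfolding e_def by (intro holomorphic_intros holomorphic_disc_fps f disc disc_eta_log_fps)
    fix q :: complex assume "q \<in> ball 0 1" "q \<noteq> 0"
    then obtain \<tau> where \<tau>: "\<tau> \<in> UHP" "nome \<tau> = q" by (rule nome_surj)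
    have "nome (r * \<tau>) * nome (s * \<tau>) * (eval_fps f q * eval_fps \<omega> q - eval_fps \<psi> q * eval_fps g q) =
        c * (nome (of_int (2 * k + 2) / 12 * \<tau>) * e q)"
      using c[OF \<tau>(1)] unfolding scalar_deriv_nome_mult(2)[OF f(1) \<tau>(1)] scalar_deriv_nome_mult(2)[OF f(3) \<tau>(1)]
        \<psi>_def[symmetric] \<omega>_def[symmetric] eta_power_def e_def \<tau>(2) by (simp add: algebra_simps)
    moreover have "nome (r * \<tau>) * nome (s * \<tau>) = nome (of_int (2 * k + 2) / 12 * \<tau>)"
    proof -
      have "(of_int k + 1) / 6 = (of_int (2 * k + 2) / 12 :: complex)" by simp
      then show ?thesis unfolding nome_add[symmetric] distrib_right[symmetric] rs(1) by (simp only:)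
    qed
    ultimately have "nome (r * \<tau>) * nome (s * \<tau>) * (eval_fps f q * eval_fps \<omega> q - eval_fps \<psi> q * eval_fps g q - c * e q) = 0"
      by (simp add: algebra_simps)
    then show "eval_fps f q * eval_fps \<omega> q - eval_fps \<psi> q * eval_fps g q - c * e q = 0" by simp
  qed (rule that)
  have "c = s - r"
    using w[of 0] by (simp add: e_def eval_fps_at_0 f \<psi>_def \<omega>_def E_fps_nth eta_log_fps_def)
  then show ?thesis using w[OF q] rs(2) by (simp add: e_def)
qed

text \<open>The entries of \<open>S'\<close> are quotients of Wronskians, all of which are multiples of one power of \<open>\<eta>\<close>.\<close>

lemma modular_ODE_S:
  assumes f: "\<And>i. (\<lambda>z. F z $ i) holomorphic_on UHP"
    and ode: "\<And>\<tau> i. \<tau> \<in> UHP \<Longrightarrow> scalar_deriv (k + 2) (scalar_deriv k (\<lambda>z. F z $ i)) \<tau> = a * E4 \<tau> * F \<tau> $ i"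
    and W: "\<And>\<tau>. \<tau> \<in> UHP \<Longrightarrow> F \<tau> $ 1 * vector_deriv k F \<tau> $ 2 - vector_deriv k F \<tau> $ 1 * F \<tau> $ 2 \<noteq> 0"
  obtains S' :: "complex^2^2" where "\<And>\<tau>. \<tau> \<in> UHP \<Longrightarrow> F (-1/\<tau>) = \<tau> powi k *s (S' *v F \<tau>)"
proof -
  have comb: "\<exists>x y. \<forall>\<tau>\<in>UHP. F (-1/\<tau>) $ i = \<tau> powi k * (x * F \<tau> $ 1 + y * F \<tau> $ 2)" for i :: 2
  proof -
    \<comment> \<open>The component \<open>i\<close> after inversion in weight \<open>k\<close>. It
      solves the same equation because \<open>E4\<close> is modular, and three Wronskians then
      express it through the components of \<open>F\<close>.\<close>
    define g where "g = (\<lambda>\<tau>. F (-1/\<tau>) $ i / \<tau> powi k)"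
    have g: "F (-1/z) $ i = z powi k * g z" if "z \<in> UHP" for z
      using UHP_nonzero[OF that] by (simp add: g_def)
    have g_hol: "g holomorphic_on UHP"
    proof -
      have "(\<lambda>z. -1/z) holomorphic_on UHP" using UHP_nonzero by (intro holomorphic_intros) auto
      then have "((\<lambda>z. F z $ i) \<circ> (\<lambda>z. -1/z)) holomorphic_on UHP"
        by (rule holomorphic_on_compose_gen[OF _ f]) (use neg_inverse_in_UHP in auto)
      moreover have "(\<lambda>z. z powi k) holomorphic_on UHP"
        using UHP_nonzero by (auto simp: holomorphic_on_def field_differentiable_def intro!: has_field_derivative_powi)
      ultimately show ?thesis
        unfolding g_def using UHP_nonzero by (auto intro!: holomorphic_on_divide simp: o_def)
    qed
    note D = scalar_deriv_S[OF f g_hol _ g]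
    have g_ode: "scalar_deriv (k + 2) (scalar_deriv k g) \<tau> = a * E4 \<tau> * g \<tau>" if \<tau>: "\<tau> \<in> UHP" for \<tau>
    proof -
      have ne: "\<tau> \<noteq> 0" using \<tau> by (rule UHP_nonzero)
      have "\<tau> powi (k + 2 + 2) * scalar_deriv (k + 2) (scalar_deriv k g) \<tau> =
          scalar_deriv (k + 2) (scalar_deriv k (\<lambda>z. F z $ i)) (-1/\<tau>)"
        by (rule scalar_deriv_S[symmetric]) (use f g_hol \<tau> D in \<open>auto intro!: holomorphic_scalar_deriv\<close>)
      also have "\<dots> = a * (\<tau> ^ 4 * E4 \<tau>) * (\<tau> powi k * g \<tau>)"
        unfolding ode[OF neg_inverse_in_UHP[OF \<tau>]] E4_S[OF \<tau>] g[OF \<tau>] ..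
      also have "\<dots> = \<tau> powi (k + 2 + 2) * (a * E4 \<tau> * g \<tau>)"
      proof -
        have "\<tau> powi (k + 2 + 2) = \<tau> powi k * \<tau> ^ 4"
          unfolding powi_Suc(2)[OF ne] by (simp add: power2_eq_square power4_eq_xxxx)
        then show ?thesis by (simp only: mult_ac)
      qed
      finally show ?thesis using ne by simp
    qed
    obtain p where p: "\<And>\<tau>. \<tau> \<in> UHP \<Longrightarrow> g \<tau> * scalar_deriv k (\<lambda>z. F z $ 2) \<tau> - scalar_deriv k g \<tau> * F \<tau> $ 2 = p * eta_power (2 * k + 2) \<tau>"
      using wronskian[OF g_hol g_ode f ode] by blast
    obtain r where r: "\<And>\<tau>. \<tau> \<in> UHP \<Longrightarrow> F \<tau> $ 1 * scalar_deriv k g \<tau> - scalar_deriv k (\<lambda>z. F z $ 1) \<tau> * g \<tau> = r * eta_power (2 * k + 2) \<tau>"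
      using wronskian[OF f ode g_hol g_ode] by blast
    obtain c where c: "\<And>\<tau>. \<tau> \<in> UHP \<Longrightarrow> F \<tau> $ 1 * scalar_deriv k (\<lambda>z. F z $ 2) \<tau> - scalar_deriv k (\<lambda>z. F z $ 1) \<tau> * F \<tau> $ 2 = c * eta_power (2 * k + 2) \<tau>"
      using wronskian[OF f ode f ode] by blast
    have c0: "c \<noteq> 0" using c[of \<i>] W[of \<i>] by (auto simp: UHP_def)
    have "g \<tau> = p / c * F \<tau> $ 1 + r / c * F \<tau> $ 2" if \<tau>: "\<tau> \<in> UHP" for \<tau>
    proof -
      have "g \<tau> * (c * eta_power (2 * k + 2) \<tau>) = F \<tau> $ 1 * (p * eta_power (2 * k + 2) \<tau>) + F \<tau> $ 2 * (r * eta_power (2 * k + 2) \<tau>)"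
        unfolding c[OF \<tau>, symmetric] p[OF \<tau>, symmetric] r[OF \<tau>, symmetric] by (simp add: algebra_simps)
      then have "eta_power (2 * k + 2) \<tau> * (g \<tau> * c) = eta_power (2 * k + 2) \<tau> * (F \<tau> $ 1 * p + F \<tau> $ 2 * r)"
        by (simp add: algebra_simps)
      then have "g \<tau> * c = F \<tau> $ 1 * p + F \<tau> $ 2 * r" by simp
      then show ?thesis using c0 by (simp add: field_simps)
    qed
    then show ?thesis using g by metis
  qed
  from comb[of 1] comb[of 2] obtain x y z w where
    xy: "\<And>\<tau>. \<tau> \<in> UHP \<Longrightarrow> F (-1/\<tau>) $ 1 = \<tau> powi k * (x * F \<tau> $ 1 + y * F \<tau> $ 2)"
      "\<And>\<tau>. \<tau> \<in> UHP \<Longrightarrow> F (-1/\<tau>) $ 2 = \<tau> powi k * (z * F \<tau> $ 1 + w * F \<tau> $ 2)" by metis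
  show thesis
  proof (rule that[of "mat2 x y z w"])
    fix \<tau> assume "\<tau> \<in> UHP"
    then show "F (-1/\<tau>) = \<tau> powi k *s (mat2 x y z w *v F \<tau>)"
      by (intro vec2_eqI) (simp_all only: xy vector_smult_component matrix_vector_mult_nth sum_2 mat2_nth)
  qed
qed

lemma mat_scalar_intertwine:
  fixes X Y P :: "complex^'n^'n"
  assumes "X ** P = P ** Y"
  shows "(mat c ** X) ** P = P ** (mat c ** Y)"
proof -
  have "(mat c ** X) ** P = mat c ** (X ** P)" by (simp only: matrix_mul_assoc)
  also have "\<dots> = P ** (mat c ** Y)"
    unfolding assms vec_eq_iff mat_mult_nth matrix_mult_nth[of P] by (simp add: sum_distrib_left mult_ac)
  finally show ?thesis .
qed

lemma mat_mult_mat2: "mat c ** mat2 a b d e = mat2 (c * a) (c * b) (c * d) (c * (e::complex))"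
  by (simp add: mat_eq_mat2 mat2_mult)

lemma exp_mult_nome: "exp (- (2 * of_real pi * \<i> * \<tau>) * r) = nome (- (r * \<tau>))"
  by (simp add: nome_def mult_ac)

lemma nome_1 [simp]: "nome 1 = 1"
  by (simp add: nome_def)

lemma nome_minus_mult: "nome (- a) * nome a = 1"
  by (simp flip: nome_add)

text \<open>Applied to \<open>w = Tr(L)\<close>, where \<open>nome w\<close> is the determinant of
  \<open>\<rho>(T)\<close>: its sixth power is 1, so \<open>6 w\<close> is an integer, and its cube
  decides the parity.\<close>

lemma minimal_weight_integral:
  assumes "nome w ^ 3 = - \<epsilon>" "\<epsilon>\<^sup>2 = 1"
  obtains k :: int where "of_int k = 6 * w - 1" "\<epsilon> = (-1) powi k"
proof -
  have pow: "nome w ^ n = exp (2 * of_real pi * \<i> * (of_nat n * w))" for n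
    by (simp add: nome_def exp_of_nat_mult[symmetric] mult_ac)
  have "nome w ^ 6 = (nome w ^ 3)\<^sup>2" by (simp flip: power_mult)
  then have "nome w ^ 6 = 1" using assms by simp
  then have "of_nat 6 * w \<in> \<int>" unfolding pow exp_2pi_eq_1_iff .
  then obtain n where n: "6 * w = of_int n" by (auto elim: Ints_cases)
  have "nome w ^ 3 = exp (of_int n * (of_real pi * \<i>))"
    unfolding pow n[symmetric] by (simp add: mult_ac)
  also have "\<dots> = (-1) powi n" by (simp add: exp_power_int[symmetric])
  finally have "(-1) powi n = - \<epsilon>" using assms(1) by simp
  then have "\<epsilon> = (-1) powi (n - 1)" by (simp add: power_int_diff)
  then show thesis using that[of "n - 1"] n by simp
qed

lemma smult_inverse_eq:
  fixes v w :: "complex^'n"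
  assumes "v = c *s w" "c \<noteq> 0"
  shows "w = inverse c *s v"
  using assms by (simp add: vector_smult_assoc)

text \<open>\<open>\<zeta> - 1\<close> is the elliptic point fixed by
  \<open>\<tau> \<mapsto> -1/(\<tau> + 1)\<close>, that is, by \<open>S T\<close>.\<close>

lemma sixth_root_of_unity:
  defines "\<zeta> \<equiv> exp (of_real pi * \<i> / 3)"
  shows "\<zeta> \<noteq> 0" "\<zeta>\<^sup>2 + 1 = \<zeta>" "Im \<zeta> > 0" "\<zeta> - 1 \<in> UHP" "-1/\<zeta> = \<zeta> - 1" "\<zeta> \<in> UHP"
proof -
  show 0: "\<zeta> \<noteq> 0" by (simp add: \<zeta>_def)
  have "\<zeta> ^ 3 = exp (of_nat 3 * (of_real pi * \<i> / 3))" unfolding \<zeta>_def by (rule exp_of_nat_mult[symmetric])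
  then have 3: "\<zeta> ^ 3 = -1" by simp
  have "\<zeta> = cis (pi / 3)" by (simp add: \<zeta>_def cis_conv_exp mult_ac)
  then show Im: "Im \<zeta> > 0" by (simp add: sin_gt_zero)
  have "(\<zeta> + 1) * (\<zeta>\<^sup>2 - \<zeta> + 1) = \<zeta> ^ 3 + 1" by (simp add: power2_eq_square power3_eq_cube algebra_simps)
  moreover have "\<zeta> + 1 \<noteq> 0" using Im by (auto simp: complex_eq_iff)
  ultimately have "\<zeta>\<^sup>2 - \<zeta> + 1 = 0" using 3 by simp
  then show 2: "\<zeta>\<^sup>2 + 1 = \<zeta>" by (simp add: algebra_simps)
  show "\<zeta> - 1 \<in> UHP" "\<zeta> \<in> UHP" using Im by (simp_all add: UHP_def)
  have "\<zeta> * (\<zeta> - 1) = -1" using 2 by (simp add: power2_eq_square algebra_simps)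
  then show "-1/\<zeta> = \<zeta> - 1" using 0 by (simp add: field_simps)
qed

text \<open>Rigidity: equal traces and determinants for \<open>S\<close> and \<open>S T\<close>
  force the matrix \<open>S'\<close> of the solutions and \<open>\<alpha>(S)\<close>, in an
  eigenbasis of \<open>\<alpha>(T)\<close>, to differ by a diagonal conjugation. Such a conjugation
  does not disturb \<open>T\<close>.\<close>

lemma minimal_form_diagonal:
  fixes \<alpha> :: "int^2^2 \<Rightarrow> complex^2^2"
  assumes irr: "irreducible_rep \<alpha>" and P: "det P \<noteq> 0"
    and T: "\<alpha> T_mat ** P = P ** mat2 (nome r) 0 0 (nome s)" and L: "L ** P = P ** mat2 r 0 0 s"
  obtains k A where "of_int k = 6 * (r + s) - 1" "A \<in> modular_forms \<alpha> L k"
    "\<And>\<tau>. \<tau> \<in> UHP \<Longrightarrow> vector_deriv (k + 2) (vector_deriv k A) \<tau> = ((((r - s) / 2)\<^sup>2 - 1/144) * E4 \<tau>) *s A \<tau>"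
    "free_basis \<alpha> L (\<lambda>j. if j = 1 then k else k + 2) (\<lambda>j. if j = 1 then A else modular_deriv k A)"
proof -
  define a where "a = ((r - s) / 2)\<^sup>2 - 1/144"
  obtain x y z \<epsilon> where S: "\<alpha> S_mat ** P = P ** mat2 x y z (-x)" and yz: "z \<noteq> 0" "y \<noteq> 0"
    and sq: "x\<^sup>2 + y * z = \<epsilon>" and \<epsilon>: "\<epsilon>\<^sup>2 = 1" and t3: "(nome r * nome s) ^ 3 = - \<epsilon>"
    and tr: "x * nome r + (z * 0 - x * nome s) = 1 / (nome r * nome s)"
    by (rule irreducible_rep_2_data[OF irr P T]) blast
  obtain k :: int where k: "of_int k = 6 * (r + s) - 1" "\<epsilon> = (-1) powi k"
    by (rule minimal_weight_integral[OF t3[folded nome_add] \<epsilon>]) blast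
  have rs: "r + s = (of_int k + 1) / 6" "s + r = (of_int k + 1) / 6" using k(1) by (simp_all add: add.commute)
  \<comment> \<open>Equal eigenvalues would make the trace of \<open>\<alpha>(S T)\<close> zero,
    whereas it is the inverse of a nonzero number.\<close>
  have nome_neq: "nome r \<noteq> nome s"
  proof
    assume "nome r = nome s"
    then show False using tr by simp
  qed
  have nonint: "r - s \<notin> \<int>" "s - r \<notin> \<int>"
  proof -
    have "nome u = nome v" if "u - v \<in> \<int>" for u v
    proof -
      from that obtain n where "u - v = of_int n" by (auto elim: Ints_cases)
      then have "u = v + of_int n" by (simp add: algebra_simps)
      then show ?thesis by simp
    qed
    then show "r - s \<notin> \<int>" "s - r \<notin> \<int>" using nome_neq by metis+
  qed
  obtain f where f: "disc_fps f" "fps_nth f 0 = 1"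
    "\<And>\<tau>. \<tau> \<in> UHP \<Longrightarrow> scalar_deriv (k + 2) (scalar_deriv k (\<lambda>z. nome (r * z) * eval_fps f (nome z))) \<tau> =
       a * E4 \<tau> * (nome (r * \<tau>) * eval_fps f (nome \<tau>))"
    unfolding a_def by (rule modular_ODE_solution[OF rs(1) nonint(1)]) blast
  have a': "a = ((s - r) / 2)\<^sup>2 - 1/144" by (simp add: a_def power_divide power2_commute)
  obtain g where g: "disc_fps g" "fps_nth g 0 = 1"
    "\<And>\<tau>. \<tau> \<in> UHP \<Longrightarrow> scalar_deriv (k + 2) (scalar_deriv k (\<lambda>z. nome (s * z) * eval_fps g (nome z))) \<tau> =
       a * E4 \<tau> * (nome (s * \<tau>) * eval_fps g (nome \<tau>))"
    unfolding a' by (rule modular_ODE_solution[OF rs(2) nonint(2)]) blast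
  define \<psi> \<omega> where "\<psi> = shift_theta r f - fps_const (of_int k / 12) * E2_fps * f"
    and "\<omega> = shift_theta s g - fps_const (of_int k / 12) * E2_fps * g"
  have disc: "disc_fps \<psi>" "disc_fps \<omega>"
    unfolding \<psi>_def \<omega>_def by (intro disc_fps_arith disc_shift_theta disc_E_fps disc_fps_const f g)+
  have wr: "eval_fps f q * eval_fps \<omega> q - eval_fps \<psi> q * eval_fps g q \<noteq> 0" if "q \<in> ball 0 1" for q
    unfolding \<psi>_def \<omega>_def by (rule wronskian_nonzero[OF rs(1) _ f(1,2) g(1,2) f(3) g(3) that]) (use nome_neq in auto)
  define F where "F = (\<lambda>z. vec2 (nome (r * z) * eval_fps f (nome z)) (nome (s * z) * eval_fps g (nome z)))"
  have F_hol: "(\<lambda>z. F z $ j) holomorphic_on UHP" for j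
    using exhaust_2[of j] f(1) g(1) by (auto simp: F_def intro!: holomorphic_intros holomorphic_eval_fps_nome)
  have DF: "vector_deriv k F \<tau> = vec2 (nome (r * \<tau>) * eval_fps \<psi> (nome \<tau>)) (nome (s * \<tau>) * eval_fps \<omega> (nome \<tau>))"
    if "\<tau> \<in> UHP" for \<tau>
    by (rule vec2_eqI) (simp_all add: F_def scalar_deriv_nome_mult(2)[OF f(1) that] scalar_deriv_nome_mult(2)[OF g(1) that] \<psi>_def \<omega>_def)
  have ode: "scalar_deriv (k + 2) (scalar_deriv k (\<lambda>z. F z $ i)) \<tau> = a * E4 \<tau> * F \<tau> $ i" if "\<tau> \<in> UHP" for \<tau> i
    using exhaust_2[of i] f(3)[OF that] g(3)[OF that] by (auto simp: F_def)
  have W: "F \<tau> $ 1 * vector_deriv k F \<tau> $ 2 - vector_deriv k F \<tau> $ 1 * F \<tau> $ 2 \<noteq> 0" if "\<tau> \<in> UHP" for \<tau>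
  proof -
    have "F \<tau> $ 1 * vector_deriv k F \<tau> $ 2 - vector_deriv k F \<tau> $ 1 * F \<tau> $ 2 =
      nome (r * \<tau>) * nome (s * \<tau>) * (eval_fps f (nome \<tau>) * eval_fps \<omega> (nome \<tau>) - eval_fps \<psi> (nome \<tau>) * eval_fps g (nome \<tau>))"
      unfolding DF[OF that] unfolding F_def vec2_nth by (simp add: algebra_simps)
    then show ?thesis using wr[OF nome_in_ball[OF that]] by simp
  qed
  obtain S' where S': "\<And>\<tau>. \<tau> \<in> UHP \<Longrightarrow> F (-1/\<tau>) = \<tau> powi k *s (S' *v F \<tau>)"
    using modular_ODE_S[of F k a, OF F_hol ode W] by blast
  obtain x' y' z' w' where S'_eq: "S' = mat2 x' y' z' w'" using mat2_cases by blast
  define T' where "T' = mat2 (nome r) 0 0 (nome s)"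
  have FT: "F (\<tau> + 1) = T' *v F \<tau>" if "\<tau> \<in> UHP" for \<tau>
    unfolding F_def T'_def mat2_vec2 by (simp add: distrib_left nome_add mult_ac)
  note DT = vector_deriv_T[OF F_hol _ FT, of _ k] and DS = vector_deriv_S[OF F_hol _ S']
  \<comment> \<open>The traces of \<open>S'\<close> and \<open>S' T'\<close> are computed at the elliptic points \<open>i\<close> and \<open>\<zeta> - 1\<close>.\<close>
  have i: "\<i> \<in> UHP" "-1/\<i> = \<i>" by (simp_all add: UHP_def)
  have "S' *v F \<i> = inverse (\<i> powi k) *s F \<i>" "S' *v vector_deriv k F \<i> = inverse (\<i> powi (k + 2)) *s vector_deriv k F \<i>"
    using S'[OF i(1)] DS[OF i(1)] unfolding i(2) by (intro smult_inverse_eq; simp)+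
  from eigenvectors_trace_det_2[OF this W[OF i(1)]]
  have "trace S' = inverse (\<i> powi k) + inverse (\<i> powi (k + 2))" "det S' = inverse (\<i> powi k) * inverse (\<i> powi (k + 2))" .
  moreover have "\<i> powi (k + 2) = - (\<i> powi k)" by (simp add: powi_Suc)
  ultimately have "x' + w' = 0" and det': "x' * w' - y' * z' = - (inverse (\<i> powi k) * inverse (\<i> powi k))"
    unfolding S'_eq trace_mat2 det_mat2 by simp_all
  then have w': "w' = - x'" by (simp add: eq_neg_iff_add_eq_0 add.commute)
  have "inverse (\<i> powi k) * inverse (\<i> powi k) = (-1) powi k"
    by (simp add: inverse_mult_distrib[symmetric] power_int_mult_distrib[symmetric] power_int_inverse[symmetric] del: inverse_mult_distrib)
  then have sq': "x'\<^sup>2 + y' * z' = \<epsilon>" using det' unfolding w' k(2) by (simp add: power2_eq_square algebra_simps)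
  define \<zeta> where "\<zeta> = exp (of_real pi * \<i> / 3)"
  note \<zeta> = sixth_root_of_unity[folded \<zeta>_def]
  have "S' *v (T' *v F (\<zeta> - 1)) = inverse (\<zeta> powi k) *s F (\<zeta> - 1)"
    "S' *v (T' *v vector_deriv k F (\<zeta> - 1)) = inverse (\<zeta> powi (k + 2)) *s vector_deriv k F (\<zeta> - 1)"
    using S'[OF \<zeta>(6)] DS[OF \<zeta>(6)] FT[OF \<zeta>(4)] DT[OF \<zeta>(4)] \<zeta>(1) unfolding \<zeta>(5)
    by (intro smult_inverse_eq; simp)+
  from eigenvectors_trace_det_2(1)[OF this[unfolded matrix_vector_mul_assoc] W[OF \<zeta>(4)]]
  have "trace (S' ** T') = inverse (\<zeta> powi k) + inverse (\<zeta> powi (k + 2))" .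
  \<comment> \<open>The relation \<open>\<zeta>^2 + 1 = \<zeta>\<close> merges the two eigenvalues
    into one power of \<open>\<zeta>\<close>, which is the inverse of \<open>det \<alpha>(T)\<close>
    because \<open>k + 1 = 6 (r + s)\<close>.\<close>
  also have "\<dots> = inverse (\<zeta> powi (k + 2)) * (\<zeta>\<^sup>2 + 1)" using \<zeta>(1) by (simp add: powi_Suc field_simps)
  also have "\<dots> = inverse (\<zeta> powi (k + 1))"
  proof -
    have "\<zeta> powi (k + 2) = \<zeta> powi (k + 1) * \<zeta>" using \<zeta>(1) by (simp add: powi_Suc power2_eq_square)
    then show ?thesis unfolding \<zeta>(2) using \<zeta>(1) by (simp add: field_simps)
  qed
  also have "\<zeta> powi (k + 1) = nome r * nome s"
    unfolding nome_add[symmetric] rs(1) unfolding \<zeta>_def exp_power_int nome_def by (intro arg_cong[of _ _ exp]) (simp add: field_simps)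
  finally have "x' * nome r - x' * nome s = 1 / (nome r * nome s)"
    unfolding S'_eq T'_def mat2_mult trace_mat2 w' by (simp add: divide_inverse)
  then have "(x' - x) * (nome r - nome s) = 0" using tr by (simp add: algebra_simps)
  then have x': "x' = x" using nome_neq by simp
  have "x\<^sup>2 + y' * z' = x\<^sup>2 + y * z" using sq sq' x' by simp
  then have yz': "y' * z' = y * z" by (rule add_left_imp_eq)
  \<comment> \<open>The two matrices now share their diagonal and the product of their off-diagonal
    entries; conjugation by \<open>diag(1, e)\<close> rescales those entries into each
    other.\<close>
  define e where "e = y' / y"
  have e: "e \<noteq> 0" "y * e = y'" "z = e * z'" using yz yz' by (auto simp: e_def field_simps)
  have rep: "representation \<alpha>" using irr by (simp add: irreducible_rep_def)
  define E where "E = mat2 1 0 0 e"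
  define V where "V = (\<lambda>\<tau>. mat2 (nome (- (r * \<tau>))) 0 0 (nome (- (s * \<tau>))))"
  have tw: "twist L \<tau> ** P = P ** V \<tau>" for \<tau>
    using matrix_exp_intertwine[OF mat_scalar_intertwine[OF L, of "- (2 * of_real pi * \<i> * \<tau>)"]]
    unfolding mat_mult_mat2 mult_zero_right matrix_exp_diag exp_mult_nome V_def .
  show thesis
  proof (rule minimal_form_construction[OF rep, of "P ** E" F k a T' S' L V "eval_fps f" "eval_fps g" "eval_fps \<psi>" "eval_fps \<omega>"])
    show "det (P ** E) \<noteq> 0" using P e(1) by (simp add: det_mul E_def det_mat2)
    have "mat2 (nome r) 0 0 (nome s) ** E = E ** T'" "mat2 x y z (-x) ** E = E ** S'" "V \<tau> ** E = E ** V \<tau>" for \<tau>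
      unfolding E_def T'_def V_def S'_eq mat2_mult mat2_eq_iff using e x' w' by simp_all
    then show "\<alpha> T_mat ** (P ** E) = P ** E ** T'" "\<alpha> S_mat ** (P ** E) = P ** E ** S'"
        "twist L \<tau> ** (P ** E) = P ** E ** V \<tau>" for \<tau>
      by (metis T S tw matrix_mul_assoc)+
    show "V \<tau> *v F \<tau> = vec2 (eval_fps f (nome \<tau>)) (eval_fps g (nome \<tau>))" for \<tau>
      unfolding V_def F_def mat2_vec2 by (simp add: mult.assoc[symmetric] nome_minus_mult)
    show "V \<tau> *v vector_deriv k F \<tau> = vec2 (eval_fps \<psi> (nome \<tau>)) (eval_fps \<omega> (nome \<tau>))" if "\<tau> \<in> UHP" for \<tau>
      unfolding V_def DF[OF that] mat2_vec2 by (simp add: mult.assoc[symmetric] nome_minus_mult)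
  next
    fix A
    assume "A \<in> modular_forms \<alpha> L k"
      "\<And>\<tau>. \<tau> \<in> UHP \<Longrightarrow> vector_deriv (k + 2) (vector_deriv k A) \<tau> = (a * E4 \<tau>) *s A \<tau>"
      "free_basis \<alpha> L (\<lambda>j. if j = 1 then k else k + 2) (\<lambda>j. if j = 1 then A else modular_deriv k A)"
    then show thesis using that k(1) unfolding a_def by blast
  qed (use F_hol ode FT S' wr in \<open>auto intro!: holomorphic_disc_fps f g disc\<close>)
qed

text \<open>Assigning \<open>E2\<close> the weight 1 removes its square from the derivative: this is
  Ramanujan's identity for \<open>E2\<close> in another form.\<close>

lemma scalar_deriv_E2: "\<tau> \<in> UHP \<Longrightarrow> scalar_deriv 1 E2 \<tau> = - E4 \<tau> / 12"
proof -
  assume \<tau>: "\<tau> \<in> UHP"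
  have n: "norm (nome \<tau>) < 1" using \<tau> by (rule norm_nome_less_1)
  have "scalar_deriv 1 E2 \<tau> = scalar_deriv 1 (\<lambda>z. eval_fps E2_fps (nome z)) \<tau>"
    by (rule scalar_deriv_cong[OF \<tau> E2_eq])
  also have "\<dots> = eval_fps (theta_fps E2_fps) (nome \<tau>) - 1 / 12 * E2 \<tau> * E2 \<tau>"
    using scalar_derivI[OF eval_fps_nome_deriv[OF disc_E_fps(1) \<tau>], of 1] by (simp add: E2_eq[OF \<tau>])
  also have "\<dots> = - E4 \<tau> / 12"
    unfolding E4_eq[OF \<tau>] E4_fps_eq E2_eq[OF \<tau>] using n
    by (simp add: eval_disc_fps disc_fps_arith disc_fps_power disc_E_fps disc_theta_fps power2_eq_square field_simps)
  finally show ?thesis .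
qed

text \<open>The vector \<open>(\<tau>, 1)\<close> transforms in weight \<open>-1\<close> by the
  standard representation. Multiplied by the power of eta of weight \<open>k + 1\<close> it has
  weight \<open>k\<close> and solves the equation with the double exponent
  \<open>r = (k + 1) / 12\<close>.\<close>

lemma minimal_form_Jordan:
  fixes \<alpha> :: "int^2^2 \<Rightarrow> complex^2^2"
  assumes irr: "irreducible_rep \<alpha>" and P: "det P \<noteq> 0"
    and T: "\<alpha> T_mat ** P = P ** mat2 (nome r) (nome r) 0 (nome r)"
    and L: "L ** P = P ** mat2 r (1 / (2 * of_real pi * \<i>)) 0 r"
  obtains k A where "of_int k = 6 * (r + r) - 1" "A \<in> modular_forms \<alpha> L k"
    "\<And>\<tau>. \<tau> \<in> UHP \<Longrightarrow> vector_deriv (k + 2) (vector_deriv k A) \<tau> = ((- (1/144)) * E4 \<tau>) *s A \<tau>"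
    "free_basis \<alpha> L (\<lambda>j. if j = 1 then k else k + 2) (\<lambda>j. if j = 1 then A else modular_deriv k A)"
proof -
  obtain x y z \<epsilon> where S: "\<alpha> S_mat ** P = P ** mat2 x y z (-x)" and z: "z \<noteq> 0"
    and sq: "x\<^sup>2 + y * z = \<epsilon>" and \<epsilon>: "\<epsilon>\<^sup>2 = 1" and t3: "(nome r * nome r) ^ 3 = - \<epsilon>"
    and tr: "x * nome r + (z * nome r - x * nome r) = 1 / (nome r * nome r)"
    by (rule irreducible_rep_2_data[OF irr P T]) blast
  obtain k :: int where k: "of_int k = 6 * (r + r) - 1" "\<epsilon> = (-1) powi k"
    by (rule minimal_weight_integral[OF t3[folded nome_add] \<epsilon>]) blast
  have r: "r = of_int (k + 1) / 12" using k(1) by simp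
  define h where "h = eta_power (k + 1)"
  define \<kappa> where "\<kappa> = \<i> powi (- (k + 1))"
  \<comment> \<open>For a Jordan block the trace of \<open>\<alpha>(S T)\<close> is \<open>z\<close>
    times the eigenvalue, which pins \<open>z\<close> down to the constant in the inversion formula
    for \<open>h\<close>.\<close>
  have z\<kappa>: "z = \<kappa>"
  proof -
    have "z * nome r = 1 / (nome r * nome r)" using tr by (simp add: add_ac)
    then have "z * nome r ^ 3 = 1" by (simp add: eq_divide_eq power3_eq_cube mult.assoc)
    moreover have "nome r ^ 3 = \<i> powi (k + 1)"
    proof -
      have "nome r ^ 3 = exp (of_int (k + 1) * (of_real pi * \<i> / 2))"
        unfolding r nome_def exp_of_nat_mult[symmetric] by (intro arg_cong[of _ _ exp]) (simp add: field_simps)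
      also have "\<dots> = exp (of_real pi * \<i> / 2) powi (k + 1)" by (rule exp_power_int[symmetric])
      also have "exp (of_real pi * \<i> / 2) = \<i>" using cis_pi_half by (simp add: cis_conv_exp mult_ac)
      finally show ?thesis .
    qed
    ultimately have "\<i> powi (k + 1) * z = 1" by (simp only: mult.commute)
    from inverse_unique[OF this] show ?thesis by (simp only: \<kappa>_def power_int_minus)
  qed
  have \<epsilon>\<kappa>: "\<epsilon> = - (\<kappa> * \<kappa>)"
  proof -
    have "\<kappa> * \<kappa> = (-1) powi (- (k + 1))" unfolding \<kappa>_def power_int_mult_distrib[symmetric] by simp
    also have "\<dots> = - ((-1) powi k)" by (simp add: power_int_minus_left)
    finally show ?thesis using k(2) by simp
  qed
  \<comment> \<open>The shear by \<open>x / z\<close> commutes with the Jordan block and clears the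
    diagonal of \<open>S\<close>.\<close>
  define u where "u = x / z"
  define U where "U = mat2 1 u 0 1"
  define S' where "S' = mat2 0 (-\<kappa>) \<kappa> 0"
  define F where "F = (\<lambda>\<tau>. vec2 (\<tau> * h \<tau>) (h \<tau>))"
  have h_hol: "h holomorphic_on UHP" unfolding h_def by (rule eta_power_holomorphic)
  have F_hol: "(\<lambda>z. F z $ j) holomorphic_on UHP" for j
    using exhaust_2[of j] h_hol by (auto simp: F_def intro!: holomorphic_intros)
  have h_deriv: "(h has_field_derivative 2 * of_real pi * \<i> * (of_int (k + 1) / 12 * E2 \<tau> * h \<tau>)) (at \<tau>)" if "\<tau> \<in> UHP" for \<tau>
    unfolding h_def by (rule eta_power_deriv[OF that])
  define G where "G = (\<lambda>\<tau>. E2 \<tau> * h \<tau> / 12)"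
  have Dh: "scalar_deriv k h \<tau> = G \<tau>" if "\<tau> \<in> UHP" for \<tau>
    unfolding scalar_derivI[OF h_deriv[OF that]] by (simp add: G_def algebra_simps add_divide_distrib)
  have D\<tau>: "scalar_deriv l (\<lambda>\<tau>. \<tau> * f \<tau>) \<tau> = \<tau> * scalar_deriv l f \<tau> + f \<tau> / (2 * of_real pi * \<i>)"
    if "f holomorphic_on UHP" "\<tau> \<in> UHP" for f l \<tau>
  proof -
    have "deriv (\<lambda>\<tau>. \<tau> * f \<tau>) \<tau> = f \<tau> + \<tau> * deriv f \<tau>"
      by (rule DERIV_imp_deriv) (auto intro!: derivative_eq_intros holomorphic_UHP_deriv that)
    then show ?thesis by (simp add: scalar_deriv_def add_divide_distrib algebra_simps)
  qed
  have G_hol: "G holomorphic_on UHP" unfolding G_def by (intro holomorphic_intros E2_holomorphic h_hol) simp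
  have DG: "scalar_deriv (k + 2) G \<tau> = - (1/144) * E4 \<tau> * h \<tau>" if "\<tau> \<in> UHP" for \<tau>
  proof -
    have "scalar_deriv (k + 2) G \<tau> = scalar_deriv (1 + (k + 1)) (\<lambda>z. \<Sum>j\<in>{()}. (1/12) * (\<lambda>z. E2 z * h z) z) \<tau>"
      by (simp add: G_def[abs_def] add_ac)
    also have "\<dots> = (\<Sum>j\<in>{()}. (1/12) * scalar_deriv (1 + (k + 1)) (\<lambda>z. E2 z * h z) \<tau>)"
      by (rule scalar_deriv_linear) (use that in \<open>auto intro!: holomorphic_intros E2_holomorphic h_hol\<close>)
    also have "scalar_deriv (1 + (k + 1)) (\<lambda>z. E2 z * h z) \<tau> = - E4 \<tau> / 12 * h \<tau>"
      unfolding scalar_deriv_mult[OF E2_holomorphic h_hol that] scalar_deriv_E2[OF that]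
      using scalar_deriv_eta_power[OF that, of "k + 1"] by (simp add: h_def)
    finally show ?thesis by simp
  qed
  have DF: "vector_deriv k F \<tau> = vec2 (\<tau> * G \<tau> + h \<tau> / (2 * of_real pi * \<i>)) (G \<tau>)" if "\<tau> \<in> UHP" for \<tau>
    by (rule vec2_eqI) (simp_all add: F_def D\<tau>[OF h_hol that] Dh that)
  have ode: "scalar_deriv (k + 2) (scalar_deriv k (\<lambda>z. F z $ i)) \<tau> = - (1/144) * E4 \<tau> * F \<tau> $ i" if \<tau>: "\<tau> \<in> UHP" for \<tau> i
  proof -
    have "scalar_deriv (k + 2) (scalar_deriv k h) \<tau> = scalar_deriv (k + 2) G \<tau>"
      by (rule scalar_deriv_cong[OF \<tau> Dh])
    then have 2: "scalar_deriv (k + 2) (scalar_deriv k h) \<tau> = - (1/144) * E4 \<tau> * h \<tau>"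
      using DG[OF \<tau>] by (rule trans)
    have "scalar_deriv (k + 2) (scalar_deriv k (\<lambda>\<tau>. \<tau> * h \<tau>)) \<tau> =
        scalar_deriv (k + 2) (\<lambda>\<tau>. \<tau> * G \<tau> + h \<tau> / (2 * of_real pi * \<i>)) \<tau>"
      by (rule scalar_deriv_cong[OF \<tau>]) (simp add: D\<tau>[OF h_hol] Dh)
    also have "\<dots> = scalar_deriv (k + 2) (\<lambda>\<tau>. \<tau> * G \<tau>) \<tau> + scalar_deriv (k + 2) h \<tau> / (2 * of_real pi * \<i>)"
    proof -
      have "deriv (\<lambda>\<tau>. \<tau> * G \<tau> + h \<tau> / (2 * of_real pi * \<i>)) \<tau> = deriv (\<lambda>\<tau>. \<tau> * G \<tau>) \<tau> + deriv h \<tau> / (2 * of_real pi * \<i>)"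
        by (intro DERIV_imp_deriv DERIV_add DERIV_cdivide holomorphic_UHP_deriv \<tau> h_hol holomorphic_intros G_hol)
      then show ?thesis by (simp add: scalar_deriv_def add_divide_distrib diff_divide_distrib algebra_simps)
    qed
    also have "scalar_deriv (k + 2) h \<tau> = - G \<tau>"
      unfolding scalar_derivI[OF h_deriv[OF \<tau>]] by (simp add: G_def algebra_simps add_divide_distrib)
    finally have 1: "scalar_deriv (k + 2) (scalar_deriv k (\<lambda>\<tau>. \<tau> * h \<tau>)) \<tau> = - (1/144) * E4 \<tau> * (\<tau> * h \<tau>)"
      unfolding D\<tau>[OF G_hol \<tau>] DG[OF \<tau>] by simp
    show ?thesis using exhaust_2[of i] 1 2 by (auto simp: F_def)
  qed
  define T' where "T' = mat2 (nome r) (nome r) 0 (nome r)"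
  have hT: "h (\<tau> + 1) = nome r * h \<tau>" for \<tau>
    unfolding h_def eta_power_def r[symmetric] by (simp add: distrib_left nome_add mult_ac)
  have FT: "F (\<tau> + 1) = T' *v F \<tau>" for \<tau>
    unfolding F_def T'_def mat2_vec2 hT by (simp add: algebra_simps)
  have FS: "F (-1/\<tau>) = \<tau> powi k *s (S' *v F \<tau>)" if \<tau>: "\<tau> \<in> UHP" for \<tau>
  proof -
    have ne: "\<tau> \<noteq> 0" using \<tau> by (rule UHP_nonzero)
    have hS: "h (-1/\<tau>) = \<kappa> * (\<tau> powi k * \<tau>) * h \<tau>"
      unfolding h_def \<kappa>_def eta_power_S[OF \<tau>] powi_Suc(1)[OF ne] ..
    show ?thesis
      unfolding F_def S'_def mat2_vec2 hS using ne by (intro vec2_eqI) (simp_all add: mult_ac)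
  qed
  define V where "V = (\<lambda>\<tau>. mat2 (nome (- (r * \<tau>))) (- \<tau> * nome (- (r * \<tau>))) 0 (nome (- (r * \<tau>))))"
  have tw: "twist L \<tau> ** P = P ** V \<tau>" for \<tau>
  proof -
    have 1: "- (2 * of_real pi * \<i> * \<tau>) * (1 / (2 * of_real pi * \<i>)) = - \<tau>" by (simp add: field_simps)
    show ?thesis
      using matrix_exp_intertwine[OF mat_scalar_intertwine[OF L, of "- (2 * of_real pi * \<i> * \<tau>)"]]
      unfolding mat_mult_mat2 mult_zero_right 1 matrix_exp_Jordan exp_mult_nome V_def .
  qed
  define \<phi> where "\<phi> = (\<lambda>q. exp (of_int (k + 1) * eval_fps eta_log_fps q))"
  have Vh: "nome (- (r * \<tau>)) * h \<tau> = \<phi> (nome \<tau>)" for \<tau>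
    unfolding h_def eta_power_def \<phi>_def r[symmetric] mult.assoc[symmetric] nome_minus_mult by simp
  have \<phi>_hol: "\<phi> holomorphic_on ball 0 1"
    unfolding \<phi>_def by (intro holomorphic_intros holomorphic_disc_fps disc_eta_log_fps)
  have rep: "representation \<alpha>" using irr by (simp add: irreducible_rep_def)
  show thesis
  proof (rule minimal_form_construction[OF rep, of "P ** U" F k "- (1/144)" T' S' L V "\<lambda>_. 0" \<phi>
        "\<lambda>q. \<phi> q / (2 * of_real pi * \<i>)" "\<lambda>q. eval_fps E2_fps q * \<phi> q / 12"])
    show "det (P ** U) \<noteq> 0" using P by (simp add: det_mul U_def det_mat2)
    have SU: "mat2 x y z (-x) ** U = U ** S'"
    proof -
      have "x * u + y = - \<kappa>" using sq z unfolding u_def \<epsilon>\<kappa> z\<kappa> by (simp add: field_simps power2_eq_square)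
      moreover have "z * u = x" using z by (simp add: u_def)
      ultimately show ?thesis
        unfolding U_def S'_def mat2_mult mat2_eq_iff using z\<kappa> by (simp add: mult.commute)
    qed
    have TU: "mat2 (nome r) (nome r) 0 (nome r) ** U = U ** T'" "V \<tau> ** U = U ** V \<tau>" for \<tau>
      unfolding U_def T'_def V_def mat2_mult mat2_eq_iff by (simp_all add: algebra_simps)
    show "\<alpha> T_mat ** (P ** U) = P ** U ** T'" "\<alpha> S_mat ** (P ** U) = P ** U ** S'"
        "twist L \<tau> ** (P ** U) = P ** U ** V \<tau>" for \<tau>
      using TU SU by (metis T S tw matrix_mul_assoc)+
    show "V \<tau> *v F \<tau> = vec2 0 (\<phi> (nome \<tau>))" for \<tau>
      unfolding V_def F_def mat2_vec2 Vh[symmetric] by (simp add: mult_ac)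
    show "V \<tau> *v vector_deriv k F \<tau> = vec2 (\<phi> (nome \<tau>) / (2 * of_real pi * \<i>)) (eval_fps E2_fps (nome \<tau>) * \<phi> (nome \<tau>) / 12)"
      if "\<tau> \<in> UHP" for \<tau>
      unfolding V_def DF[OF that] mat2_vec2 Vh[symmetric] G_def E2_eq[OF that]
      by (intro vec2_eqI) (simp_all add: algebra_simps)
    show "0 * (eval_fps E2_fps q * \<phi> q / 12) - \<phi> q / (2 * of_real pi * \<i>) * \<phi> q \<noteq> 0" for q
      by (simp add: \<phi>_def)
  next
    fix A
    assume "A \<in> modular_forms \<alpha> L k"
      "\<And>\<tau>. \<tau> \<in> UHP \<Longrightarrow> vector_deriv (k + 2) (vector_deriv k A) \<tau> = (- (1/144) * E4 \<tau>) *s A \<tau>"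
      "free_basis \<alpha> L (\<lambda>j. if j = 1 then k else k + 2) (\<lambda>j. if j = 1 then A else modular_deriv k A)"
    then show thesis using that k(1) by blast
  qed (use F_hol ode FT FS in \<open>auto intro!: holomorphic_intros \<phi>_hol holomorphic_disc_fps disc_E_fps\<close>)
qed

text \<open>Writing the exponents as \<open>Tr(L) / 2 \<plusminus> u\<close> treats both normal
  forms alike: the Jordan case has \<open>u = 0\<close>, and its constant \<open>-1/144\<close> is
  \<open>u^2 - 1/144\<close>.\<close>

theorem minimal_form_2:
  fixes \<alpha> :: "int^2^2 \<Rightarrow> complex^2^2"
  assumes irr: "irreducible_rep \<alpha>" and L: "choice_of_exponents \<alpha> L"
  obtains k A u P x where "of_int k = 6 * trace L - 1"
    "det P \<noteq> 0" "L ** P = P ** mat2 (trace L / 2 + u) x 0 (trace L / 2 - u)"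
    "A \<in> modular_forms \<alpha> L k"
    "\<And>\<tau>. \<tau> \<in> UHP \<Longrightarrow> vector_deriv (k + 2) (vector_deriv k A) \<tau> = ((u\<^sup>2 - 1/144) * E4 \<tau>) *s A \<tau>"
    "free_basis \<alpha> L (\<lambda>j. if j = 1 then k else k + 2) (\<lambda>j. if j = 1 then A else modular_deriv k A)"
proof -
  have y: "1 / (2 * of_real pi * \<i>) \<noteq> (0::complex)" by simp
  obtain P r s x where P: "det P \<noteq> 0" "L ** P = P ** mat2 r x 0 s"
    and x: "x = 0 \<or> r = s \<and> x = 1 / (2 * of_real pi * \<i>)"
    by (rule normal_form_2[OF y, of L]) blast
  have tr: "trace L = r + s" using similar_trace_det(1)[OF P(2,1)] by (simp add: trace_mat2)
  define u where "u = (r - s) / 2"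
  have rs: "r = trace L / 2 + u" "s = trace L / 2 - u" by (simp_all add: tr u_def field_simps)
  have T: "\<alpha> T_mat ** P = P ** matrix_exp (mat2 (2 * of_real pi * \<i> * r) (2 * of_real pi * \<i> * x) 0 (2 * of_real pi * \<i> * s))"
    using L matrix_exp_intertwine[OF mat_scalar_intertwine[OF P(2), of "2 * of_real pi * \<i>"]]
    unfolding choice_of_exponents_def mat_mult_mat2 mult_zero_right by simp
  from x show thesis
  proof
    assume x: "x = 0"
    have T': "\<alpha> T_mat ** P = P ** mat2 (nome r) 0 0 (nome s)"
      using T unfolding x mult_zero_right matrix_exp_diag nome_def .
    show thesis
    proof (rule minimal_form_diagonal[OF irr P(1) T' P(2)[unfolded x]])
      fix k A
      assume "of_int k = 6 * (r + s) - 1" "A \<in> modular_forms \<alpha> L k"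
        "\<And>\<tau>. \<tau> \<in> UHP \<Longrightarrow> vector_deriv (k + 2) (vector_deriv k A) \<tau> = ((((r - s) / 2)\<^sup>2 - 1/144) * E4 \<tau>) *s A \<tau>"
        "free_basis \<alpha> L (\<lambda>j. if j = 1 then k else k + 2) (\<lambda>j. if j = 1 then A else modular_deriv k A)"
      from that[OF this(1)[folded tr] P(1) P(2)[unfolded rs] this(2) this(3)[folded u_def] this(4)] show thesis .
    qed
  next
    assume x: "r = s \<and> x = 1 / (2 * of_real pi * \<i>)"
    have sr: "s = r" and x': "x = 1 / (2 * of_real pi * \<i>)" using x by simp_all
    have u0: "u = 0" using sr by (simp add: u_def)
    have one: "2 * of_real pi * \<i> * (1 / (2 * of_real pi * \<i>)) = (1::complex)" by simp
    have T': "\<alpha> T_mat ** P = P ** mat2 (nome r) (nome r) 0 (nome r)"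
      using T unfolding sr x' one matrix_exp_Jordan nome_def by simp
    show thesis
    proof (rule minimal_form_Jordan[OF irr P(1) T' P(2)[unfolded sr x']])
      fix k A
      assume *: "of_int k = 6 * (r + r) - 1" "A \<in> modular_forms \<alpha> L k"
        "\<And>\<tau>. \<tau> \<in> UHP \<Longrightarrow> vector_deriv (k + 2) (vector_deriv k A) \<tau> = ((- (1/144)) * E4 \<tau>) *s A \<tau>"
        "free_basis \<alpha> L (\<lambda>j. if j = 1 then k else k + 2) (\<lambda>j. if j = 1 then A else modular_deriv k A)"
      have ode: "vector_deriv (k + 2) (vector_deriv k A) \<tau> = ((u\<^sup>2 - 1/144) * E4 \<tau>) *s A \<tau>" if "\<tau> \<in> UHP" for \<tau>
        using *(3)[OF that] by (simp add: u0)
      have w: "of_int k = 6 * trace L - 1" using *(1) unfolding tr sr .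
      from that[OF w P(1) P(2)[unfolded rs] *(2) ode *(4)] show thesis .
    qed
  qed
qed

subsection \<open>Bases of the graded module\<close>

lemma modular_forms_linear:
  assumes "X \<in> modular_forms \<rho> L k" "Y \<in> modular_forms \<rho> L k" and rep: "representation \<rho>"
  shows "(\<lambda>\<tau>. a *s X \<tau> + b *s Y \<tau>) \<in> modular_forms \<rho> L k"
proof -
  note X = modular_formsD[OF assms(1)] and Y = modular_formsD[OF assms(2)]
  from X(5) obtain h where h: "\<And>i. (\<lambda>q. h q $ i) holomorphic_on ball 0 1"
    "\<And>\<tau>. \<tau> \<in> UHP \<Longrightarrow> twist L \<tau> *v X \<tau> = h (nome \<tau>)" by blast
  from Y(5) obtain g where g: "\<And>i. (\<lambda>q. g q $ i) holomorphic_on ball 0 1"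
    "\<And>\<tau>. \<tau> \<in> UHP \<Longrightarrow> twist L \<tau> *v Y \<tau> = g (nome \<tau>)" by blast
  have lin: "M *v (a *s x + b *s y) = a *s (M *v x) + b *s (M *v y)" for M :: "complex^'a^'a" and x y
    by (simp add: matrix_vector_right_distrib vector_scalar_commute)
  show ?thesis
  proof (rule modular_formsI[OF rep, where h = "\<lambda>q. a *s h q + b *s g q"])
    show "a *s X (-1/\<tau>) + b *s Y (-1/\<tau>) = \<tau> powi k *s (\<rho> S_mat *v (a *s X \<tau> + b *s Y \<tau>))" if "\<tau> \<in> UHP" for \<tau>
      unfolding X(4)[OF that] Y(4)[OF that] lin by (simp add: vector_smult_assoc vec.scale_right_distrib mult.commute)
  qed (use X(1-3) Y(1-3) h g in \<open>auto simp: lin intro!: holomorphic_intros\<close>)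
qed

text \<open>A constant invertible matrix multiplies the fundamental matrix on the right, so the
  determinant stays nonzero at the cusp as well.\<close>

lemma free_basis_change:
  fixes C :: "complex^'n^'n"
  assumes fb: "free_basis \<rho> L w b" and b': "\<And>j. b' j \<in> modular_forms \<rho> L (w' j)" and C: "det C \<noteq> 0"
    and eq: "\<And>j \<tau>. \<tau> \<in> UHP \<Longrightarrow> b' j \<tau> = (\<Sum>i\<in>UNIV. C $ i $ j *s b i \<tau>)"
  shows "free_basis \<rho> L w' b'"
proof -
  from fb obtain \<Phi> where \<Phi>: "\<And>i j. (\<lambda>q. \<Phi> q $ i $ j) holomorphic_on ball 0 1"
    "\<And>q. q \<in> ball 0 1 \<Longrightarrow> det (\<Phi> q) \<noteq> 0"
    "\<And>\<tau> j. \<tau> \<in> UHP \<Longrightarrow> twist L \<tau> *v b j \<tau> = column j (\<Phi> (nome \<tau>))"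
    unfolding free_basis_def by blast
  show ?thesis
    unfolding free_basis_def
  proof (intro conjI exI[of _ "\<lambda>q. \<Phi> q ** C"] allI ballI)
    show "(\<lambda>q. (\<Phi> q ** C) $ i $ j) holomorphic_on ball 0 1" for i j
      unfolding matrix_mult_nth by (intro holomorphic_intros \<Phi>(1))
    show "det (\<Phi> q ** C) \<noteq> 0" if "q \<in> ball 0 1" for q
      using \<Phi>(2)[OF that] C by (simp add: det_mul)
    show "twist L \<tau> *v b' j \<tau> = column j (\<Phi> (nome \<tau>) ** C)" if "\<tau> \<in> UHP" for \<tau> j
      unfolding eq[OF that] matrix_vector_mult_sum_smult \<Phi>(3)[OF that] column_matrix_mult
      unfolding matrix_vector_column_sum by (simp add: column_def)
  qed (rule b')
qed

lemma graded_mult_homogeneous: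
  assumes "f \<in> M1"
  shows "graded_mult f (homogeneous w F) k \<tau> = f (k - w) \<tau> *s F \<tau>"
proof -
  have fin: "finite {i. f i \<noteq> (\<lambda>_. 0)}" using assms by (simp add: M1_def direct_sum_def)
  have "graded_mult f (homogeneous w F) k \<tau> = (\<Sum>i | f i \<noteq> (\<lambda>_. 0). if i = k - w then f i \<tau> *s F \<tau> else 0)"
    unfolding graded_mult_def homogeneous_def by (intro sum.cong) auto
  also have "\<dots> = f (k - w) \<tau> *s F \<tau>" by (subst sum.delta[OF fin]) auto
  finally show ?thesis .
qed

lemma homogeneous_in_graded_forms:
  "F \<in> modular_forms \<rho> L k \<Longrightarrow> homogeneous k F \<in> graded_forms \<rho> L"
proof -
  have "finite {j. homogeneous k F j \<noteq> (\<lambda>_. 0)}"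
    by (rule finite_subset[of _ "{k}"]) (auto simp: homogeneous_def)
  then show "F \<in> modular_forms \<rho> L k \<Longrightarrow> ?thesis"
    by (auto simp: graded_forms_def direct_sum_def homogeneous_def zero_in_modular_forms)
qed

lemma graded_forms_coordinates:
  assumes rep: "representation \<rho>" and fb: "free_basis \<rho> L w b" and X: "X \<in> graded_forms \<rho> L"
  obtains c where "\<And>j. c j \<in> M1" "\<And>k \<tau>. X k \<tau> = (\<Sum>j\<in>UNIV. c j (k - w j) \<tau> *s b j \<tau>)"
proof -
  have "\<exists>d. (\<forall>j. d j \<in> M1_weight (k - w j)) \<and> X k = (\<lambda>\<tau>. \<Sum>j\<in>UNIV. d j \<tau> *s b j \<tau>)" for k
  proof -
    have "X k \<in> modular_forms \<rho> L k" using X by (simp add: graded_forms_def direct_sum_def)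
    from free_basis_span[OF rep fb this] show ?thesis by blast
  qed
  then obtain d where d: "\<And>k j. d k j \<in> M1_weight (k - w j)"
    "\<And>k. X k = (\<lambda>\<tau>. \<Sum>j\<in>UNIV. d k j \<tau> *s b j \<tau>)" by metis
  \<comment> \<open>Uniqueness of coordinates makes them vanish in every weight where
    \<open>X\<close> does; this yields finite support.\<close>
  have d0: "d k j = (\<lambda>_. 0)" if "X k = (\<lambda>_. 0)" for k j
  proof
    fix \<tau>
    show "d k j \<tau> = 0"
    proof (cases "\<tau> \<in> UHP")
      case True
      have "(\<Sum>j\<in>UNIV. d k j \<tau> *s b j \<tau>) = (\<Sum>j\<in>UNIV. 0 *s b j \<tau>)"
        using fun_cong[OF d(2)[of k], of \<tau>] that by simp
      from fun_cong[OF free_basis_independent[OF fb True this]] show ?thesis .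
    qed (rule M1_weight_outside[OF d(1)])
  qed
  show thesis
  proof (rule that[of "\<lambda>j i. d (i + w j) j"])
    show "(\<lambda>i. d (i + w j) j) \<in> M1" for j
      unfolding M1_def direct_sum_def
    proof (intro CollectI conjI allI)
      show "d (i + w j) j \<in> M1_weight i" for i using d(1)[of "i + w j" j] by simp
      have "{i. d (i + w j) j \<noteq> (\<lambda>_. 0)} \<subseteq> (\<lambda>k. k - w j) ` {k. X k \<noteq> (\<lambda>_. 0)}"
        using d0 by (force intro: image_eqI[of _ _ "i + w j" for i])
      then show "finite {i. d (i + w j) j \<noteq> (\<lambda>_. 0)}"
        by (rule finite_subset) (use X in \<open>auto simp: graded_forms_def direct_sum_def\<close>)
    qed
    show "X k \<tau> = (\<Sum>j\<in>UNIV. d (k - w j + w j) j \<tau> *s b j \<tau>)" for k \<tau>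
      using fun_cong[OF d(2)[of k], of \<tau>] by simp
  qed
qed

text \<open>Coefficients are determined on the half-plane by pointwise independence and vanish off
  it by convention. The list \<open>js\<close> fixes an order of the index type.\<close>

theorem free_basis_M1_basis:
  fixes js :: "'n::finite list"
  assumes rep: "representation \<rho>" and fb: "free_basis \<rho> L w b" and js: "distinct js" "set js = UNIV"
  shows "M1_basis (graded_forms \<rho> L) (map (\<lambda>j. homogeneous (w j) (b j)) js)"
proof -
  define pos where "pos = inv_into {..<length js} ((!) js)"
  have bij: "bij_betw ((!) js) {..<length js} UNIV" using js bij_betw_nth by blast
  have pos: "pos j < length js" "js ! pos j = j" for j
    using bij_betw_inv_into_right[OF bij, of j] bij_betwE[OF bij_betw_inv_into[OF bij]] by (auto simp: pos_def)
  have pos': "pos (js ! i) = i" if "i < length js" for i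
    using bij_betw_inv_into_left[OF bij] that by (simp add: pos_def)
  have expand: "(\<Sum>i<length js. graded_mult (fs ! i) (map (\<lambda>j. homogeneous (w j) (b j)) js ! i) k \<tau>) =
      (\<Sum>j\<in>UNIV. (fs ! pos j) (k - w j) \<tau> *s b j \<tau>)" if "length fs = length js" "set fs \<subseteq> M1" for fs k \<tau>
  proof -
    have "(\<Sum>i<length js. graded_mult (fs ! i) (map (\<lambda>j. homogeneous (w j) (b j)) js ! i) k \<tau>) =
      (\<Sum>i<length js. (fs ! pos (js ! i)) (k - w (js ! i)) \<tau> *s b (js ! i) \<tau>)"
      using that by (intro sum.cong) (auto simp: graded_mult_homogeneous pos' subset_iff)
    also have "\<dots> = (\<Sum>j\<in>UNIV. (fs ! pos j) (k - w j) \<tau> *s b j \<tau>)"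
      by (rule sum.reindex_bij_betw[OF bij])
    finally show ?thesis .
  qed
  have uniq: "fs = gs" if fs: "length fs = length js" "set fs \<subseteq> M1" and gs: "length gs = length js" "set gs \<subseteq> M1"
    and eq: "\<And>k \<tau>. (\<Sum>j\<in>UNIV. (fs ! pos j) (k - w j) \<tau> *s b j \<tau>) = (\<Sum>j\<in>UNIV. (gs ! pos j) (k - w j) \<tau> *s b j \<tau>)" for fs gs
  proof (rule nth_equalityI)
    show "length fs = length gs" using fs gs by simp
    fix i assume i: "i < length fs"
    then have M1: "fs ! i \<in> M1" "gs ! i \<in> M1" using fs gs by (auto simp: subset_iff)
    show "fs ! i = gs ! i"
    proof (intro ext)
      fix k \<tau>
      show "(fs ! i) k \<tau> = (gs ! i) k \<tau>"
      proof (cases "\<tau> \<in> UHP")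
        case True
        from fun_cong[OF free_basis_independent[OF fb True eq[of "k + w (js ! i)" \<tau>]], of "js ! i"]
        show ?thesis using i fs(1) by (simp add: pos')
      next
        case False
        have "(fs ! i) k \<in> M1_weight k" "(gs ! i) k \<in> M1_weight k" using M1 by (auto simp: M1_def direct_sum_def)
        then show ?thesis using M1_weight_outside[OF _ False] by metis
      qed
    qed
  qed
  show ?thesis
    unfolding M1_basis_def length_map
  proof (intro conjI ballI)
    show "set (map (\<lambda>j. homogeneous (w j) (b j)) js) \<subseteq> graded_forms \<rho> L"
      using fb by (auto simp: free_basis_def intro: homogeneous_in_graded_forms)
    fix X assume "X \<in> graded_forms \<rho> L"
    from graded_forms_coordinates[OF rep fb this] obtain c where
      c: "\<And>j. c j \<in> M1" "\<And>k \<tau>. X k \<tau> = (\<Sum>j\<in>UNIV. c j (k - w j) \<tau> *s b j \<tau>)" by blast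
    have fs: "length (map c js) = length js" "set (map c js) \<subseteq> M1" using c(1) by auto
    show "\<exists>!fs. length fs = length js \<and> set fs \<subseteq> M1 \<and>
      X = (\<lambda>k \<tau>. \<Sum>i<length js. graded_mult (fs ! i) (map (\<lambda>j. homogeneous (w j) (b j)) js ! i) k \<tau>)"
    proof (rule ex1I[of _ "map c js"])
      show "length (map c js) = length js \<and> set (map c js) \<subseteq> M1 \<and>
        X = (\<lambda>k \<tau>. \<Sum>i<length js. graded_mult (map c js ! i) (map (\<lambda>j. homogeneous (w j) (b j)) js ! i) k \<tau>)"
        unfolding expand[OF fs] using fs c(2) pos by (simp add: fun_eq_iff)
      fix gs assume gs: "length gs = length js \<and> set gs \<subseteq> M1 \<and>
        X = (\<lambda>k \<tau>. \<Sum>i<length js. graded_mult (gs ! i) (map (\<lambda>j. homogeneous (w j) (b j)) js ! i) k \<tau>)"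
      then have gs': "length gs = length js" "set gs \<subseteq> M1" by simp_all
      have "X k \<tau> = (\<Sum>j\<in>UNIV. (gs ! pos j) (k - w j) \<tau> *s b j \<tau>)" for k \<tau>
        using gs expand[OF gs'] by metis
      then show "gs = map c js" using c(2) pos by (intro uniq gs' fs) simp
    qed
  qed
qed

lemma vector_deriv_linear:
  assumes "\<And>j. (\<lambda>z. F z $ j) holomorphic_on UHP" "\<And>j. (\<lambda>z. G z $ j) holomorphic_on UHP" "\<tau> \<in> UHP"
  shows "vector_deriv k (\<lambda>z. a *s F z + b *s G z) \<tau> = a *s vector_deriv k F \<tau> + b *s vector_deriv k G \<tau>"
proof -
  have hol: "(\<lambda>z. if j then F z $ i else G z $ i) holomorphic_on UHP" for i j using assms by (cases j) auto
  have "scalar_deriv k (\<lambda>z. a * F z $ i + b * G z $ i) \<tau> = a * scalar_deriv k (\<lambda>z. F z $ i) \<tau> + b * scalar_deriv k (\<lambda>z. G z $ i) \<tau>" for i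
    using scalar_deriv_linear[of "{False, True}" "\<lambda>j z. if j then F z $ i else G z $ i" \<tau> k "\<lambda>j. if j then a else b"] hol assms(3)
    by (simp add: add.commute)
  then show ?thesis unfolding vec_eq_iff vector_deriv_nth vector_add_component vector_smult_component by blast
qed

lemma vector_deriv_smult:
  assumes "\<And>j. (\<lambda>z. F z $ j) holomorphic_on UHP" "\<tau> \<in> UHP"
  shows "vector_deriv k (\<lambda>z. a *s F z) \<tau> = a *s vector_deriv k F \<tau>"
  using vector_deriv_linear[OF assms(1,1,2), of k a 0] unfolding vector_smult_lzero add_0_right .

subsection \<open>A criterion for not being cyclic\<close>

text \<open>In weights up to 3, \<open>\<complex>[E4, E6]\<close> contains only constants. So on
  families that start in weight \<open>m\<close> with a multiple of \<open>F\<close>, every operator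
  acts in weights \<open>m\<close> and \<open>m + 2\<close> like some \<open>c + d D\<close>, with
  \<open>c\<close>, \<open>d\<close> the same for all families. Constants of weight 0 are cut off
  outside the half-plane, hence the vanishing condition there on \<open>X (m + 2)\<close>.\<close>

lemma M1D_low_weights:
  fixes P :: "(int \<Rightarrow> complex \<Rightarrow> complex^'n) \<Rightarrow> (int \<Rightarrow> complex \<Rightarrow> complex^'n)"
    and F :: "complex \<Rightarrow> complex^'n" and m :: int
  assumes "P \<in> M1D" and F: "\<And>j. (\<lambda>\<tau>. F \<tau> $ j) holomorphic_on UHP"
  defines "N \<equiv> {X. (\<forall>k. k < m \<or> k = m + 1 \<longrightarrow> X k = (\<lambda>_. 0)) \<and> (\<exists>c. X m = on_UHP (\<lambda>\<tau>. c *s F \<tau>)) \<and>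
    (\<forall>\<tau>. \<tau> \<notin> UHP \<longrightarrow> X (m + 2) \<tau> = 0)}"
  shows "\<exists>c d. \<forall>X\<in>N. P X \<in> N \<and> P X m = (\<lambda>\<tau>. c *s X m \<tau>) \<and>
    P X (m + 2) = (\<lambda>\<tau>. c *s X (m + 2) \<tau> + d *s modular_deriv m (X m) \<tau>)"
  using assms(1)
proof (induction rule: M1D.induct)
  case (mult f)
  have fin: "finite {i. f i \<noteq> (\<lambda>_. 0)}" and f: "f i \<in> M1_weight i" for i
    using mult by (auto simp: M1_def direct_sum_def)
  obtain c where c: "f 0 = on_UHP (\<lambda>_. c)" using M1_weight_0E[OF f] by blast
  have f0: "f i = (\<lambda>_. 0)" if "i < 0 \<or> odd i \<or> i = 2" for i using M1_weight_small[OF f that] .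
  have gm: "graded_mult f X k \<tau> = c *s X k \<tau>" if X: "X \<in> N" and k: "k \<le> m + 2" for X k \<tau>
  proof -
    have out: "X k \<tau> = 0" if "\<tau> \<notin> UHP"
    proof -
      consider "k < m \<or> k = m + 1" | "k = m" | "k = m + 2" using k by linarith
      then show ?thesis using X that by cases (auto simp: N_def on_UHP_def)
    qed
    have "f i \<tau> *s X (k - i) \<tau> = (if i = 0 then f 0 \<tau> *s X k \<tau> else 0)" for i
    proof (cases "i = 0 \<or> i < 0 \<or> odd i \<or> i = 2")
      case True
      then show ?thesis using f0[of i] by auto
    next
      case False
      then have "k - i < m" using k by presburger
      then show ?thesis using X False by (auto simp: N_def)
    qed
    then have "graded_mult f X k \<tau> = (\<Sum>i | f i \<noteq> (\<lambda>_. 0). if i = 0 then f 0 \<tau> *s X k \<tau> else 0)"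
      by (simp add: graded_mult_def)
    also have "\<dots> = f 0 \<tau> *s X k \<tau>" by (subst sum.delta[OF fin]) auto
    finally show ?thesis using out by (auto simp: c on_UHP_def)
  qed
  have "graded_mult f X \<in> N" if X: "X \<in> N" for X
  proof -
    from X obtain e where e: "X m = on_UHP (\<lambda>\<tau>. e *s F \<tau>)" by (auto simp: N_def)
    have "graded_mult f X m = on_UHP (\<lambda>\<tau>. (c * e) *s F \<tau>)"
      using gm[OF X, of m] by (auto simp: fun_eq_iff e on_UHP_def vector_smult_assoc)
    moreover have "graded_mult f X k = (\<lambda>_. 0)" if "k < m \<or> k = m + 1" for k
      using gm[OF X, of k] that X by (auto simp: fun_eq_iff N_def)
    moreover have "graded_mult f X (m + 2) \<tau> = 0" if "\<tau> \<notin> UHP" for \<tau>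
      using gm[OF X, of "m + 2"] that X by (auto simp: N_def)
    ultimately show ?thesis by (auto simp: N_def)
  qed
  then show ?case using gm by (intro exI[of _ c] exI[of _ 0]) (auto simp: fun_eq_iff)
next
  case deriv
  have D0: "modular_deriv k (\<lambda>_. 0 :: complex^'n) = (\<lambda>_. 0)" for k
    by (auto simp: modular_deriv_def on_UHP_def fun_eq_iff vec_eq_iff)
  have low: "graded_deriv X k = (\<lambda>_. 0)" if "X \<in> N" "k < m + 2" for X k
    using that D0 by (auto simp: graded_deriv_def N_def)
  have "graded_deriv X \<in> N" if X: "X \<in> N" for X
  proof -
    have "graded_deriv X m = on_UHP (\<lambda>\<tau>. 0 *s F \<tau>)" using low[OF X, of m] by (auto simp: on_UHP_def)
    moreover have "graded_deriv X (m + 2) \<tau> = 0" if "\<tau> \<notin> UHP" for \<tau>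
      using that by (simp add: graded_deriv_def modular_deriv_def on_UHP_def)
    moreover have "graded_deriv X k = (\<lambda>_. 0)" if "k < m \<or> k = m + 1" for k using low[OF X, of k] that by auto
    ultimately show ?thesis unfolding N_def by blast
  qed
  moreover have "graded_deriv X m = (\<lambda>\<tau>. 0 *s X m \<tau>)" if "X \<in> N" for X using low[OF that, of m] by simp
  moreover have "graded_deriv X (m + 2) = (\<lambda>\<tau>. 0 *s X (m + 2) \<tau> + 1 *s modular_deriv m (X m) \<tau>)" for X
    by (simp add: graded_deriv_def)
  ultimately show ?case by (intro exI[of _ 0] exI[of _ 1] ballI conjI)
next
  case (add P Q)
  from add.IH(1) obtain c d where
    P: "\<forall>X\<in>N. P X \<in> N \<and> P X m = (\<lambda>\<tau>. c *s X m \<tau>) \<and> P X (m + 2) = (\<lambda>\<tau>. c *s X (m + 2) \<tau> + d *s modular_deriv m (X m) \<tau>)"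
    by blast
  from add.IH(2) obtain c' d' where
    Q: "\<forall>X\<in>N. Q X \<in> N \<and> Q X m = (\<lambda>\<tau>. c' *s X m \<tau>) \<and> Q X (m + 2) = (\<lambda>\<tau>. c' *s X (m + 2) \<tau> + d' *s modular_deriv m (X m) \<tau>)"
    by blast
  have "(\<lambda>k \<tau>. P X k \<tau> + Q X k \<tau>) \<in> N" if "X \<in> N" for X
  proof -
    have PN: "P X \<in> N" and QN: "Q X \<in> N" using P Q that by blast+
    from PN obtain a where a: "P X m = on_UHP (\<lambda>\<tau>. a *s F \<tau>)" by (auto simp: N_def)
    from QN obtain b where b: "Q X m = on_UHP (\<lambda>\<tau>. b *s F \<tau>)" by (auto simp: N_def)
    have "(\<lambda>\<tau>. P X m \<tau> + Q X m \<tau>) = on_UHP (\<lambda>\<tau>. (a + b) *s F \<tau>)"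
      by (auto simp: a b on_UHP_def fun_eq_iff vec.scale_left_distrib)
    then have "\<exists>c. (\<lambda>\<tau>. P X m \<tau> + Q X m \<tau>) = on_UHP (\<lambda>\<tau>. c *s F \<tau>)" by (rule exI)
    then show ?thesis using PN QN unfolding N_def by (simp del: vec.scale_left_distrib)
  qed
  then show ?case using P Q by (intro exI[of _ "c + c'"] exI[of _ "d + d'"]) (auto simp: vec.scale_left_distrib)
next
  case (comp P Q)
  from comp.IH(1) obtain c d where
    P: "\<forall>X\<in>N. P X \<in> N \<and> P X m = (\<lambda>\<tau>. c *s X m \<tau>) \<and> P X (m + 2) = (\<lambda>\<tau>. c *s X (m + 2) \<tau> + d *s modular_deriv m (X m) \<tau>)"
    by blast
  from comp.IH(2) obtain c' d' where
    Q: "\<forall>X\<in>N. Q X \<in> N \<and> Q X m = (\<lambda>\<tau>. c' *s X m \<tau>) \<and> Q X (m + 2) = (\<lambda>\<tau>. c' *s X (m + 2) \<tau> + d' *s modular_deriv m (X m) \<tau>)"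
    by blast
  have D: "modular_deriv m (Q X m) = (\<lambda>\<tau>. c' *s modular_deriv m (X m) \<tau>)" if X: "X \<in> N" for X
  proof -
    from X obtain e where e: "X m = on_UHP (\<lambda>\<tau>. e *s F \<tau>)" by (auto simp: N_def)
    have "vector_deriv m (Q X m) \<tau> = c' *s vector_deriv m (X m) \<tau>" if \<tau>: "\<tau> \<in> UHP" for \<tau>
    proof -
      have "vector_deriv m (X m) \<tau> = e *s vector_deriv m F \<tau>"
        using vector_deriv_cong[OF \<tau>, of "X m" "\<lambda>\<tau>. e *s F \<tau>"] vector_deriv_smult[OF F \<tau>] by (simp add: e on_UHP_def)
      moreover have "vector_deriv m (Q X m) \<tau> = (c' * e) *s vector_deriv m F \<tau>"
        using vector_deriv_cong[OF \<tau>, of "Q X m" "\<lambda>\<tau>. (c' * e) *s F \<tau>"] vector_deriv_smult[OF F \<tau>] Q X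
        by (simp add: e on_UHP_def vector_smult_assoc)
      ultimately show ?thesis by (simp add: vector_smult_assoc)
    qed
    then show ?thesis by (auto simp: modular_deriv_eq on_UHP_def)
  qed
  \<comment> \<open>Operators compose like dual numbers: \<open>(c + d D)(c' + d' D)\<close> is
    taken modulo \<open>D^2\<close>.\<close>
  show ?case
  proof (rule exI[of _ "c * c'"], rule exI[of _ "c * d' + d * c'"], rule ballI)
    fix X assume X: "X \<in> N"
    then have Q': "Q X \<in> N" "Q X m = (\<lambda>\<tau>. c' *s X m \<tau>)"
      "Q X (m + 2) = (\<lambda>\<tau>. c' *s X (m + 2) \<tau> + d' *s modular_deriv m (X m) \<tau>)" using Q by blast+
    have P': "P (Q X) \<in> N" "P (Q X) m = (\<lambda>\<tau>. c *s Q X m \<tau>)"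
      "P (Q X) (m + 2) = (\<lambda>\<tau>. c *s Q X (m + 2) \<tau> + d *s modular_deriv m (Q X m) \<tau>)" using P Q'(1) by blast+
    show "(P \<circ> Q) X \<in> N \<and> (P \<circ> Q) X m = (\<lambda>\<tau>. (c * c') *s X m \<tau>) \<and>
      (P \<circ> Q) X (m + 2) = (\<lambda>\<tau>. (c * c') *s X (m + 2) \<tau> + (c * d' + d * c') *s modular_deriv m (X m) \<tau>)"
      using P'(1) unfolding o_apply P'(2,3) D[OF X] unfolding Q'(2,3)
      by (simp add: vector_smult_assoc vec.scale_right_distrib vec.scale_left_distrib add.assoc)
  qed
qed

text \<open>Since \<open>b j0\<close> is reached from a generator, the weight \<open>m\<close> part
  of the generator is a nonzero multiple of \<open>b j0\<close>. An operator producing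
  \<open>b j2\<close> alone must kill that part, so it acts as \<open>d D\<close> and makes
  \<open>b j2\<close> proportional to \<open>b j1\<close>.\<close>

theorem free_basis_not_cyclic:
  assumes rep: "representation \<rho>" and fb: "free_basis \<rho> L w b"
    and m: "w j0 = m" "\<And>j. j \<noteq> j0 \<Longrightarrow> m + 2 \<le> w j"
    and j1: "b j1 = modular_deriv m (b j0)" and j2: "w j2 = m + 2" "j2 \<noteq> j1"
  shows "\<not> cyclic_M1D_module (graded_forms \<rho> L)"
proof
  assume "cyclic_M1D_module (graded_forms \<rho> L)"
  then obtain X where X: "X \<in> graded_forms \<rho> L" "graded_forms \<rho> L = {P X | P. P \<in> M1D}"
    unfolding cyclic_M1D_module_def by blast
  have b: "b j \<in> modular_forms \<rho> L (w j)" for j using fb by (simp add: free_basis_def)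
  note b0 = modular_formsD[OF b[of j0]]
  from graded_forms_coordinates[OF rep fb X(1)] obtain c where
    c: "\<And>j. c j \<in> M1" "\<And>k \<tau>. X k \<tau> = (\<Sum>j\<in>UNIV. c j (k - w j) \<tau> *s b j \<tau>)" by blast
  have cw: "c j k \<in> M1_weight k" for j k using c(1)[of j] by (simp add: M1_def direct_sum_def)
  have c0: "c j k = (\<lambda>_. 0)" if "k < 0 \<or> odd k" for j k using M1_weight_small[OF cw] that by blast
  obtain e where e: "c j0 0 = on_UHP (\<lambda>_. e)" using M1_weight_0E[OF cw] by blast
  have low: "X k = (\<lambda>_. 0)" if "k < m \<or> k = m + 1" for k
  proof -
    have "k - w j < 0 \<or> odd (k - w j)" for j using that m by (cases "j = j0") force+
    then show ?thesis using c0 by (simp add: c(2) fun_eq_iff)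
  qed
  have Xm: "X m = on_UHP (\<lambda>\<tau>. e *s b j0 \<tau>)"
  proof
    fix \<tau>
    have "c j (m - w j) \<tau> *s b j \<tau> = (if j = j0 then on_UHP (\<lambda>\<tau>. e *s b j0 \<tau>) \<tau> else 0)" for j
      using c0[of "m - w j" j] m(2)[of j] by (auto simp: m(1) e on_UHP_def)
    then show "X m \<tau> = on_UHP (\<lambda>\<tau>. e *s b j0 \<tau>) \<tau>" unfolding c(2) by simp
  qed
  have "X (m + 2) \<in> modular_forms \<rho> L (m + 2)" using X(1) by (simp add: graded_forms_def direct_sum_def)
  note out = modular_formsD(1)[OF this]
  have D: "modular_deriv m (X m) \<tau> = e *s b j1 \<tau>" if \<tau>: "\<tau> \<in> UHP" for \<tau>
    using vector_deriv_cong[OF \<tau>, of "X m" "\<lambda>\<tau>. e *s b j0 \<tau>"] vector_deriv_smult[OF b0(2) \<tau>] \<tau>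
    by (simp add: j1 modular_deriv_eq on_UHP_def Xm)
  have act: "\<exists>c d. P X m = (\<lambda>\<tau>. c *s X m \<tau>) \<and> P X (m + 2) = (\<lambda>\<tau>. c *s X (m + 2) \<tau> + d *s modular_deriv m (X m) \<tau>)" if "P \<in> M1D" for P
    using M1D_low_weights[OF that, of "b j0" m] b0(2) low Xm out by blast
  have "homogeneous m (b j0) \<in> graded_forms \<rho> L" "homogeneous (m + 2) (b j2) \<in> graded_forms \<rho> L"
    using b m(1) j2(1) by (metis homogeneous_in_graded_forms)+
  then obtain P Q where P: "P \<in> M1D" "P X = homogeneous m (b j0)" and Q: "Q \<in> M1D" "Q X = homogeneous (m + 2) (b j2)"
    unfolding X(2) by force
  have i: "\<i> \<in> UHP" by (simp add: UHP_def)
  from act[OF P(1)] obtain s where "b j0 = (\<lambda>\<tau>. s *s X m \<tau>)" unfolding P(2) homogeneous_def by auto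
  then have s: "b j0 \<tau> = s *s on_UHP (\<lambda>\<tau>. e *s b j0 \<tau>) \<tau>" for \<tau> unfolding Xm by (rule fun_cong)
  have "e \<noteq> 0"
  proof
    assume "e = 0"
    then have "b j0 = (\<lambda>_. 0)" by (subst fun_eq_iff, subst s) (simp add: on_UHP_def)
    then show False using free_basis_nonzero[OF fb, of j0] by blast
  qed
  from act[OF Q(1)] obtain s t where st: "(\<lambda>_. 0) = (\<lambda>\<tau>. s *s X m \<tau>)"
    "b j2 = (\<lambda>\<tau>. s *s X (m + 2) \<tau> + t *s modular_deriv m (X m) \<tau>)" unfolding Q(2) homogeneous_def by auto
  have "s = 0"
  proof (rule ccontr)
    assume "s \<noteq> 0"
    then have X0: "X m \<tau> = 0" for \<tau> using fun_cong[OF st(1), of \<tau>] by simp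
    have "b j0 \<tau> = 0" for \<tau> using s[of \<tau>] unfolding X0[unfolded Xm] by simp
    then have "b j0 = (\<lambda>_. 0)" by (rule ext)
    then show False using free_basis_nonzero[OF fb, of j0] by blast
  qed
  then have "b j2 \<i> = (t * e) *s b j1 \<i>" using st(2) D[OF i] by (simp add: vector_smult_assoc)
  then have "(\<Sum>j\<in>UNIV. (if j = j2 then 1 else 0) *s b j \<i>) = (\<Sum>j\<in>UNIV. (if j = j1 then t * e else 0) *s b j \<i>)"
    by (simp add: if_distrib[of "\<lambda>c. c *s _"] cong: if_cong)
  from fun_cong[OF free_basis_independent[OF fb i this], of j2] show False using j2(2) by simp
qed

subsection \<open>Eigenvalues of the tensor product exponents\<close>

lemma elem_sym_0: "elem_sym n 0 f = 1"
proof -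
  have "{S. S \<subseteq> {1..n} \<and> card S = 0} = {{}}" by (auto dest: finite_subset)
  then show ?thesis by (simp add: elem_sym_def)
qed

lemma elem_sym_0_Suc: "elem_sym 0 (Suc d) f = 0"
proof -
  have "{S. S \<subseteq> {1..0::nat} \<and> card S = Suc d} = {}" by auto
  then show ?thesis by (simp only: elem_sym_def sum.empty)
qed

text \<open>Subsets are split according to whether they contain \<open>Suc n\<close>.\<close>

lemma elem_sym_Suc: "elem_sym (Suc n) (Suc d) f = elem_sym n (Suc d) f + f (Suc n) * elem_sym n d f"
proof -
  let ?A = "\<lambda>d. {S. S \<subseteq> {1..n} \<and> card S = d}"
  have fin: "finite (?A d)" for d by (rule finite_subset[of _ "Pow {1..n}"]) auto
  have finS: "finite S" if "S \<subseteq> {1..n}" for S using that by (rule finite_subset) simp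
  have "{S. S \<subseteq> {1..Suc n} \<and> card S = Suc d} = ?A (Suc d) \<union> insert (Suc n) ` ?A d"
  proof (intro equalityI subsetI)
    fix S assume S: "S \<in> {S. S \<subseteq> {1..Suc n} \<and> card S = Suc d}"
    then have S': "finite S" by (auto intro: finite_subset)
    show "S \<in> ?A (Suc d) \<union> insert (Suc n) ` ?A d"
    proof (cases "Suc n \<in> S")
      case True
      have "S = insert (Suc n) (S - {Suc n})" using True by auto
      moreover have "S - {Suc n} \<in> ?A d" using S S' True by (auto simp: card_Diff_singleton)
      ultimately show ?thesis by blast
    next
      case False
      then have "S \<subseteq> {1..n}" using S by (auto simp: subset_iff) (metis le_Suc_eq)
      then show ?thesis using S by auto
    qed
  next
    fix S assume "S \<in> ?A (Suc d) \<union> insert (Suc n) ` ?A d"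
    then show "S \<in> {S. S \<subseteq> {1..Suc n} \<and> card S = Suc d}"
    proof
      assume "S \<in> insert (Suc n) ` ?A d"
      then obtain R where R: "S = insert (Suc n) R" "R \<subseteq> {1..n}" "card R = d" by auto
      have "Suc n \<notin> R" using R(2) by auto
      then show ?thesis using R finS[OF R(2)] by auto
    qed auto
  qed
  moreover have "?A (Suc d) \<inter> insert (Suc n) ` ?A d = {}" by auto
  moreover have "inj_on (insert (Suc n)) (?A d)"
  proof (rule inj_onI)
    fix R S assume "R \<in> ?A d" "S \<in> ?A d" "insert (Suc n) R = insert (Suc n) S"
    moreover from this have "Suc n \<notin> R" "Suc n \<notin> S" by auto
    ultimately show "R = S" by (simp add: insert_ident)
  qed
  moreover have "(\<Sum>S\<in>?A d. \<Prod>j\<in>insert (Suc n) S. f j) = f (Suc n) * (\<Sum>S\<in>?A d. \<Prod>j\<in>S. f j)"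
    unfolding sum_distrib_left
  proof (rule sum.cong)
    fix S assume "S \<in> ?A d"
    then have "finite S" "Suc n \<notin> S" using finS by auto
    then show "(\<Prod>j\<in>insert (Suc n) S. f j) = f (Suc n) * (\<Prod>j\<in>S. f j)" by simp
  qed simp
  ultimately show ?thesis
    unfolding elem_sym_def by (simp add: sum.union_disjoint fin sum.reindex)
qed

lemma elem_sym_4:
  "elem_sym 4 1 f = f 1 + f 2 + f 3 + f 4"
  "elem_sym 4 2 f = f 1 * f 2 + f 1 * f 3 + f 1 * f 4 + f 2 * f 3 + f 2 * f 4 + f 3 * f 4"
  "elem_sym 4 3 f = f 1 * f 2 * f 3 + f 1 * f 2 * f 4 + f 1 * f 3 * f 4 + f 2 * f 3 * f 4"
  "elem_sym 4 4 f = f 1 * f 2 * f 3 * f 4"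
  by (simp_all add: elem_sym_Suc elem_sym_0 elem_sym_0_Suc eval_nat_numeral algebra_simps)

text \<open>The leading terms cancel, and the values at \<open>0\<close>, \<open>1\<close>,
  \<open>-1\<close> and \<open>2\<close> form a linear system for the remaining
  coefficients.\<close>

lemma quartic_eqD:
  fixes a1 :: complex
  assumes "\<And>y. y ^ 4 - a1 * y ^ 3 + a2 * y\<^sup>2 - a3 * y + a4 = y ^ 4 - b1 * y ^ 3 + b2 * y\<^sup>2 - b3 * y + b4"
  shows "a2 = b2" "a3 = b3" "a4 = b4"
proof -
  have 0: "a4 = b4" using assms[of 0] by simp
  have 1: "- a1 + a2 - a3 = - b1 + b2 - b3" using assms[of 1] 0 by (simp add: algebra_simps)
  have 2: "a1 + a2 + a3 = b1 + b2 + b3" using assms[of "-1"] 0 by (simp add: algebra_simps)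
  have 3: "- (8 * a1) + 4 * a2 - 2 * a3 = - (8 * b1) + 4 * b2 - 2 * b3" using assms[of 2] 0 by (simp add: algebra_simps)
  have "2 * a2 = 2 * b2" using 1 2 by algebra
  then show 4: "a2 = b2" by simp
  have "6 * a3 = 6 * b3" using 1 2 3 by algebra
  then show "a3 = b3" by simp
qed (use assms[of 0] in simp)

text \<open>Triangularity is measured by an injective rank, as the index type need not be ordered. A
  permutation with a nonzero contribution never lowers the rank, and the total rank is fixed, so it
  is the identity.\<close>

lemma det_triangular:
  fixes N :: "complex^'n^'n" and rk :: "'n \<Rightarrow> nat"
  assumes inj: "inj rk" and N: "\<And>p q. rk q < rk p \<Longrightarrow> N $ p $ q = 0"
  shows "det N = (\<Prod>p\<in>UNIV. N $ p $ p)"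
proof -
  have zero: "(\<Prod>p\<in>UNIV. N $ p $ \<pi> p) = 0" if \<pi>: "\<pi> permutes UNIV" "\<pi> \<noteq> id" for \<pi>
  proof (rule ccontr)
    assume "(\<Prod>p\<in>UNIV. N $ p $ \<pi> p) \<noteq> 0"
    then have "N $ p $ \<pi> p \<noteq> 0" for p by simp
    then have le: "rk p \<le> rk (\<pi> p)" for p using N[of "\<pi> p" p] by (meson not_le)
    have "(\<Sum>p\<in>UNIV. rk (\<pi> p)) = (\<Sum>p\<in>UNIV. rk p)"
      using sum.permute[OF \<pi>(1), of rk] by (simp add: o_def)
    then have "rk (\<pi> p) = rk p" for p
      using le sum_mono_inv[of rk UNIV "\<lambda>p. rk (\<pi> p)" p] by simp
    then have "\<pi> = id" using inj by (auto simp: inj_def fun_eq_iff)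
    then show False using \<pi>(2) by simp
  qed
  have "det N = (\<Sum>\<pi> | \<pi> permutes (UNIV :: 'n set). if \<pi> = id then (\<Prod>p\<in>UNIV. N $ p $ p) else 0)"
    unfolding det_def by (intro sum.cong) (auto simp: zero sign_id)
  also have "\<dots> = (\<Prod>p\<in>UNIV. N $ p $ p)"
    by (subst sum.delta) (auto simp: permutes_id finite_permutations)
  finally show ?thesis .
qed

lemma kronecker_inverse:
  assumes "P ** P' = mat 1" "Q ** Q' = mat 1"
  shows "kronecker P Q ** kronecker P' Q' = mat 1"
  by (simp add: kronecker_mult assms kronecker_mat_1)

lemma det_kronecker_nonzero:
  assumes "det P \<noteq> 0" "det Q \<noteq> 0"
  shows "det (kronecker P Q) \<noteq> 0"
proof -
  from assms obtain P' Q' where "P ** P' = mat 1" "Q ** Q' = mat 1"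
    unfolding invertible_det_nz[symmetric] invertible_def by blast
  from arg_cong[OF kronecker_inverse[OF this], of det] show ?thesis by (auto simp: det_mul det_I)
qed

lemma tensor_exponents_kronecker:
  assumes "L ** P = P ** L'" "M ** Q = Q ** M'"
  shows "tensor_exponents L M ** kronecker P Q = kronecker P Q ** tensor_exponents L' M'"
proof -
  have distrib: "(X + Y) ** Z = X ** Z + Y ** Z" for X Y Z :: "complex^('a \<times> 'b)^('a \<times> 'b)"
    by (simp add: vec_eq_iff matrix_mult_nth distrib_right sum.distrib)
  show ?thesis
    unfolding tensor_exponents_def distrib matrix_add_ldistrib kronecker_mult assms by simp
qed

lemma det_mat_minus_similar:
  fixes X :: "complex^'n^'n"
  assumes "X ** P = P ** Y" "det P \<noteq> 0"
  shows "det (mat y - X) = det (mat y - Y)"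
proof -
  have "mat y ** P = P ** mat y"
    unfolding vec_eq_iff mat_mult_nth by (simp add: matrix_mult_nth mat_def if_distrib[of "times _"] mult.commute cong: if_cong)
  then have "(mat y - X) ** P = P ** (mat y - Y)"
    using assms(1) by (simp add: vec_eq_iff matrix_mult_nth left_diff_distrib right_diff_distrib sum_subtractf)
  from arg_cong[OF this, of det] assms(2) show ?thesis by (simp add: det_mul)
qed

lemma trace_tensor_exponents:
  fixes L M :: "complex^2^2"
  shows "trace (tensor_exponents L M) = 2 * trace L + 2 * trace M"
  by (simp add: trace_def tensor_exponents_def kronecker_def mat_def UNIV_prod_sum sum_2 algebra_simps)

text \<open>Conjugation by \<open>kronecker P Q\<close> makes the exponents triangular for the
  lexicographic order on index pairs, with sums of eigenvalues on the diagonal.\<close>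

lemma det_tensor_exponents:
  fixes L M P Q :: "complex^2^2"
  assumes L: "L ** P = P ** mat2 r x 0 s" "det P \<noteq> 0" and M: "M ** Q = Q ** mat2 r' x' 0 s'" "det Q \<noteq> 0"
  shows "det (mat y - tensor_exponents L M) = (y - (r + r')) * (y - (r + s')) * (y - (s + r')) * (y - (s + s'))"
proof -
  let ?Y = "mat y - tensor_exponents (mat2 r x 0 s) (mat2 r' x' 0 s')"
  define rk :: "2 \<times> 2 \<Rightarrow> nat" where "rk = (\<lambda>p. (if fst p = 1 then 0 else 2) + (if snd p = 1 then 0 else 1))"
  have entries: "inj rk" "\<And>p q. rk q < rk p \<Longrightarrow> ?Y $ p $ q = 0"
  proof -
    show "inj rk"
    proof (rule injI)
      fix p q assume *: "rk p = rk q"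
      obtain a b c d where "p = (a, b)" "q = (c, d)" by fastforce
      then show "p = q" using * exhaust_2[of a] exhaust_2[of b] exhaust_2[of c] exhaust_2[of d]
        by (auto simp: rk_def)
    qed
    fix p q assume *: "rk q < rk p"
    obtain a b c d where "p = (a, b)" "q = (c, d)" by fastforce
    then show "?Y $ p $ q = 0" using * exhaust_2[of a] exhaust_2[of b] exhaust_2[of c] exhaust_2[of d]
      by (auto simp: rk_def tensor_exponents_def kronecker_def mat_def)
  qed
  have "det (mat y - tensor_exponents L M) = det ?Y"
    by (rule det_mat_minus_similar[OF tensor_exponents_kronecker[OF L(1) M(1)] det_kronecker_nonzero[OF L(2) M(2)]])
  also have "\<dots> = (\<Prod>p\<in>UNIV. ?Y $ p $ p)" by (rule det_triangular[OF entries])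
  also have "\<dots> = (\<Prod>a\<in>UNIV. \<Prod>b\<in>UNIV. ?Y $ (a, b) $ (a, b))"
    unfolding UNIV_Times_UNIV[symmetric] prod.cartesian_product by simp
  also have "\<dots> = (y - (r + r')) * (y - (r + s')) * (y - (s + r')) * (y - (s + s'))"
    by (simp add: UNIV_2 tensor_exponents_def kronecker_def mat_def algebra_simps)
  finally show ?thesis .
qed

text \<open>Comparing characteristic polynomials avoids matching \<open>e\<close> with a particular
  listing of the eigenvalues. With \<open>z = y - 1/6\<close> the product over the four sign choices
  is \<open>z^4 - 2 (u^2 + v^2) z^2 + (u^2 - v^2)^2\<close>.\<close>

lemma elem_sym_tensor_exponents:
  fixes L M P Q :: "complex^2^2" and e :: "nat \<Rightarrow> complex"
  assumes L: "L ** P = P ** mat2 (trace L / 2 + u) x 0 (trace L / 2 - u)" "det P \<noteq> 0"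
    and M: "M ** Q = Q ** mat2 (trace M / 2 + v) x' 0 (trace M / 2 - v)" "det Q \<noteq> 0"
    and e: "eigenvalues_of (tensor_exponents L M) e"
  defines "f \<equiv> \<lambda>j. e j - 1/4 * trace (tensor_exponents L M) + 1/6"
  shows "elem_sym 4 2 f = 1/6 - 2 * (u\<^sup>2 + v\<^sup>2)"
    "elem_sym 4 3 f = 1/54 - 2/3 * (u\<^sup>2 + v\<^sup>2)"
    "elem_sym 4 4 f = 1/1296 - (u\<^sup>2 + v\<^sup>2) / 18 + (u\<^sup>2 - v\<^sup>2)\<^sup>2"
proof -
  define t where "t = (trace L + trace M) / 2"
  have tr: "1/4 * trace (tensor_exponents L M) = t" by (simp add: trace_tensor_exponents t_def)
  have "y ^ 4 - elem_sym 4 1 f * y ^ 3 + elem_sym 4 2 f * y\<^sup>2 - elem_sym 4 3 f * y + elem_sym 4 4 f =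
      y ^ 4 - (2/3) * y ^ 3 + (1/6 - 2 * (u\<^sup>2 + v\<^sup>2)) * y\<^sup>2 - (1/54 - 2/3 * (u\<^sup>2 + v\<^sup>2)) * y +
      (1/1296 - (u\<^sup>2 + v\<^sup>2) / 18 + (u\<^sup>2 - v\<^sup>2)\<^sup>2)" for y
  proof -
    have "y ^ 4 - elem_sym 4 1 f * y ^ 3 + elem_sym 4 2 f * y\<^sup>2 - elem_sym 4 3 f * y + elem_sym 4 4 f =
        (y - f 1) * (y - f 2) * (y - f 3) * (y - f 4)"
      unfolding elem_sym_4 by algebra
    also have "\<dots> = (\<Prod>j=1..CARD(2 \<times> 2). (y + t - 1/6) - e j)"
    proof -
      have 1: "{1..CARD(2 \<times> 2)} = {1, 2, 3, 4::nat}" by auto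
      have 2: "y - f j = (y + t - 1/6) - e j" for j unfolding f_def tr by simp
      show ?thesis unfolding 1 2 by (simp add: mult.assoc)
    qed
    also have "\<dots> = det (mat (y + t - 1/6) - tensor_exponents L M)" using e by (simp add: eigenvalues_of_def)
    also have "\<dots> = (y - 1/6 - (u + v)) * (y - 1/6 - (u - v)) * (y - 1/6 - (- u + v)) * (y - 1/6 - (- u - v))"
      unfolding det_tensor_exponents[OF L M] t_def by (intro arg_cong2[of _ _ _ _ times]) (simp_all add: add_divide_distrib)
    also have "\<dots> = ((y - 1/6)\<^sup>2)\<^sup>2 - 2 * (u\<^sup>2 + v\<^sup>2) * (y - 1/6)\<^sup>2 + (u\<^sup>2 - v\<^sup>2)\<^sup>2"
      by algebra
    also have "\<dots> = y ^ 4 - (2/3) * y ^ 3 + (1/6 - 2 * (u\<^sup>2 + v\<^sup>2)) * y\<^sup>2 - (1/54 - 2/3 * (u\<^sup>2 + v\<^sup>2)) * y +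
      (1/1296 - (u\<^sup>2 + v\<^sup>2) / 18 + (u\<^sup>2 - v\<^sup>2)\<^sup>2)"
      by (simp add: power2_eq_square power3_eq_cube power4_eq_xxxx field_simps)
    finally show ?thesis .
  qed
  from quartic_eqD[OF this] show "elem_sym 4 2 f = 1/6 - 2 * (u\<^sup>2 + v\<^sup>2)"
    "elem_sym 4 3 f = 1/54 - 2/3 * (u\<^sup>2 + v\<^sup>2)"
    "elem_sym 4 4 f = 1/1296 - (u\<^sup>2 + v\<^sup>2) / 18 + (u\<^sup>2 - v\<^sup>2)\<^sup>2" .
qed

subsection \<open>Tensor products of modular forms\<close>

lemma tensor_form_modular:
  fixes \<alpha> :: "int^2^2 \<Rightarrow> complex^'m^'m" and \<beta> :: "int^2^2 \<Rightarrow> complex^'n^'n"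
  assumes rep: "representation (tensor_rep \<alpha> \<beta>)"
    and A: "A \<in> modular_forms \<alpha> L k" and B: "B \<in> modular_forms \<beta> M l"
  shows "tensor_form A B \<in> modular_forms (tensor_rep \<alpha> \<beta>) (tensor_exponents L M) (k + l)"
proof -
  from modular_formsD(5)[OF A] obtain g where g: "\<And>i. (\<lambda>q. g q $ i) holomorphic_on ball 0 1"
    "\<And>\<tau>. \<tau> \<in> UHP \<Longrightarrow> twist L \<tau> *v A \<tau> = g (nome \<tau>)" by blast
  from modular_formsD(5)[OF B] obtain h where h: "\<And>i. (\<lambda>q. h q $ i) holomorphic_on ball 0 1"
    "\<And>\<tau>. \<tau> \<in> UHP \<Longrightarrow> twist M \<tau> *v B \<tau> = h (nome \<tau>)" by blast
  show ?thesis
  proof (rule modular_formsI[OF rep, where h = "\<lambda>q. \<chi> p. g q $ fst p * h q $ snd p"])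
    show "tensor_form A B \<tau> = 0" if "\<tau> \<notin> UHP" for \<tau>
      using modular_formsD(1)[OF A that] by (simp add: tensor_form_def vec_eq_iff)
    show "(\<lambda>\<tau>. tensor_form A B \<tau> $ i) holomorphic_on UHP" for i
      by (simp add: tensor_form_def) (intro holomorphic_intros modular_formsD(2)[OF A] modular_formsD(2)[OF B])
    show "(\<lambda>q. (\<chi> p. g q $ fst p * h q $ snd p) $ i) holomorphic_on ball 0 1" for i
      by simp (intro holomorphic_intros g h)
    fix \<tau> assume \<tau>: "\<tau> \<in> UHP"
    show "tensor_form A B (\<tau> + 1) = tensor_rep \<alpha> \<beta> T_mat *v tensor_form A B \<tau>"
      unfolding tensor_form_def tensor_rep_def kronecker_mult_tensor_form modular_formsD(3)[OF A \<tau>] modular_formsD(3)[OF B \<tau>] ..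
    have "\<tau> powi (k + l) = \<tau> powi k * \<tau> powi l" using UHP_nonzero[OF \<tau>] by (simp add: power_int_add)
    then show "tensor_form A B (-1/\<tau>) = \<tau> powi (k + l) *s (tensor_rep \<alpha> \<beta> S_mat *v tensor_form A B \<tau>)"
      unfolding tensor_form_def tensor_rep_def kronecker_mult_tensor_form modular_formsD(4)[OF A \<tau>] modular_formsD(4)[OF B \<tau>]
      by (simp add: vec_eq_iff)
    show "twist (tensor_exponents L M) \<tau> *v tensor_form A B \<tau> = (\<chi> p. g (nome \<tau>) $ fst p * h (nome \<tau>) $ snd p)"
      unfolding mat_mult_tensor_exponents matrix_exp_tensor_exponents tensor_form_def kronecker_mult_tensor_form g(2)[OF \<tau>] h(2)[OF \<tau>] ..
  qed
qed

text \<open>The twist for the tensor product exponents is the Kronecker product of the twists. Hence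
  so is the fundamental matrix, and it stays invertible at the cusp.\<close>

theorem free_basis_tensor:
  fixes \<alpha> :: "int^2^2 \<Rightarrow> complex^'m^'m" and \<beta> :: "int^2^2 \<Rightarrow> complex^'n^'n"
  assumes rep: "representation (tensor_rep \<alpha> \<beta>)"
    and A: "free_basis \<alpha> L v a" and B: "free_basis \<beta> M w b"
  shows "free_basis (tensor_rep \<alpha> \<beta>) (tensor_exponents L M) (\<lambda>p. v (fst p) + w (snd p))
    (\<lambda>p. tensor_form (a (fst p)) (b (snd p)))"
proof -
  from A obtain \<Phi> where \<Phi>: "\<And>i j. (\<lambda>q. \<Phi> q $ i $ j) holomorphic_on ball 0 1"
    "\<And>q. q \<in> ball 0 1 \<Longrightarrow> det (\<Phi> q) \<noteq> 0"
    "\<And>\<tau> j. \<tau> \<in> UHP \<Longrightarrow> twist L \<tau> *v a j \<tau> = column j (\<Phi> (nome \<tau>))"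
    unfolding free_basis_def by blast
  from B obtain \<Psi> where \<Psi>: "\<And>i j. (\<lambda>q. \<Psi> q $ i $ j) holomorphic_on ball 0 1"
    "\<And>q. q \<in> ball 0 1 \<Longrightarrow> det (\<Psi> q) \<noteq> 0"
    "\<And>\<tau> j. \<tau> \<in> UHP \<Longrightarrow> twist M \<tau> *v b j \<tau> = column j (\<Psi> (nome \<tau>))"
    unfolding free_basis_def by blast
  show ?thesis
    unfolding free_basis_def
  proof (intro conjI exI[of _ "\<lambda>q. kronecker (\<Phi> q) (\<Psi> q)"] allI ballI)
    show "tensor_form (a (fst p)) (b (snd p)) \<in> modular_forms (tensor_rep \<alpha> \<beta>) (tensor_exponents L M) (v (fst p) + w (snd p))" for p
      using A B by (intro tensor_form_modular[OF rep]) (simp_all add: free_basis_def)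
    show "(\<lambda>q. kronecker (\<Phi> q) (\<Psi> q) $ i $ j) holomorphic_on ball 0 1" for i j
      by (simp add: kronecker_def) (intro holomorphic_intros \<Phi> \<Psi>)
    show "det (kronecker (\<Phi> q) (\<Psi> q)) \<noteq> 0" if "q \<in> ball 0 1" for q
      by (rule det_kronecker_nonzero[OF \<Phi>(2)[OF that] \<Psi>(2)[OF that]])
    show "twist (tensor_exponents L M) \<tau> *v tensor_form (a (fst p)) (b (snd p)) \<tau> = column p (kronecker (\<Phi> (nome \<tau>)) (\<Psi> (nome \<tau>)))"
      if "\<tau> \<in> UHP" for \<tau> p
      unfolding mat_mult_tensor_exponents matrix_exp_tensor_exponents tensor_form_def kronecker_mult_tensor_form \<Phi>(3)[OF that] \<Psi>(3)[OF that]
      by (simp add: column_def kronecker_def)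
  qed
qed

lemma vector_deriv_tensor_form:
  assumes "\<And>i. (\<lambda>z. A z $ i) holomorphic_on UHP" "\<And>i. (\<lambda>z. B z $ i) holomorphic_on UHP" "\<tau> \<in> UHP"
  shows "vector_deriv (k + l) (tensor_form A B) \<tau> = tensor_form (modular_deriv k A) B \<tau> + tensor_form A (modular_deriv l B) \<tau>"
  using scalar_deriv_mult[OF assms(1) assms(2) assms(3)] assms(3)
  by (simp add: vec_eq_iff tensor_form_def modular_deriv_eq on_UHP_def)

text \<open>In an index pair, \<open>2\<close> marks a derivative of that factor, so the arguments
  list \<open>A \<otimes> B\<close>, \<open>D A \<otimes> B\<close>, \<open>A \<otimes> D B\<close>,
  \<open>D A \<otimes> D B\<close>.\<close>

definition vec4 :: "'a \<Rightarrow> 'a \<Rightarrow> 'a \<Rightarrow> 'a \<Rightarrow> 'a^(2 \<times> 2)" where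
  "vec4 a b c d = (\<chi> p. if p = (1, 1) then a else if p = (2, 1) then b else if p = (1, 2) then c else d)"

lemma vec4_nth [simp]: "vec4 a b c d $ (1, 1) = a" "vec4 a b c d $ (2, 1) = b"
  "vec4 a b c d $ (1, 2) = c" "vec4 a b c d $ (2, 2) = d"
  by (simp_all add: vec4_def)

lemma forall_2x2: "(\<forall>p :: 2 \<times> 2. P p) \<longleftrightarrow> P (1, 1) \<and> P (2, 1) \<and> P (1, 2) \<and> P (2, 2)"
  by (auto simp: split_paired_All forall_2)

lemma sum_2x2: "(\<Sum>p\<in>(UNIV :: (2 \<times> 2) set). f p) = f (1, 1) + f (2, 1) + f (1, 2) + f (2, 2)"
  for f :: "2 \<times> 2 \<Rightarrow> 'a::comm_monoid_add"
  by (simp add: UNIV_prod_sum sum_2 add_ac)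

text \<open>The coordinates of any form of weight \<open>k\<close> have weights \<open>0\<close> and
  \<open>-2\<close>, hence are a constant and zero. So all forms of minimal weight are multiples of
  one, and basis and equation carry over to each of them.\<close>

lemma minimal_forms_2:
  fixes \<alpha> :: "int^2^2 \<Rightarrow> complex^2^2"
  assumes irr: "irreducible_rep \<alpha>" and L: "choice_of_exponents \<alpha> L"
  obtains k u P x where "of_int k = 6 * trace L - 1"
    "det P \<noteq> 0" "L ** P = P ** mat2 (trace L / 2 + u) x 0 (trace L / 2 - u)"
    "minimal_weight \<alpha> L k"
    "\<And>A. minimal_weight_form \<alpha> L k A \<Longrightarrow>
      free_basis \<alpha> L (\<lambda>j. if j = 1 then k else k + 2) (\<lambda>j. if j = 1 then A else modular_deriv k A)"
    "\<And>A \<tau>. minimal_weight_form \<alpha> L k A \<Longrightarrow> \<tau> \<in> UHP \<Longrightarrow>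
      vector_deriv (k + 2) (vector_deriv k A) \<tau> = ((u\<^sup>2 - 1/144) * E4 \<tau>) *s A \<tau>"
proof (rule minimal_form_2[OF irr L])
  fix k :: int and A u P x
  assume k: "of_int k = 6 * trace L - 1" and P: "det P \<noteq> 0" "L ** P = P ** mat2 (trace L / 2 + u) x 0 (trace L / 2 - u)"
    and A: "A \<in> modular_forms \<alpha> L k"
    and ode: "\<And>\<tau>. \<tau> \<in> UHP \<Longrightarrow> vector_deriv (k + 2) (vector_deriv k A) \<tau> = ((u\<^sup>2 - 1/144) * E4 \<tau>) *s A \<tau>"
    and fb: "free_basis \<alpha> L (\<lambda>j. if j = 1 then k else k + 2) (\<lambda>j. if j = 1 then A else modular_deriv k A)"
  have rep: "representation \<alpha>" using irr by (simp add: irreducible_rep_def)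
  let ?b = "\<lambda>B j. if (j::2) = 1 then B else modular_deriv k B"
  have b: "?b A j \<in> modular_forms \<alpha> L (if j = 1 then k else k + 2)" for j using fb by (simp add: free_basis_def)
  have DA: "modular_deriv k A \<in> modular_forms \<alpha> L (k + 2)" using b[of 2] by simp
  note A' = modular_formsD[OF A]
  have multiple: "\<exists>e. e \<noteq> 0 \<and> B = (\<lambda>\<tau>. e *s A \<tau>)" if "minimal_weight_form \<alpha> L k B" for B
  proof -
    have B: "B \<in> modular_forms \<alpha> L k" "B \<noteq> (\<lambda>_. 0)" using that by (simp_all add: minimal_weight_form_def)
    from free_basis_span[OF rep fb B(1)] obtain c where c: "\<And>j. c j \<in> M1_weight (k - (if j = 1 then k else k + 2))"
      "B = (\<lambda>\<tau>. \<Sum>j\<in>UNIV. c j \<tau> *s ?b A j \<tau>)" by blast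
    have "c 2 \<in> M1_weight (-2)" "c 1 \<in> M1_weight 0" using c(1)[of 2] c(1)[of 1] by simp_all
    then obtain e where e: "c 2 = (\<lambda>_. 0)" "c 1 = on_UHP (\<lambda>_. e)"
      using M1_weight_small[of "c 2" "-2"] M1_weight_0E[of "c 1"] by auto
    have "B \<tau> = e *s A \<tau>" for \<tau>
      using fun_cong[OF c(2), of \<tau>] A'(1)[of \<tau>] by (simp add: sum_2 e on_UHP_def split: if_splits)
    then have eq: "B = (\<lambda>\<tau>. e *s A \<tau>)" by (rule ext)
    then have "e \<noteq> 0" using B(2) by auto
    then show ?thesis using eq by blast
  qed
  have D: "vector_deriv k (\<lambda>z. e *s A z) \<tau> = e *s vector_deriv k A \<tau>" if "\<tau> \<in> UHP" for e \<tau>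
    by (rule vector_deriv_smult[OF A'(2) that])
  have vd: "(\<lambda>z. vector_deriv k A z $ j) holomorphic_on UHP" for j
    unfolding vector_deriv_nth by (rule holomorphic_scalar_deriv[OF A'(2)])
  show thesis
  proof (rule that[OF k P])
    show "minimal_weight \<alpha> L k" using free_basis_minimal_weight[OF rep fb, of 1] by simp
    fix B assume B: "minimal_weight_form \<alpha> L k B"
    obtain e where e: "e \<noteq> 0" "B = (\<lambda>\<tau>. e *s A \<tau>)" using multiple[OF B] by blast
    have DB: "modular_deriv k B = (\<lambda>\<tau>. e *s modular_deriv k A \<tau>)"
      unfolding e(2) modular_deriv_eq using D by (auto simp: on_UHP_def)
    have bB: "?b B j = (\<lambda>\<tau>. e *s ?b A j \<tau>)" for j using DB e(2) by simp
    show "free_basis \<alpha> L (\<lambda>j. if j = 1 then k else k + 2) (?b B)"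
    proof (rule free_basis_change[OF fb, where C = "mat e"])
      show "?b B j \<in> modular_forms \<alpha> L (if j = 1 then k else k + 2)" for j
        using modular_forms_linear[OF b[of j] b[of j] rep, of e 0] unfolding bB vector_smult_lzero add_0_right .
      show "det (mat e :: complex^2^2) \<noteq> 0" using e(1) by (simp add: mat_eq_mat2 det_mat2)
      show "?b B j \<tau> = (\<Sum>i\<in>UNIV. (mat e :: complex^2^2) $ i $ j *s ?b A i \<tau>)" for j \<tau>
        unfolding bB sum_2 mat_eq_mat2 using exhaust_2[of j] by auto
    qed
    fix \<tau> assume \<tau>: "\<tau> \<in> UHP"
    have "vector_deriv (k + 2) (vector_deriv k B) \<tau> = vector_deriv (k + 2) (\<lambda>z. e *s vector_deriv k A z) \<tau>"
      unfolding e(2) by (rule vector_deriv_cong[OF \<tau> D])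
    also have "\<dots> = e *s (((u\<^sup>2 - 1/144) * E4 \<tau>) *s A \<tau>)" unfolding vector_deriv_smult[OF vd \<tau>] ode[OF \<tau>] ..
    finally show "vector_deriv (k + 2) (vector_deriv k B) \<tau> = ((u\<^sup>2 - 1/144) * E4 \<tau>) *s B \<tau>"
      unfolding e(2) vector_smult_assoc by (simp only: mult.commute)
  qed
qed

lemma free_basis_of_derivatives:
  fixes \<rho> :: "int^2^2 \<Rightarrow> complex^(2 \<times> 2)^(2 \<times> 2)"
  assumes irr: "irreducible_rep \<rho>"
    and fb: "free_basis \<rho> \<Lambda> (\<lambda>p. vec4 m (m + 2) (m + 2) (m + 4) $ p) (\<lambda>p. vec4 F U V Q $ p)"
    and DF: "\<And>\<tau>. \<tau> \<in> UHP \<Longrightarrow> vector_deriv m F \<tau> = U \<tau> + V \<tau>"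
    and DU: "\<And>\<tau>. \<tau> \<in> UHP \<Longrightarrow> vector_deriv (m + 2) U \<tau> = (a1 * E4 \<tau>) *s F \<tau> + Q \<tau>"
    and DV: "\<And>\<tau>. \<tau> \<in> UHP \<Longrightarrow> vector_deriv (m + 2) V \<tau> = (a2 * E4 \<tau>) *s F \<tau> + Q \<tau>"
    and DQ: "\<And>\<tau>. \<tau> \<in> UHP \<Longrightarrow> vector_deriv (m + 4) Q \<tau> = (a1 * E4 \<tau>) *s V \<tau> + (a2 * E4 \<tau>) *s U \<tau>"
  defines "DF \<equiv> modular_deriv m F"
    and "H \<equiv> \<lambda>\<tau>. modular_deriv (m + 2) (modular_deriv m F) \<tau> - ((a1 + a2) * E4 \<tau>) *s F \<tau>"
  shows "a1 \<noteq> a2"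
    and "\<exists>G. (\<forall>\<tau>\<in>UHP. (- (a1 - a2)\<^sup>2 * E4 \<tau>) *s G \<tau> = modular_deriv (m + 4) H \<tau> - ((a1 + a2) * E4 \<tau>) *s DF \<tau>) \<and>
      free_basis \<rho> \<Lambda> (\<lambda>p. vec4 m (m + 2) (m + 2) (m + 4) $ p) (\<lambda>p. vec4 F DF G H $ p)"
proof -
  have rep: "representation \<rho>" using irr by (simp add: irreducible_rep_def)
  have mf: "vec4 F U V Q $ p \<in> modular_forms \<rho> \<Lambda> (vec4 m (m + 2) (m + 2) (m + 4) $ p)" for p
    using fb unfolding free_basis_def by blast
  have F: "F \<in> modular_forms \<rho> \<Lambda> m" and U: "U \<in> modular_forms \<rho> \<Lambda> (m + 2)"
    and V: "V \<in> modular_forms \<rho> \<Lambda> (m + 2)" and Q: "Q \<in> modular_forms \<rho> \<Lambda> (m + 4)"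
    using mf[of "(1, 1)"] mf[of "(2, 1)"] mf[of "(1, 2)"] mf[of "(2, 2)"] by simp_all
  note F' = modular_formsD[OF F] and U' = modular_formsD[OF U] and V' = modular_formsD[OF V] and Q' = modular_formsD[OF Q]
  show neq: "a1 \<noteq> a2"
  proof
    assume eq: "a1 = a2"
    \<comment> \<open>All components of \<open>U - V\<close> are multiples of the same power of eta,
      so \<open>X\<close> has a constant direction \<open>v\<close>, which is an eigenvector of
      \<open>\<rho>(S)\<close> and \<open>\<rho>(T)\<close>.\<close>
    define X where "X = (\<lambda>\<tau>. 1 *s U \<tau> + (-1) *s V \<tau>)"
    have X: "X \<in> modular_forms \<rho> \<Lambda> (m + 2)" unfolding X_def by (rule modular_forms_linear[OF U V rep])
    note X' = modular_formsD[OF X]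
    have DX: "vector_deriv (m + 2) X \<tau> = 0" if \<tau>: "\<tau> \<in> UHP" for \<tau>
      unfolding X_def vector_deriv_linear[OF U'(2) V'(2) \<tau>] DU[OF \<tau>] DV[OF \<tau>] eq by simp
    have "\<exists>c. \<forall>\<tau>\<in>UHP. X \<tau> $ i = c * eta_power (m + 2) \<tau>" for i
    proof -
      have "scalar_deriv (m + 2) (\<lambda>z. X z $ i) \<tau> = 0" if "\<tau> \<in> UHP" for \<tau>
        using arg_cong[OF DX[OF that], of "\<lambda>x. x $ i"] by simp
      then obtain c where "X \<tau> $ i = c * eta_power (m + 2) \<tau>" if "\<tau> \<in> UHP" for \<tau>
        by (rule scalar_deriv_eq_0[OF X'(2)]; blast)
      then show ?thesis by (intro exI ballI)
    qed
    then have "\<forall>i. \<exists>c. \<forall>\<tau>\<in>UHP. X \<tau> $ i = c * eta_power (m + 2) \<tau>" by blast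
    from choice[OF this] obtain c where c: "\<And>i \<tau>. \<tau> \<in> UHP \<Longrightarrow> X \<tau> $ i = c i * eta_power (m + 2) \<tau>" by blast
    define v where "v = (\<chi> i. c i)"
    have Xv: "X \<tau> = eta_power (m + 2) \<tau> *s v" if "\<tau> \<in> UHP" for \<tau>
      using c[OF that] by (simp add: vec_eq_iff v_def)
    have i: "\<i> \<in> UHP" "\<i> + 1 \<in> UHP" "-1/\<i> = \<i>" by (simp_all add: UHP_def)
    have "v \<noteq> 0"
    proof
      assume "v = 0"
      then have "U \<i> = V \<i>" using Xv[OF i(1)] by (simp add: X_def)
      then have "(\<Sum>p\<in>UNIV. vec4 0 1 0 0 $ p *s (vec4 F U V Q $ p) \<i>) = (\<Sum>p\<in>UNIV. vec4 0 0 1 0 $ p *s (vec4 F U V Q $ p) \<i>)"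
        by (simp add: sum_2x2)
      from fun_cong[OF free_basis_independent[OF fb i(1) this], of "(2, 1)"] show False by simp
    qed
    moreover have "\<rho> T_mat *v v = inverse (eta_power (m + 2) \<i>) *s (eta_power (m + 2) (\<i> + 1) *s v)"
      using X'(3)[OF i(1)] unfolding Xv[OF i(1)] Xv[OF i(2)] vector_scalar_commute
      by (rule smult_inverse_eq) simp
    moreover have "\<rho> S_mat *v v = inverse (\<i> powi (m + 2) * eta_power (m + 2) \<i>) *s (eta_power (m + 2) \<i> *s v)"
      using X'(4)[OF i(1)] unfolding i(3) Xv[OF i(1)] vector_scalar_commute vector_smult_assoc[of "\<i> powi (m + 2)"]
      by (rule smult_inverse_eq) simp
    moreover have "(1, 1) \<noteq> (2 :: 2, 2 :: 2)" by simp
    ultimately show False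
      unfolding vector_smult_assoc by (intro irreducible_rep_no_eigenvector[OF irr])
  qed
  define d where "d = a1 - a2"
  have d: "d \<noteq> 0" using neq by (simp add: d_def)
  \<comment> \<open>One computes \<open>D H - (a1 + a2) E4 DF = (a1 - a2) E4 (V - U)\<close>; taking
    out the factor \<open>- (a1 - a2)^2 E4\<close> leaves this \<open>G\<close>, which is visibly
    holomorphic at the zeros of \<open>E4\<close>.\<close>
  define G where "G = (\<lambda>\<tau>. (1/d) *s U \<tau> + (-1/d) *s V \<tau>)"
  have DF_eq: "DF = (\<lambda>\<tau>. 1 *s U \<tau> + 1 *s V \<tau>)"
  proof
    show "DF \<tau> = 1 *s U \<tau> + 1 *s V \<tau>" for \<tau>
      using DF[of \<tau>] U'(1)[of \<tau>] V'(1)[of \<tau>] by (cases "\<tau> \<in> UHP") (simp_all add: DF_def modular_deriv_eq on_UHP_def)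
  qed
  have H_eq: "H = (\<lambda>\<tau>. 2 *s Q \<tau> + 0 *s Q \<tau>)"
  proof
    fix \<tau>
    show "H \<tau> = 2 *s Q \<tau> + 0 *s Q \<tau>"
    proof (cases "\<tau> \<in> UHP")
      case \<tau>: True
      have "modular_deriv (m + 2) DF \<tau> = ((a1 * E4 \<tau>) *s F \<tau> + Q \<tau>) + ((a2 * E4 \<tau>) *s F \<tau> + Q \<tau>)"
        unfolding modular_deriv_eq DF_eq using \<tau> vector_deriv_linear[OF U'(2) V'(2) \<tau>, of "m + 2" 1 1]
        by (simp add: on_UHP_def DU DV)
      then show ?thesis unfolding H_def DF_def[symmetric] by (simp add: vec_eq_iff algebra_simps)
    next
      case False
      then show ?thesis using F'(1) Q'(1) by (simp add: H_def modular_deriv_eq on_UHP_def)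
    qed
  qed
  show "\<exists>G. (\<forall>\<tau>\<in>UHP. (- (a1 - a2)\<^sup>2 * E4 \<tau>) *s G \<tau> = modular_deriv (m + 4) H \<tau> - ((a1 + a2) * E4 \<tau>) *s DF \<tau>) \<and>
      free_basis \<rho> \<Lambda> (\<lambda>p. vec4 m (m + 2) (m + 2) (m + 4) $ p) (\<lambda>p. vec4 F DF G H $ p)"
  proof (intro exI[of _ G] conjI ballI)
    fix \<tau> assume \<tau>: "\<tau> \<in> UHP"
    have "modular_deriv (m + 4) H \<tau> = 2 *s ((a1 * E4 \<tau>) *s V \<tau> + (a2 * E4 \<tau>) *s U \<tau>)"
      unfolding modular_deriv_eq H_eq using \<tau> vector_deriv_linear[OF Q'(2) Q'(2) \<tau>, of "m + 4" 2 0]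
      by (simp add: on_UHP_def DQ)
    moreover have "(- (a1 - a2)\<^sup>2 * E4 \<tau>) *s G \<tau> = (d * E4 \<tau>) *s (V \<tau> - U \<tau>)"
      unfolding G_def d_def[symmetric] using d by (simp add: vec_eq_iff field_simps power2_eq_square)
    ultimately show "(- (a1 - a2)\<^sup>2 * E4 \<tau>) *s G \<tau> = modular_deriv (m + 4) H \<tau> - ((a1 + a2) * E4 \<tau>) *s DF \<tau>"
      unfolding DF_eq d_def by (simp add: vec_eq_iff algebra_simps)
  next
    \<comment> \<open>The columns of \<open>C\<close> express \<open>F\<close>, \<open>DF\<close>,
      \<open>G\<close>, \<open>H\<close> in the old basis; \<open>E\<close> is its inverse.\<close>
    define C where "C = vec4 (vec4 1 0 0 0) (vec4 0 1 (1/d) 0) (vec4 0 1 (-1/d) 0) (vec4 0 0 0 2)"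
    define E where "E = vec4 (vec4 1 0 0 0) (vec4 0 (1/2) (1/2) 0) (vec4 0 (d/2) (-d/2) 0) (vec4 0 0 0 (1/2))"
    have "C ** E = mat 1"
      unfolding vec_eq_iff forall_2x2 matrix_mult_nth sum_2x2 C_def E_def mat_def using d by simp
    from arg_cong[OF this, of det] have "det C \<noteq> 0" by (auto simp: det_mul det_I)
    moreover have "vec4 F DF G H $ p \<in> modular_forms \<rho> \<Lambda> (vec4 m (m + 2) (m + 2) (m + 4) $ p)" for p
    proof -
      have "DF \<in> modular_forms \<rho> \<Lambda> (m + 2)" "G \<in> modular_forms \<rho> \<Lambda> (m + 2)" "H \<in> modular_forms \<rho> \<Lambda> (m + 4)"
        unfolding DF_eq G_def H_eq by (rule modular_forms_linear[OF U V rep] modular_forms_linear[OF Q Q rep])+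
      then have "\<forall>p. vec4 F DF G H $ p \<in> modular_forms \<rho> \<Lambda> (vec4 m (m + 2) (m + 2) (m + 4) $ p)"
        unfolding forall_2x2 using F by simp
      then show ?thesis ..
    qed
    moreover have "(vec4 F DF G H $ p) \<tau> = (\<Sum>i\<in>UNIV. C $ i $ p *s (vec4 F U V Q $ i) \<tau>)" for p \<tau>
    proof -
      have "\<forall>p. (vec4 F DF G H $ p) \<tau> = (\<Sum>i\<in>UNIV. C $ i $ p *s (vec4 F U V Q $ i) \<tau>)"
        unfolding forall_2x2 sum_2x2 C_def DF_eq G_def H_eq by simp
      then show ?thesis ..
    qed
    ultimately show "free_basis \<rho> \<Lambda> (\<lambda>p. vec4 m (m + 2) (m + 2) (m + 4) $ p) (\<lambda>p. vec4 F DF G H $ p)"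
      using free_basis_change[OF fb] by blast
  qed
qed

lemma tensor_basis:
  fixes \<alpha> \<beta> :: "int^2^2 \<Rightarrow> complex^2^2" and L M :: "complex^2^2"
  assumes irr: "irreducible_rep (tensor_rep \<alpha> \<beta>)"
    and A: "free_basis \<alpha> L (\<lambda>j. if j = 1 then k else k + 2) (\<lambda>j. if j = 1 then A else modular_deriv k A)"
      "\<And>\<tau>. \<tau> \<in> UHP \<Longrightarrow> vector_deriv (k + 2) (vector_deriv k A) \<tau> = (a1 * E4 \<tau>) *s A \<tau>"
    and B: "free_basis \<beta> M (\<lambda>j. if j = 1 then l else l + 2) (\<lambda>j. if j = 1 then B else modular_deriv l B)"
      "\<And>\<tau>. \<tau> \<in> UHP \<Longrightarrow> vector_deriv (l + 2) (vector_deriv l B) \<tau> = (a2 * E4 \<tau>) *s B \<tau>"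
  defines "\<rho> \<equiv> tensor_rep \<alpha> \<beta>" and "\<Lambda> \<equiv> tensor_exponents L M"
    and "F \<equiv> tensor_form A B" and "DF \<equiv> modular_deriv (k + l) (tensor_form A B)"
    and "H \<equiv> \<lambda>\<tau>. modular_deriv (k + l + 2) (modular_deriv (k + l) (tensor_form A B)) \<tau> - ((a1 + a2) * E4 \<tau>) *s tensor_form A B \<tau>"
  shows "DF = (\<lambda>\<tau>. tensor_form (modular_deriv k A) B \<tau> + tensor_form A (modular_deriv l B) \<tau>)"
    and "a1 \<noteq> a2"
    and "\<exists>G. (\<forall>\<tau>\<in>UHP. (- (a1 - a2)\<^sup>2 * E4 \<tau>) *s G \<tau> = modular_deriv (k + l + 4) H \<tau> - ((a1 + a2) * E4 \<tau>) *s DF \<tau>) \<and>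
      free_basis \<rho> \<Lambda> (\<lambda>p. vec4 (k + l) (k + l + 2) (k + l + 2) (k + l + 4) $ p) (\<lambda>p. vec4 F DF G H $ p)"
proof -
  have rep: "representation (tensor_rep \<alpha> \<beta>)" using irr by (simp add: irreducible_rep_def)
  have bA: "(if j = 1 then A else modular_deriv k A) \<in> modular_forms \<alpha> L (if j = 1 then k else k + 2)" for j :: 2
    using A(1) by (simp add: free_basis_def)
  have bB: "(if j = 1 then B else modular_deriv l B) \<in> modular_forms \<beta> M (if j = 1 then l else l + 2)" for j :: 2
    using B(1) by (simp add: free_basis_def)
  have mfA: "A \<in> modular_forms \<alpha> L k" "modular_deriv k A \<in> modular_forms \<alpha> L (k + 2)" using bA[of 1] bA[of 2] by simp_all
  have mfB: "B \<in> modular_forms \<beta> M l" "modular_deriv l B \<in> modular_forms \<beta> M (l + 2)" using bB[of 1] bB[of 2] by simp_all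
  note hA = modular_formsD(2)[OF mfA(1)] modular_formsD(2)[OF mfA(2)]
  note hB = modular_formsD(2)[OF mfB(1)] modular_formsD(2)[OF mfB(2)]
  define U V Q where "U = tensor_form (modular_deriv k A) B" and "V = tensor_form A (modular_deriv l B)"
    and "Q = tensor_form (modular_deriv k A) (modular_deriv l B)"
  have D2A: "modular_deriv (k + 2) (modular_deriv k A) \<tau> = (a1 * E4 \<tau>) *s A \<tau>" if \<tau>: "\<tau> \<in> UHP" for \<tau>
    using vector_deriv_cong[OF \<tau>, of "modular_deriv k A" "vector_deriv k A" "k + 2"] A(2)[OF \<tau>] \<tau>
    by (simp add: modular_deriv_eq on_UHP_def)
  have D2B: "modular_deriv (l + 2) (modular_deriv l B) \<tau> = (a2 * E4 \<tau>) *s B \<tau>" if \<tau>: "\<tau> \<in> UHP" for \<tau>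
    using vector_deriv_cong[OF \<tau>, of "modular_deriv l B" "vector_deriv l B" "l + 2"] B(2)[OF \<tau>] \<tau>
    by (simp add: modular_deriv_eq on_UHP_def)
  have w: "k + 2 + l = k + l + 2" "k + (l + 2) = k + l + 2" "k + 2 + (l + 2) = k + l + 4" by simp_all
  have DF': "vector_deriv (k + l) (tensor_form A B) \<tau> = U \<tau> + V \<tau>" if "\<tau> \<in> UHP" for \<tau>
    unfolding U_def V_def by (rule vector_deriv_tensor_form[OF hA(1) hB(1) that])
  have DU: "vector_deriv (k + l + 2) U \<tau> = (a1 * E4 \<tau>) *s tensor_form A B \<tau> + Q \<tau>" if "\<tau> \<in> UHP" for \<tau>
    using vector_deriv_tensor_form[OF hA(2) hB(1) that, of "k + 2" l] D2A[OF that]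
    unfolding w U_def Q_def by (simp add: vec_eq_iff tensor_form_def)
  have DV: "vector_deriv (k + l + 2) V \<tau> = (a2 * E4 \<tau>) *s tensor_form A B \<tau> + Q \<tau>" if "\<tau> \<in> UHP" for \<tau>
    using vector_deriv_tensor_form[OF hA(1) hB(2) that, of k "l + 2"] D2B[OF that]
    unfolding w V_def Q_def by (simp add: vec_eq_iff tensor_form_def)
  have DQ: "vector_deriv (k + l + 4) Q \<tau> = (a1 * E4 \<tau>) *s V \<tau> + (a2 * E4 \<tau>) *s U \<tau>" if "\<tau> \<in> UHP" for \<tau>
    using vector_deriv_tensor_form[OF hA(2) hB(2) that, of "k + 2" "l + 2"] D2A[OF that] D2B[OF that]
    unfolding w V_def U_def Q_def by (simp add: vec_eq_iff tensor_form_def)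
  have weights: "(if fst p = 1 then k else k + 2) + (if snd p = 1 then l else l + 2) =
      vec4 (k + l) (k + l + 2) (k + l + 2) (k + l + 4) $ p" for p :: "2 \<times> 2"
  proof -
    have "\<forall>p :: 2 \<times> 2. (if fst p = 1 then k else k + 2) + (if snd p = 1 then l else l + 2) =
      vec4 (k + l) (k + l + 2) (k + l + 2) (k + l + 4) $ p" unfolding forall_2x2 by simp
    then show ?thesis ..
  qed
  have forms: "tensor_form (if fst p = 1 then A else modular_deriv k A) (if snd p = 1 then B else modular_deriv l B) =
      vec4 (tensor_form A B) U V Q $ p" for p :: "2 \<times> 2"
  proof -
    have "\<forall>p :: 2 \<times> 2. tensor_form (if fst p = 1 then A else modular_deriv k A) (if snd p = 1 then B else modular_deriv l B) =
      vec4 (tensor_form A B) U V Q $ p" unfolding forall_2x2 by (simp add: U_def V_def Q_def)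
    then show ?thesis ..
  qed
  note fb = free_basis_tensor[OF rep A(1) B(1), unfolded weights forms]
  from free_basis_of_derivatives[OF irr fb DF' DU DV DQ]
  show "a1 \<noteq> a2" and "\<exists>G. (\<forall>\<tau>\<in>UHP. (- (a1 - a2)\<^sup>2 * E4 \<tau>) *s G \<tau> = modular_deriv (k + l + 4) H \<tau> - ((a1 + a2) * E4 \<tau>) *s DF \<tau>) \<and>
      free_basis \<rho> \<Lambda> (\<lambda>p. vec4 (k + l) (k + l + 2) (k + l + 2) (k + l + 4) $ p) (\<lambda>p. vec4 F DF G H $ p)"
    unfolding \<rho>_def \<Lambda>_def F_def DF_def H_def by blast+
  show "DF = (\<lambda>\<tau>. tensor_form (modular_deriv k A) B \<tau> + tensor_form A (modular_deriv l B) \<tau>)"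
  proof
    fix \<tau>
    show "DF \<tau> = tensor_form (modular_deriv k A) B \<tau> + tensor_form A (modular_deriv l B) \<tau>"
    proof (cases "\<tau> \<in> UHP")
      case True
      then show ?thesis using DF'[OF True] by (simp add: DF_def modular_deriv_eq on_UHP_def U_def V_def)
    next
      case False
      then show ?thesis using modular_formsD(1)[OF mfA(1) False]
        by (simp add: DF_def modular_deriv_eq on_UHP_def tensor_form_def vec_eq_iff)
    qed
  qed
qed

theorem theorem26:
  fixes \<alpha> \<beta> :: "int^2^2 \<Rightarrow> complex^2^2"
    and L1 L2 :: "complex^2^2"
    and \<rho> :: "int^2^2 \<Rightarrow> complex^(2 \<times> 2)^(2 \<times> 2)"
    and \<Lambda> :: "complex^(2 \<times> 2)^(2 \<times> 2)"
  defines "\<rho> \<equiv> tensor_rep \<alpha> \<beta>"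
    and "\<Lambda> \<equiv> tensor_exponents L1 L2"
  assumes "irreducible_rep \<alpha>" and "irreducible_rep \<beta>" and "irreducible_rep \<rho>"
    and "choice_of_exponents \<alpha> L1" and "choice_of_exponents \<beta> L2"
  shows "\<not> cyclic_M1D_module (graded_forms \<rho> \<Lambda>)
    \<and> (\<exists>k l :: int.
        of_int k = 6 * trace L1 - 1 \<and> of_int l = 6 * trace L2 - 1
        \<and> minimal_weight \<alpha> L1 k \<and> minimal_weight \<beta> L2 l
        \<and> minimal_weight \<rho> \<Lambda> (k + l)
        \<and> (\<forall>A B. minimal_weight_form \<alpha> L1 k A \<and> minimal_weight_form \<beta> L2 l B \<longrightarrow>
            (\<forall>e. eigenvalues_of \<Lambda> e \<longrightarrow>
              (let f = (\<lambda>j. e j - 1/4 * trace \<Lambda> + 1/6);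
                   \<sigma> = (\<lambda>d. elem_sym 4 d f);
                   a = - 3 * \<sigma> 3 + 1/2 * \<sigma> 2 - 1/24;
                   b = 3 * \<sigma> 3 - 3/2 * \<sigma> 2 + 13/72;
                   c = - \<sigma> 4 - 1/18 * a;
                   F = tensor_form A B;
                   DF = modular_deriv (k + l) F;
                   H = (\<lambda>\<tau>. modular_deriv (k + l + 2) DF \<tau> - (a * E4 \<tau>) *s F \<tau>);
                   DH = modular_deriv (k + l + 4) H
               in DF = (\<lambda>\<tau>. tensor_form (modular_deriv k A) B \<tau>
                             + tensor_form A (modular_deriv l B) \<tau>)
                  \<and> c \<noteq> 0
                  \<and> (\<exists>G. (\<forall>\<tau>\<in>UHP. (c * E4 \<tau>) *s G \<tau> = DH \<tau> - (b * E4 \<tau>) *s DF \<tau>)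
                        \<and> M1_basis (graded_forms \<rho> \<Lambda>)
                            [homogeneous (k + l) F, homogeneous (k + l + 2) DF,
                             homogeneous (k + l + 4) H, homogeneous (k + l + 2) G])))))"
proof -
  obtain k u P x where k: "of_int k = 6 * trace L1 - 1"
    and P: "det P \<noteq> 0" "L1 ** P = P ** mat2 (trace L1 / 2 + u) x 0 (trace L1 / 2 - u)"
    and mwA: "minimal_weight \<alpha> L1 k"
    and fbA: "\<And>A. minimal_weight_form \<alpha> L1 k A \<Longrightarrow>
      free_basis \<alpha> L1 (\<lambda>j. if j = 1 then k else k + 2) (\<lambda>j. if j = 1 then A else modular_deriv k A)"
    and odeA: "\<And>A \<tau>. minimal_weight_form \<alpha> L1 k A \<Longrightarrow> \<tau> \<in> UHP \<Longrightarrow>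
      vector_deriv (k + 2) (vector_deriv k A) \<tau> = ((u\<^sup>2 - 1/144) * E4 \<tau>) *s A \<tau>"
    by (rule minimal_forms_2[OF assms(3,6)]) blast
  obtain l v Q y where l: "of_int l = 6 * trace L2 - 1"
    and Q: "det Q \<noteq> 0" "L2 ** Q = Q ** mat2 (trace L2 / 2 + v) y 0 (trace L2 / 2 - v)"
    and mwB: "minimal_weight \<beta> L2 l"
    and fbB: "\<And>B. minimal_weight_form \<beta> L2 l B \<Longrightarrow>
      free_basis \<beta> L2 (\<lambda>j. if j = 1 then l else l + 2) (\<lambda>j. if j = 1 then B else modular_deriv l B)"
    and odeB: "\<And>B \<tau>. minimal_weight_form \<beta> L2 l B \<Longrightarrow> \<tau> \<in> UHP \<Longrightarrow>
      vector_deriv (l + 2) (vector_deriv l B) \<tau> = ((v\<^sup>2 - 1/144) * E4 \<tau>) *s B \<tau>"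
    by (rule minimal_forms_2[OF assms(4,7)]) blast
  have irr: "irreducible_rep (tensor_rep \<alpha> \<beta>)" using assms(5) by (simp add: \<rho>_def)
  then have rep: "representation \<rho>" by (simp add: irreducible_rep_def \<rho>_def)
  define m a1 a2 where "m = k + l" and "a1 = u\<^sup>2 - 1/144" and "a2 = v\<^sup>2 - 1/144"
  let ?w = "\<lambda>p. vec4 m (m + 2) (m + 2) (m + 4) $ p"
  have basis: "modular_deriv m (tensor_form A B) =
        (\<lambda>\<tau>. tensor_form (modular_deriv k A) B \<tau> + tensor_form A (modular_deriv l B) \<tau>)"
      "a1 \<noteq> a2"
      "\<exists>G. (\<forall>\<tau>\<in>UHP. (- (a1 - a2)\<^sup>2 * E4 \<tau>) *s G \<tau> =
          modular_deriv (m + 4) (\<lambda>\<tau>. modular_deriv (m + 2) (modular_deriv m (tensor_form A B)) \<tau> -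
            ((a1 + a2) * E4 \<tau>) *s tensor_form A B \<tau>) \<tau> - ((a1 + a2) * E4 \<tau>) *s modular_deriv m (tensor_form A B) \<tau>) \<and>
        free_basis \<rho> \<Lambda> ?w (\<lambda>p. vec4 (tensor_form A B) (modular_deriv m (tensor_form A B)) G
          (\<lambda>\<tau>. modular_deriv (m + 2) (modular_deriv m (tensor_form A B)) \<tau> -
            ((a1 + a2) * E4 \<tau>) *s tensor_form A B \<tau>) $ p)"
    if "minimal_weight_form \<alpha> L1 k A" "minimal_weight_form \<beta> L2 l B" for A B
    unfolding \<rho>_def \<Lambda>_def m_def a1_def a2_def
    by (rule tensor_basis[OF irr fbA[OF that(1)] odeA[OF that(1)] fbB[OF that(2)] odeB[OF that(2)]]; assumption)+
  have "\<exists>A. minimal_weight_form \<alpha> L1 k A" "\<exists>B. minimal_weight_form \<beta> L2 l B"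
    using mwA mwB zero_in_modular_forms[of \<alpha> L1 k] zero_in_modular_forms[of \<beta> L2 l]
    unfolding minimal_weight_form_def minimal_weight_def by blast+
  \<comment> \<open>Parts (1) and (2) do not mention \<open>A\<close> and \<open>B\<close>, so one
    pair of forms of minimal weight settles them.\<close>
  then obtain A0 B0 where 0: "minimal_weight_form \<alpha> L1 k A0" "minimal_weight_form \<beta> L2 l B0" by blast
  from basis(3)[OF 0] obtain G0 H0 where
    fb0: "free_basis \<rho> \<Lambda> ?w (\<lambda>p. vec4 (tensor_form A0 B0) (modular_deriv m (tensor_form A0 B0)) G0 H0 $ p)" by blast
  have w_ge: "m \<le> ?w p" "p \<noteq> (1, 1) \<Longrightarrow> m + 2 \<le> ?w p" for p
  proof -
    have "\<forall>p. m \<le> ?w p \<and> (p \<noteq> (1, 1) \<longrightarrow> m + 2 \<le> ?w p)" unfolding forall_2x2 by simp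
    then show "m \<le> ?w p" "p \<noteq> (1, 1) \<Longrightarrow> m + 2 \<le> ?w p" by blast+
  qed
  have mw: "minimal_weight \<rho> \<Lambda> m"
    using free_basis_minimal_weight[OF rep fb0, of "(1, 1)"] w_ge(1) by simp
  have "\<not> cyclic_M1D_module (graded_forms \<rho> \<Lambda>)"
    by (rule free_basis_not_cyclic[OF rep fb0, of "(1, 1)" m "(2, 1)" "(1, 2)"]) (use w_ge(2) in simp_all)
  moreover have "let f = (\<lambda>j. e j - 1/4 * trace \<Lambda> + 1/6);
                   \<sigma> = (\<lambda>d. elem_sym 4 d f);
                   a = - 3 * \<sigma> 3 + 1/2 * \<sigma> 2 - 1/24;
                   b = 3 * \<sigma> 3 - 3/2 * \<sigma> 2 + 13/72;
                   c = - \<sigma> 4 - 1/18 * a;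
                   F = tensor_form A B;
                   DF = modular_deriv (k + l) F;
                   H = (\<lambda>\<tau>. modular_deriv (k + l + 2) DF \<tau> - (a * E4 \<tau>) *s F \<tau>);
                   DH = modular_deriv (k + l + 4) H
               in DF = (\<lambda>\<tau>. tensor_form (modular_deriv k A) B \<tau>
                             + tensor_form A (modular_deriv l B) \<tau>)
                  \<and> c \<noteq> 0
                  \<and> (\<exists>G. (\<forall>\<tau>\<in>UHP. (c * E4 \<tau>) *s G \<tau> = DH \<tau> - (b * E4 \<tau>) *s DF \<tau>)
                        \<and> M1_basis (graded_forms \<rho> \<Lambda>)
                            [homogeneous (k + l) F, homogeneous (k + l + 2) DF,
                             homogeneous (k + l + 4) H, homogeneous (k + l + 2) G])"
    if A: "minimal_weight_form \<alpha> L1 k A" and B: "minimal_weight_form \<beta> L2 l B" and e: "eigenvalues_of \<Lambda> e" for A B e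
  proof -
    note \<sigma> = elem_sym_tensor_exponents[OF P(2,1) Q(2,1) e[unfolded \<Lambda>_def], folded \<Lambda>_def]
    let ?\<sigma> = "\<lambda>d. elem_sym 4 d (\<lambda>j. e j - 1/4 * trace \<Lambda> + 1/6)"
    \<comment> \<open>With \<open>S = u^2 + v^2\<close> one has
      \<open>\<sigma>_2 = 1/6 - 2 S\<close> and \<open>\<sigma>_3 = 1/54 - 2 S / 3\<close>; both
      \<open>a\<close> and \<open>b\<close> reduce to \<open>S - 1/72\<close>.\<close>
    have a: "- 3 * ?\<sigma> 3 + 1/2 * ?\<sigma> 2 - 1/24 = a1 + a2"
      unfolding \<sigma> a1_def a2_def by (simp add: field_simps)
    have b: "3 * ?\<sigma> 3 - 3/2 * ?\<sigma> 2 + 13/72 = a1 + a2"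
      unfolding \<sigma> a1_def a2_def by (simp add: field_simps)
    have c: "- ?\<sigma> 4 - 1/18 * (a1 + a2) = - (a1 - a2)\<^sup>2"
    proof -
      have "a1 - a2 = u\<^sup>2 - v\<^sup>2" "a1 + a2 = u\<^sup>2 + v\<^sup>2 - 1/72" by (simp_all add: a1_def a2_def)
      then show ?thesis unfolding \<sigma> by (simp add: diff_divide_distrib)
    qed
    note basis = basis[OF A B]
    have "a1 \<noteq> a2" using basis(2) .
    then have neq: "- (a1 - a2)\<^sup>2 \<noteq> 0" by simp
    define F DF where "F = tensor_form A B" and "DF = modular_deriv m F"
    define H where "H = (\<lambda>\<tau>. modular_deriv (m + 2) DF \<tau> - ((a1 + a2) * E4 \<tau>) *s F \<tau>)"
    from basis(3)[folded F_def, folded DF_def, folded H_def]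
    obtain G where G: "\<forall>\<tau>\<in>UHP. (- (a1 - a2)\<^sup>2 * E4 \<tau>) *s G \<tau> = modular_deriv (m + 4) H \<tau> - ((a1 + a2) * E4 \<tau>) *s DF \<tau>"
      and fb: "free_basis \<rho> \<Lambda> ?w (\<lambda>p. vec4 F DF G H $ p)" by blast
    \<comment> \<open>The last two indices are interchanged because \<open>H\<close> precedes
      \<open>G\<close> in the basis to be shown, while \<open>vec4\<close> lists \<open>G\<close>
      first.\<close>
    have js: "distinct [(1, 1), (2, 1), (2, 2), (1 :: 2, 2 :: 2)]" "set [(1, 1), (2, 1), (2, 2), (1 :: 2, 2 :: 2)] = UNIV"
    proof -
      have "\<forall>p. p \<in> set [(1, 1), (2, 1), (2, 2), (1 :: 2, 2 :: 2)]" unfolding forall_2x2 by simp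
      then show "set [(1, 1), (2, 1), (2, 2), (1 :: 2, 2 :: 2)] = UNIV" by blast
    qed simp
    have "M1_basis (graded_forms \<rho> \<Lambda>)
        [homogeneous m F, homogeneous (m + 2) DF, homogeneous (m + 4) H, homogeneous (m + 2) G]"
      using free_basis_M1_basis[OF rep fb js] by simp
    then show ?thesis
      unfolding Let_def a b c m_def[symmetric] F_def[symmetric] DF_def[symmetric] H_def[symmetric]
      using neq G basis(1)[folded F_def, folded DF_def] by blast
  qed
  ultimately show ?thesis using k l mwA mwB mw[unfolded m_def] by blast
qed

end
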